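(* Let $1<p<\infty$, $\mu\neq 0$, let $\nu$ be a weight on $\Lambda$, and set $w=|\Phi_-'|^{1-p}\,(\nu\circ\Phi_-)$ on $\mathbb{R}$. Assume that $\Psi=\Phi_+^{-1}\circ\Phi_-:\mathbb{R}\to\mathbb{R}$ is locally absolutely continuous. Then the transmission problem $$\Delta v^\pm=0 \text{ in } \Omega^\pm,\qquad v^+=v^- \text{ on } \Lambda,\qquad \partial_{\mathbf n}v^+-\mu\,\partial_{\mathbf n}v^-=g \text{ on } \Lambda$$ is uniquely solvable in $L^p(\Lambda,\nu)$ if and only if the problem $P_\Psi(\mu)$ is uniquely solvable in $L^p(\mathbb{R},w)$.
   Context: Setting. $\Lambda$ is an unbounded rectifiable Jordan curve in $\mathbb{C}$ given parametrically by $x+i\gamma(x)$, $x\in\mathbb{R}$, with $\gamma$ real-valued; $\Omega^+=\{z:\operatorname{Im}z>\gamma(\operatorname{Re}z)\}$ and $\Omega^-=\operatorname{int}((\Omega^+)^c)$, so $\Lambda=\partial\Omega^\pm$. $\mathbb{R}^2_\pm$ are the upper/lower half-planes. $\Phi_\pm:\mathbb{R}^2_\pm\to\Omega^\pm$ are conformal maps with $\Phi_\pm(\infty)=\infty$; they extend to homeomorphisms of the closures, are locally absolutely continuous on $\mathbb{R}$, and $\Phi_\pm'(x)$ exists and is nonzero for a.e. $x\in\mathbb{R}$ (as non-tangential limits). $\mathbf n$ is the inward unit normal to $\Omega^+$ on $\Lambda$ (defined a.e. with respect to arc length $ds$), and $\partial_{\mathbf n}v^\pm=\nabla v^\pm\cdot\mathbf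 n$. A weight on $\Lambda$ is a nonnegative function locally integrable with respect to $ds$; $L^p(\Lambda,\nu)$ is the space of functions $p$-integrable with respect to $\nu\,ds$. A weight on $\mathbb{R}$ is a nonnegative locally integrable function, and $L^p(\mathbb{R},w)$ has norm $(\int|f|^pw\,dx)^{1/p}$. Notation. For an a.e. differentiable $\beta$ on $\mathbb{R}$, $T_\beta g=|\beta'|\,(g\circ\beta)$. For a homeomorphism $\Psi$ of $\mathbb{R}$ and a weight $w$, $\widetilde w_p=|(\Psi^{-1})'|^{1-p}\,(w\circ\Psi^{-1})$. For $0<\alpha<\pi/2$ and $x\in\mathbb{R}$, $\Gamma^+_\alpha(x)=\{z:\operatorname{Im}z>0,\ |\operatorname{Re}z-x|<\tan(\alpha)\operatorname{Im}z\}$, $\Gamma^-_\alpha(x)=\{z:\bar z\in\Gamma^+_\alpha(x)\}$, and $N^\pm_\alpha F(x)=\sup_{z\in\Gamma^\pm_\alpha(x)}|F(z)|$. Non-tangential convergence at $x$ means convergence as $z\to x$ within $\Gamma^\pm_\alpha(x)$. $\Phi_\pm$ non-tangential convergence: for $\xi\in\Lambda$, a function $R$ on $\Omega^\pm$ converges to $r(\xi)$ in this sense if for some $0<\alpha<\pi/2$, $R(z)\to r(\xi)$ as $z\to\xi$ with $z\in\Phi_\pm(\Gamma^\pm_\alpha(\Phi_\pm^{-1}(\xi)))$. Solvability of $P_\Psi(\mu)$: given a homeomorphism $\Psi$ of $\mathbb{R}$, $\mu\ne0$ and a weight $w$, $P_\Psi(\mu)$ is solvable in $L^p(\mathbb{R},w)$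 if for every $f\in L^p(\mathbb{R},w)$ there are harmonic $u^\pm$ in $\mathbb{R}^2_\pm$ such that (a) $u^\pm$ and $\partial_yu^\pm$ have boundary values on $\mathbb{R}$ in the sense of non-tangential convergence; (b) $u^+\circ\Psi=u^-$ and $T_\Psi(\partial_yu^+)-\mu\,\partial_yu^-=f$ a.e. on $\mathbb{R}$; (c) for $0<\alpha<\pi/2$, $\|N^+_\alpha\nabla u^+\|_{L^p(\widetilde w_p)}\lesssim\|f\|_{L^p(w)}$ and $\|N^-_\alpha\nabla u^-\|_{L^p(w)}\lesssim\|f\|_{L^p(w)}$. It is uniquely solvable if moreover solutions are unique modulo constants. Solvability of the transmission problem: it is solvable in $L^p(\Lambda,\nu)$ if for every $g\in L^p(\Lambda,\nu)$ there are harmonic $v^\pm$ in $\Omega^\pm$ such that (a) $v^\pm$ and $\partial_{\mathbf n}v^\pm$ have boundary values on $\Lambda$ in the sense of $\Phi_\pm$ non-tangential convergence and $\partial_{\mathbf n}v^\pm\in L^p(\Lambda,\nu)$; (b) $v^+=v^-$ and $\partial_{\mathbf n}v^+-\mu\partial_{\mathbf n}v^-=g$ a.e. on $\Lambda$ with respect to arc length; (c) for $0<\alpha<\pi/2$, $\|N^+_\alpha\nabla(v^+\circ\Phi_+)\|_{L^p(\widetilde w_p)}\lesssim\|g\|_{L^p(\Lambda,\nu)}$ and $\|N^-_\alpha\nabla(v^-\circ\Phi_-)\|_{L^p(w)}\lesssim\|g\|_{L^p(\Lambda,\nu)}$, where $w=|\Phi_-'|^{1-p}(\nu\circ\Phi_-)$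 and $\widetilde w_p$ is formed with $\Psi=\Phi_+^{-1}\circ\Phi_-$. It is uniquely solvable if moreover solutions are unique modulo constants. *)

theory Defs
  imports "HOL-Analysis.Analysis"
begin

definition upper_hp :: "complex set" where "upper_hp = {z. Im z > 0}"
definition lower_hp :: "complex set" where "lower_hp = {z. Im z < 0}"

definition cparam :: "(real \<Rightarrow> real) \<Rightarrow> real \<Rightarrow> complex" where
  "cparam \<gamma> x = Complex x (\<gamma> x)"

definition Lambda :: "(real \<Rightarrow> real) \<Rightarrow> complex set" where
  "Lambda \<gamma> = range (cparam \<gamma>)"

definition Omega_plus :: "(real \<Rightarrow> real) \<Rightarrow> complex set" where
  "Omega_plus \<gamma> = {z. Im z > \<gamma> (Re z)}"

definition Omega_minus :: "(real \<Rightarrow> real) \<Rightarrow> complex set" where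
  "Omega_minus \<gamma> = interior (- Omega_plus \<gamma>)"

definition cone_plus :: "real \<Rightarrow> real \<Rightarrow> complex set" where
  "cone_plus \<alpha> x = {z. Im z > 0 \<and> \<bar>Re z - x\<bar> < tan \<alpha> * Im z}"

definition cone_minus :: "real \<Rightarrow> real \<Rightarrow> complex set" where
  "cone_minus \<alpha> x = {z. cnj z \<in> cone_plus \<alpha> x}"

definition curve_length :: "(real \<Rightarrow> complex) \<Rightarrow> real \<Rightarrow> real \<Rightarrow> ennreal" where
  "curve_length c a b =
     (SUP nt \<in> {(n::nat, t::nat \<Rightarrow> real). t 0 = a \<and> t n = b \<and> (\<forall>i<n. t i \<le> t (Suc i))}.
        ennreal (\<Sum>i<fst nt. norm (c (snd nt (Suc i)) - c (snd nt i))))"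

definition locally_rectifiable :: "(real \<Rightarrow> complex) \<Rightarrow> bool" where
  "locally_rectifiable c \<longleftrightarrow> (\<forall>a b. a \<le> b \<longrightarrow> curve_length c a b < \<infinity>)"

definition arclen_fun :: "(real \<Rightarrow> real) \<Rightarrow> real \<Rightarrow> real" where
  "arclen_fun \<gamma> x = (if 0 \<le> x then enn2real (curve_length (cparam \<gamma>) 0 x)
                      else - enn2real (curve_length (cparam \<gamma>) x 0))"

definition arclen :: "(real \<Rightarrow> real) \<Rightarrow> complex measure" where
  "arclen \<gamma> = distr (interval_measure (arclen_fun \<gamma>)) borel (cparam \<gamma>)"

text \<open>N is the inward (into Omega^+) unit normal at xi: i times the unit tangent,
  the tangent being the derivative of the parametrisation w.r.t. arc length.\<close>
definition inward_normal :: "(real \<Rightarrow> real) \<Rightarrow> complex \<Rightarrow> complex \<Rightarrow> bool" where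
  "inward_normal \<gamma> \<xi> N \<longleftrightarrow> (\<exists>x T. \<xi> = cparam \<gamma> x \<and>
      ((\<lambda>y. (cparam \<gamma> y - cparam \<gamma> x) / complex_of_real (arclen_fun \<gamma> y - arclen_fun \<gamma> x))
         \<longlongrightarrow> T) (at x) \<and> norm T = 1 \<and> N = \<i> * T)"

definition weight_on_Lambda :: "(real \<Rightarrow> real) \<Rightarrow> (complex \<Rightarrow> real) \<Rightarrow> bool" where
  "weight_on_Lambda \<gamma> \<nu> \<longleftrightarrow> (\<forall>\<xi>\<in>Lambda \<gamma>. 0 \<le> \<nu> \<xi>) \<and> \<nu> \<in> borel_measurable borel \<and>
     (\<forall>K. compact K \<longrightarrow> (\<integral>\<^sup>+\<xi>. ennreal (\<nu> \<xi> * indicator K \<xi>) \<partial>arclen \<gamma>) < \<infinity>)"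

definition enn_powr :: "ennreal \<Rightarrow> real \<Rightarrow> ennreal" where
  "enn_powr a q = (if a = \<infinity> then \<infinity> else ennreal (enn2real a powr q))"

definition lpnorm :: "'a measure \<Rightarrow> real \<Rightarrow> ('a \<Rightarrow> real) \<Rightarrow> ('a \<Rightarrow> ennreal) \<Rightarrow> ennreal" where
  "lpnorm M p wt F = enn_powr (\<integral>\<^sup>+x. enn_powr (F x) p * ennreal (wt x) \<partial>M) (1 / p)"

definition in_Lp :: "'a measure \<Rightarrow> real \<Rightarrow> ('a \<Rightarrow> real) \<Rightarrow> ('a \<Rightarrow> real) \<Rightarrow> bool" where
  "in_Lp M p wt f \<longleftrightarrow> f \<in> borel_measurable M \<and> lpnorm M p wt (\<lambda>x. ennreal \<bar>f x\<bar>) < \<infinity>"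

definition dx :: "(complex \<Rightarrow> real) \<Rightarrow> complex \<Rightarrow> real" where
  "dx v z = frechet_derivative v (at z) 1"

definition dy :: "(complex \<Rightarrow> real) \<Rightarrow> complex \<Rightarrow> real" where
  "dy v z = frechet_derivative v (at z) \<i>"

definition grad :: "(complex \<Rightarrow> real) \<Rightarrow> complex \<Rightarrow> complex" where
  "grad v z = Complex (dx v z) (dy v z)"

definition harmonic_on :: "complex set \<Rightarrow> (complex \<Rightarrow> real) \<Rightarrow> bool" where
  "harmonic_on S v \<longleftrightarrow> open S \<and>
     (\<forall>z\<in>S. v differentiable (at z) \<and> dx v differentiable (at z) \<and> dy v differentiable (at z)) \<and>
     continuous_on S (dx (dx v)) \<and> continuous_on S (dy (dx v)) \<and>
     continuous_on S (dx (dy v)) \<and> continuous_on S (dy (dy v)) \<and>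
     (\<forall>z\<in>S. dx (dx v) z + dy (dy v) z = 0)"

definition nt_conv :: "(real \<Rightarrow> real \<Rightarrow> complex set) \<Rightarrow> (complex \<Rightarrow> 'b::topological_space) \<Rightarrow> real \<Rightarrow> 'b \<Rightarrow> bool" where
  "nt_conv Gam F x l \<longleftrightarrow> (\<exists>\<alpha>. 0 < \<alpha> \<and> \<alpha> < pi / 2 \<and> (F \<longlongrightarrow> l) (at (complex_of_real x) within Gam \<alpha> x))"

definition nt_bv :: "(real \<Rightarrow> real \<Rightarrow> complex set) \<Rightarrow> (complex \<Rightarrow> real) \<Rightarrow> (real \<Rightarrow> real) \<Rightarrow> bool" where
  "nt_bv Gam F b \<longleftrightarrow> (AE x in lebesgue. nt_conv Gam F x (b x))"

definition ntmax :: "(real \<Rightarrow> real \<Rightarrow> complex set) \<Rightarrow> real \<Rightarrow> (complex \<Rightarrow> complex) \<Rightarrow> real \<Rightarrow> ennreal" where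
  "ntmax Gam \<alpha> F x = (SUP z \<in> Gam \<alpha> x. ennreal (norm (F z)))"

definition locally_abs_cont :: "(real \<Rightarrow> 'a::real_normed_vector) \<Rightarrow> bool" where
  "locally_abs_cont f \<longleftrightarrow> (\<forall>a b \<epsilon>. a \<le> b \<longrightarrow> \<epsilon> > 0 \<longrightarrow> (\<exists>\<delta>>0. \<forall>(n::nat) l r.
      (\<forall>i<n. a \<le> l i \<and> l i \<le> r i \<and> r i \<le> b) \<and>
      (\<forall>i<n. \<forall>j<n. i \<noteq> j \<longrightarrow> r i \<le> l j \<or> r j \<le> l i) \<and>
      (\<Sum>i<n. r i - l i) < \<delta> \<longrightarrow> (\<Sum>i<n. norm (f (r i) - f (l i))) < \<epsilon>))"

definition conformal_setting ::
  "complex set \<Rightarrow> (real \<Rightarrow> real \<Rightarrow> complex set) \<Rightarrow> complex set \<Rightarrow> (complex \<Rightarrow> complex) \<Rightarrow> (real \<Rightarrow> complex) \<Rightarrow> bool" where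
  "conformal_setting H Gam \<Omega> \<Phi> d\<Phi> \<longleftrightarrow>
     \<Phi> holomorphic_on H \<and> inj_on \<Phi> H \<and> \<Phi> ` H = \<Omega> \<and>
     continuous_on (closure H) \<Phi> \<and> inj_on \<Phi> (closure H) \<and> \<Phi> ` closure H = closure \<Omega> \<and>
     continuous_on (closure \<Omega>) (inv_into (closure H) \<Phi>) \<and>
     filterlim \<Phi> at_infinity (inf at_infinity (principal (closure H))) \<and>
     locally_abs_cont (\<lambda>x. \<Phi> (complex_of_real x)) \<and>
     (AE x in lebesgue. nt_conv Gam (deriv \<Phi>) x (d\<Phi> x) \<and> d\<Phi> x \<noteq> 0)"

definition bd_inv :: "(complex \<Rightarrow> complex) \<Rightarrow> complex \<Rightarrow> real" where
  "bd_inv \<Phi> \<xi> = (THE t. \<Phi> (complex_of_real t) = \<xi>)"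

definition Psi_map :: "(complex \<Rightarrow> complex) \<Rightarrow> (complex \<Rightarrow> complex) \<Rightarrow> real \<Rightarrow> real" where
  "Psi_map \<Phi>p \<Phi>m x = bd_inv \<Phi>p (\<Phi>m (complex_of_real x))"

definition T_op :: "(real \<Rightarrow> real) \<Rightarrow> (real \<Rightarrow> real) \<Rightarrow> real \<Rightarrow> real" where
  "T_op \<beta> g x = \<bar>deriv \<beta> x\<bar> * g (\<beta> x)"

definition wtilde :: "(real \<Rightarrow> real) \<Rightarrow> real \<Rightarrow> (real \<Rightarrow> real) \<Rightarrow> real \<Rightarrow> real" where
  "wtilde \<Psi> p w x = \<bar>deriv (inv \<Psi>) x\<bar> powr (1 - p) * w (inv \<Psi> x)"

text \<open>(u+,u-) solves P_Psi(mu) with datum f: conditions (a), (b), and finiteness of the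
  non-tangential maximal norms (the admissible class for uniqueness).\<close>
definition P_solution ::
  "(real \<Rightarrow> real) \<Rightarrow> real \<Rightarrow> real \<Rightarrow> (real \<Rightarrow> real) \<Rightarrow> (real \<Rightarrow> real) \<Rightarrow>
   (complex \<Rightarrow> real) \<Rightarrow> (complex \<Rightarrow> real) \<Rightarrow> bool" where
  "P_solution \<Psi> \<mu> p w f up um \<longleftrightarrow>
     harmonic_on upper_hp up \<and> harmonic_on lower_hp um \<and>
     (\<exists>bp bm dp dm.
        nt_bv cone_plus up bp \<and> nt_bv cone_minus um bm \<and>
        nt_bv cone_plus (dy up) dp \<and> nt_bv cone_minus (dy um) dm \<and>
        (AE x in lebesgue. bp (\<Psi> x) = bm x) \<and>
        (AE x in lebesgue. T_op \<Psi> dp x - \<mu> * dm x = f x)) \<and>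
     (\<forall>\<alpha>. 0 < \<alpha> \<and> \<alpha> < pi / 2 \<longrightarrow>
        lpnorm lebesgue p (wtilde \<Psi> p w) (ntmax cone_plus \<alpha> (grad up)) < \<infinity> \<and>
        lpnorm lebesgue p w (ntmax cone_minus \<alpha> (grad um)) < \<infinity>)"

definition P_solvable :: "(real \<Rightarrow> real) \<Rightarrow> real \<Rightarrow> real \<Rightarrow> (real \<Rightarrow> real) \<Rightarrow> bool" where
  "P_solvable \<Psi> \<mu> p w \<longleftrightarrow> (\<exists>C :: real \<Rightarrow> real. \<forall>f. in_Lp lebesgue p w f \<longrightarrow>
     (\<exists>up um. P_solution \<Psi> \<mu> p w f up um \<and>
        (\<forall>\<alpha>. 0 < \<alpha> \<and> \<alpha> < pi / 2 \<longrightarrow>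
           lpnorm lebesgue p (wtilde \<Psi> p w) (ntmax cone_plus \<alpha> (grad up))
             \<le> ennreal (C \<alpha>) * lpnorm lebesgue p w (\<lambda>x. ennreal \<bar>f x\<bar>) \<and>
           lpnorm lebesgue p w (ntmax cone_minus \<alpha> (grad um))
             \<le> ennreal (C \<alpha>) * lpnorm lebesgue p w (\<lambda>x. ennreal \<bar>f x\<bar>))))"

definition P_uniquely_solvable :: "(real \<Rightarrow> real) \<Rightarrow> real \<Rightarrow> real \<Rightarrow> (real \<Rightarrow> real) \<Rightarrow> bool" where
  "P_uniquely_solvable \<Psi> \<mu> p w \<longleftrightarrow> P_solvable \<Psi> \<mu> p w \<and>
     (\<forall>f up um up' um'. in_Lp lebesgue p w f \<longrightarrow>
        P_solution \<Psi> \<mu> p w f up um \<longrightarrow> P_solution \<Psi> \<mu> p w f up' um' \<longrightarrow>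
        (\<exists>c. (\<forall>z\<in>upper_hp. up z - up' z = c) \<and> (\<forall>z\<in>lower_hp. um z - um' z = c)))"

definition Phi_nt_conv :: "(real \<Rightarrow> real \<Rightarrow> complex set) \<Rightarrow> (complex \<Rightarrow> complex) \<Rightarrow> (complex \<Rightarrow> real) \<Rightarrow> complex \<Rightarrow> real \<Rightarrow> bool" where
  "Phi_nt_conv Gam \<Phi> R \<xi> l \<longleftrightarrow> (\<exists>\<alpha>. 0 < \<alpha> \<and> \<alpha> < pi / 2 \<and>
      (R \<longlongrightarrow> l) (at \<xi> within \<Phi> ` Gam \<alpha> (bd_inv \<Phi> \<xi>)))"

definition T_solution ::
  "(real \<Rightarrow> real) \<Rightarrow> (complex \<Rightarrow> complex) \<Rightarrow> (complex \<Rightarrow> complex) \<Rightarrow> real \<Rightarrow> real \<Rightarrow>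
   (complex \<Rightarrow> real) \<Rightarrow> (real \<Rightarrow> real) \<Rightarrow> (complex \<Rightarrow> real) \<Rightarrow> (complex \<Rightarrow> real) \<Rightarrow> (complex \<Rightarrow> real) \<Rightarrow> bool" where
  "T_solution \<gamma> \<Phi>p \<Phi>m \<mu> p \<nu> w g vp vm \<longleftrightarrow>
     harmonic_on (Omega_plus \<gamma>) vp \<and> harmonic_on (Omega_minus \<gamma>) vm \<and>
     (\<exists>bp bm np nm.
        (AE \<xi> in arclen \<gamma>. Phi_nt_conv cone_plus \<Phi>p vp \<xi> (bp \<xi>) \<and>
                            Phi_nt_conv cone_minus \<Phi>m vm \<xi> (bm \<xi>) \<and>
                            (\<exists>N. inward_normal \<gamma> \<xi> N \<and>
                               Phi_nt_conv cone_plus \<Phi>p (\<lambda>z. grad vp z \<bullet> N) \<xi> (np \<xi>) \<and>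
                               Phi_nt_conv cone_minus \<Phi>m (\<lambda>z. grad vm z \<bullet> N) \<xi> (nm \<xi>))) \<and>
        in_Lp (arclen \<gamma>) p \<nu> np \<and> in_Lp (arclen \<gamma>) p \<nu> nm \<and>
        (AE \<xi> in arclen \<gamma>. bp \<xi> = bm \<xi>) \<and>
        (AE \<xi> in arclen \<gamma>. np \<xi> - \<mu> * nm \<xi> = g \<xi>)) \<and>
     (\<forall>\<alpha>. 0 < \<alpha> \<and> \<alpha> < pi / 2 \<longrightarrow>
        lpnorm lebesgue p (wtilde (Psi_map \<Phi>p \<Phi>m) p w) (ntmax cone_plus \<alpha> (grad (vp \<circ> \<Phi>p))) < \<infinity> \<and>
        lpnorm lebesgue p w (ntmax cone_minus \<alpha> (grad (vm \<circ> \<Phi>m))) < \<infinity>)"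

definition T_solvable ::
  "(real \<Rightarrow> real) \<Rightarrow> (complex \<Rightarrow> complex) \<Rightarrow> (complex \<Rightarrow> complex) \<Rightarrow> real \<Rightarrow> real \<Rightarrow>
   (complex \<Rightarrow> real) \<Rightarrow> (real \<Rightarrow> real) \<Rightarrow> bool" where
  "T_solvable \<gamma> \<Phi>p \<Phi>m \<mu> p \<nu> w \<longleftrightarrow> (\<exists>C :: real \<Rightarrow> real. \<forall>g. in_Lp (arclen \<gamma>) p \<nu> g \<longrightarrow>
     (\<exists>vp vm. T_solution \<gamma> \<Phi>p \<Phi>m \<mu> p \<nu> w g vp vm \<and>
        (\<forall>\<alpha>. 0 < \<alpha> \<and> \<alpha> < pi / 2 \<longrightarrow>
           lpnorm lebesgue p (wtilde (Psi_map \<Phi>p \<Phi>m) p w) (ntmax cone_plus \<alpha> (grad (vp \<circ> \<Phi>p)))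
             \<le> ennreal (C \<alpha>) * lpnorm (arclen \<gamma>) p \<nu> (\<lambda>\<xi>. ennreal \<bar>g \<xi>\<bar>) \<and>
           lpnorm lebesgue p w (ntmax cone_minus \<alpha> (grad (vm \<circ> \<Phi>m)))
             \<le> ennreal (C \<alpha>) * lpnorm (arclen \<gamma>) p \<nu> (\<lambda>\<xi>. ennreal \<bar>g \<xi>\<bar>))))"

definition T_uniquely_solvable ::
  "(real \<Rightarrow> real) \<Rightarrow> (complex \<Rightarrow> complex) \<Rightarrow> (complex \<Rightarrow> complex) \<Rightarrow> real \<Rightarrow> real \<Rightarrow>
   (complex \<Rightarrow> real) \<Rightarrow> (real \<Rightarrow> real) \<Rightarrow> bool" where
  "T_uniquely_solvable \<gamma> \<Phi>p \<Phi>m \<mu> p \<nu> w \<longleftrightarrow> T_solvable \<gamma> \<Phi>p \<Phi>m \<mu> p \<nu> w \<and>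
     (\<forall>g vp vm vp' vm'. in_Lp (arclen \<gamma>) p \<nu> g \<longrightarrow>
        T_solution \<gamma> \<Phi>p \<Phi>m \<mu> p \<nu> w g vp vm \<longrightarrow> T_solution \<gamma> \<Phi>p \<Phi>m \<mu> p \<nu> w g vp' vm' \<longrightarrow>
        (\<exists>c. (\<forall>z\<in>Omega_plus \<gamma>. vp z - vp' z = c) \<and> (\<forall>z\<in>Omega_minus \<gamma>. vm z - vm' z = c)))"

end

(* Pull back by the conformal maps: u = v o Phi on each side and f(x) = |Phi_-'(x)| g(Phi_-(x)).
   Arc length s makes sigma a unit speed parametrisation of the curve, and s o Re o Phi is a
   homeomorphism f of the line with f' = |Phi'| almost everywhere (the non-tangential value of Phi' is
   the tangential derivative off a countable set), so Psi' = |Phi_-'| / |Phi_+' o Psi| and all weighted norms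
   match. The delicate point is the normal derivative: the weight may vanish on large sets, so
   nothing is known about the gradient there except that one of its components has a limit. A
   Plessner type theorem rescues this: a holomorphic function that omits a disc in truncated cones at
   the points of a set is bounded in truncated cones at almost every point of it. It follows by
   comparing log |G - q| on a sawtooth region with sums of Green functions. *)
theory Submission
  imports Defs "HOL-Complex_Analysis.Complex_Analysis"
begin

text \<open>Arc length mediates between the two sides. Absolute continuity of a boundary map sends
  null sets of the line to null sets of arc length, and the almost everywhere positive derivative of
  arc length along it sends them back. So almost everywhere means the same on the line and on the
  curve, seen from either half-plane. A limit of one component of a gradient bounds, up to a
  rotation, the imaginary part of a holomorphic function in a truncated cone. Such a function omits
  a disc there, and only in this form is the Plessner type theorem applied. Its proof rests on a
  scale-free inequality: the sum of the Green functions has a lower bound that depends on the slope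
  of the cones alone, while the point of evaluation can be lowered and the interval filled more
  densely until all errors are small against it. The orientation of the boundary map has to be
  proved, since the normal is inward and is computed as i times the tangent: with the wrong
  orientation the image of a vertical ray would leave the domain.\<close>

section \<open>Harmonic functions\<close>

text \<open>Twice the Wirtinger derivative of \<open>v\<close>; for harmonic \<open>v\<close> this
  is the complex derivative of any local holomorphic function with real part \<open>v\<close>. With
  this sign of the second component harmonicity becomes holomorphy, and composition with a conformal
  map becomes multiplication by its derivative.\<close>

definition cgrad :: "(complex \<Rightarrow> real) \<Rightarrow> complex \<Rightarrow> complex" where
  "cgrad v z = Complex (dx v z) (- dy v z)"

lemma grad_eq_cnj_cgrad: "grad v z = cnj (cgrad v z)"
  by (simp add: grad_def cgrad_def complex_eq_iff)

lemma has_derivative_cgrad: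
  assumes "v differentiable (at z)"
  shows "(v has_derivative (\<lambda>h. Re (cgrad v z * h))) (at z)"
proof -
  have d: "(v has_derivative frechet_derivative v (at z)) (at z)"
    using assms frechet_derivative_works by blast
  then interpret bounded_linear "frechet_derivative v (at z)"
    by (rule has_derivative_bounded_linear)
  have "frechet_derivative v (at z) h = Re (cgrad v z * h)" for h
  proof -
    have "h = Re h *\<^sub>R 1 + Im h *\<^sub>R \<i>" by (simp add: complex_eq_iff)
    then have "frechet_derivative v (at z) h = Re h * dx v z + Im h * dy v z"
      by (metis add scaleR dx_def dy_def real_scaleR_def)
    then show ?thesis by (simp add: cgrad_def)
  qed
  then have "frechet_derivative v (at z) = (\<lambda>h. Re (cgrad v z * h))" by blast
  with d show ?thesis by simp
qed

lemma cgrad_unique: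
  assumes "(v has_derivative (\<lambda>h. Re (g * h))) (at z)"
  shows "cgrad v z = g"
  using frechet_derivative_at[OF assms, symmetric]
  by (simp add: cgrad_def dx_def dy_def complex_eq_iff)

lemma frechet_derivative_Re_holomorphic:
  assumes "(g has_field_derivative g') (at z)"
  shows "((\<lambda>w. Re (g w)) has_derivative (\<lambda>h. Re (g' * h))) (at z)"
    and "((\<lambda>w. - Im (g w)) has_derivative (\<lambda>h. Re (\<i> * g' * h))) (at z)"
proof -
  have "(g has_derivative (\<lambda>h. g' * h)) (at z)"
    using assms by (simp add: has_field_derivative_def)
  note this[THEN bounded_linear.has_derivative[OF bounded_linear_Re]]
    this[THEN bounded_linear.has_derivative[OF bounded_linear_Im], THEN has_derivative_minus]
  then show "((\<lambda>w. Re (g w)) has_derivative (\<lambda>h. Re (g' * h))) (at z)"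
    "((\<lambda>w. - Im (g w)) has_derivative (\<lambda>h. Re (\<i> * g' * h))) (at z)"
    by (auto elim!: has_derivative_eq_rhs simp: algebra_simps)
qed

lemma cgrad_cong_open:
  assumes "open S" "z \<in> S" "\<And>w. w \<in> S \<Longrightarrow> f w = g w"
  shows "cgrad f z = cgrad g z"
proof -
  have "(f has_derivative D) (at z) = (g has_derivative D) (at z)" for D
    using assms by (metis has_derivative_transform_within_open)
  then have "frechet_derivative f (at z) = frechet_derivative g (at z)"
    by (simp add: frechet_derivative_def)
  then show ?thesis by (simp add: cgrad_def dx_def dy_def)
qed

lemma dx_eq: "dx v z = Re (cgrad v z)" and dy_eq: "dy v z = - Im (cgrad v z)"
  by (simp_all add: cgrad_def)

text \<open>The mean value theorem in the direction \<open>a\<close> turns the second difference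
  into a first difference of the derivative along \<open>a\<close>, whose linearisation at
  \<open>z\<close> gives the limit. The quotient is symmetric in \<open>a\<close> and
  \<open>b\<close> while the limit is not visibly so; applied in both orders, the lemma yields the
  symmetry of second derivatives from differentiability of the first ones.\<close>

lemma second_difference_tendsto:
  fixes v :: "complex \<Rightarrow> real" and a b :: complex
  assumes S: "open S" "z \<in> S" and v: "\<And>w. w \<in> S \<Longrightarrow> v differentiable (at w)"
    and d: "(\<lambda>w. frechet_derivative v (at w) a) differentiable (at z)"
  shows "((\<lambda>t. (v (z + t *\<^sub>R a + t *\<^sub>R b) - v (z + t *\<^sub>R a) - v (z + t *\<^sub>R b) + v z) / t\<^sup>2)
    \<longlongrightarrow> frechet_derivative (\<lambda>w. frechet_derivative v (at w) a) (at z) b) (at_right 0)"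
proof (rule tendstoI)
  fix e :: real assume e: "0 < e"
  define D where "D w = frechet_derivative v (at w) a" for w
  define L where "L = frechet_derivative D (at z)"
  define M where "M = norm a + norm b + 1"
  have M: "M > 0" by (simp add: M_def add_nonneg_pos)
  have LD: "(D has_derivative L) (at z)"
    using d unfolding D_def L_def by (simp add: frechet_derivative_works)
  then interpret L: bounded_linear L by (rule has_derivative_bounded_linear)
  \<comment> \<open>Two linearisation errors of size \<open>e' * (t * M)\<close> occur below; the
    factor 3 leaves the final inequality strict.\<close>
  define e' where "e' = e / (3 * M)"
  have e': "e' > 0" using e M by (simp add: e'_def)
  obtain \<delta> where \<delta>: "\<delta> > 0" "\<And>w. norm (w - z) < \<delta> \<Longrightarrow> norm (D w - D z - L (w - z)) \<le> e' * norm (w - z)"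
    using LD[unfolded has_derivative_at_alt] e' by blast
  obtain \<rho> where \<rho>: "\<rho> > 0" "ball z \<rho> \<subseteq> S" using S openE by blast
  define \<eta> where "\<eta> = min \<delta> \<rho> / M"
  have \<eta>: "\<eta> > 0" using \<delta> \<rho> M by (simp add: \<eta>_def)
  have near: "norm (r *\<^sub>R a + s *\<^sub>R b) \<le> t * M" "t * M < min \<delta> \<rho>"
    if "0 \<le> r" "r \<le> t" "0 \<le> s" "s \<le> t" "t < \<eta>" "0 < t" for r s t
  proof -
    have "norm (r *\<^sub>R a + s *\<^sub>R b) \<le> r * norm a + s * norm b"
      using that by (metis abs_of_nonneg norm_scaleR norm_triangle_ineq)
    also have "\<dots> \<le> t * norm a + t * norm b" using that by (intro add_mono mult_right_mono) auto
    also have "\<dots> \<le> t * M" using that by (simp add: M_def algebra_simps)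
    finally show "norm (r *\<^sub>R a + s *\<^sub>R b) \<le> t * M" .
    show "t * M < min \<delta> \<rho>" using that M by (simp add: \<eta>_def pos_less_divide_eq)
  qed
  have "dist ((v (z + t *\<^sub>R a + t *\<^sub>R b) - v (z + t *\<^sub>R a) - v (z + t *\<^sub>R b) + v z) / t\<^sup>2) (L b) < e"
    if t: "0 < t" "t < \<eta>" for t
  proof -
    define \<phi> where "\<phi> r = v (z + r *\<^sub>R a + t *\<^sub>R b) - v (z + r *\<^sub>R a)" for r
    have \<phi>': "(\<phi> has_field_derivative D (z + r *\<^sub>R a + t *\<^sub>R b) - D (z + r *\<^sub>R a)) (at r)"
      if r: "0 \<le> r" "r \<le> t" for r
    proof -
      have g: "((\<lambda>r. v (z + r *\<^sub>R a + s *\<^sub>R b)) has_field_derivative D (z + r *\<^sub>R a + s *\<^sub>R b)) (at r)"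
        if s: "0 \<le> s" "s \<le> t" for s
      proof -
        have "norm ((z + r *\<^sub>R a + s *\<^sub>R b) - z) < \<rho>"
          using near[OF r s t(2,1)] by (simp add: algebra_simps)
        then have "z + r *\<^sub>R a + s *\<^sub>R b \<in> S"
          using \<rho> by (metis mem_ball dist_norm norm_minus_commute subsetD)
        then have vd: "(v has_derivative frechet_derivative v (at (z + r *\<^sub>R a + s *\<^sub>R b))) (at (z + r *\<^sub>R a + s *\<^sub>R b))"
          using v frechet_derivative_works by blast
        interpret V: bounded_linear "frechet_derivative v (at (z + r *\<^sub>R a + s *\<^sub>R b))"
          by (rule has_derivative_bounded_linear[OF vd])
        have "((\<lambda>r. z + r *\<^sub>R a + s *\<^sub>R b) has_derivative (\<lambda>h. h *\<^sub>R a)) (at r)"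
          by (auto intro!: derivative_eq_intros)
        from has_derivative_compose[OF this vd]
        show ?thesis
          unfolding has_field_derivative_def by (rule has_derivative_eq_rhs) (simp add: V.scaleR D_def fun_eq_iff)
      qed
      from g[of 0] g[of t] t show ?thesis
        unfolding \<phi>_def by (auto intro!: derivative_eq_intros)
    qed
    obtain r where r: "0 < r" "r < t" "\<phi> t - \<phi> 0 = (t - 0) * (D (z + r *\<^sub>R a + t *\<^sub>R b) - D (z + r *\<^sub>R a))"
      using MVT2[OF t(1), of \<phi> "\<lambda>r. D (z + r *\<^sub>R a + t *\<^sub>R b) - D (z + r *\<^sub>R a)"] \<phi>' by blast
    have n1: "norm (D (z + r *\<^sub>R a + s *\<^sub>R b) - D z - L (r *\<^sub>R a + s *\<^sub>R b)) \<le> e' * (t * M)"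
      if s: "0 \<le> s" "s \<le> t" for s
    proof -
      have "norm (r *\<^sub>R a + s *\<^sub>R b) \<le> t * M" "t * M < \<delta>" using near[of r t s] r t s by auto
      moreover have "(z + r *\<^sub>R a + s *\<^sub>R b) - z = r *\<^sub>R a + s *\<^sub>R b" by simp
      ultimately have "norm (D (z + r *\<^sub>R a + s *\<^sub>R b) - D z - L (r *\<^sub>R a + s *\<^sub>R b))
          \<le> e' * norm (r *\<^sub>R a + s *\<^sub>R b)" "norm (r *\<^sub>R a + s *\<^sub>R b) \<le> t * M"
        using \<delta>(2)[of "z + r *\<^sub>R a + s *\<^sub>R b"] by auto
      then show ?thesis
        using e' by (meson less_imp_le mult_left_mono order_trans)
    qed
    have "\<bar>D (z + r *\<^sub>R a + t *\<^sub>R b) - D (z + r *\<^sub>R a) - t * L b\<bar> \<le> 2 * (e' * (t * M))"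
      using n1[of t] n1[of 0] t by (simp add: L.add L.scaleR)
    then have "t * \<bar>D (z + r *\<^sub>R a + t *\<^sub>R b) - D (z + r *\<^sub>R a) - t * L b\<bar> \<le> t * (2 * (e' * (t * M)))"
      using t by (intro mult_left_mono) auto
    moreover have "\<phi> t - \<phi> 0 - t\<^sup>2 * L b = t * (D (z + r *\<^sub>R a + t *\<^sub>R b) - D (z + r *\<^sub>R a) - t * L b)"
      unfolding r(3) by (simp add: power2_eq_square right_diff_distrib)
    then have "\<bar>\<phi> t - \<phi> 0 - t\<^sup>2 * L b\<bar> = t * \<bar>D (z + r *\<^sub>R a + t *\<^sub>R b) - D (z + r *\<^sub>R a) - t * L b\<bar>"
      using t by (simp add: abs_mult)
    ultimately have "\<bar>\<phi> t - \<phi> 0 - t\<^sup>2 * L b\<bar> \<le> t\<^sup>2 * (2 * (e' * M))"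
      by (simp add: power2_eq_square mult_ac)
    also have "\<dots> < t\<^sup>2 * e" using t e M by (simp add: e'_def)
    finally have "\<bar>\<phi> t - \<phi> 0 - t\<^sup>2 * L b\<bar> / t\<^sup>2 < e" using t by (simp add: divide_simps mult.commute)
    moreover have "(\<phi> t - \<phi> 0) / t\<^sup>2 - L b = (\<phi> t - \<phi> 0 - t\<^sup>2 * L b) / t\<^sup>2"
      using t by (simp add: diff_divide_distrib)
    then have "\<bar>(\<phi> t - \<phi> 0) / t\<^sup>2 - L b\<bar> = \<bar>\<phi> t - \<phi> 0 - t\<^sup>2 * L b\<bar> / t\<^sup>2"
      by simp
    moreover have "\<phi> t - \<phi> 0 = v (z + t *\<^sub>R a + t *\<^sub>R b) - v (z + t *\<^sub>R a) - v (z + t *\<^sub>R b) + v z"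
      by (simp add: \<phi>_def)
    ultimately show ?thesis by (simp add: dist_norm)
  qed
  then show "\<forall>\<^sub>F t in at_right 0. dist ((v (z + t *\<^sub>R a + t *\<^sub>R b) - v (z + t *\<^sub>R a) - v (z + t *\<^sub>R b) + v z) / t\<^sup>2)
      (frechet_derivative (\<lambda>w. frechet_derivative v (at w) a) (at z) b) < e"
    using \<eta> unfolding eventually_at_right_field L_def D_def by blast
qed

lemma dx_dy_commute:
  assumes "open S" "z \<in> S" "\<And>w. w \<in> S \<Longrightarrow> v differentiable (at w)"
    "dx v differentiable (at z)" "dy v differentiable (at z)"
  shows "dx (dy v) z = dy (dx v) z"
proof -
  have "((\<lambda>t. (v (z + t *\<^sub>R 1 + t *\<^sub>R \<i>) - v (z + t *\<^sub>R 1) - v (z + t *\<^sub>R \<i>) + v z) / t\<^sup>2)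
      \<longlongrightarrow> dy (dx v) z) (at_right 0)"
    using second_difference_tendsto[OF assms(1-3), of 1 \<i>] assms(4)
    by (simp add: dx_def[abs_def] dy_def)
  moreover have "((\<lambda>t. (v (z + t *\<^sub>R \<i> + t *\<^sub>R 1) - v (z + t *\<^sub>R \<i>) - v (z + t *\<^sub>R 1) + v z) / t\<^sup>2)
      \<longlongrightarrow> dx (dy v) z) (at_right 0)"
    using second_difference_tendsto[OF assms(1-3), of \<i> 1] assms(5)
    by (simp add: dy_def[abs_def] dx_def)
  then have "((\<lambda>t. (v (z + t *\<^sub>R 1 + t *\<^sub>R \<i>) - v (z + t *\<^sub>R 1) - v (z + t *\<^sub>R \<i>) + v z) / t\<^sup>2)
      \<longlongrightarrow> dx (dy v) z) (at_right 0)"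
    by (simp add: algebra_simps)
  ultimately show ?thesis by (rule tendsto_unique[OF trivial_limit_at_right_real, symmetric])
qed

text \<open>Laplace's equation and the symmetry of second derivatives are the Cauchy-Riemann
  equations of \<open>cgrad v\<close>. Conversely the second derivatives of \<open>v\<close> are, up
  to sign, the real and imaginary parts of \<open>deriv (cgrad v)\<close>, which supplies their
  continuity.\<close>

lemma harmonic_on_iff:
  "harmonic_on S v \<longleftrightarrow> open S \<and> (\<forall>z\<in>S. v differentiable (at z)) \<and> cgrad v holomorphic_on S"
proof
  assume h: "harmonic_on S v"
  then have S: "open S" and v: "\<And>z. z \<in> S \<Longrightarrow> v differentiable (at z)"
    and vx: "\<And>z. z \<in> S \<Longrightarrow> dx v differentiable (at z)"
    and vy: "\<And>z. z \<in> S \<Longrightarrow> dy v differentiable (at z)"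
    and l: "\<And>z. z \<in> S \<Longrightarrow> dx (dx v) z + dy (dy v) z = 0"
    by (auto simp: harmonic_on_def)
  have "cgrad v field_differentiable (at z)" if z: "z \<in> S" for z
  proof -
    have c: "dx (dy v) z = dy (dx v) z"
      using dx_dy_commute[OF S z v vx[OF z] vy[OF z]] by blast
    let ?g = "Complex (dx (dx v) z) (- dy (dx v) z)"
    have x: "(dx v has_derivative (\<lambda>h. Re (?g * h))) (at z)"
      using has_derivative_cgrad[OF vx[OF z]] by (simp add: cgrad_def)
    have y: "(dy v has_derivative (\<lambda>h. - Im (?g * h))) (at z)"
      using has_derivative_cgrad[OF vy[OF z]] l[OF z] c by (simp add: cgrad_def add_eq_0_iff)
    have "((\<lambda>w. complex_of_real (dx v w) - \<i> * complex_of_real (dy v w)) has_derivative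
        (\<lambda>h. complex_of_real (Re (?g * h)) - \<i> * complex_of_real (- Im (?g * h)))) (at z)"
      by (intro derivative_intros x y)
    moreover have "(\<lambda>w. complex_of_real (dx v w) - \<i> * complex_of_real (dy v w)) = cgrad v"
      by (simp add: cgrad_def complex_eq_iff fun_eq_iff)
    moreover have "(\<lambda>h. complex_of_real (Re (?g * h)) - \<i> * complex_of_real (- Im (?g * h))) = (\<lambda>h. ?g * h)"
      by (simp add: complex_eq_iff fun_eq_iff)
    ultimately have "(cgrad v has_field_derivative ?g) (at z)"
      by (simp add: has_field_derivative_def)
    then show ?thesis by (auto simp: field_differentiable_def)
  qed
  then have "cgrad v holomorphic_on S"
    using S by (simp add: holomorphic_on_open field_differentiable_def)
  with S v show "open S \<and> (\<forall>z\<in>S. v differentiable (at z)) \<and> cgrad v holomorphic_on S"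
    by blast
next
  assume "open S \<and> (\<forall>z\<in>S. v differentiable (at z)) \<and> cgrad v holomorphic_on S"
  then have S: "open S" and v: "\<And>z. z \<in> S \<Longrightarrow> v differentiable (at z)"
    and g: "cgrad v holomorphic_on S" by auto
  have g': "(cgrad v has_field_derivative deriv (cgrad v) z) (at z)" if "z \<in> S" for z
    using holomorphic_derivI[OF g S that] .
  have dX: "(dx v has_derivative (\<lambda>h. Re (deriv (cgrad v) z * h))) (at z)" if "z \<in> S" for z
    using frechet_derivative_Re_holomorphic(1)[OF g'[OF that]] by (simp add: dx_eq [abs_def])
  have dY: "(dy v has_derivative (\<lambda>h. Re (\<i> * deriv (cgrad v) z * h))) (at z)" if "z \<in> S" for z
    using frechet_derivative_Re_holomorphic(2)[OF g'[OF that]] by (simp add: dy_eq [abs_def])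
  have cX: "cgrad (dx v) z = deriv (cgrad v) z" "cgrad (dy v) z = \<i> * deriv (cgrad v) z" if "z \<in> S" for z
    using cgrad_unique[OF dX[OF that]] cgrad_unique[OF dY[OF that]] by auto
  have con: "continuous_on S (deriv (cgrad v))"
    using g S by (intro holomorphic_on_imp_continuous_on holomorphic_deriv)
  have "dx v differentiable (at z)" "dy v differentiable (at z)" if "z \<in> S" for z
    using dX dY that by (auto simp: differentiable_def)
  moreover have "continuous_on S (dx (dx v))"
    by (rule continuous_on_eq[of S "\<lambda>z. Re (deriv (cgrad v) z)"])
      (auto intro!: continuous_intros con simp: dx_eq[of "dx v"] cX)
  moreover have "continuous_on S (dy (dx v))"
    by (rule continuous_on_eq[of S "\<lambda>z. - Im (deriv (cgrad v) z)"])
      (auto intro!: continuous_intros con simp: dy_eq[of "dx v"] cX)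
  moreover have "continuous_on S (dx (dy v))"
    by (rule continuous_on_eq[of S "\<lambda>z. - Im (deriv (cgrad v) z)"])
      (auto intro!: continuous_intros con simp: dx_eq[of "dy v"] cX)
  moreover have "continuous_on S (dy (dy v))"
    by (rule continuous_on_eq[of S "\<lambda>z. - Re (deriv (cgrad v) z)"])
      (auto intro!: continuous_intros con simp: dy_eq[of "dy v"] cX)
  moreover have "dx (dx v) z + dy (dy v) z = 0" if "z \<in> S" for z
    using cX[OF that] by (simp add: dx_eq[of "dx v"] dy_eq[of "dy v"])
  ultimately show "harmonic_on S v" using S v by (simp add: harmonic_on_def)
qed

lemma cgrad_compose:
  assumes "v differentiable (at (\<Phi> z))" "(\<Phi> has_field_derivative d) (at z)"
  shows "cgrad (v \<circ> \<Phi>) z = cgrad v (\<Phi> z) * d" and "(v \<circ> \<Phi>) differentiable (at z)"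
proof -
  have "(\<Phi> has_derivative (\<lambda>h. d * h)) (at z)"
    using assms(2) by (simp add: has_field_derivative_def)
  then have "((\<lambda>w. v (\<Phi> w)) has_derivative (\<lambda>h. Re (cgrad v (\<Phi> z) * (d * h)))) (at z)"
    by (rule has_derivative_compose) (rule has_derivative_cgrad[OF assms(1)])
  then have *: "((v \<circ> \<Phi>) has_derivative (\<lambda>h. Re ((cgrad v (\<Phi> z) * d) * h))) (at z)"
    by (simp add: o_def mult.assoc)
  show "cgrad (v \<circ> \<Phi>) z = cgrad v (\<Phi> z) * d" by (rule cgrad_unique[OF *])
  show "(v \<circ> \<Phi>) differentiable (at z)" using * by (auto simp: differentiable_def)
qed

lemma harmonic_on_compose:
  assumes v: "harmonic_on T v" and \<Phi>: "\<Phi> holomorphic_on S" "\<Phi> ` S \<subseteq> T" "open S"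
  shows "harmonic_on S (v \<circ> \<Phi>)"
    and "\<And>z. z \<in> S \<Longrightarrow> cgrad (v \<circ> \<Phi>) z = cgrad v (\<Phi> z) * deriv \<Phi> z"
proof -
  have v': "\<And>z. z \<in> T \<Longrightarrow> v differentiable (at z)" "cgrad v holomorphic_on T"
    using v by (auto simp: harmonic_on_iff)
  have d: "(\<Phi> has_field_derivative deriv \<Phi> z) (at z)" if "z \<in> S" for z
    using holomorphic_derivI \<Phi> that by blast
  show c: "cgrad (v \<circ> \<Phi>) z = cgrad v (\<Phi> z) * deriv \<Phi> z" if "z \<in> S" for z
    using cgrad_compose(1)[OF v'(1) d] that \<Phi> by blast
  have "(v \<circ> \<Phi>) differentiable (at z)" if "z \<in> S" for z
    using cgrad_compose(2)[OF v'(1) d] that \<Phi> by blast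
  moreover have "(\<lambda>z. cgrad v (\<Phi> z) * deriv \<Phi> z) holomorphic_on S"
    using holomorphic_on_compose_gen[OF \<Phi>(1) v'(2) \<Phi>(2)] \<Phi>
    by (auto intro!: holomorphic_intros holomorphic_deriv simp: o_def)
  then have "cgrad (v \<circ> \<Phi>) holomorphic_on S"
    using c by (auto elim: holomorphic_transform)
  ultimately show "harmonic_on S (v \<circ> \<Phi>)" using \<Phi>(3) by (simp add: harmonic_on_iff)
qed

lemma harmonic_on_cong:
  assumes "harmonic_on S v" "\<And>z. z \<in> S \<Longrightarrow> v z = w z"
  shows "harmonic_on S w"
proof -
  have S: "open S" using assms(1) by (simp add: harmonic_on_iff)
  have "w differentiable (at z)" if "z \<in> S" for z
    using assms S that
    by (metis (no_types, lifting) differentiable_def harmonic_on_iff has_derivative_transform_within_open)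
  moreover have "cgrad w holomorphic_on S"
    using assms cgrad_cong_open[OF S, of _ v w] by (auto simp: harmonic_on_iff elim!: holomorphic_transform)
  ultimately show ?thesis using S by (simp add: harmonic_on_iff)
qed

section \<open>Increasing homeomorphisms of the line\<close>

text \<open>Intervals that merely contain \<open>x\<close> are allowed, not only those with
  \<open>x\<close> as an endpoint: their images form a Vitali cover, and the four Dini derivates
  need not be told apart.\<close>

definition shrinks :: "(real \<Rightarrow> real) \<Rightarrow> real \<Rightarrow> real \<Rightarrow> bool" where
  "shrinks f u x \<longleftrightarrow> (\<forall>d>0. \<exists>a b. a \<le> x \<and> x \<le> b \<and> a < b \<and> b - a < d \<and> f b - f a \<le> u * (b - a))"

definition expands :: "(real \<Rightarrow> real) \<Rightarrow> real \<Rightarrow> real \<Rightarrow> bool" where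
  "expands f v x \<longleftrightarrow> (\<forall>d>0. \<exists>a b. a \<le> x \<and> x \<le> b \<and> a < b \<and> b - a < d \<and> v * (b - a) \<le> f b - f a)"

lemma small_interval_continuous:
  fixes f :: "real \<Rightarrow> real"
  assumes "isCont f x" "0 < e"
  obtains d where "d > 0" "\<And>a b. a \<le> x \<Longrightarrow> x \<le> b \<Longrightarrow> b - a < d \<Longrightarrow> \<bar>f b - f a\<bar> < e"
proof -
  obtain d where d: "d > 0" "\<And>y. \<bar>y - x\<bar> < d \<Longrightarrow> \<bar>f y - f x\<bar> < e / 2"
    using assms(1)[unfolded continuous_at_eps_delta, rule_format, of "e / 2"] assms(2)
    by (auto simp: dist_real_def)
  show ?thesis
  proof (rule that[OF d(1)])
    fix a b assume "a \<le> x" "x \<le> b" "b - a < d"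
    then have "\<bar>f a - f x\<bar> < e / 2" "\<bar>f b - f x\<bar> < e / 2" using d(2)[of a] d(2)[of b] by auto
    then show "\<bar>f b - f a\<bar> < e" by linarith
  qed
qed

text \<open>Vitali's theorem is applied in the image, so that what remains uncovered is a null
  subset of the image of \<open>A\<close>. Disjoint image intervals come from disjoint intervals
  inside \<open>U\<close>, and each is at most \<open>u\<close> times as long as its source.\<close>

lemma shrinks_image_cover:
  assumes f: "strict_mono f" "continuous_on UNIV f"
    and A: "A \<subseteq> U" "open U" and u: "0 \<le> u" and sh: "\<And>x. x \<in> A \<Longrightarrow> shrinks f u x"
  obtains W where "W \<in> sets lebesgue" "f ` A \<subseteq> W" "emeasure lebesgue W \<le> ennreal u * emeasure lebesgue U"
proof -
  define K where "K = {(a, b). a < b \<and> {a..b} \<subseteq> U \<and> f b - f a \<le> u * (b - a)}"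
  define c where "c = (\<lambda>(a, b). (f a + f b) / 2)"
  define r where "r = (\<lambda>(a, b). (f b - f a) / 2)"
  have less: "f a < f b" if "a < b" for a b using f(1) that by (simp add: strict_mono_less)
  have le: "f a \<le> f b \<longleftrightarrow> a \<le> b" for a b using f(1) by (simp add: strict_mono_less_eq)
  have rpos: "0 < r i" if "i \<in> K" for i using that less by (auto simp: K_def r_def)
  have cb: "cball (c i) (r i) = {f (fst i)..f (snd i)}" for i
    by (cases i) (auto simp: c_def r_def cball_eq_atLeastAtMost field_simps)
  have ex: "\<exists>i. i \<in> K \<and> y \<in> cball (c i) (r i) \<and> r i < d" if y: "y \<in> f ` A" and d: "0 < d" for y d
  proof -
    obtain x where x: "x \<in> A" "y = f x" using y by auto
    obtain e where e: "e > 0" "ball x e \<subseteq> U" using A x openE by blast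
    have "isCont f x" using f(2) by (simp add: continuous_on_eq_continuous_at)
    then obtain d' where d': "d' > 0" "\<And>a b. a \<le> x \<Longrightarrow> x \<le> b \<Longrightarrow> b - a < d' \<Longrightarrow> \<bar>f b - f a\<bar> < d"
      using small_interval_continuous d by blast
    obtain a b where ab: "a \<le> x" "x \<le> b" "a < b" "b - a < min e d'" "f b - f a \<le> u * (b - a)"
      using sh[OF x(1)] e(1) d'(1) unfolding shrinks_def by (meson min_less_iff_conj)
    have "{a..b} \<subseteq> ball x e" using ab by (auto simp: dist_real_def)
    then have "(a, b) \<in> K" using ab e by (auto simp: K_def)
    moreover have "y \<in> cball (c (a, b)) (r (a, b))" using ab x by (simp add: cb le)
    moreover have "r (a, b) < d" using d'(2)[of a b] ab by (simp add: r_def)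
    ultimately show ?thesis by blast
  qed
  obtain C where C: "countable C" "C \<subseteq> K"
    "pairwise (\<lambda>i j. disjnt (cball (c i) (r i)) (cball (c j) (r j))) C"
    "negligible (f ` A - (\<Union>i \<in> C. cball (c i) (r i)))"
    using Vitali_covering_theorem_cballs[of K r "f ` A" c] rpos ex by blast
  let ?J = "\<lambda>i. {f (fst i)..f (snd i)}" and ?I = "\<lambda>i. {fst i..snd i}"
  have dJ: "disjoint_family_on ?J C"
    using C(3) by (auto simp: disjoint_family_on_def pairwise_def disjnt_def cb)
  have dI: "disjoint_family_on ?I C"
  proof (unfold disjoint_family_on_def, intro ballI impI)
    fix i j assume "i \<in> C" "j \<in> C" "i \<noteq> j"
    then have *: "?J i \<inter> ?J j = {}" using dJ by (auto simp: disjoint_family_on_def)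
    have "f x \<in> ?J i \<inter> ?J j" if "x \<in> ?I i \<inter> ?I j" for x using that by (simp add: le)
    then show "?I i \<inter> ?I j = {}" using * by blast
  qed
  let ?N = "f ` A - (\<Union>i \<in> C. ?J i)"
  have N: "?N \<in> null_sets lebesgue" using C(4) by (simp add: cb negligible_iff_null_sets)
  have UJ: "(\<Union>i \<in> C. ?J i) \<in> sets lebesgue" using C(1) by (intro sets.countable_UN') auto
  have "emeasure lebesgue ((\<Union>i \<in> C. ?J i) \<union> ?N) = emeasure lebesgue (\<Union>i \<in> C. ?J i)"
    using emeasure_Un_null_set[OF UJ N] .
  also have "\<dots> = (\<integral>\<^sup>+i. emeasure lebesgue (?J i) \<partial>count_space C)"
    using C(1) dJ by (intro emeasure_UN_countable) auto
  also have "\<dots> \<le> (\<integral>\<^sup>+i. ennreal u * emeasure lebesgue (?I i) \<partial>count_space C)"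
  proof (rule nn_integral_mono)
    fix i assume "i \<in> space (count_space C)"
    then have i: "i \<in> K" using C(2) by auto
    then have "fst i < snd i" "f (snd i) - f (fst i) \<le> u * (snd i - fst i)" by (auto simp: K_def)
    then show "emeasure lebesgue (?J i) \<le> ennreal u * emeasure lebesgue (?I i)"
      using less[of "fst i" "snd i"] u by (simp add: ennreal_mult[symmetric] ennreal_leI)
  qed
  also have "\<dots> = ennreal u * emeasure lebesgue (\<Union>i \<in> C. ?I i)"
    using C(1) dI by (subst emeasure_UN_countable) (auto simp: nn_integral_cmult)
  also have "\<dots> \<le> ennreal u * emeasure lebesgue U"
    using C(2) A(2) by (intro mult_left_mono emeasure_mono) (fastforce simp: K_def)+
  finally show ?thesis
    by (rule that[rotated 2]) (use N UJ in \<open>blast intro: sets.Un null_setsD2\<close>)+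
qed

text \<open>An interval that \<open>f\<close> stretches is mapped to one that the inverse contracts,
  and continuity of \<open>f\<close> keeps the image short. One covering lemma thus serves both
  notions.\<close>

lemma shrinks_inverse:
  assumes f: "strict_mono f" "continuous_on UNIV f" and g: "\<And>x. g (f x) = x"
    and v: "0 < v" and ex: "expands f v x"
  shows "shrinks g (1 / v) (f x)"
  unfolding shrinks_def
proof (intro allI impI)
  fix d :: real assume "0 < d"
  moreover have "isCont f x" using f(2) by (simp add: continuous_on_eq_continuous_at)
  ultimately obtain d' where d': "d' > 0" "\<And>a b. a \<le> x \<Longrightarrow> x \<le> b \<Longrightarrow> b - a < d' \<Longrightarrow> \<bar>f b - f a\<bar> < d"
    using small_interval_continuous by blast
  obtain a b where ab: "a \<le> x" "x \<le> b" "a < b" "b - a < d'" "v * (b - a) \<le> f b - f a"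
    using ex d'(1) unfolding expands_def by blast
  have "f a \<le> f x" "f x \<le> f b" "f a < f b" "f b - f a < d"
    using ab f(1) d'(2)[of a b] by (auto simp: strict_mono_less_eq strict_mono_less)
  moreover have "g (f b) - g (f a) \<le> 1 / v * (f b - f a)" using ab v by (simp add: g field_simps)
  ultimately show "\<exists>a b. a \<le> f x \<and> f x \<le> b \<and> a < b \<and> b - a < d \<and> g b - g a \<le> 1 / v * (b - a)" by blast
qed

lemma lebesgue_outer_open_le:
  assumes "W \<in> sets lebesgue" "emeasure lebesgue W \<le> ennreal r" "0 \<le> r" "r < s"
  obtains U where "open U" "W \<subseteq> U" "emeasure lebesgue U \<le> ennreal s"
proof -
  obtain U where U: "open U" "W \<subseteq> U" "emeasure lebesgue (U - W) < ennreal (s - r)"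
    using sets_lebesgue_outer_open[OF assms(1), of "s - r"] assms(4)
    by (metis diff_gt_0_iff_gt)
  have "U - W \<in> sets lebesgue" using U assms(1) by (intro sets.Diff) auto
  then have "emeasure lebesgue (W \<union> (U - W)) \<le> emeasure lebesgue W + emeasure lebesgue (U - W)"
    by (rule emeasure_subadditive[OF assms(1)])
  moreover have "W \<union> (U - W) = U" using U by blast
  ultimately have "emeasure lebesgue U \<le> emeasure lebesgue W + emeasure lebesgue (U - W)" by metis
  also have "\<dots> \<le> ennreal r + ennreal (s - r)" by (rule add_mono[OF assms(2) less_imp_le[OF U(3)]])
  also have "\<dots> = ennreal s" using assms by (simp flip: ennreal_plus)
  finally show ?thesis using U that by blast
qed

lemma negligible_if_open_covers:
  assumes "\<And>e. 0 < e \<Longrightarrow> \<exists>U. U \<in> sets lebesgue \<and> A \<subseteq> U \<and> emeasure lebesgue U \<le> ennreal e"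
  shows "negligible (A :: real set)"
  unfolding negligible_outer
proof (intro allI impI)
  fix e :: real assume e: "0 < e"
  then obtain U where U: "U \<in> sets lebesgue" "A \<subseteq> U" "emeasure lebesgue U \<le> ennreal (e / 2)"
    using assms[of "e / 2"] by auto
  have "emeasure lebesgue U < \<infinity>" by (rule le_less_trans[OF U(3)]) simp
  then have "U \<in> lmeasurable" using U(1) by (rule fmeasurableI[rotated])
  moreover have "measure lebesgue U \<le> e / 2"
    unfolding measure_def by (rule enn2real_leI) (use U e in auto)
  moreover have "e / 2 < e" using e by simp
  ultimately show "\<exists>T. A \<subseteq> T \<and> T \<in> lmeasurable \<and> measure lebesgue T < e"
    using U(2) le_less_trans by blast
qed

lemma negligible_open_cover:
  assumes "negligible (A :: real set)" "0 < e"
  obtains U where "open U" "A \<subseteq> U" "emeasure lebesgue U \<le> ennreal e"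
proof -
  have "A \<in> null_sets lebesgue" using assms by (simp add: negligible_iff_null_sets)
  then have "A \<in> sets lebesgue" "emeasure lebesgue A \<le> ennreal 0" by (blast, metis null_setsD1 zero_le)
  from lebesgue_outer_open_le[OF this order_refl assms(2)] that show ?thesis by blast
qed

lemma negligible_bounded_parts:
  assumes "\<And>n::nat. negligible (A \<inter> {- real n<..<real n})"
  shows "negligible A"
proof -
  have "A = (\<Union>n. A \<inter> {- real n<..<real n})"
    using reals_Archimedean2 by (auto simp: abs_less_iff[symmetric] minus_less_iff[of "real _"] conj_commute)
  then show ?thesis using negligible_countable_Union[of "range (\<lambda>n::nat. A \<inter> {- real n<..<real n})"] assms
    by auto
qed

section \<open>Lebesgue's differentiation theorem for increasing homeomorphisms\<close>

locale real_homeo =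
  fixes f g :: "real \<Rightarrow> real"
  assumes f_mono: "strict_mono f" and f_cont: "continuous_on UNIV f"
    and g_mono: "strict_mono g" and g_cont: "continuous_on UNIV g"
    and gf [simp]: "g (f x) = x" and fg [simp]: "f (g y) = y"
begin

lemma expands_preimage_cover:
  assumes "f ` A \<subseteq> W" "open W" "0 < v" "\<And>x. x \<in> A \<Longrightarrow> expands f v x"
  obtains V where "V \<in> sets lebesgue" "A \<subseteq> V" "emeasure lebesgue V \<le> ennreal (1 / v) * emeasure lebesgue W"
proof -
  have "shrinks g (1 / v) y" if "y \<in> f ` A" for y
    using that shrinks_inverse[OF f_mono f_cont gf assms(3)] assms(4) by blast
  then obtain V where V: "V \<in> sets lebesgue" "g ` f ` A \<subseteq> V" "emeasure lebesgue V \<le> ennreal (1 / v) * emeasure lebesgue W"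
    using shrinks_image_cover[OF g_mono g_cont assms(1,2), of "1 / v"] assms(3) by auto
  then show ?thesis using that by (auto simp: image_image)
qed

text \<open>Passing to the image along shrinking intervals and back along expanding ones turns an open cover into
  one whose measure is smaller by a factor close to u / v; iterate.\<close>
lemma negligible_shrinks_expands:
  assumes "0 < u" "u < v"
  shows "negligible {x. shrinks f u x \<and> expands f v x}"
proof (rule negligible_bounded_parts)
  fix n :: nat
  define A where "A = {x. shrinks f u x \<and> expands f v x} \<inter> {- real n<..<real n}"
  \<comment> \<open>Any number strictly between \<open>u / v\<close> and 1 would do; the room above
    \<open>u / v\<close> pays for enlarging two measurable covers to open sets.\<close>
  define \<rho> where "\<rho> = (1 + u / v) / 2"
  have \<rho>: "u / v < \<rho>" "\<rho> < 1" "0 < \<rho>" using assms by (simp_all add: \<rho>_def field_simps)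
  \<comment> \<open>The summand 1 keeps the bound positive also for \<open>n\<close> = 0, which the
    strict inequalities of the induction step use.\<close>
  have step: "\<exists>U. open U \<and> A \<subseteq> U \<and> emeasure lebesgue U \<le> ennreal (\<rho> ^ k * (2 * real n + 1))" for k
  proof (induction k)
    case 0
    show ?case by (rule exI[of _ "{- real n<..<real n}"]) (auto simp: A_def ennreal_leI)
  next
    case (Suc k)
    define r where "r = \<rho> ^ k * (2 * real n + 1)"
    have r: "r > 0" using \<rho> by (simp add: r_def add_nonneg_pos)
    from Suc obtain U where U: "open U" "A \<subseteq> U" "emeasure lebesgue U \<le> ennreal r" by (auto simp: r_def)
    obtain W where W: "W \<in> sets lebesgue" "f ` A \<subseteq> W" "emeasure lebesgue W \<le> ennreal u * emeasure lebesgue U"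
      using shrinks_image_cover[OF f_mono f_cont U(2,1), of u] assms by (auto simp: A_def)
    have "emeasure lebesgue W \<le> ennreal u * ennreal r"
      using W(3) U(3) by (meson mult_left_mono order_trans zero_le)
    then have W3: "emeasure lebesgue W \<le> ennreal (u * r)" using assms r by (simp add: ennreal_mult)
    have "(u / v) * r < \<rho> * r" using \<rho> r by (simp only: mult_less_cancel_right) auto
    then have "v * (u / v * r) < v * (\<rho> * r)" using assms by (intro mult_strict_left_mono) auto
    then have ur: "u * r < v * (\<rho> * r)" using assms by simp
    obtain r1 where r1: "u * r < r1" and r2: "r1 < v * (\<rho> * r)" using dense[OF ur] by blast
    from r2 have r1': "1 / v * r1 < \<rho> * r" using assms by (simp add: divide_less_eq mult.commute)
    obtain W' where W': "open W'" "W \<subseteq> W'" "emeasure lebesgue W' \<le> ennreal r1"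
      by (rule lebesgue_outer_open_le[OF W(1) W3 _ r1]) (use r assms in auto)
    obtain V where V: "V \<in> sets lebesgue" "A \<subseteq> V" "emeasure lebesgue V \<le> ennreal (1 / v) * emeasure lebesgue W'"
    proof (rule expands_preimage_cover[of A W' v])
      show "f ` A \<subseteq> W'" using W(2) W'(2) by blast
      show "\<And>x. x \<in> A \<Longrightarrow> expands f v x" by (simp add: A_def)
    qed (use W' assms in auto)
    have pos: "0 \<le> r1" using r1 r assms by (meson less_imp_le mult_nonneg_nonneg order_trans)
    have "emeasure lebesgue V \<le> ennreal (1 / v) * ennreal r1"
      using V(3) W'(3) by (meson mult_left_mono order_trans zero_le)
    then have "emeasure lebesgue V \<le> ennreal (1 / v * r1)" using assms pos by (subst ennreal_mult) auto
    then obtain V' where "open V'" "V \<subseteq> V'" "emeasure lebesgue V' \<le> ennreal (\<rho> * r)"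
      by (rule lebesgue_outer_open_le[OF V(1) _ _ r1']) (use assms pos in auto)
    moreover have "\<rho> * r = \<rho> ^ Suc k * (2 * real n + 1)" by (simp add: r_def mult.assoc)
    ultimately show ?case using V(2) by (metis order_trans)
  qed
  show "negligible A"
  proof (rule negligible_if_open_covers)
    fix e :: real assume e: "0 < e"
    have "(\<lambda>k. \<rho> ^ k * (2 * real n + 1)) \<longlonglongrightarrow> 0 * (2 * real n + 1)"
      using \<rho> by (intro tendsto_mult LIMSEQ_realpow_zero tendsto_const) auto
    then have "\<forall>\<^sub>F k in sequentially. \<rho> ^ k * (2 * real n + 1) < e" using e by (intro order_tendstoD(2)) auto
    then obtain k where "\<rho> ^ k * (2 * real n + 1) < e" by (metis eventually_at_top_linorder order_refl)
    then have k: "ennreal (\<rho> ^ k * (2 * real n + 1)) \<le> ennreal e" by (simp add: ennreal_leI)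
    obtain U where "open U" "A \<subseteq> U" "emeasure lebesgue U \<le> ennreal (\<rho> ^ k * (2 * real n + 1))" using step by blast
    then show "\<exists>U. U \<in> sets lebesgue \<and> A \<subseteq> U \<and> emeasure lebesgue U \<le> ennreal e"
      using k by (intro exI[of _ U]) (auto intro: order_trans)
  qed
qed

text \<open>The image of a bounded part lies in an interval of fixed length \<open>M\<close>, so
  pulling this interval back bounds the measure by \<open>M / v\<close> for every
  \<open>v\<close>.\<close>

lemma negligible_expands_all: "negligible {x. \<forall>v>0. expands f v x}"
proof (rule negligible_bounded_parts)
  fix n :: nat
  define A where "A = {x. \<forall>v>0. expands f v x} \<inter> {- real n<..<real n}"
  define M where "M = f (real n) - f (- real n)"
  have M: "M \<ge> 0" using f_mono by (simp add: M_def strict_mono_less_eq)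
  have im: "f ` A \<subseteq> {f (- real n)<..<f (real n)}" using f_mono by (auto simp: A_def strict_mono_less)
  show "negligible A"
  proof (rule negligible_if_open_covers)
    fix e :: real assume e: "0 < e"
    define v where "v = (M + 1) / e"
    have v: "v > 0" using M e by (simp add: v_def)
    obtain V where V: "V \<in> sets lebesgue" "A \<subseteq> V"
      "emeasure lebesgue V \<le> ennreal (1 / v) * emeasure lebesgue {f (- real n)<..<f (real n)}"
      using expands_preimage_cover[OF im _ v] v by (auto simp: A_def)
    note V(3)
    also have "ennreal (1 / v) * emeasure lebesgue {f (- real n)<..<f (real n)} = ennreal (1 / v * M)"
      using v M by (simp add: M_def flip: ennreal_mult)
    also have "1 / v * M \<le> e" using v M e by (simp add: v_def field_simps)
    then have "ennreal (1 / v * M) \<le> ennreal e" by (rule ennreal_leI)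
    finally show "\<exists>U. U \<in> sets lebesgue \<and> A \<subseteq> U \<and> emeasure lebesgue U \<le> ennreal e" using V by blast
  qed
qed

text \<open>Here the source has bounded length 2n and the contraction factor is arbitrary, so the
  image has measure at most \<open>u\<close> times 2n for every \<open>u\<close>.\<close>

lemma negligible_image_shrinks_all: "negligible (f ` {x. \<forall>u>0. shrinks f u x})"
proof -
  have "negligible (f ` ({x. \<forall>u>0. shrinks f u x} \<inter> {- real n<..<real n}))" for n :: nat
  proof (rule negligible_if_open_covers)
    fix e :: real assume e: "0 < e"
    define u where "u = e / (2 * real n + 1)"
    have u: "u > 0" using e by (simp add: u_def add_nonneg_pos)
    let ?U = "{- real n<..<real n}"
    obtain W where W: "W \<in> sets lebesgue" "f ` ({x. \<forall>u>0. shrinks f u x} \<inter> ?U) \<subseteq> W"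
      "emeasure lebesgue W \<le> ennreal u * emeasure lebesgue ?U"
      using shrinks_image_cover[OF f_mono f_cont, of "{x. \<forall>u>0. shrinks f u x} \<inter> ?U" ?U u] u by auto
    note W(3)
    also have "ennreal u * emeasure lebesgue ?U = ennreal (u * (2 * real n))" using u by (simp flip: ennreal_mult)
    also have "u * (2 * real n) \<le> e" using e by (simp add: u_def field_simps)
    then have "ennreal (u * (2 * real n)) \<le> ennreal e" by (rule ennreal_leI)
    finally show "\<exists>U. U \<in> sets lebesgue \<and> f ` ({x. \<forall>u>0. shrinks f u x} \<inter> ?U) \<subseteq> U \<and> emeasure lebesgue U \<le> ennreal e"
      using W by blast
  qed
  then have "negligible (\<Union>n::nat. f ` ({x. \<forall>u>0. shrinks f u x} \<inter> {- real n<..<real n}))"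
    by (intro negligible_countable_Union) auto
  moreover have "f ` {x. \<forall>u>0. shrinks f u x} \<subseteq> (\<Union>n::nat. f ` ({x. \<forall>u>0. shrinks f u x} \<inter> {- real n<..<real n}))"
  proof
    fix y assume "y \<in> f ` {x. \<forall>u>0. shrinks f u x}"
    then obtain x where "y = f x" "\<forall>u>0. shrinks f u x" by auto
    moreover obtain n :: nat where "\<bar>x\<bar> < real n" using reals_Archimedean2 by blast
    ultimately show "y \<in> (\<Union>n::nat. f ` ({x. \<forall>u>0. shrinks f u x} \<inter> {- real n<..<real n}))"
      by (auto intro!: imageI exI[of _ n])
  qed
  ultimately show ?thesis by (rule negligible_subset)
qed

text \<open>An open set of measure at most \<open>v * e\<close> around \<open>N\<close> pulls back
  to a cover of measure at most \<open>e\<close>.\<close>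

lemma negligible_preimage_expands:
  assumes "negligible N" "0 < v"
  shows "negligible {x. f x \<in> N \<and> expands f v x}"
proof (rule negligible_if_open_covers)
  fix e :: real assume e: "0 < e"
  obtain W where W: "open W" "N \<subseteq> W" "emeasure lebesgue W \<le> ennreal (v * e)"
    using negligible_open_cover[OF assms(1), of "v * e"] e assms(2) by auto
  obtain V where V: "V \<in> sets lebesgue" "{x. f x \<in> N \<and> expands f v x} \<subseteq> V"
    "emeasure lebesgue V \<le> ennreal (1 / v) * emeasure lebesgue W"
    using expands_preimage_cover[of "{x. f x \<in> N \<and> expands f v x}" W v] W(1,2) assms by blast
  have "emeasure lebesgue V \<le> ennreal (1 / v) * ennreal (v * e)"
    using V(3) W(3) by (meson mult_left_mono order_trans zero_le)
  also have "\<dots> = ennreal e" using assms e by (simp flip: ennreal_mult)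
  finally show "\<exists>U. U \<in> sets lebesgue \<and> {x. f x \<in> N \<and> expands f v x} \<subseteq> U \<and> emeasure lebesgue U \<le> ennreal e"
    using V by blast
qed

text \<open>The supremum of the slopes at which \<open>f\<close> expands is the derivative. Only
  rational slopes are excluded in \<open>se\<close>, which keeps the exceptional set a countable
  union; density of the rationals recovers the lower bound for all slopes.\<close>

lemma differentiable_if:
  assumes se: "\<And>u v. u \<in> \<rat> \<Longrightarrow> v \<in> \<rat> \<Longrightarrow> 0 < u \<Longrightarrow> u < v \<Longrightarrow> \<not> (shrinks f u x \<and> expands f v x)"
    and v0: "0 < v0" "\<not> expands f v0 x"
  shows "\<exists>D. (f has_real_derivative D) (at x)"
proof -
  define q where "q y = (f y - f x) / (y - x)" for y
  have upper: "\<forall>\<^sub>F y in at x. q y < v" if v: "\<not> expands f v x" for v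
  proof -
    obtain d where d: "d > 0" "\<And>a b. a \<le> x \<Longrightarrow> x \<le> b \<Longrightarrow> a < b \<Longrightarrow> b - a < d \<Longrightarrow> f b - f a < v * (b - a)"
      using v unfolding expands_def by (meson not_le)
    have "q y < v" if "y \<noteq> x" "dist y x < d" for y
      using that d(2)[of x y] d(2)[of y x] by (cases "x < y") (auto simp: q_def dist_real_def field_simps)
    then show ?thesis using d(1) by (auto simp: eventually_at)
  qed
  have lower: "\<forall>\<^sub>F y in at x. u < q y" if u: "\<not> shrinks f u x" for u
  proof -
    obtain d where d: "d > 0" "\<And>a b. a \<le> x \<Longrightarrow> x \<le> b \<Longrightarrow> a < b \<Longrightarrow> b - a < d \<Longrightarrow> u * (b - a) < f b - f a"
      using u unfolding shrinks_def by (meson not_le)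
    have "u < q y" if "y \<noteq> x" "dist y x < d" for y
      using that d(2)[of x y] d(2)[of y x] by (cases "x < y") (auto simp: q_def dist_real_def field_simps)
    then show ?thesis using d(1) by (auto simp: eventually_at)
  qed
  have qpos: "0 < q y" if "y \<noteq> x" for y
    using that strict_monoD[OF f_mono, of x y] strict_monoD[OF f_mono, of y x]
    by (cases "x < y") (auto simp: q_def divide_pos_pos divide_neg_neg)
  have anti: "expands f u x" if "expands f v x" "u \<le> v" for u v
    using that unfolding expands_def by (smt (verit) mult_right_mono)
  \<comment> \<open>The element 0 makes the set nonempty: when \<open>f\<close> expands at no
    positive slope, the derivative is 0.\<close>
  define V where "V = insert 0 {v. 0 < v \<and> expands f v x}"
  have bdd: "bdd_above V"
  proof (rule bdd_aboveI)
    fix v assume "v \<in> V"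
    then show "v \<le> v0" using anti[of v v0] v0 by (cases "v \<le> v0") (auto simp: V_def)
  qed
  define L where "L = Sup V"
  have L0: "0 \<le> L" using bdd by (simp add: L_def V_def cSup_upper)
  have "(q \<longlongrightarrow> L) (at x)"
  proof (rule order_tendstoI)
    fix v assume v: "L < v"
    then have "\<not> expands f v x" using cSup_upper[OF _ bdd, of v] L0 by (force simp: L_def V_def)
    then show "\<forall>\<^sub>F y in at x. q y < v" by (rule upper)
  next
    fix u assume u: "u < L"
    show "\<forall>\<^sub>F y in at x. u < q y"
    proof (cases "u < 0")
      case True
      then show ?thesis using qpos by (auto simp: eventually_at intro!: exI[of _ 1] intro: less_trans)
    next
      case False
      obtain v where v: "v \<in> V" "u < v" using u bdd by (auto simp: L_def less_cSup_iff V_def)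
      obtain u1 where u1: "u1 \<in> \<rat>" "u < u1" "u1 < v" using Rats_dense_in_real v by blast
      obtain v1 where v1: "v1 \<in> \<rat>" "u1 < v1" "v1 < v" using Rats_dense_in_real u1 by blast
      have "expands f v1 x" using v v1 u1 False anti[of v v1] by (auto simp: V_def)
      then have "\<not> shrinks f u1 x" using se[of u1 v1] u1 v1 False by auto
      then have "\<forall>\<^sub>F y in at x. u1 < q y" by (rule lower)
      then show ?thesis using u1(2) by (auto elim!: eventually_mono)
    qed
  qed
  then have "(f has_real_derivative L) (at x)"
    by (simp add: has_field_derivative_iff q_def[abs_def])
  then show ?thesis by blast
qed

text \<open>Lebesgue's theorem for monotone functions, in the case of a homeomorphism. At a bad
  point the difference quotients oscillate across two rational slopes, which gives countably many
  null sets, or they are unbounded.\<close>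

theorem AE_differentiable: "negligible {x. \<not> (\<exists>D. (f has_real_derivative D) (at x))}"
proof (rule negligible_subset)
  let ?P = "{(u, v). u \<in> \<rat> \<and> v \<in> \<rat> \<and> 0 < u \<and> u < v}"
  let ?B = "(\<Union>(u, v)\<in>?P. {x. shrinks f u x \<and> expands f v x})"
  have "countable ?P" by (rule countable_subset[of _ "\<rat> \<times> \<rat>"]) (auto intro: countable_rat)
  then have "negligible ?B" by (intro negligible_countable_Union) (auto intro: negligible_shrinks_expands)
  then show "negligible (?B \<union> {x. \<forall>v>0. expands f v x})" using negligible_expands_all by (rule negligible_Un)
  show "{x. \<not> (\<exists>D. (f has_real_derivative D) (at x))} \<subseteq> ?B \<union> {x. \<forall>v>0. expands f v x}"
    using differentiable_if by fastforce
qed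

section \<open>Null sets, images and change of variables\<close>

lemma quotient_at_interval:
  assumes "(f has_real_derivative D) (at x)" "0 < d" "0 < e"
  obtains y where "x < y" "y - x < d" "\<bar>(f y - f x) / (y - x) - D\<bar> < e"
proof -
  have "((\<lambda>y. (f y - f x) / (y - x)) \<longlongrightarrow> D) (at x)"
    using assms(1) by (simp add: has_field_derivative_iff)
  from tendstoD[OF this assms(3)] obtain d' where d': "d' > 0"
    "\<And>y. y \<noteq> x \<Longrightarrow> dist y x < d' \<Longrightarrow> dist ((f y - f x) / (y - x)) D < e"
    unfolding eventually_at by blast
  define y where "y = x + min d d' / 2"
  have "x < y" "y - x < d" "dist y x < d'" using d' assms(2) by (auto simp: y_def dist_real_def min_def)
  then show ?thesis using that[of y] d'(2)[of y] by (simp add: dist_real_def)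
qed

lemma expands_if_deriv:
  assumes "(f has_real_derivative D) (at x)" "v < D"
  shows "expands f v x"
  unfolding expands_def
proof (intro allI impI)
  fix d :: real assume "0 < d"
  then obtain y where y: "x < y" "y - x < d" "\<bar>(f y - f x) / (y - x) - D\<bar> < D - v"
    using quotient_at_interval[OF assms(1), of d "D - v"] assms(2) by auto
  then have "v < (f y - f x) / (y - x)" by linarith
  then have "v * (y - x) \<le> f y - f x" using y by (simp add: field_simps)
  then show "\<exists>a b. a \<le> x \<and> x \<le> b \<and> a < b \<and> b - a < d \<and> v * (b - a) \<le> f b - f a"
    using y by (intro exI[of _ x] exI[of _ y]) auto
qed

lemma shrinks_if_deriv:
  assumes "(f has_real_derivative D) (at x)" "D < u"
  shows "shrinks f u x"
  unfolding shrinks_def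
proof (intro allI impI)
  fix d :: real assume "0 < d"
  then obtain y where y: "x < y" "y - x < d" "\<bar>(f y - f x) / (y - x) - D\<bar> < u - D"
    using quotient_at_interval[OF assms(1), of d "u - D"] assms(2) by auto
  then have "(f y - f x) / (y - x) < u" by linarith
  then have "f y - f x \<le> u * (y - x)" using y by (simp add: field_simps)
  then show "\<exists>a b. a \<le> x \<and> x \<le> b \<and> a < b \<and> b - a < d \<and> f b - f a \<le> u * (b - a)"
    using y by (intro exI[of _ x] exI[of _ y]) auto
qed

text \<open>A one-dimensional Sard lemma. It later excludes that the tangent of the curve is
  vertical almost everywhere.\<close>

lemma negligible_image_deriv_0: "negligible (f ` {x. (f has_real_derivative 0) (at x)})"
  by (rule negligible_subset[OF negligible_image_shrinks_all]) (auto intro!: imageI shrinks_if_deriv)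

text \<open>A positive derivative exceeds some 1/(n+1), and on each of these countably many pieces
  null sets pull back to null sets. With \<open>f\<close> the arc length, this returns almost
  everywhere statements from the curve to the line.\<close>

lemma negligible_preimage_deriv_pos:
  assumes "negligible N"
  shows "negligible {x. f x \<in> N \<and> (\<exists>D>0. (f has_real_derivative D) (at x))}"
proof (rule negligible_subset)
  show "negligible (\<Union>n::nat. {x. f x \<in> N \<and> expands f (1 / real (Suc n)) x})"
    by (intro negligible_countable_Union) (auto intro!: negligible_preimage_expands assms)
  show "{x. f x \<in> N \<and> (\<exists>D>0. (f has_real_derivative D) (at x))} \<subseteq> (\<Union>n::nat. {x. f x \<in> N \<and> expands f (1 / real (Suc n)) x})"
  proof
    fix x assume "x \<in> {x. f x \<in> N \<and> (\<exists>D>0. (f has_real_derivative D) (at x))}"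
    then obtain D where D: "f x \<in> N" "D > 0" "(f has_real_derivative D) (at x)" by auto
    obtain n :: nat where "1 / real (Suc n) < D" using D(2) nat_approx_posE by blast
    then show "x \<in> (\<Union>n::nat. {x. f x \<in> N \<and> expands f (1 / real (Suc n)) x})"
      using expands_if_deriv[OF D(3)] D(1) by blast
  qed
qed

lemma deriv_nonneg:
  assumes "(f has_real_derivative D) (at x)"
  shows "0 \<le> D"
proof (rule ccontr)
  assume "\<not> 0 \<le> D"
  then obtain d where "d > 0" "\<And>h. 0 < h \<Longrightarrow> h < d \<Longrightarrow> f (x + h) < f x"
    using DERIV_neg_dec_right[OF assms] by auto
  from this(2)[of "d / 2"] this(1) f_mono show False by (simp add: strict_mono_less)
qed

text \<open>The fundamental theorem of calculus for monotone functions under Lusin's property (N),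
  which is \<open>lus\<close>. Off a null set the change of variables formula computes the length of
  the image, and \<open>lus\<close> guarantees that the removed set contributes nothing to
  it.\<close>

lemma nn_integral_deriv_Ioo:
  assumes D: "AE x in lborel. (f has_real_derivative D x) (at x)"
    and m: "D \<in> borel_measurable borel"
    and lus: "\<And>N. negligible N \<Longrightarrow> negligible (f ` N)" and ab: "a \<le> b"
  shows "(\<integral>\<^sup>+x. ennreal (D x) * indicator {a<..<b} x \<partial>lborel) = ennreal (f b - f a)"
proof -
  obtain N where N: "N \<in> null_sets lborel" "{x. \<not> (f has_real_derivative D x) (at x)} \<subseteq> N"
    using AE_E3[OF D] by (metis (no_types, lifting) DiffI UNIV_I mem_Collect_eq space_borel space_lborel subsetI)
  define E where "E = {a<..<b} - N"
  have E: "E \<in> sets borel" using N(1) by (auto simp: E_def null_sets_def)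
  then have E': "E \<in> sets lebesgue" by simp
  have der: "(f has_field_derivative D x) (at x within E)" if "x \<in> E" for x
    using that N(2) has_field_derivative_at_within by (fastforce simp: E_def)
  have D0: "0 \<le> D x" if "x \<in> E" for x
    using that N(2) deriv_nonneg[of "D x" x] by (auto simp: E_def)
  have inj: "inj_on f E" by (metis gf inj_onI)
  have im: "f ` {a<..<b} = {f a<..<f b}"
  proof -
    have "y \<in> f ` {a<..<b}" if "f a < y" "y < f b" for y
    proof (rule image_eqI[of _ _ "g y"])
      have "f a < f (g y)" "f (g y) < f b" using that by simp_all
      then show "g y \<in> {a<..<b}" by (simp add: strict_mono_less[OF f_mono] del: fg)
    qed simp
    then show ?thesis using f_mono by (auto simp: strict_mono_less)
  qed
  have nN: "negligible (f ` ({a<..<b} \<inter> N))"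
    using lus[of "{a<..<b} \<inter> N"] N(1)
    by (meson Int_lower2 negligible_iff_null_sets negligible_subset null_sets_completionI)
  have diff: "f ` E = {f a<..<f b} - f ` ({a<..<b} \<inter> N)"
    using im by (auto simp: E_def image_iff) (metis gf)+
  have sd: "negligible (f ` E - {f a<..<f b} \<union> ({f a<..<f b} - f ` E))"
    by (rule negligible_subset[OF nN]) (auto simp: diff)
  have le: "f a \<le> f b" using f_mono ab by (simp add: strict_mono_less_eq)
  have one: "((\<lambda>x::real. 1::real) has_integral (f b - f a)) (f ` E)"
  proof -
    have "((\<lambda>x::real. 1::real) has_integral (f b - f a)) {f a<..<f b}"
      using has_integral_const_real[of "1::real" "f a" "f b"] le by (simp add: has_integral_Icc_iff_Ioo)
    moreover have "((\<lambda>x::real. 1::real) has_integral (f b - f a)) (f ` E)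
        \<longleftrightarrow> ((\<lambda>x::real. 1::real) has_integral (f b - f a)) {f a<..<f b}"
      by (intro has_integral_spike_set_eq negligible_subset[OF sd]) auto
    ultimately show ?thesis by blast
  qed
  have "(\<lambda>x. 1::real) absolutely_integrable_on (f ` E)"
    using one by (intro nonnegative_absolutely_integrable_1) (auto simp: integrable_on_def)
  then have "(\<lambda>x. \<bar>D x\<bar> * 1) absolutely_integrable_on E \<and> integral E (\<lambda>x. \<bar>D x\<bar> * 1) = f b - f a"
    using one has_absolute_integral_change_of_variables_1'[OF E' der inj, of "\<lambda>_. 1" "f b - f a"]
    by (auto simp: integral_unique)
  then have "(\<lambda>x. \<bar>D x\<bar>) integrable_on E" "integral E (\<lambda>x. \<bar>D x\<bar>) = f b - f a"
    by (auto dest: set_lebesgue_integral_eq_integral(1))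
  then have hi: "((\<lambda>x. \<bar>D x\<bar>) has_integral (f b - f a)) E" by (metis integrable_integral)
  have "(\<integral>\<^sup>+x. ennreal (D x) * indicator {a<..<b} x \<partial>lborel) = (\<integral>\<^sup>+x. ennreal \<bar>D x\<bar> * indicator E x \<partial>lborel)"
  proof (rule nn_integral_cong_AE)
    have "AE x in lborel. x \<notin> N" using N(1) by (rule AE_not_in)
    then show "AE x in lborel. ennreal (D x) * indicator {a<..<b} x = ennreal \<bar>D x\<bar> * indicator E x"
      by eventually_elim (use D0 in \<open>auto simp: E_def indicator_def\<close>)
  qed
  also have "\<dots> = ennreal (f b - f a)"
    using nn_integral_has_integral_lebesgue[OF _ hi] m E
    by (simp add: nn_integral_completion indicator_mult_ennreal mult.commute)
  finally show ?thesis .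
qed

text \<open>The area formula as an identity of measures, checked on intervals. For arc length along
  a boundary map it says that ds is |Phi'| dx.\<close>

theorem lborel_eq_distr:
  assumes D: "AE x in lborel. (f has_real_derivative D x) (at x)"
    and m: "D \<in> borel_measurable borel"
    and lus: "\<And>N. negligible N \<Longrightarrow> negligible (f ` N)"
  shows "lborel = distr (density lborel (\<lambda>x. ennreal (D x))) borel f"
proof (rule lborel_eqI)
  fix l u :: real assume "\<And>b. b \<in> Basis \<Longrightarrow> l \<bullet> b \<le> u \<bullet> b"
  then have lu: "l \<le> u" by simp
  have fm: "f \<in> borel_measurable borel" using f_cont by (rule borel_measurable_continuous_onI)
  have vi: "f -` box l u = {g l<..<g u}"
    using g_mono by (auto simp: box_real) (metis gf strict_mono_less)+
  have "emeasure (distr (density lborel (\<lambda>x. ennreal (D x))) borel f) (box l u)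
      = emeasure (density lborel (\<lambda>x. ennreal (D x))) {g l<..<g u}"
    using fm by (simp add: emeasure_distr flip: vi)
  also have "\<dots> = (\<integral>\<^sup>+x. ennreal (D x) * indicator {g l<..<g u} x \<partial>lborel)"
    using m by (simp add: emeasure_density)
  also have "\<dots> = ennreal (f (g u) - f (g l))"
    using lu g_mono by (intro nn_integral_deriv_Ioo[OF D m lus]) (auto simp: strict_mono_less_eq)
  finally show "emeasure (distr (density lborel (\<lambda>x. ennreal (D x))) borel f) (box l u) = (\<Prod>b\<in>Basis. (u - l) \<bullet> b)"
    by simp
qed simp

end

section \<open>Arc length\<close>

definition partn :: "real \<Rightarrow> real \<Rightarrow> (nat \<Rightarrow> real) \<Rightarrow> nat \<Rightarrow> bool" where
  "partn a b t n \<longleftrightarrow> t 0 = a \<and> t n = b \<and> (\<forall>i<n. t i \<le> t (Suc i))"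

definition psum :: "(real \<Rightarrow> complex) \<Rightarrow> (nat \<Rightarrow> real) \<Rightarrow> nat \<Rightarrow> real" where
  "psum c t n = (\<Sum>i<n. norm (c (t (Suc i)) - c (t i)))"

lemma curve_length_eq:
  "curve_length c a b = (SUP nt \<in> {(n, t). partn a b t n}. ennreal (psum c (snd nt) (fst nt)))"
  by (simp add: curve_length_def partn_def psum_def)

lemma psum_le_curve_length: "partn a b t n \<Longrightarrow> ennreal (psum c t n) \<le> curve_length c a b"
  unfolding curve_length_eq by (rule SUP_upper2[of "(n, t)"]) auto

lemma curve_length_le:
  assumes "\<And>t n. partn a b t n \<Longrightarrow> ennreal (psum c t n) \<le> L"
  shows "curve_length c a b \<le> L"
  unfolding curve_length_eq by (rule SUP_least) (use assms in auto)

lemma partn_mono: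
  assumes "partn a b t n" "i \<le> j" "j \<le> n"
  shows "t i \<le> t j"
  using assms(2,3)
proof (induction rule: dec_induct)
  case (step k)
  then have "t k \<le> t (Suc k)" using assms(1) by (simp add: partn_def)
  then show ?case using step by linarith
qed simp

lemma partn_bounds: assumes "partn a b t n" "i \<le> n" shows "a \<le> t i" "t i \<le> b"
  using partn_mono[OF assms(1), of 0 i] partn_mono[OF assms(1), of i n] assms by (auto simp: partn_def)

lemma partn_single: "a \<le> b \<Longrightarrow> partn a b (\<lambda>i. if i = 0 then a else b) 1"
  and psum_single: "psum c (\<lambda>i. if i = 0 then a else b) 1 = norm (c b - c a)"
  by (auto simp: partn_def psum_def)

lemma partn_append:
  assumes 1: "partn a b t n" and 2: "partn b d u k"
  obtains v where "partn a d v (n + k)" "psum c v (n + k) = psum c t n + psum c u k"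
proof -
  define v where "v i = (if i \<le> n then t i else u (i - n))" for i
  have vn: "v (n + j) = u j" for j using 1 2 by (cases j) (auto simp: v_def partn_def)
  have vi: "v i = t i" if "i \<le> n" for i using that by (simp add: v_def)
  have "v i \<le> v (Suc i)" if "i < n + k" for i
  proof (cases "i < n")
    case True then show ?thesis using 1 by (simp add: vi partn_def)
  next
    case False
    then obtain j where j: "i = n + j" using le_Suc_ex not_less by blast
    then show ?thesis using 2 that vn[of j] vn[of "Suc j"] by (simp add: partn_def)
  qed
  then have "partn a d v (n + k)" using 1 2 vn[of k] vi[of 0] by (simp add: partn_def)
  moreover have "psum c v (n + k) = psum c t n + psum c u k"
  proof -
    have "psum c v (n + k) = (\<Sum>i<n. norm (c (v (Suc i)) - c (v i))) + (\<Sum>j<k. norm (c (v (Suc (n + j))) - c (v (n + j))))"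
      unfolding psum_def by (induction k) (simp_all add: add.assoc)
    also have "(\<Sum>i<n. norm (c (v (Suc i)) - c (v i))) = psum c t n"
      unfolding psum_def by (intro sum.cong) (auto simp: vi)
    also have "(\<Sum>j<k. norm (c (v (Suc (n + j))) - c (v (n + j)))) = psum c u k"
      unfolding psum_def using vn by (intro sum.cong) (auto simp flip: add_Suc_right)
    finally show ?thesis .
  qed
  ultimately show ?thesis by (rule that)
qed

text \<open>Inserting \<open>b\<close> as a node can only increase the polygonal sum, by the
  triangle inequality. The induction peels off the last edge: either \<open>b\<close> lies before
  it, or it is the edge to be cut.\<close>

lemma partn_split:
  assumes "partn a d t n" "a \<le> b" "b \<le> d"
  obtains u k v l where "partn a b u k" "partn b d v l" "psum c t n \<le> psum c u k + psum c v l"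
proof -
  have "\<exists>u k v l. partn a b u k \<and> partn b d v l \<and> psum c t n \<le> psum c u k + psum c v l"
    using assms
  proof (induction n arbitrary: d)
    case 0
    then have "a = d" "b = a" by (auto simp: partn_def)
    then have "partn a b t 0" "partn b d t 0" using 0 by (auto simp: partn_def)
    then show ?case by (intro exI[of _ t] exI[of _ 0]) (simp add: psum_def)
  next
    case (Suc n)
    have P: "partn a (t n) t n" and le: "t n \<le> d" and d: "t (Suc n) = d" using Suc.prems(1) by (auto simp: partn_def)
    have ps: "psum c t (Suc n) = psum c t n + norm (c d - c (t n))" by (simp add: psum_def d)
    show ?case
    proof (cases "b \<le> t n")
      case True
      from Suc.IH[OF P Suc.prems(2) True] obtain u k v l where
        u: "partn a b u k" "partn b (t n) v l" "psum c t n \<le> psum c u k + psum c v l" by blast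
      obtain w where "partn b d w (l + 1)" "psum c w (l + 1) = psum c v l + psum c (\<lambda>i. if i = 0 then t n else d) 1"
        using partn_append[OF u(2) partn_single[OF le]] .
      then show ?thesis using u ps psum_single[of c "t n" d]
        by (intro exI[of _ u] exI[of _ k] exI[of _ w] exI[of _ "l + 1"]) simp
    next
      case False
      then have tb: "t n \<le> b" by simp
      obtain w where w: "partn a b w (n + 1)" "psum c w (n + 1) = psum c t n + psum c (\<lambda>i. if i = 0 then t n else b) 1"
        using partn_append[OF P partn_single[OF tb]] .
      have "norm (c d - c (t n)) \<le> norm (c b - c (t n)) + norm (c d - c b)"
        using norm_triangle_ineq[of "c b - c (t n)" "c d - c b"] by simp
      then show ?thesis
        using w ps psum_single[of c "t n" b] partn_single[OF Suc.prems(3)] psum_single[of c b d]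
        by (intro exI[of _ w] exI[of _ "n + 1"] exI[of _ "\<lambda>i. if i = 0 then b else d"] exI[of _ 1]) simp
    qed
  qed
  then show ?thesis using that by blast
qed

definition len :: "(real \<Rightarrow> complex) \<Rightarrow> real \<Rightarrow> real \<Rightarrow> real" where
  "len c a b = enn2real (curve_length c a b)"

lemma psum_nonneg: "0 \<le> psum c t n"
  by (simp add: psum_def sum_nonneg)

context
  fixes c :: "real \<Rightarrow> complex"
  assumes rect: "locally_rectifiable c"
begin

lemma curve_length_len: "a \<le> b \<Longrightarrow> curve_length c a b = ennreal (len c a b)"
  using rect by (simp add: locally_rectifiable_def len_def less_top)

lemma psum_le_len: assumes "partn a b t n" "a \<le> b" shows "psum c t n \<le> len c a b"
proof -
  have "ennreal (psum c t n) \<le> ennreal (len c a b)"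
    using psum_le_curve_length[OF assms(1), of c] curve_length_len[OF assms(2)] by simp
  then show ?thesis by (simp add: ennreal_le_iff len_def)
qed

lemma len_le:
  assumes "\<And>t n. partn a b t n \<Longrightarrow> psum c t n \<le> L" "a \<le> b"
  shows "len c a b \<le> L"
proof -
  have "0 \<le> L" using assms(1)[OF partn_single[OF assms(2)]] psum_nonneg order_trans by blast
  moreover have "ennreal (len c a b) \<le> ennreal L"
    using curve_length_le[of a b c "ennreal L"] assms curve_length_len[of a b] by (simp add: ennreal_leI)
  ultimately show ?thesis by (simp add: ennreal_le_iff)
qed

lemma len_approx:
  assumes "a \<le> b" "0 < e"
  obtains t n where "partn a b t n" "len c a b - e < psum c t n"
proof -
  have "\<not> (\<forall>t n. partn a b t n \<longrightarrow> psum c t n \<le> len c a b - e)"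
    using len_le[of a b "len c a b - e"] assms by fastforce
  then show ?thesis using that by (auto simp: not_le)
qed

lemma chord_le_len: "a \<le> b \<Longrightarrow> norm (c b - c a) \<le> len c a b"
  using psum_le_len[OF partn_single] psum_single by metis

text \<open>Splitting partitions at \<open>b\<close> gives one inequality, concatenating almost
  optimal ones gives the other.\<close>

lemma len_add:
  assumes "a \<le> b" "b \<le> d"
  shows "len c a d = len c a b + len c b d"
proof (rule antisym)
  show "len c a d \<le> len c a b + len c b d"
  proof (rule len_le)
    fix t n assume t: "partn a d t n"
    obtain u k v l where u: "partn a b u k" "partn b d v l" "psum c t n \<le> psum c u k + psum c v l"
      using partn_split[OF t assms, of c] .
    show "psum c t n \<le> len c a b + len c b d"
      using u(3) psum_le_len[OF u(1) assms(1)] psum_le_len[OF u(2) assms(2)] by linarith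
  qed (use assms in simp)
  have ad: "a \<le> d" using assms by simp
  show "len c a b + len c b d \<le> len c a d"
  proof (rule field_le_epsilon)
    fix e :: real assume e: "0 < e"
    obtain t n where t: "partn a b t n" "len c a b - e / 2 < psum c t n" using len_approx[OF assms(1), of "e / 2"] e by auto
    obtain u k where u: "partn b d u k" "len c b d - e / 2 < psum c u k" using len_approx[OF assms(2), of "e / 2"] e by auto
    obtain v where v: "partn a d v (n + k)" "psum c v (n + k) = psum c t n + psum c u k" using partn_append[OF t(1) u(1)] .
    show "len c a b + len c b d \<le> len c a d + e"
      using psum_le_len[OF v(1) ad] v(2) t(2) u(2) by linarith
  qed
qed

end

section \<open>Arc length along an absolutely continuous parametrisation\<close>

lemma arclen_fun_diff:
  assumes rect: "locally_rectifiable (cparam \<gamma>)" and "x \<le> y"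
  shows "arclen_fun \<gamma> y - arclen_fun \<gamma> x = len (cparam \<gamma>) x y"
proof -
  note a = len_add[OF rect]
  consider "0 \<le> x" | "x < 0" "0 \<le> y" | "y < 0" by linarith
  then show ?thesis
  proof cases
    case 1 then show ?thesis using assms(2) a[of 0 x y] by (simp add: arclen_fun_def len_def)
  next
    case 2 then show ?thesis using a[of x 0 y] by (simp add: arclen_fun_def len_def)
  next
    case 3 then show ?thesis using assms(2) a[of x y 0] by (simp add: arclen_fun_def len_def)
  qed
qed

text \<open>Finite sets of intervals replace the indexed families of
  \<open>locally_abs_cont\<close>, because partitions of several intervals have to be
  united.\<close>

definition nonoverlapping :: "(real \<times> real) set \<Rightarrow> bool" where
  "nonoverlapping P \<longleftrightarrow> (\<forall>p\<in>P. \<forall>q\<in>P. p \<noteq> q \<longrightarrow> snd p \<le> fst q \<or> snd q \<le> fst p)"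

lemma locally_abs_cont_sets:
  assumes "locally_abs_cont f" "a \<le> b" "0 < e"
  obtains d where "0 < d" "\<And>P. finite P \<Longrightarrow> nonoverlapping P \<Longrightarrow> (\<And>p. p \<in> P \<Longrightarrow> a \<le> fst p \<and> fst p \<le> snd p \<and> snd p \<le> b) \<Longrightarrow>
    (\<Sum>p\<in>P. snd p - fst p) < d \<Longrightarrow> (\<Sum>p\<in>P. norm (f (snd p) - f (fst p))) < e"
proof -
  obtain d where d: "d > 0" "\<And>(n::nat) l r. (\<forall>i<n. a \<le> l i \<and> l i \<le> r i \<and> r i \<le> b) \<and>
      (\<forall>i<n. \<forall>j<n. i \<noteq> j \<longrightarrow> r i \<le> l j \<or> r j \<le> l i) \<and>
      (\<Sum>i<n. r i - l i) < d \<Longrightarrow> (\<Sum>i<n. norm (f (r i) - f (l i))) < e"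
    using assms(1)[unfolded locally_abs_cont_def, rule_format, OF assms(2,3)] by blast
  show ?thesis
  proof (rule that[OF d(1)])
    fix P :: "(real \<times> real) set"
    assume P: "finite P" "nonoverlapping P" "\<And>p. p \<in> P \<Longrightarrow> a \<le> fst p \<and> fst p \<le> snd p \<and> snd p \<le> b"
      "(\<Sum>p\<in>P. snd p - fst p) < d"
    obtain h where h: "bij_betw h {..<card P} P" using ex_bij_betw_nat_finite[OF P(1)] by (auto simp: atLeast0LessThan)
    have hP: "h i \<in> P" if "i < card P" for i using h that by (auto simp: bij_betw_def)
    have "(\<Sum>i<card P. norm (f (snd (h i)) - f (fst (h i)))) < e"
    proof (rule d(2), intro conjI allI impI)
      fix i j assume ij: "i < card P" "j < card P" "i \<noteq> j"
      then have "h i \<noteq> h j" using h by (auto simp: bij_betw_def inj_on_def)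
      then show "snd (h i) \<le> fst (h j) \<or> snd (h j) \<le> fst (h i)"
        using P(2) hP ij by (auto simp: nonoverlapping_def)
    next
      show "(\<Sum>i<card P. snd (h i) - fst (h i)) < d"
        using P(4) sum.reindex_bij_betw[OF h, of "\<lambda>p. snd p - fst p"] by simp
    qed (use P(3) hP in auto)
    then show "(\<Sum>p\<in>P. norm (f (snd p) - f (fst p))) < e"
      using sum.reindex_bij_betw[OF h, of "\<lambda>p. norm (f (snd p) - f (fst p))"] by simp
  qed
qed

lemma partition_pairs:
  assumes t: "partn a b t n"
  obtains Q where "finite Q" "nonoverlapping Q" "\<forall>p\<in>Q. a \<le> fst p \<and> fst p < snd p \<and> snd p \<le> b"
    "(\<Sum>p\<in>Q. snd p - fst p) = b - a" "(\<Sum>p\<in>Q. norm (f (snd p) - f (fst p))) = psum f t n"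
proof -
  \<comment> \<open>Degenerate steps are dropped. This makes \<open>h\<close> injective and later
    keeps the sets of pieces of different intervals disjoint, even when the intervals share an
    endpoint.\<close>
  define I where "I = {i. i < n \<and> t i < t (Suc i)}"
  define h where "h i = (t i, t (Suc i))" for i
  have order: "t (Suc i) \<le> t j" if "i \<in> I" "j \<in> I" "i < j" for i j
    using partn_mono[OF t, of "Suc i" j] that by (auto simp: I_def)
  have inj: "inj_on h I"
  proof (rule inj_onI)
    fix i j assume ij: "i \<in> I" "j \<in> I" "h i = h j"
    then have "t i = t j" "t i < t (Suc i)" "t j < t (Suc j)" by (auto simp: h_def I_def)
    then show "i = j" using order[of i j] order[of j i] ij by (cases i j rule: linorder_cases) auto
  qed
  have fI: "finite I" by (simp add: I_def)
  have eq: "(\<Sum>p\<in>h ` I. F (fst p) (snd p)) = (\<Sum>i<n. F (t i) (t (Suc i)))" if "\<And>x. F x x = 0" for F :: "real \<Rightarrow> real \<Rightarrow> real"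
  proof -
    have "(\<Sum>p\<in>h ` I. F (fst p) (snd p)) = (\<Sum>i\<in>I. F (t i) (t (Suc i)))"
      unfolding sum.reindex[OF inj] by (simp add: h_def)
    also have "\<dots> = (\<Sum>i<n. F (t i) (t (Suc i)))"
    proof (rule sum.mono_neutral_left)
      show "\<forall>i\<in>{..<n} - I. F (t i) (t (Suc i)) = 0"
      proof
        fix i assume i: "i \<in> {..<n} - I"
        then have "t i \<le> t (Suc i)" using t by (auto simp: partn_def)
        then have "t i = t (Suc i)" using i by (auto simp: I_def)
        then show "F (t i) (t (Suc i)) = 0" using that by simp
      qed
    qed (auto simp: I_def)
    finally show ?thesis .
  qed
  show ?thesis
  proof (rule that[of "h ` I"])
    show "nonoverlapping (h ` I)" unfolding nonoverlapping_def
    proof (intro ballI impI)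
      fix p q assume "p \<in> h ` I" "q \<in> h ` I" "p \<noteq> q"
      then obtain i j where "i \<in> I" "j \<in> I" "p = h i" "q = h j" "i \<noteq> j" by auto
      then show "snd p \<le> fst q \<or> snd q \<le> fst p"
        using order[of i j] order[of j i] by (cases i j rule: linorder_cases) (auto simp: h_def)
    qed
    show "\<forall>p\<in>h ` I. a \<le> fst p \<and> fst p < snd p \<and> snd p \<le> b"
      using partn_bounds[OF t] by (auto simp: h_def I_def)
    show "(\<Sum>p\<in>h ` I. snd p - fst p) = b - a"
      using eq[of "\<lambda>x y. y - x"] t by (simp add: sum_lessThan_telescope partn_def)
    show "(\<Sum>p\<in>h ` I. norm (f (snd p) - f (fst p))) = psum f t n"
      using eq[of "\<lambda>x y. norm (f y - f x)"] by (simp add: psum_def)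
  qed (use fI in simp)
qed

text \<open>In the application \<open>\<phi>\<close> is the boundary map of a conformal map,
  reflected if necessary, and \<open>Y\<close> is its abscissa. Absolute continuity is available for
  \<open>\<phi>\<close> and not for \<open>\<gamma>\<close>, so the continuity of arc length is
  obtained through \<open>\<phi>\<close>.\<close>

locale arc_param =
  fixes \<gamma> :: "real \<Rightarrow> real" and \<phi> :: "real \<Rightarrow> complex" and Y Z :: "real \<Rightarrow> real"
  assumes rect: "locally_rectifiable (cparam \<gamma>)"
    and Y: "real_homeo Y Z"
    and \<phi>: "\<And>x. \<phi> x = cparam \<gamma> (Y x)"
    and ac: "locally_abs_cont \<phi>"
begin

sublocale Y: real_homeo Y Z by (rule Y)

abbreviation s where "s \<equiv> arclen_fun \<gamma>"

definition f where "f x = s (Y x)"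

lemma chord_le_arclen: "x \<le> y \<Longrightarrow> norm (cparam \<gamma> y - cparam \<gamma> x) \<le> s y - s x"
  using chord_le_len[OF rect] arclen_fun_diff[OF rect] by simp

text \<open>A chord dominates its horizontal projection. Together with continuity this makes
  \<open>s\<close> a bijection of the line with a 1-Lipschitz inverse.\<close>

lemma arclen_expanding: "x \<le> y \<Longrightarrow> y - x \<le> s y - s x"
  using chord_le_arclen[of x y] abs_Re_le_cmod[of "cparam \<gamma> y - cparam \<gamma> x"] by (simp add: cparam_def)

lemma s_strict_mono: "strict_mono s"
proof (rule strict_monoI)
  fix x y :: real assume "x < y"
  then show "s x < s y" using arclen_expanding[of x y] by linarith
qed

lemma f_strict_mono: "strict_mono f"
  using s_strict_mono Y.f_mono by (auto simp: strict_mono_def f_def)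

lemma f_approx:
  assumes "l \<le> r" "0 < e"
  obtains t n where "partn l r t n" "f r - f l - e < psum \<phi> t n"
proof -
  have lr: "Y l \<le> Y r" using assms Y.f_mono by (simp add: strict_mono_less_eq)
  obtain t n where t: "partn (Y l) (Y r) t n" "len (cparam \<gamma>) (Y l) (Y r) - e < psum (cparam \<gamma>) t n"
    using len_approx[OF rect lr assms(2)] .
  have "partn l r (Z \<circ> t) n" using t(1) Y.g_mono by (auto simp: partn_def strict_mono_less_eq)
  moreover have "psum (cparam \<gamma>) t n = psum \<phi> (Z \<circ> t) n" by (simp add: psum_def \<phi>)
  ultimately show ?thesis using that t(2) arclen_fun_diff[OF rect lr] by (simp add: f_def)
qed

text \<open>Arc length on an interval is almost attained by an inscribed polygon, whose nodes cut
  the interval into pieces of the same total length. Absolute continuity of \<open>\<phi>\<close>,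
  applied to the pieces of all intervals at once, therefore bounds the sum of the lengths.\<close>

lemma f_abs_cont:
  assumes "a \<le> b" "0 < e"
  obtains d where "0 < d" "\<And>P. finite P \<Longrightarrow> nonoverlapping P \<Longrightarrow> (\<And>p. p \<in> P \<Longrightarrow> a \<le> fst p \<and> fst p \<le> snd p \<and> snd p \<le> b) \<Longrightarrow>
    (\<Sum>p\<in>P. snd p - fst p) < d \<Longrightarrow> (\<Sum>p\<in>P. f (snd p) - f (fst p)) \<le> e"
proof -
  obtain d where d: "0 < d" "\<And>P. finite P \<Longrightarrow> nonoverlapping P \<Longrightarrow> (\<And>p. p \<in> P \<Longrightarrow> a \<le> fst p \<and> fst p \<le> snd p \<and> snd p \<le> b) \<Longrightarrow>
    (\<Sum>p\<in>P. snd p - fst p) < d \<Longrightarrow> (\<Sum>p\<in>P. norm (\<phi> (snd p) - \<phi> (fst p))) < e"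
    using locally_abs_cont_sets[OF ac assms] by blast
  show ?thesis
  proof (rule that[OF d(1)], rule ccontr)
    fix P :: "(real \<times> real) set"
    assume P: "finite P" "nonoverlapping P" "\<And>p. p \<in> P \<Longrightarrow> a \<le> fst p \<and> fst p \<le> snd p \<and> snd p \<le> b"
      "(\<Sum>p\<in>P. snd p - fst p) < d" and neg: "\<not> (\<Sum>p\<in>P. f (snd p) - f (fst p)) \<le> e"
    \<comment> \<open>The excess over \<open>e\<close> is shared among the intervals; the additional
      1 leaves one share over, which gives the contradiction.\<close>
    define \<eta> where "\<eta> = ((\<Sum>p\<in>P. f (snd p) - f (fst p)) - e) / (real (card P) + 1)"
    have \<eta>: "\<eta> > 0" using neg by (simp add: \<eta>_def add_nonneg_pos)
    have "\<exists>Q. finite Q \<and> nonoverlapping Q \<and> (\<forall>q\<in>Q. fst p \<le> fst q \<and> fst q < snd q \<and> snd q \<le> snd p) \<and>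
       (\<Sum>q\<in>Q. snd q - fst q) = snd p - fst p \<and> f (snd p) - f (fst p) - \<eta> < (\<Sum>q\<in>Q. norm (\<phi> (snd q) - \<phi> (fst q)))"
      if p: "p \<in> P" for p
    proof -
      have "fst p \<le> snd p" using P(3)[OF p] by simp
      then obtain t n where t: "partn (fst p) (snd p) t n" "f (snd p) - f (fst p) - \<eta> < psum \<phi> t n" using f_approx \<eta> by blast
      obtain Q where Q: "finite Q" "nonoverlapping Q" "\<forall>q\<in>Q. fst p \<le> fst q \<and> fst q < snd q \<and> snd q \<le> snd p"
        "(\<Sum>q\<in>Q. snd q - fst q) = snd p - fst p" "(\<Sum>q\<in>Q. norm (\<phi> (snd q) - \<phi> (fst q))) = psum \<phi> t n"
        by (rule partition_pairs[OF t(1), of \<phi>])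
      show ?thesis using Q t(2) by (intro exI[of _ Q]) simp
    qed
    then have exQ: "\<forall>p. \<exists>Q. p \<in> P \<longrightarrow> finite Q \<and> nonoverlapping Q \<and> (\<forall>q\<in>Q. fst p \<le> fst q \<and> fst q < snd q \<and> snd q \<le> snd p) \<and>
       (\<Sum>q\<in>Q. snd q - fst q) = snd p - fst p \<and> f (snd p) - f (fst p) - \<eta> < (\<Sum>q\<in>Q. norm (\<phi> (snd q) - \<phi> (fst q)))"
      by blast
    obtain Q where "\<forall>p. p \<in> P \<longrightarrow> finite (Q p) \<and> nonoverlapping (Q p) \<and> (\<forall>q\<in>Q p. fst p \<le> fst q \<and> fst q < snd q \<and> snd q \<le> snd p) \<and>
       (\<Sum>q\<in>Q p. snd q - fst q) = snd p - fst p \<and> f (snd p) - f (fst p) - \<eta> < (\<Sum>q\<in>Q p. norm (\<phi> (snd q) - \<phi> (fst q)))"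
      using choice[OF exQ] by blast
    then have Q: "\<And>p. p \<in> P \<Longrightarrow> finite (Q p)" "\<And>p. p \<in> P \<Longrightarrow> nonoverlapping (Q p)"
      "\<And>p q. p \<in> P \<Longrightarrow> q \<in> Q p \<Longrightarrow> fst p \<le> fst q \<and> fst q < snd q \<and> snd q \<le> snd p"
      "\<And>p. p \<in> P \<Longrightarrow> (\<Sum>q\<in>Q p. snd q - fst q) = snd p - fst p"
      "\<And>p. p \<in> P \<Longrightarrow> f (snd p) - f (fst p) - \<eta> < (\<Sum>q\<in>Q p. norm (\<phi> (snd q) - \<phi> (fst q)))"
      by blast+
    have sep: "snd q \<le> fst q' \<or> snd q' \<le> fst q" if "p \<in> P" "p' \<in> P" "p \<noteq> p'" "q \<in> Q p" "q' \<in> Q p'" for p p' q q'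
      using P(2) that Q(3)[of p q] Q(3)[of p' q'] unfolding nonoverlapping_def by force
    have disj: "\<forall>p\<in>P. \<forall>p'\<in>P. p \<noteq> p' \<longrightarrow> Q p \<inter> Q p' = {}"
    proof (intro ballI impI equals0I)
      fix p p' q assume *: "p \<in> P" "p' \<in> P" "p \<noteq> p'" "q \<in> Q p \<inter> Q p'"
      then show False using sep[of p p' q q] Q(3)[of p q] by auto
    qed
    have fin: "\<forall>p\<in>P. finite (Q p)" using Q(1) by blast
    note su = sum.UNION_disjoint[OF P(1) fin disj]
    have "(\<Sum>q\<in>(\<Union>p\<in>P. Q p). norm (\<phi> (snd q) - \<phi> (fst q))) < e"
    proof (rule d(2))
      show "finite (\<Union>p\<in>P. Q p)" using P(1) Q(1) by blast
      show "nonoverlapping (\<Union>p\<in>P. Q p)"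
        unfolding nonoverlapping_def
      proof (intro ballI impI)
        fix q q' assume "q \<in> (\<Union>p\<in>P. Q p)" "q' \<in> (\<Union>p\<in>P. Q p)" "q \<noteq> q'"
        then obtain p p' where "p \<in> P" "p' \<in> P" "q \<in> Q p" "q' \<in> Q p'" by blast
        then show "snd q \<le> fst q' \<or> snd q' \<le> fst q"
          using sep[of p p' q q'] Q(2)[of p] \<open>q \<noteq> q'\<close> unfolding nonoverlapping_def by blast
      qed
      show "a \<le> fst q \<and> fst q \<le> snd q \<and> snd q \<le> b" if "q \<in> (\<Union>p\<in>P. Q p)" for q
        using that P(3) Q(3) by fastforce
      show "(\<Sum>q\<in>(\<Union>p\<in>P. Q p). snd q - fst q) < d"
        using P(4) Q(4) by (subst su) simp
    qed
    then have 1: "(\<Sum>p\<in>P. \<Sum>q\<in>Q p. norm (\<phi> (snd q) - \<phi> (fst q))) < e" by (subst (asm) su)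
    have "(\<Sum>p\<in>P. f (snd p) - f (fst p) - \<eta>) \<le> (\<Sum>p\<in>P. \<Sum>q\<in>Q p. norm (\<phi> (snd q) - \<phi> (fst q)))"
      using Q(5) by (intro sum_mono less_imp_le)
    then have "(\<Sum>p\<in>P. f (snd p) - f (fst p)) - real (card P) * \<eta> < e" using 1 by (simp add: sum_subtractf)
    moreover have "(real (card P) + 1) * \<eta> = (\<Sum>p\<in>P. f (snd p) - f (fst p)) - e" by (simp add: \<eta>_def)
    ultimately show False using \<eta> by (simp add: distrib_right)
  qed
qed

lemma f_continuous: "continuous_on UNIV f"
  unfolding continuous_on_eq_continuous_at[OF open_UNIV] continuous_at_eps_delta
proof (intro ballI allI impI)
  fix x e :: real assume e: "0 < e"
  obtain d where d: "0 < d" "\<And>P. finite P \<Longrightarrow> nonoverlapping P \<Longrightarrow> (\<And>p. p \<in> P \<Longrightarrow> x - 1 \<le> fst p \<and> fst p \<le> snd p \<and> snd p \<le> x + 1) \<Longrightarrow>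
    (\<Sum>p\<in>P. snd p - fst p) < d \<Longrightarrow> (\<Sum>p\<in>P. f (snd p) - f (fst p)) \<le> e / 2"
    using f_abs_cont[of "x - 1" "x + 1" "e / 2"] e by auto
  have step: "f v - f u \<le> e / 2" if "x - 1 \<le> u" "u \<le> v" "v \<le> x + 1" "v - u < d" for u v
    using d(2)[of "{(u, v)}"] that by (simp add: nonoverlapping_def)
  have "dist (f y) (f x) < e" if y: "dist y x < min d 1" for y
  proof (cases "x \<le> y")
    case True
    then have "f x \<le> f y" using f_strict_mono by (simp add: strict_mono_less_eq)
    moreover have "f y - f x \<le> e / 2" using True y by (intro step) (auto simp: dist_real_def)
    ultimately show ?thesis using e by (simp add: dist_real_def)
  next
    case False
    then have "f y \<le> f x" using f_strict_mono by (simp add: strict_mono_less_eq)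
    moreover have "f x - f y \<le> e / 2" using False y by (intro step) (auto simp: dist_real_def)
    ultimately show ?thesis using e by (simp add: dist_real_def)
  qed
  then show "\<exists>d>0. \<forall>y. dist y x < d \<longrightarrow> dist (f y) (f x) < e" using d(1) by (intro exI[of _ "min d 1"]) auto
qed

lemma s_continuous: "continuous_on UNIV s"
proof -
  have "s = f \<circ> Z" by (simp add: f_def fun_eq_iff)
  then show ?thesis using f_continuous Y.g_cont
    by (metis continuous_on_compose continuous_on_subset subset_UNIV)
qed

text \<open>Lusin's property (N) of arc length. Nonoverlapping intervals inside an open set of small
  measure cover \<open>N\<close>; by absolute continuity any finitely many of their images have
  total length at most \<open>e\<close>, and this bound passes to the countable union.\<close>

lemma f_image_negligible_bounded:
  assumes N: "negligible N" "N \<subseteq> {a..b}" and ab: "a < b"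
  shows "negligible (f ` N)"
  unfolding negligible_outer_le
proof (intro allI impI)
  fix e :: real assume e: "0 < e"
  obtain d where d: "0 < d" "\<And>P. finite P \<Longrightarrow> nonoverlapping P \<Longrightarrow> (\<And>p. p \<in> P \<Longrightarrow> a \<le> fst p \<and> fst p \<le> snd p \<and> snd p \<le> b) \<Longrightarrow>
    (\<Sum>p\<in>P. snd p - fst p) < d \<Longrightarrow> (\<Sum>p\<in>P. f (snd p) - f (fst p)) \<le> e"
    using f_abs_cont[of a b e] ab e by auto
  obtain U where U: "open U" "N \<subseteq> U" "emeasure lebesgue U \<le> ennreal (d / 2)"
    using negligible_open_cover[OF N(1), of "d / 2"] d(1) by auto
  have Um: "U \<in> lmeasurable"
  proof (rule fmeasurableI)
    show "emeasure lebesgue U < \<infinity>" using U(3) by (rule le_less_trans) simp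
  qed (use U in auto)
  have mU: "measure lebesgue U < d"
  proof -
    have "measure lebesgue U \<le> d / 2" unfolding measure_def by (rule enn2real_leI) (use U(3) d(1) in auto)
    then show ?thesis using d(1) by linarith
  qed
  \<comment> \<open>This gauge forces each interval of the covering lemma, being tagged by a point
    of \<open>N\<close>, into \<open>U\<close>.\<close>
  have "gauge (\<lambda>x. if x \<in> U then U else UNIV)" using U(1) by (auto simp: gauge_def)
  moreover have "N \<subseteq> cbox a b" "box a b \<noteq> {}" using N(2) ab by auto
  ultimately obtain \<D> where D: "countable \<D>" "\<Union>\<D> \<subseteq> cbox a b"
    "\<And>K. K \<in> \<D> \<Longrightarrow> interior K \<noteq> {} \<and> (\<exists>c d. K = cbox c d)"
    "pairwise (\<lambda>A B. interior A \<inter> interior B = {}) \<D>"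
    "\<And>K. K \<in> \<D> \<Longrightarrow> \<exists>x \<in> N \<inter> K. K \<subseteq> (if x \<in> U then U else UNIV)"
    "N \<subseteq> \<Union>\<D>"
    using covering_lemma[of N a b "\<lambda>x. if x \<in> U then U else UNIV"] by metis
  have KU: "K \<subseteq> U" if "K \<in> \<D>" for K using D(5)[OF that] U(2) by (auto split: if_splits)
  define lo hi where "lo K = Inf K" and "hi K = Sup K" for K :: "real set"
  have K: "lo K < hi K" "K = {lo K..hi K}" if KD: "K \<in> \<D>" for K
  proof -
    obtain u v where uv: "K = {u..v}" "interior K \<noteq> {}" using D(3)[OF KD] by auto
    then have "u < v" by (auto simp: interior_atLeastAtMost_real)
    then show "lo K < hi K" "K = {lo K..hi K}" using uv(1) by (auto simp: lo_def hi_def)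
  qed
  have fK: "f ` K \<subseteq> {f (lo K)..f (hi K)}" if "K \<in> \<D>" for K
    using K(2)[OF that] f_strict_mono by (auto simp: strict_mono_less_eq)
  have bound: "measure lebesgue (\<Union>K\<in>\<D>'. {f (lo K)..f (hi K)}) \<le> e" if D': "\<D>' \<subseteq> \<D>" "finite \<D>'" for \<D>'
  proof -
    define P where "P = (\<lambda>K. (lo K, hi K)) ` \<D>'"
    have injP: "inj_on (\<lambda>K. (lo K, hi K)) \<D>'"
      using K(2) D'(1) by (intro inj_onI) (metis prod.inject subsetD)
    have order: "hi A \<le> lo B \<or> hi B \<le> lo A" if AB: "A \<in> \<D>" "B \<in> \<D>" "A \<noteq> B" for A B
    proof (rule ccontr)
      assume "\<not> (hi A \<le> lo B \<or> hi B \<le> lo A)"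
      then have "max (lo A) (lo B) < min (hi A) (hi B)" using K(1)[OF AB(1)] K(1)[OF AB(2)] by auto
      then obtain x where x: "max (lo A) (lo B) < x" "x < min (hi A) (hi B)" using dense by blast
      have "interior A = {lo A<..<hi A}" "interior B = {lo B<..<hi B}"
        using K(2)[OF AB(1)] K(2)[OF AB(2)] by (metis interior_atLeastAtMost_real)+
      then have "x \<in> interior A \<inter> interior B" using x by auto
      then show False using D(4) AB by (auto simp: pairwise_def)
    qed
    have "(\<Sum>p\<in>P. f (snd p) - f (fst p)) \<le> e"
    proof (rule d(2))
      show "finite P" using D'(2) by (simp add: P_def)
      show "nonoverlapping P" unfolding nonoverlapping_def P_def using order D'(1) by fastforce
      show "a \<le> fst p \<and> fst p \<le> snd p \<and> snd p \<le> b" if p: "p \<in> P" for p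
      proof -
        obtain A where A: "A \<in> \<D>" "p = (lo A, hi A)" using p D'(1) by (auto simp: P_def)
        have "{lo A..hi A} \<subseteq> {a..b}" using A(1) D(2) K(2)[OF A(1)] by auto
        then show ?thesis using K(1)[OF A(1)] A(2) by auto
      qed
      have "(\<Sum>p\<in>P. snd p - fst p) = (\<Sum>K\<in>\<D>'. hi K - lo K)"
        unfolding P_def by (simp add: sum.reindex[OF injP])
      also have "\<dots> = (\<Sum>K\<in>\<D>'. measure lebesgue {lo K<..<hi K})"
        using K(1) D'(1) by (intro sum.cong) (auto simp: less_imp_le subset_iff)
      also have "\<dots> = measure lebesgue (\<Union>K\<in>\<D>'. {lo K<..<hi K})"
      proof (rule measure_UNION'[symmetric, OF D'(2)])
        show "pairwise (\<lambda>A B. disjnt {lo A<..<hi A} {lo B<..<hi B}) \<D>'"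
        proof (rule pairwiseI)
          fix A B assume "A \<in> \<D>'" "B \<in> \<D>'" "A \<noteq> B"
          then have "hi A \<le> lo B \<or> hi B \<le> lo A" using order D'(1) by blast
          then show "disjnt {lo A<..<hi A} {lo B<..<hi B}" by (auto simp: disjnt_def)
        qed
      qed simp
      also have "\<dots> \<le> measure lebesgue U"
      proof (rule measure_mono_fmeasurable[OF _ _ Um])
        show "(\<Union>K\<in>\<D>'. {lo K<..<hi K}) \<subseteq> U"
        proof (rule UN_least)
          fix A assume "A \<in> \<D>'"
          then have "A \<in> \<D>" using D'(1) by blast
          then show "{lo A<..<hi A} \<subseteq> U" using KU K(2) greaterThanLessThan_subseteq_atLeastAtMost_iff
            by (metis order_refl order_trans)
        qed
        show "(\<Union>K\<in>\<D>'. {lo K<..<hi K}) \<in> sets lebesgue" using D'(2) by (intro sets.finite_UN) auto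
      qed
      finally show "(\<Sum>p\<in>P. snd p - fst p) < d" using mU by linarith
    qed
    then have sumle: "(\<Sum>K\<in>\<D>'. f (hi K) - f (lo K)) \<le> e" unfolding P_def by (simp add: sum.reindex[OF injP])
    have "measure lebesgue (\<Union>K\<in>\<D>'. {f (lo K)..f (hi K)}) \<le> (\<Sum>K\<in>\<D>'. measure lebesgue {f (lo K)..f (hi K)})"
      using D'(2) by (intro measure_UNION_le) auto
    also have "\<dots> = (\<Sum>K\<in>\<D>'. f (hi K) - f (lo K))"
      using K(1) D'(1) f_strict_mono by (intro sum.cong) (auto simp: strict_mono_less_eq less_imp_le subset_iff)
    finally show ?thesis using sumle by linarith
  qed
  have lm: "{f (lo K)..f (hi K)} \<in> lmeasurable" for K by (simp add: lmeasurable_compact)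
  let ?T = "\<Union>K\<in>\<D>. {f (lo K)..f (hi K)}"
  have "?T \<in> lmeasurable" "measure lebesgue ?T \<le> e"
    using fmeasurable_UN_bound[OF D(1) lm bound] measure_UN_bound[OF D(1) lm bound] by blast+
  moreover have "f ` N \<subseteq> ?T" using D(6) fK by fastforce
  ultimately show "\<exists>T. f ` N \<subseteq> T \<and> T \<in> lmeasurable \<and> measure lebesgue T \<le> e" by blast
qed

lemma f_image_negligible:
  assumes "negligible N" shows "negligible (f ` N)"
proof -
  have "f ` N = (\<Union>n::nat. f ` (N \<inter> {- real n - 1..real n + 1}))"
  proof (intro equalityI subsetI)
    fix y assume "y \<in> f ` N"
    then obtain x where x: "x \<in> N" "y = f x" by blast
    obtain n :: nat where "\<bar>x\<bar> \<le> real n" using real_arch_simple by blast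
    then have "x \<in> N \<inter> {- real n - 1..real n + 1}" using x(1) by auto
    then show "y \<in> (\<Union>n::nat. f ` (N \<inter> {- real n - 1..real n + 1}))" using x(2) by blast
  qed blast
  moreover have "negligible (f ` (N \<inter> {- real n - 1..real n + 1}))" for n :: nat
    by (rule f_image_negligible_bounded[of _ "- real n - 1" "real n + 1"])
      (auto intro: negligible_subset[OF assms])
  then have "negligible (\<Union>n::nat. f ` (N \<inter> {- real n - 1..real n + 1}))"
    by (intro negligible_countable_Union) auto
  ultimately show ?thesis by simp
qed

end

section \<open>Cones and boundary derivatives\<close>

text \<open>The sign \<open>e\<close>, which is 1 or -1 in all uses, selects the side, so that both
  half-planes and both conformal maps are handled by one argument.\<close>

definition half_plane :: "real \<Rightarrow> complex set" where
  "half_plane e = {z. 0 < e * Im z}"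

definition cone :: "real \<Rightarrow> real \<Rightarrow> real \<Rightarrow> complex set" where
  "cone e \<alpha> x = {z. 0 < e * Im z \<and> \<bar>Re z - x\<bar> < tan \<alpha> * (e * Im z)}"

lemma upper_hp_eq: "upper_hp = half_plane 1" and lower_hp_eq: "lower_hp = half_plane (- 1)"
  by (auto simp: upper_hp_def lower_hp_def half_plane_def)

lemma cone_plus_eq: "cone_plus = cone 1" and cone_minus_eq: "cone_minus = cone (- 1)"
  by (auto simp: cone_plus_def cone_minus_def cone_def fun_eq_iff)

lemma open_half_plane: "open (half_plane e)"
  unfolding half_plane_def by (intro open_Collect_less continuous_intros)

lemma closure_half_plane:
  assumes "e \<noteq> 0" shows "closure (half_plane e) = {z. 0 \<le> e * Im z}"
proof (rule antisym)
  show "closure (half_plane e) \<subseteq> {z. 0 \<le> e * Im z}"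
    by (rule closure_minimal) (auto simp: half_plane_def intro!: closed_Collect_le continuous_intros)
  show "{z. 0 \<le> e * Im z} \<subseteq> closure (half_plane e)"
  proof
    fix z assume z: "z \<in> {z. 0 \<le> e * Im z}"
    have "(\<lambda>n. z + Complex 0 (e / real (Suc n))) \<longlonglongrightarrow> z + Complex 0 0"
      by (intro tendsto_intros LIMSEQ_Suc lim_const_over_n)
    moreover have "z + Complex 0 (e / real (Suc n)) \<in> half_plane e" for n
    proof -
      have "0 < e * e" using assms by (simp add: zero_less_mult_iff) linarith
      then have "0 < e * (e / real (Suc n))" by (simp only: times_divide_eq_right) (rule divide_pos_pos, auto)
      then show ?thesis using z by (simp add: half_plane_def distrib_left)
    qed
    ultimately show "z \<in> closure (half_plane e)"
      by (metis (no_types, lifting) add.right_neutral closure_sequential zero_complex.code)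
  qed
qed

lemma cone_mono: assumes "0 < \<alpha>" "\<alpha> \<le> \<beta>" "\<beta> < pi / 2" shows "cone e \<alpha> x \<subseteq> cone e \<beta> x"
proof
  fix z assume z: "z \<in> cone e \<alpha> x"
  have "tan \<alpha> \<le> tan \<beta>" using assms by (simp add: tan_mono_le_eq)
  then have "tan \<alpha> * (e * Im z) \<le> tan \<beta> * (e * Im z)" using z by (intro mult_right_mono) (auto simp: cone_def)
  then show "z \<in> cone e \<beta> x" using z by (auto simp: cone_def)
qed

lemma cone_subset_half_plane: "cone e \<alpha> x \<subseteq> half_plane e"
  by (auto simp: cone_def half_plane_def)

lemma tan_gt_0: "0 < \<alpha> \<Longrightarrow> \<alpha> < pi / 2 \<Longrightarrow> 0 < tan \<alpha>"
  by (simp add: tan_gt_zero)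

lemma vertical_in_cone:
  assumes e: "e = 1 \<or> e = - 1" and "0 < t" "0 < \<alpha>" "\<alpha> < pi / 2"
  shows "Complex x (e * t) \<in> cone e \<alpha> x"
  using assms tan_gt_0[of \<alpha>] by (auto simp: cone_def)

lemma trivial_limit_cone:
  assumes e: "e = 1 \<or> e = - 1" and "0 < \<alpha>" "\<alpha> < pi / 2"
  shows "at (complex_of_real x) within cone e \<alpha> x \<noteq> bot"
proof -
  have "complex_of_real x islimpt cone e \<alpha> x"
    unfolding islimpt_approachable
  proof (intro allI impI)
    fix d :: real assume d: "0 < d"
    have "Complex x (e * (d / 2)) \<in> cone e \<alpha> x" by (rule vertical_in_cone) (use assms d in auto)
    moreover have "Complex x (e * (d / 2)) \<noteq> of_real x" using d e by (auto simp: complex_eq_iff)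
    moreover have "Complex x (e * (d / 2)) - of_real x = Complex 0 (e * (d / 2))" by (simp add: complex_eq_iff)
    then have "dist (Complex x (e * (d / 2))) (of_real x) = \<bar>e * (d / 2)\<bar>"
      by (simp add: dist_norm complex_norm)
    then have "dist (Complex x (e * (d / 2))) (of_real x) < d" using d e by auto
    ultimately show "\<exists>x'\<in>cone e \<alpha> x. x' \<noteq> of_real x \<and> dist x' (of_real x) < d" by blast
  qed
  then show ?thesis by (simp add: trivial_limit_within)
qed

lemma nt_conv_mono:
  assumes "(F \<longlongrightarrow> l) (at (complex_of_real x) within cone e \<beta> x)" "0 < \<alpha>" "\<alpha> \<le> \<beta>" "\<beta> < pi / 2"
  shows "(F \<longlongrightarrow> l) (at (complex_of_real x) within cone e \<alpha> x)"
  using tendsto_within_subset[OF assms(1) cone_mono[OF assms(2-4)]] .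

section \<open>Non-tangential and tangential derivatives at the boundary\<close>

lemma cone_segment:
  assumes z: "z \<in> cone e \<alpha> x" and t: "0 < t" "t \<le> 1"
  shows "of_real x + of_real t * (z - of_real x) \<in> cone e \<alpha> x"
proof -
  have "\<bar>t * (Re z - x)\<bar> < tan \<alpha> * (e * (t * Im z))"
  proof -
    have "t * \<bar>Re z - x\<bar> < t * (tan \<alpha> * (e * Im z))" using z t by (intro mult_strict_left_mono) (auto simp: cone_def)
    then show ?thesis using t by (simp add: abs_mult mult_ac)
  qed
  moreover have "0 < e * Im z" using z by (simp add: cone_def)
  then have "0 < t * (e * Im z)" by (rule mult_pos_pos[OF t(1)])
  then have "0 < e * (t * Im z)" by (simp only: mult.left_commute)
  ultimately show ?thesis by (simp add: cone_def)
qed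

text \<open>The segment from the boundary point to \<open>z\<close> stays in the cone, so the mean
  value inequality applies to \<open>\<Phi>\<close> minus its linear part. At the boundary point
  itself only continuity is used.\<close>

lemma cone_increment_bound:
  assumes hol: "\<Phi> holomorphic_on half_plane e" and cont: "continuous_on (closure (half_plane e)) \<Phi>" and e0: "e \<noteq> 0"
    and bd: "\<And>w. w \<in> cone e \<alpha> x \<Longrightarrow> norm (w - of_real x) < r \<Longrightarrow> norm (deriv \<Phi> w - q) \<le> \<epsilon>"
    and z: "z \<in> cone e \<alpha> x" "norm (z - of_real x) < r"
  shows "norm (\<Phi> z - \<Phi> (of_real x) - q * (z - of_real x)) \<le> \<epsilon> * norm (z - of_real x)"
proof -
  define p where "p t = of_real x + complex_of_real t * (z - of_real x)" for t
  define g where "g t = \<Phi> (p t) - q * (p t - of_real x)" for t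
  have pc: "p t \<in> cone e \<alpha> x" if "0 < t" "t \<le> 1" for t
    unfolding p_def by (rule cone_segment[OF z(1) that])
  have pcl: "p t \<in> closure (half_plane e)" if t: "t \<in> {0..1}" for t
  proof (cases "t = 0")
    case True then show ?thesis by (simp add: closure_half_plane[OF e0] p_def)
  next
    case False
    then show ?thesis using pc[of t] t cone_subset_half_plane closure_subset by fastforce
  qed
  have contg: "continuous_on {0..1} g"
    unfolding g_def
    by (intro continuous_intros continuous_on_compose2[OF cont]) (auto simp: pcl, auto simp: p_def intro!: continuous_intros)
  have derg: "(g has_derivative (\<lambda>h. of_real h * ((deriv \<Phi> (p t) - q) * (z - of_real x)))) (at t)" if t: "0 < t" "t < 1" for t
  proof -
    have "p t \<in> half_plane e" using pc[of t] t cone_subset_half_plane by fastforce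
    then have d: "(\<Phi> has_field_derivative deriv \<Phi> (p t)) (at (p t))"
      using holomorphic_derivI[OF hol open_half_plane] by blast
    have p': "(p has_derivative (\<lambda>h. of_real h * (z - of_real x))) (at t)"
      unfolding p_def by (auto intro!: derivative_eq_intros)
    have "((\<lambda>t. \<Phi> (p t)) has_derivative (\<lambda>h. deriv \<Phi> (p t) * (of_real h * (z - of_real x)))) (at t)"
      by (rule has_derivative_compose[OF p']) (use d in \<open>simp add: has_field_derivative_def\<close>)
    then have "(g has_derivative (\<lambda>h. deriv \<Phi> (p t) * (of_real h * (z - of_real x)) - q * (of_real h * (z - of_real x) - 0))) (at t)"
      unfolding g_def by (intro derivative_intros p')
    then show ?thesis by (rule has_derivative_eq_rhs) (simp add: fun_eq_iff algebra_simps)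
  qed
  obtain t where t: "t \<in> {0<..<1}" "norm (g 1 - g 0) \<le> norm (of_real (1 - 0) * ((deriv \<Phi> (p t) - q) * (z - of_real x)))"
    using mvt_general[of 0 1 g, OF _ contg derg] by auto
  have "p t - of_real x = of_real t * (z - of_real x)" by (simp add: p_def)
  then have "norm (p t - of_real x) = t * norm (z - of_real x)" using t by (simp add: norm_mult)
  also have "\<dots> \<le> norm (z - of_real x)" using t by (intro mult_left_le_one_le) auto
  finally have "norm (deriv \<Phi> (p t) - q) \<le> \<epsilon>" using bd[OF pc[of t]] t z(2) by auto
  then have "norm (deriv \<Phi> (p t) - q) * norm (z - of_real x) \<le> \<epsilon> * norm (z - of_real x)" by (rule mult_right_mono) simp
  then have "norm (g 1 - g 0) \<le> \<epsilon> * norm (z - of_real x)" using t(2) by (simp add: norm_mult)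
  moreover have "g 1 - g 0 = \<Phi> z - \<Phi> (of_real x) - q * (z - of_real x)" by (simp add: g_def p_def)
  ultimately show ?thesis by simp
qed

text \<open>An isolated point of \<open>A\<close> is determined by two rationals that separate it
  from all other points of \<open>A\<close>.\<close>

lemma countable_non_limit_points: "countable {x \<in> A. \<not> x islimpt (A :: real set)}"
proof (rule countable_subset)
  show "countable ((\<lambda>(p, q). THE x. x \<in> A \<and> p < x \<and> x < q) ` (\<rat> \<times> \<rat>))"
    by (intro countable_image countable_SIGMA countable_rat)
  show "{x \<in> A. \<not> x islimpt A} \<subseteq> (\<lambda>(p, q). THE x. x \<in> A \<and> p < x \<and> x < q) ` (\<rat> \<times> \<rat>)"
  proof
    fix x assume "x \<in> {x \<in> A. \<not> x islimpt A}"
    then obtain d where d: "x \<in> A" "d > 0" "\<And>y. y \<in> A \<Longrightarrow> dist y x < d \<Longrightarrow> y = x"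
      by (auto simp: islimpt_approachable)
    obtain p where p: "p \<in> \<rat>" "x - d < p" "p < x" using Rats_dense_in_real[of "x - d" x] d(2) by auto
    obtain q where q: "q \<in> \<rat>" "x < q" "q < x + d" using Rats_dense_in_real[of x "x + d"] d(2) by auto
    have "(THE y. y \<in> A \<and> p < y \<and> y < q) = x"
    proof (rule the_equality)
      show "y = x" if "y \<in> A \<and> p < y \<and> y < q" for y
        using that p q by (intro d(3)) (auto simp: dist_real_def abs_less_iff)
    qed (use d p q in auto)
    then show "x \<in> (\<lambda>(p, q). THE x. x \<in> A \<and> p < x \<and> x < q) ` (\<rat> \<times> \<rat>)"
      using p(1) q(1) by (intro image_eqI[of _ _ "(p, q)"]) auto
  qed
qed

text \<open>The size of the cone and the centre \<open>q\<close> are uniform over the set. Countably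
  many such sets, with discrete parameters, catch every point at which \<open>F\<close> has a
  non-tangential limit.\<close>

definition near_set :: "real \<Rightarrow> (complex \<Rightarrow> complex) \<Rightarrow> real \<Rightarrow> real \<Rightarrow> real \<Rightarrow> complex \<Rightarrow> real set" where
  "near_set e F \<alpha> r \<epsilon> q = {x. \<forall>w\<in>cone e \<alpha> x. norm (w - of_real x) < r \<longrightarrow> norm (F w - q) \<le> \<epsilon>}"

text \<open>The cones over \<open>x\<close> and \<open>y\<close> share the point \<open>z\<close>
  above the midpoint at height |y - x| / tan \<alpha>, and the boundary increment is the difference
  of two increments to \<open>z\<close>. In units of |y - x|, the constant \<open>K\<close> adds the
  horizontal offset 1/2 of \<open>z\<close> and its height.\<close>

lemma near_set_chord:
  assumes hol: "\<Phi> holomorphic_on half_plane e" and cont: "continuous_on (closure (half_plane e)) \<Phi>"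
    and e: "e = 1 \<or> e = - 1" and \<alpha>: "0 < \<alpha>" "\<alpha> < pi / 2"
    and xy: "x \<in> near_set e (deriv \<Phi>) \<alpha> r \<epsilon> q" "y \<in> near_set e (deriv \<Phi>) \<alpha> r \<epsilon> q" "x \<noteq> y"
    and K: "K = 1 / 2 + 1 / tan \<alpha>" and small: "K * \<bar>y - x\<bar> < r" and \<epsilon>: "0 \<le> \<epsilon>"
  shows "norm (\<Phi> (of_real y) - \<Phi> (of_real x) - q * of_real (y - x)) \<le> 2 * K * \<epsilon> * \<bar>y - x\<bar>"
proof -
  define h where "h = \<bar>y - x\<bar> / tan \<alpha>"
  have ta: "tan \<alpha> > 0" using tan_gt_0 \<alpha> .
  have h: "h > 0" "tan \<alpha> * h = \<bar>y - x\<bar>" using xy(3) ta by (simp_all add: h_def)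
  define z where "z = Complex ((x + y) / 2) (e * h)"
  have eh: "e * (e * h) = h" using e by auto
  have Im: "e * Im z = h" by (simp add: z_def eh)
  have R: "\<bar>Re z - x\<bar> = \<bar>y - x\<bar> / 2" "\<bar>Re z - y\<bar> = \<bar>y - x\<bar> / 2" by (auto simp: z_def abs_if field_simps)
  have zc: "z \<in> cone e \<alpha> x" "z \<in> cone e \<alpha> y" unfolding cone_def mem_Collect_eq Im R h(2) using h(1) xy(3) by auto
  have n: "norm (z - of_real u) \<le> K * \<bar>y - x\<bar>" if "\<bar>Re z - u\<bar> = \<bar>y - x\<bar> / 2" for u
  proof -
    have "norm (z - of_real u) \<le> \<bar>Re z - u\<bar> + \<bar>Im z\<bar>" using cmod_le[of "z - of_real u"] by simp
    moreover have "\<bar>Im z\<bar> = h" using e h(1) by (auto simp: z_def)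
    ultimately show ?thesis using that by (simp add: K h_def distrib_right)
  qed
  have e0: "e \<noteq> 0" using e by auto
  have b: "norm (\<Phi> z - \<Phi> (of_real u) - q * (z - of_real u)) \<le> \<epsilon> * (K * \<bar>y - x\<bar>)"
    if u: "u \<in> near_set e (deriv \<Phi>) \<alpha> r \<epsilon> q" "z \<in> cone e \<alpha> u" "\<bar>Re z - u\<bar> = \<bar>y - x\<bar> / 2" for u
  proof -
    have "norm (z - of_real u) < r" using n[OF u(3)] small by linarith
    then have "norm (\<Phi> z - \<Phi> (of_real u) - q * (z - of_real u)) \<le> \<epsilon> * norm (z - of_real u)"
      using u(1) by (intro cone_increment_bound[OF hol cont e0 _ u(2)]) (auto simp: near_set_def)
    also have "\<dots> \<le> \<epsilon> * (K * \<bar>y - x\<bar>)" using n[OF u(3)] \<epsilon> by (rule mult_left_mono)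
    finally show ?thesis .
  qed
  have "\<Phi> (of_real y) - \<Phi> (of_real x) - q * of_real (y - x)
     = (\<Phi> z - \<Phi> (of_real x) - q * (z - of_real x)) - (\<Phi> z - \<Phi> (of_real y) - q * (z - of_real y))"
    by (simp add: algebra_simps)
  also have "norm \<dots> \<le> \<epsilon> * (K * \<bar>y - x\<bar>) + \<epsilon> * (K * \<bar>y - x\<bar>)"
    by (intro order_trans[OF norm_triangle_ineq4] add_mono b xy zc R)
  finally show ?thesis by (simp add: mult_ac)
qed

lemma vector_derivative_quotient:
  fixes f :: "real \<Rightarrow> complex"
  assumes "(f has_vector_derivative D) (at x)"
  shows "((\<lambda>y. (f y - f x) / of_real (y - x)) \<longlongrightarrow> D) (at x)"
proof -
  have "((\<lambda>y. Re (f y)) has_vector_derivative Re D) (at x)" "((\<lambda>y. Im (f y)) has_vector_derivative Im D) (at x)"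
    using assms by (auto intro: bounded_linear.has_vector_derivative bounded_linear_Re bounded_linear_Im)
  then have "((\<lambda>y. (Re (f y) - Re (f x)) / (y - x)) \<longlongrightarrow> Re D) (at x)" "((\<lambda>y. (Im (f y) - Im (f x)) / (y - x)) \<longlongrightarrow> Im D) (at x)"
    by (simp_all add: has_field_derivative_iff flip: has_real_derivative_iff_has_vector_derivative)
  then show ?thesis
    by (subst tendsto_complex_iff) (simp add: Re_divide_of_real Im_divide_of_real del: of_real_diff)
qed

text \<open>Off a countable set, a point is a limit point of every near set of a countable family
  that contains it. Secants along such a set converge to the tangential derivative, and the chord
  estimate keeps them close to the non-tangential limit.\<close>

theorem nt_derivative_eq_tangential:
  assumes hol: "\<Phi> holomorphic_on half_plane e" and cont: "continuous_on (closure (half_plane e)) \<Phi>"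
    and e: "e = 1 \<or> e = - 1"
  shows "countable {x. \<exists>d D. nt_conv (cone e) (deriv \<Phi>) x d \<and>
    ((\<lambda>t. \<Phi> (of_real t)) has_vector_derivative D) (at x) \<and> D \<noteq> d}"
proof (rule countable_subset)
  define al where "al n = 1 / real (Suc n)" for n
  have al: "0 < al n" "al n < pi / 2" for n
  proof -
    have "al n \<le> 1" by (simp add: al_def)
    then show "al n < pi / 2" using pi_gt3 by linarith
  qed (simp add: al_def)
  define K where "K n = 1 / 2 + 1 / tan (al n)" for n
  have K: "K n > 0" for n using tan_gt_0[OF al, of n] by (simp add: K_def add_pos_pos)
  \<comment> \<open>The final error consists of \<open>2 * K n * eps n j\<close> from the chord and
    at most \<open>eps n j\<close> from the distance of \<open>q\<close> to \<open>d\<close>; this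
    normalisation makes the sum 1/(j+1).\<close>
  define eps where "eps n j = 1 / (real (Suc j) * (2 * K n + 1))" for n j
  have eps: "eps n j > 0" "(2 * K n + 1) * eps n j = 1 / real (Suc j)" for n j
  proof -
    have "2 * K n + 1 > 0" using K[of n] by linarith
    then show "eps n j > 0" "(2 * K n + 1) * eps n j = 1 / real (Suc j)" by (simp_all add: eps_def)
  qed
  define Q where "Q = (\<lambda>(a, b). Complex a b) ` (\<rat> \<times> \<rat>)"
  have Q: "countable Q" unfolding Q_def by (intro countable_image countable_SIGMA countable_rat)
  have Qd: "\<exists>q\<in>Q. norm (d - q) < \<epsilon>" if pos: "0 < \<epsilon>" for d \<epsilon>
  proof -
    obtain a where a: "a \<in> \<rat>" "Re d - \<epsilon> / 2 < a" "a < Re d" using Rats_dense_in_real[of "Re d - \<epsilon> / 2" "Re d"] pos by auto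
    obtain b where b: "b \<in> \<rat>" "Im d - \<epsilon> / 2 < b" "b < Im d" using Rats_dense_in_real[of "Im d - \<epsilon> / 2" "Im d"] pos by auto
    have "norm (d - Complex a b) \<le> \<bar>Re d - a\<bar> + \<bar>Im d - b\<bar>" using cmod_le[of "d - Complex a b"] by simp
    also have "\<dots> < \<epsilon>" using a b by linarith
    finally show ?thesis using a(1) b(1) by (intro bexI[of _ "Complex a b"]) (auto simp: Q_def)
  qed
  define A where "A n j k q = near_set e (deriv \<Phi>) (al n) (1 / real (Suc k)) (eps n j) q" for n j k q
  define B where "B = (\<Union>n. \<Union>j. \<Union>k. \<Union>q\<in>Q. {x \<in> A n j k q. \<not> x islimpt A n j k q})"
  show "countable B" unfolding B_def
    by (intro countable_UN Q countable_non_limit_points) auto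
  show "{x. \<exists>d D. nt_conv (cone e) (deriv \<Phi>) x d \<and> ((\<lambda>t. \<Phi> (of_real t)) has_vector_derivative D) (at x) \<and> D \<noteq> d} \<subseteq> B"
  proof (rule subsetI, rule ccontr)
    fix x assume "x \<in> {x. \<exists>d D. nt_conv (cone e) (deriv \<Phi>) x d \<and> ((\<lambda>t. \<Phi> (of_real t)) has_vector_derivative D) (at x) \<and> D \<noteq> d}"
      and xB: "x \<notin> B"
    then obtain d D \<alpha> where \<alpha>: "0 < \<alpha>" "\<alpha> < pi / 2" "(deriv \<Phi> \<longlongrightarrow> d) (at (of_real x) within cone e \<alpha> x)"
      and D: "((\<lambda>t. \<Phi> (of_real t)) has_vector_derivative D) (at x)" "D \<noteq> d"
      unfolding nt_conv_def by blast
    obtain n where n: "al n < \<alpha>" using nat_approx_posE[OF \<alpha>(1)] unfolding al_def by metis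
    have lim: "(deriv \<Phi> \<longlongrightarrow> d) (at (of_real x) within cone e (al n) x)"
      by (rule nt_conv_mono[OF \<alpha>(3)]) (use n al[of n] \<alpha> in auto)
    have "norm (D - d) \<le> 1 / real (Suc j)" for j
    proof -
      obtain q where q: "q \<in> Q" "norm (d - q) < eps n j / 2" using Qd[of "eps n j / 2" d] eps(1)[of n j] by auto
      have "\<forall>\<^sub>F w in at (of_real x) within cone e (al n) x. dist (deriv \<Phi> w) d < eps n j / 2"
        using tendstoD[OF lim, of "eps n j / 2"] eps(1)[of n j] by simp
      then obtain r where r: "r > 0" "\<And>w. w \<in> cone e (al n) x \<Longrightarrow> w \<noteq> of_real x \<Longrightarrow> dist w (of_real x) < r \<Longrightarrow> dist (deriv \<Phi> w) d < eps n j / 2"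
        unfolding eventually_at by blast
      obtain k where k: "1 / real (Suc k) < r" using nat_approx_posE[OF r(1)] .
      have xA: "x \<in> A n j k q"
        unfolding A_def near_set_def
      proof (intro CollectI ballI impI)
        fix w assume w: "w \<in> cone e (al n) x" "norm (w - of_real x) < 1 / real (Suc k)"
        have "w \<noteq> of_real x" using w(1) by (auto simp: cone_def)
        then have "dist (deriv \<Phi> w) d < eps n j / 2" using r(2)[OF w(1)] w(2) k by (simp add: dist_norm)
        then show "norm (deriv \<Phi> w - q) \<le> eps n j"
          using q(2) norm_triangle_ineq[of "deriv \<Phi> w - d" "d - q"] by (simp add: dist_norm)
      qed
      then have lp: "x islimpt A n j k q" using xB q(1) unfolding B_def by blast
      have quot: "((\<lambda>y. (\<Phi> (of_real y) - \<Phi> (of_real x)) / of_real (y - x)) \<longlongrightarrow> D) (at x within A n j k q)"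
        by (rule tendsto_within_subset[OF vector_derivative_quotient[OF D(1)]]) simp
      have "norm (D - q) \<le> 2 * K n * eps n j"
      proof (rule tendsto_upperbound[OF tendsto_norm[OF tendsto_diff[OF quot tendsto_const]]])
        have "\<forall>\<^sub>F y in at x within A n j k q. y \<in> A n j k q \<and> y \<noteq> x \<and> \<bar>y - x\<bar> < (1 / real (Suc k)) / K n"
          unfolding eventually_at using K[of n] by (intro exI[of _ "(1 / real (Suc k)) / K n"]) (auto simp: dist_real_def)
        then show "\<forall>\<^sub>F y in at x within A n j k q. norm ((\<Phi> (of_real y) - \<Phi> (of_real x)) / of_real (y - x) - q) \<le> 2 * K n * eps n j"
        proof eventually_elim
          case (elim y)
          then have "K n * \<bar>y - x\<bar> < K n * (1 / real (Suc k) / K n)" using K[of n] by (intro mult_strict_left_mono) auto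
          then have "K n * \<bar>y - x\<bar> < 1 / real (Suc k)" using K[of n] by simp
          then have "norm (\<Phi> (of_real y) - \<Phi> (of_real x) - q * of_real (y - x)) \<le> 2 * K n * eps n j * \<bar>y - x\<bar>"
            using elim xA eps(1)[of n j] unfolding A_def
            by (intro near_set_chord[OF hol cont e al _ _ _ K_def]) auto
          moreover have "(\<Phi> (of_real y) - \<Phi> (of_real x)) / of_real (y - x) - q
              = (\<Phi> (of_real y) - \<Phi> (of_real x) - q * of_real (y - x)) / of_real (y - x)"
            using elim by (simp add: diff_divide_distrib)
          ultimately show ?case
            using elim by (simp only: norm_divide norm_of_real) (subst pos_divide_le_eq, auto)
        qed
        show "at x within A n j k q \<noteq> bot" using lp by (simp add: trivial_limit_within)
      qed
      then have "norm (D - d) \<le> 2 * K n * eps n j + eps n j"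
        using norm_triangle_ineq[of "D - q" "q - d"] q(2) eps(1)[of n j] by (simp add: norm_minus_commute)
      also have "\<dots> = 1 / real (Suc j)" using eps(2)[of n j] by (simp add: distrib_right)
      finally show ?thesis .
    qed
    then have "norm (D - d) \<le> 0" by (metis nat_approx_posE not_le)
    then show False using D(2) by simp
  qed
qed

text \<open>The image of a vertical ray leaves the boundary at a right angle to the tangent
  \<open>d\<close>. This determines on which side of the oriented curve the domain lies.\<close>

lemma vertical_derivative:
  assumes hol: "\<Phi> holomorphic_on half_plane e" and cont: "continuous_on (closure (half_plane e)) \<Phi>"
    and e: "e = 1 \<or> e = - 1" and nt: "nt_conv (cone e) (deriv \<Phi>) x d"
  shows "((\<lambda>t. (\<Phi> (Complex x (e * t)) - \<Phi> (of_real x)) / of_real t) \<longlongrightarrow> \<i> * of_real e * d) (at_right 0)"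
proof (rule tendstoI)
  fix \<epsilon> :: real assume \<epsilon>: "0 < \<epsilon>"
  obtain \<alpha> where \<alpha>: "0 < \<alpha>" "\<alpha> < pi / 2" "(deriv \<Phi> \<longlongrightarrow> d) (at (of_real x) within cone e \<alpha> x)"
    using nt unfolding nt_conv_def by blast
  have "\<forall>\<^sub>F w in at (of_real x) within cone e \<alpha> x. dist (deriv \<Phi> w) d < \<epsilon> / 2"
    using tendstoD[OF \<alpha>(3), of "\<epsilon> / 2"] \<epsilon> by simp
  then obtain r where r: "r > 0" "\<And>w. w \<in> cone e \<alpha> x \<Longrightarrow> w \<noteq> of_real x \<Longrightarrow> dist w (of_real x) < r \<Longrightarrow> dist (deriv \<Phi> w) d < \<epsilon> / 2"
    unfolding eventually_at by blast
  have e0: "e \<noteq> 0" using e by auto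
  have "dist ((\<Phi> (Complex x (e * t)) - \<Phi> (of_real x)) / of_real t) (\<i> * of_real e * d) < \<epsilon>" if t: "0 < t" "t < r" for t
  proof -
    define z where "z = Complex x (e * t)"
    have zx: "z - of_real x = \<i> * of_real e * of_real t" by (simp add: z_def complex_eq_iff)
    have nz: "norm (z - of_real x) = t" unfolding zx using t e by (auto simp: norm_mult)
    have "norm (\<Phi> z - \<Phi> (of_real x) - d * (z - of_real x)) \<le> \<epsilon> / 2 * norm (z - of_real x)"
    proof (rule cone_increment_bound[OF hol cont e0])
      show "z \<in> cone e \<alpha> x" unfolding z_def by (rule vertical_in_cone[OF e t(1) \<alpha>(1,2)])
      show "norm (z - of_real x) < r" using nz t by simp
      show "norm (deriv \<Phi> w - d) \<le> \<epsilon> / 2" if "w \<in> cone e \<alpha> x" "norm (w - of_real x) < r" for w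
      proof -
        have "w \<noteq> of_real x" using that(1) by (auto simp: cone_def)
        then show ?thesis using r(2)[OF that(1)] that(2) by (simp add: dist_norm)
      qed
    qed
    then have le: "norm (\<Phi> z - \<Phi> (of_real x) - d * (\<i> * of_real e * of_real t)) \<le> \<epsilon> / 2 * t" unfolding nz unfolding zx .
    have "(\<Phi> z - \<Phi> (of_real x)) / of_real t - \<i> * of_real e * d = (\<Phi> z - \<Phi> (of_real x) - d * (\<i> * of_real e * of_real t)) / of_real t"
      using t by (simp add: diff_divide_distrib)
    then have "norm ((\<Phi> z - \<Phi> (of_real x)) / of_real t - \<i> * of_real e * d) \<le> \<epsilon> / 2"
      using le t by (simp add: norm_divide pos_divide_le_eq)
    then show ?thesis using \<epsilon> by (simp add: dist_norm z_def)
  qed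
  then show "\<forall>\<^sub>F t in at_right 0. dist ((\<Phi> (Complex x (e * t)) - \<Phi> (of_real x)) / of_real t) (\<i> * of_real e * d) < \<epsilon>"
    using r(1) unfolding eventually_at_right_field by blast
qed

section \<open>Unit speed parametrisation\<close>

lemma real_homeo_sym: "real_homeo f g \<Longrightarrow> real_homeo g f"
  by (simp add: real_homeo_def)

lemma AE_lborel_negligible: "(AE x in lborel. P x) \<longleftrightarrow> negligible {x::real. \<not> P x}"
proof -
  have "(AE x in lborel. P x) \<longleftrightarrow> (AE x in lebesgue. P x)" by (simp add: AE_completion_iff)
  also have "\<dots> \<longleftrightarrow> negligible {x::real. \<not> P x}"
  proof
    assume "AE x in lebesgue. P x"
    then obtain N where "N \<in> null_sets lebesgue" "{x\<in>space lebesgue. \<not> P x} \<subseteq> N"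
      by (rule AE_E3) auto
    then have "negligible N" "{x. \<not> P x} \<subseteq> N" by (auto simp: negligible_iff_null_sets)
    then show "negligible {x. \<not> P x}" by (rule negligible_subset)
  next
    assume "negligible {x. \<not> P x}"
    then show "AE x in lebesgue. P x"
      by (intro AE_I'[of "{x. \<not> P x}"]) (auto simp: negligible_iff_null_sets)
  qed
  finally show ?thesis .
qed

lemma real_homeo_expanding:
  assumes h: "continuous_on UNIV h" and ex: "\<And>x y::real. x \<le> y \<Longrightarrow> y - x \<le> h y - h x"
  shows "real_homeo h (inv h)"
proof -
  have mono: "strict_mono h"
  proof (rule strict_monoI)
    fix x y :: real assume "x < y" then show "h x < h y" using ex[of x y] by linarith
  qed
  have surj: "surj h"
    unfolding surj_def
  proof
    fix y
    define M where "M = \<bar>y - h 0\<bar>"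
    have "h (- M) \<le> y" "y \<le> h M" using ex[of 0 M] ex[of "- M" 0] by (auto simp: M_def)
    moreover have "- M \<le> M" by (simp add: M_def)
    moreover have "continuous_on {- M..M} h" using h continuous_on_subset by blast
    ultimately show "\<exists>x. y = h x" using IVT'[of h "- M" y M] by blast
  qed
  have inj: "inj h" using mono strict_mono_eq by (metis injI)
  have hi: "h (inv h y) = y" for y using surj by (rule surj_f_inv_f)
  have ih: "inv h (h x) = x" for x using inj by simp
  have imono: "strict_mono (inv h)"
    using mono by (metis hi strict_mono_def strict_mono_less)
  have "continuous_on UNIV (inv h)"
    unfolding continuous_on_eq_continuous_at[OF open_UNIV] continuous_at_eps_delta
  proof (intro ballI allI impI)
    fix x e :: real assume e: "0 < e"
    have "dist (inv h y) (inv h x) \<le> dist y x" for y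
      using ex[of "inv h y" "inv h x"] ex[of "inv h x" "inv h y"]
      by (cases "inv h y \<le> inv h x") (auto simp: dist_real_def hi)
    then show "\<exists>d>0. \<forall>y. dist y x < d \<longrightarrow> dist (inv h y) (inv h x) < e" using e le_less_trans by blast
  qed
  with mono h imono hi ih show ?thesis by unfold_locales auto
qed

lemma negligible_lipschitz_image_real:
  assumes "negligible N" "\<And>x y. \<bar>h y - h x\<bar> \<le> B * \<bar>y - x\<bar>"
  shows "negligible (h ` N :: real set)"
proof (rule negligible_locally_Lipschitz_image)
  fix x assume "x \<in> N"
  show "\<exists>T B. open T \<and> x \<in> T \<and> (\<forall>y\<in>N \<inter> T. norm (h y - h x) \<le> B * norm (y - x))"
    using assms(2) by (intro exI[of _ UNIV] exI[of _ B]) auto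
qed (use assms in auto)

section \<open>Borel versions of derivatives and their integrals\<close>

context real_homeo
begin

lemma borel_f [measurable]: "f \<in> borel_measurable borel"
  using f_cont by (rule borel_measurable_continuous_onI)

text \<open>A limit along the fixed sequence 1/(n+1) is a Borel function whatever value
  \<open>lim\<close> takes where there is no limit, and it agrees with the derivative where that
  exists.\<close>

lemma borel_derivative:
  obtains D where "D \<in> borel_measurable borel" "AE x in lborel. (f has_real_derivative D x) (at x)"
proof -
  define D where "D x = lim (\<lambda>n. (f (x + 1 / real (Suc n)) - f x) / (1 / real (Suc n)))" for x
  have "D \<in> borel_measurable borel" unfolding D_def by measurable
  moreover have "(f has_real_derivative D x) (at x)" if d: "(f has_real_derivative d) (at x)" for x d
  proof -
    have "((\<lambda>h. (f (x + h) - f x) / h) \<longlongrightarrow> d) (at 0)" using d by (simp add: DERIV_def)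
    moreover have "filterlim (\<lambda>n. 1 / real (Suc n)) (at 0) sequentially"
      unfolding filterlim_at using LIMSEQ_Suc[OF lim_const_over_n[of 1]] by (auto intro!: always_eventually)
    ultimately have "(\<lambda>n. (f (x + 1 / real (Suc n)) - f x) / (1 / real (Suc n))) \<longlonglongrightarrow> d"
      by (rule filterlim_compose)
    then have "D x = d" unfolding D_def by (rule limI)
    then show ?thesis using d by simp
  qed
  then have "AE x in lborel. (f has_real_derivative D x) (at x)"
    unfolding AE_lborel_negligible by (intro negligible_subset[OF AE_differentiable]) auto
  ultimately show ?thesis by (rule that)
qed

lemma integral_derivative:
  assumes D: "AE x in lborel. (f has_real_derivative D x) (at x)" and m: "D \<in> borel_measurable borel"
    and lus: "\<And>N. negligible N \<Longrightarrow> negligible (f ` N)" and ab: "a \<le> b"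
  shows "integrable lborel (\<lambda>x. D x * indicator {a<..<b} x)"
    and "(LINT x|lborel. D x * indicator {a<..<b} x) = f b - f a"
proof -
  have "AE x in lborel. 0 \<le> D x * indicator {a<..<b} x"
    using D by eventually_elim (simp add: deriv_nonneg)
  moreover have "(\<integral>\<^sup>+x. ennreal (D x * indicator {a<..<b} x) \<partial>lborel) = ennreal (f b - f a)"
    using nn_integral_deriv_Ioo[OF D m lus ab] by (simp add: ennreal_mult'' ennreal_indicator)
  moreover have "0 \<le> f b - f a" using f_mono ab by (simp add: strict_mono_less_eq)
  ultimately show "integrable lborel (\<lambda>x. D x * indicator {a<..<b} x)"
    and "(LINT x|lborel. D x * indicator {a<..<b} x) = f b - f a"
    using nn_integral_eq_integrable[of "\<lambda>x. D x * indicator {a<..<b} x" lborel "f b - f a"] m by auto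
qed

end

context arc_param
begin

abbreviation r where "r \<equiv> inv s"

sublocale s: real_homeo s r
  by (rule real_homeo_expanding[OF s_continuous arclen_expanding])

sublocale r: real_homeo r s
  by (rule real_homeo_sym[OF s.real_homeo_axioms])

definition \<sigma> where "\<sigma> t = cparam \<gamma> (r t)"

lemma \<sigma>_lipschitz: "norm (\<sigma> v - \<sigma> u) \<le> \<bar>v - u\<bar>"
proof -
  have "norm (\<sigma> v - \<sigma> u) \<le> v - u" if "u \<le> v" for u v
    using chord_le_arclen[of "r u" "r v"] that r.f_mono by (simp add: \<sigma>_def strict_mono_less_eq)
  from this[of u v] this[of v u] show ?thesis by (cases "u \<le> v") (auto simp: norm_minus_commute)
qed

text \<open>Adding 2 t makes q increasing, because \<open>\<gamma> \<circ> r\<close> is 1-Lipschitz.\<close>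
definition q where "q t = \<gamma> (r t) + 2 * t"

lemma Re_Im_\<sigma>: "Re (\<sigma> t) = r t" "Im (\<sigma> t) = q t - 2 * t"
  by (simp_all add: \<sigma>_def cparam_def q_def)

lemma r_lipschitz: "\<bar>r v - r u\<bar> \<le> 1 * \<bar>v - u\<bar>"
  using abs_Re_le_cmod[of "\<sigma> v - \<sigma> u"] \<sigma>_lipschitz[of v u] by (simp add: Re_Im_\<sigma>)

lemma Im_\<sigma>_lipschitz: "\<bar>Im (\<sigma> v) - Im (\<sigma> u)\<bar> \<le> \<bar>v - u\<bar>"
  using abs_Im_le_cmod[of "\<sigma> v - \<sigma> u"] \<sigma>_lipschitz[of v u] by simp

lemma q_lipschitz: "\<bar>q v - q u\<bar> \<le> 3 * \<bar>v - u\<bar>"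
  using Im_\<sigma>_lipschitz[of v u] by (simp add: Re_Im_\<sigma> abs_if split: if_splits)

sublocale q: real_homeo q "inv q"
proof (rule real_homeo_expanding)
  show "continuous_on UNIV q"
    unfolding continuous_on_eq_continuous_at[OF open_UNIV] continuous_at_eps_delta
  proof (intro ballI allI impI)
    fix x e :: real assume e: "0 < e"
    have "dist (q y) (q x) < e" if "dist y x < e / 3" for y
      using q_lipschitz[of y x] that by (simp add: dist_real_def)
    then show "\<exists>d>0. \<forall>y. dist y x < d \<longrightarrow> dist (q y) (q x) < e" using e by (intro exI[of _ "e / 3"]) auto
  qed
  show "y - x \<le> q y - q x" if "x \<le> y" for x y
    using Im_\<sigma>_lipschitz[of y x] that by (simp add: Re_Im_\<sigma>)
qed

text \<open>The Stieltjes measure of \<open>s\<close> gives an interval the increment of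
  \<open>s\<close>, so \<open>s\<close> carries it to Lebesgue measure; and
  \<open>cparam \<gamma>\<close> is \<open>\<sigma>\<close> after \<open>s\<close>.\<close>

lemma arclen_eq_distr: "arclen \<gamma> = distr lborel borel \<sigma>"
proof -
  have "lborel = distr (interval_measure s) borel s"
  proof (rule lborel_eqI)
    fix l u :: real assume "\<And>b. b \<in> Basis \<Longrightarrow> l \<bullet> b \<le> u \<bullet> b"
    then have lu: "l \<le> u" by simp
    have Icc: "emeasure (interval_measure s) {a..b} = ennreal (s b - s a)" if "a \<le> b" for a b
      using that s.f_mono s.f_cont by (intro emeasure_interval_measure_Icc) (auto simp: strict_mono_less_eq)
    have vi: "s -` box l u = {r l<..<r u}"
      using r.f_mono by (auto simp: box_real) (metis s.gf strict_mono_less)+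
    have null: "{r l, r u} \<in> null_sets (interval_measure s)"
    proof -
      have "{a} \<in> null_sets (interval_measure s)" for a using Icc[of a a] by (intro null_setsI) auto
      from null_sets.Un[OF this this] show ?thesis by (simp add: insert_commute)
    qed
    have "emeasure (distr (interval_measure s) borel s) (box l u) = emeasure (interval_measure s) {r l<..<r u}"
      by (simp add: emeasure_distr flip: vi)
    also have "{r l<..<r u} = {r l..r u} - {r l, r u}" by auto
    also have "emeasure (interval_measure s) \<dots> = emeasure (interval_measure s) {r l..r u}"
      by (rule emeasure_Diff_null_set[OF null]) simp
    also have "\<dots> = ennreal (u - l)" using lu r.f_mono by (simp add: Icc strict_mono_less_eq)
    finally show "emeasure (distr (interval_measure s) borel s) (box l u) = (\<Prod>b\<in>Basis. (u - l) \<bullet> b)" by simp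
  qed simp
  then have "distr lborel borel \<sigma> = distr (distr (interval_measure s) borel s) borel \<sigma>" by metis
  moreover have "\<sigma> \<in> borel_measurable borel"
  proof (rule borel_measurable_continuous_onI)
    have 1: "continuous_on UNIV (\<lambda>t. Complex (r t) (q t - 2 * t))"
      using r.f_cont q.f_cont unfolding Complex_eq by (intro continuous_intros)
    have 2: "(\<lambda>t. Complex (r t) (q t - 2 * t)) = \<sigma>" by (simp add: fun_eq_iff complex_eq_iff Re_Im_\<sigma>)
    show "continuous_on UNIV \<sigma>" using 1 unfolding 2 .
  qed
  ultimately have "distr lborel borel \<sigma> = distr (interval_measure s) borel (\<sigma> \<circ> s)"
    using distr_distr[of \<sigma> borel borel s "interval_measure s"] s.borel_f by simp
  also have "\<sigma> \<circ> s = cparam \<gamma>" by (simp add: \<sigma>_def fun_eq_iff)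
  finally show ?thesis by (simp add: arclen_def)
qed

text \<open>The speed is at most 1 because \<open>\<sigma>\<close> is 1-Lipschitz. Each chord is at
  most the integral of the speed, hence so is the length of every inscribed polygon, and the
  supremum of these is the length of the parameter interval. A function that is at most 1 and has
  this integral is 1 almost everywhere.\<close>

theorem unit_speed: "AE t in lborel. \<exists>w. (\<sigma> has_vector_derivative w) (at t) \<and> norm w = 1"
proof -
  obtain D1 where D1: "D1 \<in> borel_measurable borel" "AE x in lborel. (r has_real_derivative D1 x) (at x)"
    using r.borel_derivative .
  obtain D2 where D2: "D2 \<in> borel_measurable borel" "AE x in lborel. (q has_real_derivative D2 x) (at x)"
    using q.borel_derivative .
  note [measurable] = D1(1) D2(1)
  \<comment> \<open>The summand \<open>2 * t\<close> in \<open>q\<close> raises its derivative above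
    that of the ordinate by 2.\<close>
  define w where "w t = complex_of_real (D1 t) + \<i> * of_real (D2 t - 2)" for t
  have w[measurable]: "w \<in> borel_measurable borel" unfolding w_def by measurable
  have der: "AE t in lborel. (\<sigma> has_vector_derivative w t) (at t)"
    using D1(2) D2(2)
  proof eventually_elim
    case (elim t)
    have "((\<lambda>t. complex_of_real (r t) + \<i> * of_real (q t - 2 * t)) has_vector_derivative (of_real (D1 t) + \<i> * of_real (D2 t - 2))) (at t)"
      using elim by (auto intro!: derivative_eq_intros simp: has_real_derivative_iff_has_vector_derivative)
    moreover have "(\<lambda>t. complex_of_real (r t) + \<i> * of_real (q t - 2 * t)) = \<sigma>" by (simp add: fun_eq_iff complex_eq_iff Re_Im_\<sigma>)
    ultimately show ?case by (simp add: w_def)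
  qed
  have le1: "AE t in lborel. norm (w t) \<le> 1"
    using der
  proof eventually_elim
    case (elim t)
    show ?case
    proof (rule tendsto_upperbound[OF tendsto_norm[OF vector_derivative_quotient[OF elim]]])
      show "\<forall>\<^sub>F y in at t. norm ((\<sigma> y - \<sigma> t) / of_real (y - t)) \<le> 1"
        unfolding eventually_at
      proof (intro exI[of _ 1] conjI ballI impI)
        fix y assume "y \<noteq> t \<and> dist y t < 1"
        then show "norm ((\<sigma> y - \<sigma> t) / of_real (y - t)) \<le> 1"
          unfolding norm_divide norm_of_real using \<sigma>_lipschitz[of y t] by (subst pos_divide_le_eq) auto
      qed simp
    qed simp
  qed
  have chord: "ennreal (norm (\<sigma> b - \<sigma> a)) \<le> (\<integral>\<^sup>+t. ennreal (norm (w t)) * indicator {a..<b} t \<partial>lborel)" if ab: "a \<le> b" for a b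
  proof -
    let ?I = "\<lambda>t. indicator {a<..<b} t :: real"
    note i1 = r.integral_derivative[OF D1(2,1) negligible_lipschitz_image_real[OF _ r_lipschitz] ab]
    note i2 = q.integral_derivative[OF D2(2,1) negligible_lipschitz_image_real[OF _ q_lipschitz] ab]
    have i3: "integrable lborel ?I" "(LINT t|lborel. ?I t) = b - a" using ab by simp_all
    have eq: "of_real (?I t) * w t = complex_of_real (D1 t * ?I t) + \<i> * of_real (D2 t * ?I t) - 2 * \<i> * of_real (?I t)" for t
      by (simp add: w_def algebra_simps)
    have "has_bochner_integral lborel (\<lambda>t. complex_of_real (D1 t * ?I t)) (of_real (r b - r a))"
      using i1 by (intro has_bochner_integral_of_real) (simp add: has_bochner_integral_iff)
    moreover have "has_bochner_integral lborel (\<lambda>t. complex_of_real (D2 t * ?I t)) (of_real (q b - q a))"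
      using i2 by (intro has_bochner_integral_of_real) (simp add: has_bochner_integral_iff)
    moreover have "has_bochner_integral lborel (\<lambda>t. complex_of_real (?I t)) (of_real (b - a))"
      using i3 by (intro has_bochner_integral_of_real) (simp add: has_bochner_integral_iff)
    ultimately have hb: "has_bochner_integral lborel (\<lambda>t. of_real (?I t) * w t)
        (of_real (r b - r a) + \<i> * of_real (q b - q a) - 2 * \<i> * of_real (b - a))"
      unfolding eq by (intro has_bochner_integral_add has_bochner_integral_diff has_bochner_integral_mult_right)
    have int: "integrable lborel (\<lambda>t. of_real (?I t) * w t)" using hb by (simp add: has_bochner_integral_iff)
    have "(LINT t|lborel. of_real (?I t) * w t) = of_real (r b - r a) + \<i> * of_real (q b - q a) - 2 * \<i> * of_real (b - a)"
      using hb by (simp add: has_bochner_integral_iff)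
    also have "\<dots> = \<sigma> b - \<sigma> a" by (simp add: complex_eq_iff Re_Im_\<sigma>)
    finally have "norm (\<sigma> b - \<sigma> a) = norm (LINT t|lborel. of_real (?I t) * w t)" by simp
    also have "ennreal \<dots> \<le> (\<integral>\<^sup>+t. norm (of_real (?I t) * w t) \<partial>lborel)"
      by (rule integral_norm_bound_ennreal[OF int])
    also have "\<dots> \<le> (\<integral>\<^sup>+t. ennreal (norm (w t)) * indicator {a..<b} t \<partial>lborel)"
      by (intro nn_integral_mono) (auto simp: indicator_def norm_mult)
    finally show ?thesis .
  qed
  have ps: "ennreal (psum (cparam \<gamma>) t k) \<le> (\<integral>\<^sup>+v. ennreal (norm (w v)) * indicator {s (t 0)..<s (t k)} v \<partial>lborel)"
    if t: "partn x y t n" and k: "k \<le> n" for x y t n k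
    using k
  proof (induction k)
    case 0 then show ?case by (simp add: psum_def)
  next
    case (Suc k)
    have m: "s (t 0) \<le> s (t k)" "s (t k) \<le> s (t (Suc k))"
      using partn_mono[OF t, of 0 k] partn_mono[OF t, of k "Suc k"] Suc.prems s.f_mono by (auto simp: strict_mono_less_eq)
    have "ennreal (psum (cparam \<gamma>) t (Suc k)) = ennreal (psum (cparam \<gamma>) t k) + ennreal (norm (\<sigma> (s (t (Suc k))) - \<sigma> (s (t k))))"
      by (simp add: psum_def \<sigma>_def sum_nonneg)
    also have "\<dots> \<le> (\<integral>\<^sup>+v. ennreal (norm (w v)) * indicator {s (t 0)..<s (t k)} v \<partial>lborel)
        + (\<integral>\<^sup>+v. ennreal (norm (w v)) * indicator {s (t k)..<s (t (Suc k))} v \<partial>lborel)"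
      using Suc m by (intro add_mono chord) auto
    also have "\<dots> = (\<integral>\<^sup>+v. ennreal (norm (w v)) * indicator {s (t 0)..<s (t k)} v + ennreal (norm (w v)) * indicator {s (t k)..<s (t (Suc k))} v \<partial>lborel)"
      by (rule nn_integral_add[symmetric]) simp_all
    also have "\<dots> = (\<integral>\<^sup>+v. ennreal (norm (w v)) * indicator {s (t 0)..<s (t (Suc k))} v \<partial>lborel)"
      using m by (intro nn_integral_cong) (auto simp: indicator_def)
    finally show ?case .
  qed
  have full: "ennreal (b - a) \<le> (\<integral>\<^sup>+v. ennreal (norm (w v)) * indicator {a..<b} v \<partial>lborel)" if ab: "a \<le> b" for a b
  proof -
    have rab: "r a \<le> r b" using ab r.f_mono by (simp add: strict_mono_less_eq)
    have "ennreal (b - a) = curve_length (cparam \<gamma>) (r a) (r b)"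
      using curve_length_len[OF rect rab] arclen_fun_diff[OF rect rab] by simp
    also have "\<dots> \<le> (\<integral>\<^sup>+v. ennreal (norm (w v)) * indicator {a..<b} v \<partial>lborel)"
    proof (rule curve_length_le)
      fix t n assume t: "partn (r a) (r b) t n"
      then have "t 0 = r a" "t n = r b" by (auto simp: partn_def)
      then show "ennreal (psum (cparam \<gamma>) t n) \<le> (\<integral>\<^sup>+v. ennreal (norm (w v)) * indicator {a..<b} v \<partial>lborel)"
        using ps[OF t order_refl] by simp
    qed
    finally show ?thesis .
  qed
  \<comment> \<open>On a bounded interval both integrals are finite, so they can be
    subtracted.\<close>
  have "AE v in lborel. v \<in> {- real n..<real n} \<longrightarrow> norm (w v) = 1" for n :: nat
  proof -
    let ?I = "{- real n..<real n}"
    let ?u = "\<lambda>v. ennreal (norm (w v)) * indicator ?I v" and ?o = "\<lambda>v. indicator ?I v :: ennreal"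
    have leI: "AE v in lborel. ?u v \<le> ?o v" using le1 by eventually_elim (auto simp: indicator_def)
    have oI: "(\<integral>\<^sup>+v. ?o v \<partial>lborel) = ennreal (real n - - real n)" by simp
    have "(\<integral>\<^sup>+v. ?u v \<partial>lborel) \<le> (\<integral>\<^sup>+v. ?o v \<partial>lborel)" by (rule nn_integral_mono_AE[OF leI])
    then have fin: "(\<integral>\<^sup>+v. ?u v \<partial>lborel) \<noteq> \<infinity>" unfolding oI by (auto simp: top_unique)
    have "(\<integral>\<^sup>+v. ?o v - ?u v \<partial>lborel) = (\<integral>\<^sup>+v. ?o v \<partial>lborel) - (\<integral>\<^sup>+v. ?u v \<partial>lborel)"
      by (rule nn_integral_diff[OF _ _ fin leI]) simp_all
    also have "\<dots> = 0" unfolding oI using full[of "- real n" "real n"] by (simp add: diff_eq_0_iff_ennreal ennreal_minus_eq_0)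
    finally have "AE v in lborel. ?o v - ?u v = 0" by (subst (asm) nn_integral_0_iff_AE) simp_all
    then show ?thesis using le1
    proof eventually_elim
      case (elim v)
      show ?case
      proof
        assume "v \<in> ?I"
        then have "1 - ennreal (norm (w v)) = 0" using elim(1) by simp
        then have "ennreal 1 \<le> ennreal (norm (w v))" unfolding ennreal_1 by (rule ennreal_minus_eq_0)
        then have "1 \<le> norm (w v)" using ennreal_le_iff[of "norm (w v)" 1] by simp
        then show "norm (w v) = 1" using elim(2) by simp
      qed
    qed
  qed
  then have "AE v in lborel. \<forall>n::nat. v \<in> {- real n..<real n} \<longrightarrow> norm (w v) = 1"
    by (intro AE_all_countable[THEN iffD2] allI)
  then show ?thesis using der
  proof eventually_elim
    case (elim v)
    obtain n :: nat where "\<bar>v\<bar> < real n" using reals_Archimedean2 by blast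
    then have "v \<in> {- real n..<real n}" by auto
    then show ?case using elim by blast
  qed
qed

abbreviation g where "g \<equiv> Z \<circ> r"

sublocale f: real_homeo f g
proof
  show "strict_mono g" using Y.g_mono r.f_mono by (simp add: strict_mono_def)
  show "continuous_on UNIV g" using Y.g_cont r.f_cont by (metis continuous_on_compose continuous_on_subset subset_UNIV)
qed (use f_strict_mono f_continuous in \<open>auto simp: f_def\<close>)

lemma \<phi>_eq: "\<phi> x = \<sigma> (f x)"
  by (simp add: \<phi> \<sigma>_def f_def)

text \<open>Arc length is differentiable almost everywhere. Where its derivative is 0, the Lipschitz
  bound for \<open>\<sigma>\<close> forces \<open>\<phi>\<close> to have derivative 0, which
  \<open>nz\<close> excludes. Where it is positive, almost every parameter is sent to a point at
  which \<open>\<sigma>\<close> has unit speed, and the chain rule applies.\<close>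

theorem tangent:
  assumes nz: "AE x in lborel. \<forall>D. (\<phi> has_vector_derivative D) (at x) \<longrightarrow> D \<noteq> 0"
  shows "AE x in lborel. \<exists>D. D \<noteq> 0 \<and> (\<phi> has_vector_derivative D) (at x) \<and> (f has_real_derivative norm D) (at x) \<and>
     (\<sigma> has_vector_derivative D / of_real (norm D)) (at (f x))"
proof -
  define N0 where "N0 = {t. \<not> (\<exists>w. (\<sigma> has_vector_derivative w) (at t) \<and> norm w = 1)}"
  have N0: "negligible N0" using unit_speed unfolding AE_lborel_negligible N0_def .
  have a1: "AE x in lborel. \<exists>D. (f has_real_derivative D) (at x)"
    using f.AE_differentiable unfolding AE_lborel_negligible .
  have a2: "AE x in lborel. \<not> (f x \<in> N0 \<and> (\<exists>D>0. (f has_real_derivative D) (at x)))"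
    using f.negligible_preimage_deriv_pos[OF N0] unfolding AE_lborel_negligible by simp
  show ?thesis
    using a1 a2 nz
  proof eventually_elim
    case (elim x)
    obtain D where D: "(f has_real_derivative D) (at x)" using elim(1) by blast
    have "D \<noteq> 0"
    proof
      assume "D = 0"
      then have "((\<lambda>y. (f y - f x) / (y - x)) \<longlongrightarrow> 0) (at x)" using D by (simp add: has_field_derivative_iff)
      then have lim: "((\<lambda>y. norm ((f y - f x) / (y - x))) \<longlongrightarrow> 0) (at x)" by (rule tendsto_norm_zero)
      have "((\<lambda>y. norm ((\<phi> y - \<phi> x - (y - x) *\<^sub>R 0)) / norm (y - x)) \<longlongrightarrow> 0) (at x)"
      proof (rule tendsto_sandwich[OF _ _ tendsto_const lim])
        show "\<forall>\<^sub>F y in at x. norm (\<phi> y - \<phi> x - (y - x) *\<^sub>R 0) / norm (y - x) \<le> norm ((f y - f x) / (y - x))"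
          using \<sigma>_lipschitz by (auto simp: \<phi>_eq abs_divide intro!: always_eventually divide_right_mono)
      qed (auto intro!: always_eventually)
      then have "(\<phi> has_vector_derivative 0) (at x)"
        unfolding has_vector_derivative_def has_derivative_iff_norm by (simp add: bounded_linear_zero)
      then show False using elim(3) by blast
    qed
    moreover have "0 \<le> D" by (rule f.deriv_nonneg[OF D])
    ultimately have Dp: "0 < D" by simp
    then obtain w where w: "(\<sigma> has_vector_derivative w) (at (f x))" "norm w = 1"
      using elim(2) D unfolding N0_def by blast
    have "((\<sigma> \<circ> f) has_vector_derivative D *\<^sub>R w) (at x)"
      using D w(1) by (intro vector_diff_chain_at) (simp add: has_real_derivative_iff_has_vector_derivative)
    then have "(\<phi> has_vector_derivative D *\<^sub>R w) (at x)" by (simp add: \<phi>_eq[abs_def] o_def)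
    moreover have "norm (D *\<^sub>R w) = D" using Dp w(2) by simp
    moreover have "D *\<^sub>R w / of_real D = w" using Dp by (simp add: scaleR_conv_of_real)
    moreover have "D *\<^sub>R w \<noteq> 0" using Dp w(2) by auto
    ultimately show ?case using D w(1) by metis
  qed
qed

end

section \<open>Maximum principle and Harnack inequality\<close>

text \<open>A form of harmonicity that passes to finite sums and includes the logarithm of the
  modulus of a holomorphic function without zeros, with no second derivatives to compute.\<close>

definition locally_Re_holo :: "complex set \<Rightarrow> (complex \<Rightarrow> real) \<Rightarrow> bool" where
  "locally_Re_holo S U \<longleftrightarrow>
     (\<forall>z\<in>S. \<exists>f d. 0 < d \<and> f holomorphic_on ball z d \<and> (\<forall>w\<in>ball z d. U w = Re (f w)))"

lemma locally_Re_holoE: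
  assumes "locally_Re_holo S U" "z \<in> S"
  obtains f d where "0 < d" "f holomorphic_on ball z d" "\<And>w. w \<in> ball z d \<Longrightarrow> U w = Re (f w)"
  using assms unfolding locally_Re_holo_def by metis

lemma locally_Re_holo_add:
  assumes "locally_Re_holo S U" "locally_Re_holo S V"
  shows "locally_Re_holo S (\<lambda>z. U z + V z)"
  unfolding locally_Re_holo_def
proof
  fix z assume "z \<in> S"
  then obtain f d g e where *: "0 < d" "f holomorphic_on ball z d" "\<And>w. w \<in> ball z d \<Longrightarrow> U w = Re (f w)"
    "0 < e" "g holomorphic_on ball z e" "\<And>w. w \<in> ball z e \<Longrightarrow> V w = Re (g w)"
    using assms by (metis locally_Re_holoE)
  then show "\<exists>f d. 0 < d \<and> f holomorphic_on ball z d \<and> (\<forall>w\<in>ball z d. U w + V w = Re (f w))"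
    by (intro exI[of _ "\<lambda>w. f w + g w"] exI[of _ "min d e"])
      (auto intro!: holomorphic_intros elim: holomorphic_on_subset)
qed

lemma locally_Re_holo_cmult:
  assumes "locally_Re_holo S U"
  shows "locally_Re_holo S (\<lambda>z. c * U z)"
  unfolding locally_Re_holo_def
proof
  fix z assume "z \<in> S"
  then obtain f d where "0 < d" "f holomorphic_on ball z d" "\<And>w. w \<in> ball z d \<Longrightarrow> U w = Re (f w)"
    using assms by (metis locally_Re_holoE)
  then show "\<exists>f d. 0 < d \<and> f holomorphic_on ball z d \<and> (\<forall>w\<in>ball z d. c * U w = Re (f w))"
    by (intro exI[of _ "\<lambda>w. of_real c * f w"] exI[of _ d]) (auto intro!: holomorphic_intros)
qed

lemma locally_Re_holo_Re:
  assumes "f holomorphic_on S" "open S"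
  shows "locally_Re_holo S (\<lambda>z. Re (f z))"
  unfolding locally_Re_holo_def
proof
  fix z assume "z \<in> S"
  then obtain d where "0 < d" "ball z d \<subseteq> S" using assms(2) openE by blast
  then show "\<exists>g d. 0 < d \<and> g holomorphic_on ball z d \<and> (\<forall>w\<in>ball z d. Re (f w) = Re (g w))"
    using assms(1) holomorphic_on_subset by blast
qed

lemma locally_Re_holo_const: "locally_Re_holo S (\<lambda>z. c)"
  unfolding locally_Re_holo_def
  by (intro ballI exI[of _ "\<lambda>_. of_real c"] exI[of _ 1]) auto

lemma locally_Re_holo_sum:
  assumes "\<And>i. i \<in> F \<Longrightarrow> locally_Re_holo S (U i)"
  shows "locally_Re_holo S (\<lambda>z. \<Sum>i\<in>F. U i z)"
  using assms
  by (induction F rule: infinite_finite_induct) (auto intro: locally_Re_holo_const locally_Re_holo_add)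

lemma locally_Re_holo_subset: "locally_Re_holo S U \<Longrightarrow> T \<subseteq> S \<Longrightarrow> locally_Re_holo T U"
  unfolding locally_Re_holo_def by blast

lemma locally_Re_holo_ln_norm:
  assumes "f holomorphic_on S" "open S" "\<And>z. z \<in> S \<Longrightarrow> f z \<noteq> 0"
  shows "locally_Re_holo S (\<lambda>z. ln (norm (f z)))"
  unfolding locally_Re_holo_def
proof
  fix z assume "z \<in> S"
  then obtain d where d: "0 < d" "ball z d \<subseteq> S" using assms(2) openE by blast
  obtain g where "g holomorphic_on ball z d" "\<And>w. w \<in> ball z d \<Longrightarrow> f w = exp (g w)"
    using contractible_imp_holomorphic_log[of f "ball z d"] convex_imp_contractible[of "ball z d"] assms d
    by (metis convex_ball holomorphic_on_subset subsetD)
  then show "\<exists>g d. 0 < d \<and> g holomorphic_on ball z d \<and> (\<forall>w\<in>ball z d. ln (norm (f w)) = Re (g w))"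
    using d(1) by (intro exI[of _ g] exI[of _ d]) auto
qed

lemma locally_Re_holo_continuous:
  assumes "locally_Re_holo S U" "z \<in> S"
  shows "isCont U z"
proof -
  obtain f d where *: "0 < d" "f holomorphic_on ball z d" "\<And>w. w \<in> ball z d \<Longrightarrow> U w = Re (f w)"
    using assms by (metis locally_Re_holoE)
  have "continuous_on (ball z d) (\<lambda>w. Re (f w))"
    using *(2) by (intro continuous_intros holomorphic_on_imp_continuous_on)
  then have "continuous_on (ball z d) U" by (rule continuous_on_eq) (simp add: *(3))
  then show ?thesis using *(1) by (simp add: continuous_on_eq_continuous_at)
qed

text \<open>The mean of f over w, -w, iw, -iw reproduces f(0) up to o(w^2) for holomorphic f, whereas for |z|^2
  it exceeds the value at 0 by exactly |w|^2.\<close>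
lemma four_point_mean:
  assumes f: "f holomorphic_on ball z d" "0 < d" and e: "0 < e"
  obtains t where "0 < t" "t < d"
    "norm (f (z + of_real t) + f (z - of_real t) + f (z + \<i> * of_real t) + f (z - \<i> * of_real t) - 4 * f z) \<le> e * t\<^sup>2"
proof -
  define f1 where "f1 = deriv f"
  define g where "g w = f (z + w) + f (z - w) + f (z + \<i> * w) + f (z - \<i> * w) - 4 * f z" for w
  define g1 where "g1 w = f1 (z + w) - f1 (z - w) + \<i> * f1 (z + \<i> * w) - \<i> * f1 (z - \<i> * w)" for w
  have f1: "(f has_field_derivative f1 w) (at w)" if "w \<in> ball z d" for w
    unfolding f1_def by (rule holomorphic_derivI[OF f(1) open_ball that])
  have f2: "(f1 has_field_derivative deriv f1 z) (at z)"
    using f unfolding f1_def by (intro holomorphic_derivI[of _ "ball z d"] holomorphic_deriv) auto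
  have gd: "(g has_field_derivative g1 w) (at w)" if "norm w < d" for w
  proof -
    have 1: "((\<lambda>w. f (z + c * w)) has_field_derivative c * f1 (z + c * w)) (at w)" if c: "norm c = 1" for c
    proof -
      have "z + c * w \<in> ball z d" using \<open>norm w < d\<close> c by (simp add: dist_norm norm_mult)
      then have "((\<lambda>w. f (z + c * w)) has_field_derivative f1 (z + c * w) * c) (at w)"
        by (intro DERIV_chain2[of f "f1 (z + c * w)" "\<lambda>w. z + c * w" w c UNIV] f1)
          (auto intro!: derivative_eq_intros)
      then show ?thesis by (simp add: mult.commute)
    qed
    show ?thesis unfolding g_def g1_def
      using 1[of 1] 1[of "-1"] 1[of "\<i>"] 1[of "-\<i>"] by (auto intro!: derivative_eq_intros)
  qed
  have "(g1 has_field_derivative 0) (at 0)"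
  proof -
    have 1: "((\<lambda>w. c * f1 (z + c * w)) has_field_derivative c * (c * deriv f1 z)) (at 0)" for c
    proof -
      have "((\<lambda>w. f1 (z + c * w)) has_field_derivative deriv f1 z * c) (at 0)"
        by (rule DERIV_chain2[of f1 "deriv f1 z" "\<lambda>w. z + c * w" 0 c UNIV])
          (use f2 in \<open>auto intro!: derivative_eq_intros\<close>)
      from DERIV_cmult[OF this, of c] show ?thesis by (simp add: mult_ac)
    qed
    have "((\<lambda>w. (1 * f1 (z + 1 * w) + (-1) * f1 (z + (-1) * w)) + (\<i> * f1 (z + \<i> * w) + (-\<i>) * f1 (z + (-\<i>) * w)))
        has_field_derivative ((1 * (1 * deriv f1 z) + (-1) * ((-1) * deriv f1 z)) + (\<i> * (\<i> * deriv f1 z) + (-\<i>) * ((-\<i>) * deriv f1 z)))) (at 0)"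
      by (intro DERIV_add 1)
    then show ?thesis by (simp add: g1_def[abs_def] add_diff_eq)
  qed
  moreover have "g1 0 = 0" by (simp add: g1_def)
  ultimately obtain s where s: "s > 0" "\<And>w. norm w < s \<Longrightarrow> norm (g1 w) \<le> e * norm w"
    using e unfolding has_field_derivative_def has_derivative_at_alt by (auto simp: mult_commute_abs)
  define t where "t = min d s / 2"
  have t: "0 < t" "t < d" "t < s" using f(2) s(1) by (auto simp: t_def)
  have "norm (g (of_real t) - g 0) \<le> (e * t) * norm (of_real t - (0::complex))"
  proof (rule field_differentiable_bound[of "cball 0 t" g g1])
    show "(g has_field_derivative g1 w) (at w within cball 0 t)" if "w \<in> cball 0 t" for w
      using gd that t by (auto intro: has_field_derivative_at_within)
    show "norm (g1 w) \<le> e * t" if "w \<in> cball 0 t" for w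
    proof -
      have "norm (g1 w) \<le> e * norm w" using s(2)[of w] that t by auto
      also have "\<dots> \<le> e * t" using that e by (intro mult_left_mono) auto
      finally show ?thesis .
    qed
  qed (use t in auto)
  moreover have "g 0 = 0" by (simp add: g_def)
  ultimately have "norm (g (of_real t)) \<le> e * t\<^sup>2" using t by (simp add: power2_eq_square)
  then show ?thesis using that t unfolding g_def by blast
qed

text \<open>A small multiple of |z|^2 makes the function strictly subharmonic, and the four-point
  mean then rules out an interior maximum. The boundary condition is an asymptotic upper bound, so
  that no continuity up to the boundary is involved.\<close>

theorem maximum_principle:
  assumes Om: "open \<Omega>" "bounded \<Omega>" and U: "locally_Re_holo \<Omega> U"
    and bd: "\<And>\<zeta> e. \<zeta> \<in> closure \<Omega> - \<Omega> \<Longrightarrow> 0 < e \<Longrightarrow> \<exists>d>0. \<forall>z\<in>\<Omega>. dist z \<zeta> < d \<longrightarrow> U z \<le> M + e"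
    and z1: "z1 \<in> \<Omega>"
  shows "U z1 \<le> M"
proof (rule ccontr)
  assume "\<not> U z1 \<le> M"
  define a where "a = U z1 - M"
  have a: "a > 0" using \<open>\<not> U z1 \<le> M\<close> by (simp add: a_def)
  obtain R where R: "R > 0" "\<And>z. z \<in> \<Omega> \<Longrightarrow> norm z \<le> R" using Om(2) bounded_pos by blast
  \<comment> \<open>On \<open>\<Omega>\<close> the perturbation is at most \<open>a / 4\<close>.
    With the boundary tolerance \<open>a / 4\<close>, the perturbed function stays below
    \<open>M + a / 2\<close> near the boundary, while at \<open>z1\<close> it is at least
    \<open>M + a\<close>.\<close>
  define \<epsilon> where "\<epsilon> = a / (4 * R\<^sup>2)"
  have \<epsilon>: "\<epsilon> > 0" using a R by (simp add: \<epsilon>_def)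
  define V where "V z = U z + \<epsilon> * (norm z)\<^sup>2" for z
  have Rb: "\<epsilon> * (norm z)\<^sup>2 \<le> a / 4" if "z \<in> \<Omega>" for z
  proof -
    have "(norm z)\<^sup>2 \<le> R\<^sup>2" using R(2)[OF that] by (intro power_mono) auto
    then have "\<epsilon> * (norm z)\<^sup>2 \<le> \<epsilon> * R\<^sup>2" using \<epsilon> by (intro mult_left_mono) auto
    then show ?thesis using R(1) by (simp add: \<epsilon>_def)
  qed
  define K where "K = {z\<in>\<Omega>. V z1 \<le> V z}"
  have cont: "isCont V z" if "z \<in> \<Omega>" for z
    unfolding V_def using locally_Re_holo_continuous[OF U that] by (intro continuous_intros)
  have "closed K"
  proof (rule closed_sequential_limits[THEN iffD2], intro allI impI, elim conjE)
    fix x l assume x: "\<forall>n. x n \<in> K" "x \<longlonglongrightarrow> l"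
    then have xO: "\<And>n. x n \<in> \<Omega>" by (auto simp: K_def)
    have lc: "l \<in> closure \<Omega>" using xO x(2) closure_sequential by blast
    show "l \<in> K"
    proof (cases "l \<in> \<Omega>")
      case True
      then have "(\<lambda>n. V (x n)) \<longlonglongrightarrow> V l" using cont x(2) isCont_tendsto_compose by blast
      then have "V z1 \<le> V l" using x(1) by (intro LIMSEQ_le_const) (auto simp: K_def)
      then show ?thesis using True by (simp add: K_def)
    next
      case False
      then obtain d where d: "d > 0" "\<And>z. z \<in> \<Omega> \<Longrightarrow> dist z l < d \<Longrightarrow> U z \<le> M + a / 4"
        using bd[of l "a / 4"] lc a by auto
      obtain n where n: "dist (x n) l < d" using x(2) d(1) unfolding lim_sequentially by blast
      have "U (x n) \<le> M + a / 4" using d(2)[OF xO n] .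
      then have "V (x n) \<le> M + a / 2" using Rb[OF xO[of n]] by (simp add: V_def)
      moreover have "V z1 \<ge> M + a" using \<epsilon> by (simp add: V_def a_def)
      ultimately have "V (x n) < V z1" using a by linarith
      then show ?thesis using x(1) by (auto simp: K_def not_le[symmetric])
    qed
  qed
  moreover have "bounded K" using Om(2) by (rule bounded_subset) (auto simp: K_def)
  ultimately have "compact K" by (simp add: compact_eq_bounded_closed)
  moreover have "z1 \<in> K" using z1 by (simp add: K_def)
  moreover have "continuous_on K V"
    using cont by (intro continuous_at_imp_continuous_on) (auto simp: K_def)
  ultimately obtain s where s: "s \<in> K" "\<And>z. z \<in> K \<Longrightarrow> V z \<le> V s"
    using continuous_attains_sup[of K V] by blast
  have sO: "s \<in> \<Omega>" using s(1) by (simp add: K_def)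
  have smax: "V z \<le> V s" if "z \<in> \<Omega>" for z
    using s that by (cases "z \<in> K") (auto simp: K_def)
  obtain f d where f: "0 < d" "f holomorphic_on ball s d" "\<And>w. w \<in> ball s d \<Longrightarrow> U w = Re (f w)"
    using locally_Re_holoE[OF U sO] by metis
  obtain d' where d': "0 < d'" "ball s d' \<subseteq> \<Omega>" using Om(1) sO openE by blast
  define r where "r = min d d'"
  have r: "0 < r" "f holomorphic_on ball s r" "ball s r \<subseteq> \<Omega>"
    using f d' by (auto simp: r_def intro: holomorphic_on_subset)
  \<comment> \<open>The permitted error \<open>2 * \<epsilon> * t\<^sup>2\<close> is half of the
    gain \<open>4 * \<epsilon> * t\<^sup>2\<close> that the perturbation contributes.\<close>
  obtain t where t: "0 < t" "t < r"
    "norm (f (s + of_real t) + f (s - of_real t) + f (s + \<i> * of_real t) + f (s - \<i> * of_real t) - 4 * f s) \<le> (2 * \<epsilon>) * t\<^sup>2"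
    using four_point_mean[OF r(2,1), of "2 * \<epsilon>"] \<epsilon> by auto
  have mem: "s + of_real t \<in> ball s r" "s - of_real t \<in> ball s r" "s + \<i> * of_real t \<in> ball s r" "s - \<i> * of_real t \<in> ball s r"
    using t by (auto simp: dist_norm norm_mult)
  have "\<bar>Re (f (s + of_real t) + f (s - of_real t) + f (s + \<i> * of_real t) + f (s - \<i> * of_real t) - 4 * f s)\<bar> \<le> (2 * \<epsilon>) * t\<^sup>2"
    using abs_Re_le_cmod t(3) order_trans by blast
  moreover have "U w = Re (f w)" if "w \<in> ball s r" for w using f(3) that by (simp add: r_def)
  moreover have "s \<in> ball s r" using r(1) by simp
  ultimately have Us: "U (s + of_real t) + U (s - of_real t) + U (s + \<i> * of_real t) + U (s - \<i> * of_real t) - 4 * U s \<ge> - (2 * (\<epsilon> * t\<^sup>2))"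
    using mem by simp
  have "(norm (s + of_real t))\<^sup>2 + (norm (s - of_real t))\<^sup>2 + (norm (s + \<i> * of_real t))\<^sup>2 + (norm (s - \<i> * of_real t))\<^sup>2
      = 4 * (norm s)\<^sup>2 + 4 * t\<^sup>2"
    unfolding cmod_power2 by (simp add: power2_eq_square algebra_simps)
  then have ns: "\<epsilon> * (norm (s + of_real t))\<^sup>2 + \<epsilon> * (norm (s - of_real t))\<^sup>2 + \<epsilon> * (norm (s + \<i> * of_real t))\<^sup>2 + \<epsilon> * (norm (s - \<i> * of_real t))\<^sup>2
      = 4 * (\<epsilon> * (norm s)\<^sup>2) + 4 * (\<epsilon> * t\<^sup>2)"
    by (metis (no_types, lifting) distrib_left mult.left_commute)
  have ar: "4 * (u + a) + 2 * e \<le> u1 + a1 + (u2 + a2) + (u3 + a3) + (u4 + a4)"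
    if "u1 + u2 + u3 + u4 - 4 * u \<ge> - (2 * e)" "a1 + a2 + a3 + a4 = 4 * a + 4 * e"
    for u u1 u2 u3 u4 a a1 a2 a3 a4 e :: real
    using that by argo
  have Vs: "4 * V s + 2 * (\<epsilon> * t\<^sup>2) \<le> V (s + of_real t) + V (s - of_real t) + V (s + \<i> * of_real t) + V (s - \<i> * of_real t)"
    unfolding V_def by (rule ar[OF Us ns])
  have "V (s + of_real t) \<le> V s" "V (s - of_real t) \<le> V s" "V (s + \<i> * of_real t) \<le> V s" "V (s - \<i> * of_real t) \<le> V s"
    using smax mem r(3) by blast+
  moreover have "\<epsilon> * t\<^sup>2 > 0" using \<epsilon> t by simp
  ultimately show False using Vs by linarith
qed

lemma harnack_half_ball:
  assumes F: "F holomorphic_on ball c R" "0 < R" and gt: "\<And>z. z \<in> ball c R \<Longrightarrow> 1 < norm (F z)"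
    and z: "dist z c \<le> R / 2"
  shows "ln (norm (F c)) / 3 \<le> ln (norm (F z))"
proof -
  obtain L where L: "L holomorphic_on ball c R" "\<And>w. w \<in> ball c R \<Longrightarrow> F w = exp (L w)"
    using contractible_imp_holomorphic_log[of F "ball c R"] convex_imp_contractible[of "ball c R"] F gt
    by (metis convex_ball norm_zero not_one_less_zero)
  have ReL: "Re (L w) = ln (norm (F w))" "Re (L w) > 0" if "w \<in> ball c R" for w
    using L(2)[OF that] gt[OF that] by (auto simp: one_less_exp_iff)
  have cR: "c \<in> ball c R" using F(2) by simp
  define W where "W w = (L (c + of_real R * w) - L c) / (L (c + of_real R * w) + cnj (L c))" for w
  have inb: "c + of_real R * w \<in> ball c R" if "norm w < 1" for w
    using that F(2) by (simp add: dist_norm norm_mult)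
  have den: "L (c + of_real R * w) + cnj (L c) \<noteq> 0" if "norm w < 1" for w
    using ReL(2)[OF inb[OF that]] ReL(2)[OF cR] by (metis add_pos_pos complex_cnj plus_complex.sel(1) less_irrefl zero_complex.sel(1) cnj.sel(1))
  have Wh: "W holomorphic_on ball 0 1"
    unfolding W_def
    by (intro holomorphic_intros holomorphic_on_compose_gen[OF _ L(1), unfolded o_def])
      (use inb den in auto)
  have key: "norm (x - b) < norm (x + cnj b)" if "Re x > 0" "Re b > 0" for x b :: complex
  proof -
    have "(norm (x + cnj b))\<^sup>2 - (norm (x - b))\<^sup>2 = 4 * Re x * Re b"
      unfolding cmod_power2 by (simp add: power2_eq_square algebra_simps)
    moreover have "4 * Re x * Re b > 0" using that by simp
    ultimately have "(norm (x - b))\<^sup>2 < (norm (x + cnj b))\<^sup>2" by linarith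
    then show ?thesis by (rule power_less_imp_less_base) simp
  qed
  have W1: "norm (W w) < 1" if "norm w < 1" for w
    using key[OF ReL(2)[OF inb[OF that]] ReL(2)[OF cR]] den[OF that]
    by (simp add: W_def norm_divide divide_less_eq)
  have W0: "W 0 = 0" by (simp add: W_def)
  define w where "w = (z - c) / of_real R"
  have w: "norm w \<le> 1 / 2" "c + of_real R * w = z"
    using z F(2) by (auto simp: w_def dist_norm norm_divide field_simps)
  have zb: "z \<in> ball c R" using z F(2) by (simp add: dist_commute)
  have "norm (W w) \<le> norm w" using Schwarz_Lemma(1)[OF Wh W0 W1, of w] w by auto
  then have "norm (W w) \<le> 1 / 2" using w(1) by linarith
  then have *: "2 * norm (L z - L c) \<le> norm (L z + cnj (L c))"
    using den[of w] w by (simp add: W_def norm_divide divide_le_eq)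
  have "4 * (norm (L z - L c))\<^sup>2 \<le> (norm (L z + cnj (L c)))\<^sup>2"
    using power_mono[OF *, of 2] by (simp add: power_mult_distrib)
  then have "4 * ((Re (L z) - Re (L c))\<^sup>2 + (Im (L z) - Im (L c))\<^sup>2) \<le> (Re (L z) + Re (L c))\<^sup>2 + (Im (L z) - Im (L c))\<^sup>2"
    by (simp add: cmod_power2)
  moreover have "4 * B' \<le> C" if "4 * (B + D) \<le> C + D" "0 \<le> D" "B' = B" for B B' C D :: real
    using that by argo
  ultimately have "4 * (Re (L c) - Re (L z))\<^sup>2 \<le> (Re (L z) + Re (L c))\<^sup>2"
    using zero_le_power2 power2_commute by blast
  then have "(2 * (Re (L c) - Re (L z)))\<^sup>2 \<le> (Re (L z) + Re (L c))\<^sup>2"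
    unfolding power_mult_distrib by simp
  moreover have "0 \<le> Re (L z) + Re (L c)" using ReL(2)[OF zb] ReL(2)[OF cR] by argo
  ultimately have "2 * (Re (L c) - Re (L z)) \<le> Re (L z) + Re (L c)" by (rule power2_le_imp_le)
  then show ?thesis unfolding ReL(1)[OF zb, symmetric] ReL(1)[OF cR, symmetric] by argo
qed

section \<open>Density of sets of reals\<close>

text \<open>If all short intervals were deficient, a Vitali family of them inside a tight open set
  \<open>U\<close> would give \<open>measure lebesgue S\<close> at most (1 - e) times the measure of
  \<open>U\<close>. With \<open>U\<close> larger than \<open>S\<close> by a factor below 1 + e, this
  is less than the measure of \<open>S\<close>. One good interval is enough for what follows, and
  its centre need not lie in \<open>S\<close>.\<close>

lemma weak_density:
  fixes S :: "real set"
  assumes S: "S \<in> lmeasurable" "0 < measure lebesgue S" and e: "0 < e" and \<tau>: "0 < \<tau>"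
  shows "\<exists>x r. 0 < r \<and> r < \<tau> \<and> (1 - e) * (2 * r) \<le> measure lebesgue (S \<inter> cball x r)"
proof (rule ccontr)
  assume neg: "\<not> ?thesis"
  then have no: "measure lebesgue (S \<inter> cball x r) < (1 - e) * (2 * r)" if "0 < r" "r < \<tau>" for x r
    using neg that by (meson not_le)
  have e1: "e < 1"
  proof (rule ccontr)
    assume "\<not> e < 1"
    then have "(1 - e) * (2 * (\<tau> / 2)) \<le> 0" using \<tau> by (intro mult_nonpos_nonneg) auto
    moreover have "0 \<le> measure lebesgue (S \<inter> cball 0 (\<tau> / 2))" by simp
    ultimately show False using no[of "\<tau> / 2" 0] \<tau> by linarith
  qed
  define s where "s = measure lebesgue S"
  define e' where "e' = e * s"
  have e': "e' > 0" using e S by (simp add: e'_def s_def)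
  obtain U where U: "open U" "S \<subseteq> U" "U - S \<in> lmeasurable" "emeasure lebesgue (U - S) < ennreal e'"
    using sets_lebesgue_outer_open[of S e', OF fmeasurableD[OF S(1)] e'] by blast
  have mU: "U \<in> lmeasurable" using U(2,3) S(1) by (metis Diff_partition fmeasurable.Un)
  have "measure lebesgue (U - S) < e'"
    using U(3,4) by (metis emeasure_eq_measure2 ennreal_less_iff measure_nonneg)
  moreover have "measure lebesgue (U - S) = measure lebesgue U - s"
    using mU S(1) U(2) by (simp add: s_def measurable_measure_Diff fmeasurableD)
  ultimately have Us: "measure lebesgue U < s + e'" by simp
  define K where "K = {(a, r). 0 < r \<and> r < \<tau> \<and> cball a r \<subseteq> U}"
  have ex: "\<exists>i. i \<in> K \<and> x \<in> cball (fst i) (snd i) \<and> snd i < d" if x: "x \<in> S" and d: "0 < d" for x d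
  proof -
    obtain r where r: "0 < r" "ball x r \<subseteq> U" using U x openE by blast
    define q where "q = min (min r \<tau>) d / 2"
    have q: "0 < q" "q < r" "q < \<tau>" "q < d" using r d \<tau> by (auto simp: q_def)
    have "cball x q \<subseteq> ball x r" using q(2) by auto
    then have "cball x q \<subseteq> U" using r(2) by blast
    then show ?thesis using q by (intro exI[of _ "(x, q)"]) (auto simp: K_def)
  qed
  have rp: "\<And>i. i \<in> K \<Longrightarrow> 0 < snd i" by (auto simp: K_def)
  obtain C where C: "countable C" "C \<subseteq> K"
    "pairwise (\<lambda>i j. disjnt (cball (fst i) (snd i)) (cball (fst j) (snd j))) C"
    "negligible (S - (\<Union>i \<in> C. cball (fst i) (snd i)))"
    by (rule Vitali_covering_theorem_cballs[of K snd S fst, OF rp ex])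
  let ?B = "\<lambda>i. cball (fst i) (snd i :: real)"
  have disj: "disjoint_family_on ?B C"
    using C(3) by (auto simp: disjoint_family_on_def pairwise_def disjnt_def)
  have disj': "disjoint_family_on (\<lambda>i. S \<inter> ?B i) C"
    using disj unfolding disjoint_family_on_def by blast
  let ?N = "S - (\<Union>i \<in> C. ?B i)"
  have mi: "S \<inter> ?B i \<in> lmeasurable" for i using S(1) by (intro fmeasurable.Int) auto
  have UB: "(\<Union>i\<in>C. S \<inter> ?B i) \<in> sets lebesgue"
    using C(1) mi by (intro sets.countable_UN') (auto simp: fmeasurableD)
  have N: "?N \<in> null_sets lebesgue" using C(4) by (simp add: negligible_iff_null_sets)
  have Seq: "S = (\<Union>i\<in>C. S \<inter> ?B i) \<union> ?N" by blast
  have "emeasure lebesgue S = emeasure lebesgue (\<Union>i\<in>C. S \<inter> ?B i)"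
    by (subst Seq) (rule emeasure_Un_null_set[OF UB N])
  also have "\<dots> = (\<integral>\<^sup>+i. emeasure lebesgue (S \<inter> ?B i) \<partial>count_space C)"
    using C(1) disj' mi by (intro emeasure_UN_countable) (auto simp: fmeasurableD)
  also have "\<dots> \<le> (\<integral>\<^sup>+i. ennreal (1 - e) * emeasure lebesgue (?B i) \<partial>count_space C)"
  proof (rule nn_integral_mono)
    fix i assume "i \<in> space (count_space C)"
    then have i: "0 < snd i" "snd i < \<tau>" using C(2) by (auto simp: K_def)
    have "emeasure lebesgue (S \<inter> ?B i) = ennreal (measure lebesgue (S \<inter> ?B i))"
      by (rule emeasure_eq_measure2[OF mi])
    also have "\<dots> \<le> ennreal ((1 - e) * (2 * snd i))" using no[OF i] by (intro ennreal_leI less_imp_le)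
    also have "\<dots> = ennreal (1 - e) * ennreal (2 * snd i)" using e1 i by (intro ennreal_mult) auto
    also have "ennreal (2 * snd i) = emeasure lebesgue (?B i)" using i by (simp add: cball_eq_atLeastAtMost)
    finally show "emeasure lebesgue (S \<inter> ?B i) \<le> ennreal (1 - e) * emeasure lebesgue (?B i)" .
  qed
  also have "\<dots> = ennreal (1 - e) * (\<integral>\<^sup>+i. emeasure lebesgue (?B i) \<partial>count_space C)"
    by (rule nn_integral_cmult) simp
  also have "(\<integral>\<^sup>+i. emeasure lebesgue (?B i) \<partial>count_space C) = emeasure lebesgue (\<Union>i\<in>C. ?B i)"
    using C(1) disj by (intro emeasure_UN_countable[symmetric]) auto
  also have "\<dots> \<le> emeasure lebesgue U"
  proof (intro emeasure_mono UN_least)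
    fix i assume "i \<in> C"
    then show "?B i \<subseteq> U" using C(2) by (cases i) (auto simp: K_def simp del: mem_cball)
  qed (use mU in \<open>simp add: fmeasurableD\<close>)
  also have "emeasure lebesgue U = ennreal (measure lebesgue U)" by (rule emeasure_eq_measure2[OF mU])
  finally have "emeasure lebesgue S \<le> ennreal (1 - e) * ennreal (measure lebesgue U)" by (simp add: mult_left_mono)
  then have "ennreal s \<le> ennreal ((1 - e) * measure lebesgue U)"
    using e1 S(1) by (simp add: s_def emeasure_eq_measure2 ennreal_mult)
  then have "s \<le> (1 - e) * measure lebesgue U" using e1 by (simp add: ennreal_le_iff)
  also have "\<dots> \<le> (1 - e) * (s + e')" using Us e1 by (intro mult_left_mono) auto
  also have "\<dots> = s - e * e'" by (simp add: e'_def algebra_simps)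
  finally show False using mult_pos_pos[OF e e'] by linarith
qed

section \<open>Holomorphic functions omitting a disc in cones\<close>

text \<open>Slope instead of angle and truncation by height: halving the aperture and comparing
  truncations become plain arithmetic.\<close>

definition sector :: "real \<Rightarrow> real \<Rightarrow> real \<Rightarrow> complex set" where
  "sector m k x = {z. 0 < Im z \<and> \<bar>Re z - x\<bar> < m * Im z \<and> Im z < k}"

text \<open>The Green function of the upper half-plane with pole \<open>w\<close>.\<close>

definition green :: "complex \<Rightarrow> complex \<Rightarrow> real" where
  "green w z = ln (norm ((z - cnj w) / (z - w)))"

text \<open>The Poisson kernel of the upper half-plane, multiplied by \<pi>.\<close>

definition pois :: "real \<Rightarrow> complex \<Rightarrow> real" where
  "pois t z = Im z / ((Re z - t)\<^sup>2 + (Im z)\<^sup>2)"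

text \<open>Let \<open>q\<close> and \<open>p\<close> be the squared distances of \<open>z\<close>
  from the pole and from its reflection. Then \<open>p = q + t\<close>, and twice the Green function
  is ln (p / q). The bounds are ln u \<le> u - 1 for u = p / q and for u = q / p.\<close>

lemma green_bounds:
  assumes "0 < Im z" "0 < Im w" "z \<noteq> w"
  shows "green w z \<le> 2 * Im z * Im w / (norm (z - w))\<^sup>2"
    and "2 * Im z * Im w / (norm (z - cnj w))\<^sup>2 \<le> green w z"
    and "0 \<le> green w z"
proof -
  define q where "q = (norm (z - w))\<^sup>2"
  define p where "p = (norm (z - cnj w))\<^sup>2"
  define t where "t = 4 * (Im z * Im w)"
  have q: "q > 0" using assms by (simp add: q_def)
  have pq: "p = q + t" unfolding p_def q_def t_def cmod_power2 by (simp add: power2_eq_square algebra_simps)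
  have t: "t > 0" using assms by (simp add: t_def)
  have p: "p > 0" using pq q t by simp
  have "ln (p / q) = 2 * green w z"
  proof -
    have "p / q = (norm ((z - cnj w) / (z - w)))\<^sup>2" by (simp add: p_def q_def norm_divide power_divide)
    moreover have "norm ((z - cnj w) / (z - w)) > 0"
      using p q by (simp add: norm_divide p_def q_def)
    ultimately show ?thesis by (simp add: green_def ln_realpow)
  qed
  moreover have "ln (p / q) \<le> t / q"
  proof -
    have "p / q - 1 = t / q" using q by (simp add: pq add_divide_distrib)
    then show ?thesis using ln_le_minus_one[of "p / q"] p q by simp
  qed
  moreover have "t / p \<le> ln (p / q)"
  proof -
    have "ln (q / p) \<le> q / p - 1" using ln_le_minus_one[of "q / p"] p q by simp
    moreover have "ln (q / p) = - ln (p / q)" using p q by (simp add: ln_div)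
    moreover have "q / p - 1 = - (t / p)" using p by (simp add: pq field_simps)
    ultimately show ?thesis by linarith
  qed
  moreover have "2 * Im z * Im w / q = t / q / 2" "2 * Im z * Im w / p = t / p / 2" by (simp_all add: t_def)
  moreover have "t / p > 0" using t p by simp
  moreover have "g \<le> A \<and> B \<le> g \<and> 0 \<le> g" if "L = 2 * g" "L \<le> u" "v \<le> L" "A = u / 2" "B = v / 2" "0 < v"
    for g A B L u v :: real
    using that by argo
  ultimately have "green w z \<le> 2 * Im z * Im w / q \<and> 2 * Im z * Im w / p \<le> green w z \<and> 0 \<le> green w z"
    by blast
  then show "green w z \<le> 2 * Im z * Im w / (norm (z - w))\<^sup>2"
    "2 * Im z * Im w / (norm (z - cnj w))\<^sup>2 \<le> green w z" "0 \<le> green w z"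
    by (simp_all add: p_def q_def)
qed

text \<open>Each increment is the angle under which an interval is seen from x + iy; disjoint
  intervals fill disjoint parts of an angle \<pi>.\<close>

lemma arctan_increments_sum_le:
  assumes "finite F" "\<And>j. j \<in> F \<Longrightarrow> a j < b j" "0 < y"
    and disj: "\<And>i j. i \<in> F \<Longrightarrow> j \<in> F \<Longrightarrow> i \<noteq> j \<Longrightarrow> {a i<..<b i} \<inter> {a j<..<b j} = {}"
  shows "(\<Sum>j\<in>F. arctan ((b j - x) / y) - arctan ((a j - x) / y)) \<le> pi"
proof -
  define \<theta> where "\<theta> t = arctan ((t - x) / y)" for t
  have mono: "\<theta> s \<le> \<theta> t" if "s \<le> t" for s t
    using that assms(3) by (simp add: \<theta>_def arctan_le_iff divide_right_mono)
  have smono: "\<theta> s < \<theta> t" if "s < t" for s t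
    using that assms(3) by (simp add: \<theta>_def arctan_less_iff divide_strict_right_mono)
  have ord: "b i \<le> a j \<or> b j \<le> a i" if ij: "i \<in> F" "j \<in> F" "i \<noteq> j" for i j
  proof (rule ccontr)
    assume "\<not> (b i \<le> a j \<or> b j \<le> a i)"
    then have "max (a i) (a j) < min (b i) (b j)" using assms(2)[OF ij(1)] assms(2)[OF ij(2)] by auto
    then obtain s where "max (a i) (a j) < s" "s < min (b i) (b j)" using dense by blast
    then show False using disj[OF ij] by auto
  qed
  let ?I = "\<lambda>j. {\<theta> (a j)<..<\<theta> (b j)}"
  have "pairwise (\<lambda>i j. disjnt (?I i) (?I j)) F"
  proof (rule pairwiseI)
    fix i j assume "i \<in> F" "j \<in> F" "i \<noteq> j"
    then have "\<theta> (b i) \<le> \<theta> (a j) \<or> \<theta> (b j) \<le> \<theta> (a i)" using ord mono by blast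
    then show "disjnt (?I i) (?I j)" by (auto simp: disjnt_def)
  qed
  then have "measure lebesgue (\<Union>j\<in>F. ?I j) = (\<Sum>j\<in>F. measure lebesgue (?I j))"
    using assms(1) by (intro measure_UNION') auto
  also have "\<dots> = (\<Sum>j\<in>F. \<theta> (b j) - \<theta> (a j))"
    using smono assms(2) by (intro sum.cong) (auto simp: less_imp_le)
  finally have "(\<Sum>j\<in>F. \<theta> (b j) - \<theta> (a j)) = measure lebesgue (\<Union>j\<in>F. ?I j)" by simp
  also have "\<dots> \<le> measure lebesgue {- (pi / 2)<..<pi / 2}"
  proof (rule measure_mono_fmeasurable)
    show "(\<Union>j\<in>F. ?I j) \<subseteq> {- (pi / 2)<..<pi / 2}"
    proof (rule UN_least)
      fix j assume "j \<in> F"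
      have "- (pi / 2) < \<theta> (a j)" "\<theta> (b j) < pi / 2"
        using arctan_lbound arctan_ubound by (auto simp: \<theta>_def)
      then show "?I j \<subseteq> {- (pi / 2)<..<pi / 2}" by auto
    qed
    show "(\<Union>j\<in>F. ?I j) \<in> sets lebesgue" using assms(1) by (intro sets.finite_UN) auto
    show "{- (pi / 2)<..<pi / 2} \<in> lmeasurable" by (rule lmeasurable_open) auto
  qed
  also have "\<dots> = pi" by simp
  finally show ?thesis by (simp add: \<theta>_def)
qed

text \<open>Each Green function is at most a constant times the angle under which \<open>z\<close>
  sees the shadow of the pole, an interval of half-width \<open>a * Im (c j)\<close>. The mean value
  theorem for arctan supplies the comparison, and the shadows are disjoint, so the angles add up to
  at most \<pi>.\<close>

lemma green_sum_le:
  assumes F: "finite F" and c: "\<And>j. j \<in> F \<Longrightarrow> 0 < Im (c j)" and a: "0 < a" and \<rho>: "0 < \<rho>" and z: "0 < Im z"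
    and far: "\<And>j. j \<in> F \<Longrightarrow> \<rho> * Im (c j) \<le> norm (z - c j)"
    and disj: "\<And>i j. i \<in> F \<Longrightarrow> j \<in> F \<Longrightarrow> i \<noteq> j \<Longrightarrow>
      {Re (c i) - a * Im (c i)<..<Re (c i) + a * Im (c i)} \<inter> {Re (c j) - a * Im (c j)<..<Re (c j) + a * Im (c j)} = {}"
  shows "(\<Sum>j\<in>F. green (c j) z) \<le> ((1 + a / \<rho>)\<^sup>2 + (1 + 1 / \<rho>)\<^sup>2) / a * pi"
proof -
  \<comment> \<open>With N the distance of \<open>z\<close> from the pole, the first square bounds
    the horizontal distance from \<open>z\<close> to any point of the shadow and the second the
    height of \<open>z\<close>, both in units of N. They use that the height of the pole is at most
    N / \<rho>.\<close>
  define C where "C = (1 + a / \<rho>)\<^sup>2 + (1 + 1 / \<rho>)\<^sup>2"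
  define x y where "x = Re z" and "y = Im z"
  define \<theta> where "\<theta> t = arctan ((t - x) / y)" for t
  have y: "0 < y" using z by (simp add: y_def)
  have "1 + a / \<rho> > 0" using a \<rho> by (simp add: add_pos_pos)
  then have C: "C > 0" by (simp add: C_def add_pos_nonneg)
  have "green (c j) z \<le> C / a * (\<theta> (Re (c j) + a * Im (c j)) - \<theta> (Re (c j) - a * Im (c j)))" if j: "j \<in> F" for j
  proof -
    define w where "w = c j"
    have w: "0 < Im w" "\<rho> * Im w \<le> norm (z - w)" using c[OF j] far[OF j] by (auto simp: w_def)
    define N where "N = norm (z - w)"
    have N: "N > 0" using w \<rho> by (simp add: N_def) (metis mult_pos_pos less_le_trans zero_less_norm_iff right_minus_eq less_irrefl)
    have wN: "Im w \<le> N / \<rho>" using w(2) \<rho> by (simp add: N_def field_simps)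
    have "Re w - a * Im w < Re w + a * Im w" using a w by simp
    then obtain s where s: "Re w - a * Im w < s" "s < Re w + a * Im w"
      "\<theta> (Re w + a * Im w) - \<theta> (Re w - a * Im w) = (Re w + a * Im w - (Re w - a * Im w)) * (inverse (1 + ((s - x) / y)\<^sup>2) * (1 / y))"
    proof (rule MVT2[THEN exE])
      show "(\<theta> has_real_derivative inverse (1 + ((s - x) / y)\<^sup>2) * (1 / y)) (at s)" for s
        unfolding \<theta>_def using y by (auto intro!: derivative_eq_intros)
    qed (use that in auto)
    have nr: "\<bar>x - Re w\<bar> \<le> N" "\<bar>y - Im w\<bar> \<le> N"
      using abs_Re_le_cmod[of "z - w"] abs_Im_le_cmod[of "z - w"] by (auto simp: N_def x_def y_def)
    have aw: "a * Im w \<le> a * (N / \<rho>)" using wN a by (intro mult_left_mono) auto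
    have "\<bar>s - x\<bar> \<le> (1 + a / \<rho>) * N"
    proof -
      have "\<bar>s - x\<bar> \<le> a * Im w + N" using s(1,2) nr(1) by argo
      also have "\<dots> \<le> (1 + a / \<rho>) * N" using aw by (simp add: algebra_simps)
      finally show ?thesis .
    qed
    then have 1: "(s - x)\<^sup>2 \<le> ((1 + a / \<rho>) * N)\<^sup>2" by (metis abs_ge_zero power2_abs power_mono)
    have "y \<le> (1 + 1 / \<rho>) * N" using nr(2) wN by (simp add: algebra_simps)
    then have 2: "y\<^sup>2 \<le> ((1 + 1 / \<rho>) * N)\<^sup>2" using y by (intro power_mono) auto
    have 3: "(s - x)\<^sup>2 + y\<^sup>2 \<le> C * N\<^sup>2"
    proof -
      have "C * N\<^sup>2 = ((1 + a / \<rho>) * N)\<^sup>2 + ((1 + 1 / \<rho>) * N)\<^sup>2"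
        unfolding C_def power_mult_distrib by (rule distrib_right)
      then show ?thesis using add_mono[OF 1 2] by simp
    qed
    have y2: "y\<^sup>2 > 0" using y by simp
    have "inverse (1 + ((s - x) / y)\<^sup>2) * (1 / y) = y / ((s - x)\<^sup>2 + y\<^sup>2)"
      using y by (simp add: power_divide field_simps power2_eq_square)
    moreover have "y / (C * N\<^sup>2) \<le> y / ((s - x)\<^sup>2 + y\<^sup>2)"
      using 3 y y2 C N by (intro divide_left_mono) (auto intro!: mult_pos_pos add_nonneg_pos)
    ultimately have "2 * a * Im w * (y / (C * N\<^sup>2)) \<le> 2 * a * Im w * (inverse (1 + ((s - x) / y)\<^sup>2) * (1 / y))"
      using a w(1) by (intro mult_left_mono) auto
    also have "\<dots> = \<theta> (Re w + a * Im w) - \<theta> (Re w - a * Im w)" unfolding s(3) by simp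
    finally have "2 * a * Im w * (y / (C * N\<^sup>2)) \<le> \<theta> (Re w + a * Im w) - \<theta> (Re w - a * Im w)" .
    then have "C / a * (2 * a * Im w * (y / (C * N\<^sup>2))) \<le> C / a * (\<theta> (Re w + a * Im w) - \<theta> (Re w - a * Im w))"
      using C a by (intro mult_left_mono) auto
    moreover have "C / a * (2 * a * Im w * (y / (C * N\<^sup>2))) = 2 * Im z * Im w / N\<^sup>2"
      using C a N by (simp add: y_def field_simps)
    moreover have "green w z \<le> 2 * Im z * Im w / N\<^sup>2"
      using green_bounds(1)[OF z w(1)] N by (auto simp: N_def)
    ultimately show ?thesis by (simp add: w_def)
  qed
  then have "(\<Sum>j\<in>F. green (c j) z) \<le> (\<Sum>j\<in>F. C / a * (\<theta> (Re (c j) + a * Im (c j)) - \<theta> (Re (c j) - a * Im (c j))))"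
    by (rule sum_mono)
  also have "\<dots> = C / a * (\<Sum>j\<in>F. \<theta> (Re (c j) + a * Im (c j)) - \<theta> (Re (c j) - a * Im (c j)))"
    by (rule sum_distrib_left[symmetric])
  also have "\<dots> \<le> C / a * pi"
    unfolding \<theta>_def using C a c y by (intro mult_left_mono arctan_increments_sum_le F disj) auto
  finally show ?thesis by (simp add: C_def)
qed

text \<open>The cells are half-open so that neighbours are disjoint and their lengths add
  up.\<close>

lemma card_cells_le:
  assumes "finite X" "0 < \<eta>" "\<And>i. i \<in> X \<Longrightarrow> {of_int i * \<eta>..<(of_int i + 1) * \<eta>} \<subseteq> V" "V \<in> lmeasurable"
  shows "real (card X) * \<eta> \<le> measure lebesgue V"
proof -
  let ?I = "\<lambda>i::int. {of_int i * \<eta>..<(of_int i + 1) * \<eta>}"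
  have "pairwise (\<lambda>i j. disjnt (?I i) (?I j)) X"
  proof (rule pairwiseI)
    fix i j :: int assume "i \<noteq> j"
    have *: "?I i \<inter> ?I j = {}" if "i < j" for i j :: int
    proof -
      have "(of_int i + 1 :: real) \<le> of_int j" using that by linarith
      then have "(of_int i + 1) * \<eta> \<le> of_int j * \<eta>" using assms(2) by (intro mult_right_mono) auto
      then show ?thesis by auto
    qed
    show "disjnt (?I i) (?I j)"
      using *[of i j] *[of j i] \<open>i \<noteq> j\<close> by (cases "i < j") (auto simp: disjnt_def)
  qed
  moreover have Im: "?I i \<in> lmeasurable" for i
    by (rule fmeasurableI2[of "{of_int i * \<eta>..(of_int i + 1) * \<eta>}"]) (auto simp: lmeasurable_compact)
  ultimately have "measure lebesgue (\<Union>i\<in>X. ?I i) = (\<Sum>i\<in>X. measure lebesgue (?I i))"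
    using assms(1) by (intro measure_UNION') auto
  also have "\<dots> = (\<Sum>i\<in>X. \<eta>)"
    using assms(2) by (intro sum.cong) (auto simp: distrib_right)
  also have "\<dots> = real (card X) * \<eta>" by simp
  finally have "real (card X) * \<eta> = measure lebesgue (\<Union>i\<in>X. ?I i)" by simp
  also have "\<dots> \<le> measure lebesgue V"
    using assms Im by (intro measure_mono_fmeasurable sets.finite_UN UN_least) (auto simp: fmeasurableD)
  finally show ?thesis .
qed

lemma pois_nonneg: "0 < Im z \<Longrightarrow> 0 \<le> pois t z"
  by (simp add: pois_def)

lemma locally_Re_holo_pois: "locally_Re_holo {z. 0 < Im z} (pois t)"
proof -
  have "locally_Re_holo {z. 0 < Im z} (\<lambda>z. Re (\<i> / (z - of_real t)))"
    by (rule locally_Re_holo_Re) (auto intro!: holomorphic_intros simp: open_halfspace_Im_gt)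
  moreover have "(\<lambda>z. Re (\<i> / (z - of_real t))) = pois t"
    by (simp add: pois_def fun_eq_iff Re_divide)
  ultimately show ?thesis by simp
qed

lemma locally_Re_holo_green:
  assumes "0 < Im w"
  shows "locally_Re_holo ({z. 0 < Im z} - {w}) (green w)"
proof -
  have "open ({z. 0 < Im z} - {w})" by (simp add: open_Diff open_halfspace_Im_gt)
  moreover have "z - cnj w \<noteq> 0" if "0 < Im z" for z
    using that assms by (auto simp: complex_eq_iff)
  ultimately show ?thesis
    unfolding green_def [abs_def]
    by (intro locally_Re_holo_ln_norm) (auto intro!: holomorphic_intros)
qed

section \<open>Comparison with Green functions on a sawtooth region\<close>

locale sawtooth =
  fixes E :: "real set" and x0 l m :: real
  assumes m: "0 < m" and l: "0 < l" and E: "E \<subseteq> cball x0 l"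
begin

definition region :: "complex set" where
  "region = {z. 0 < Im z \<and> Im z < l \<and> (\<exists>x\<in>E. \<bar>Re z - x\<bar> < m * Im z)}"

text \<open>Large enough for the shadow of every point of the closure of the region below height
  \<open>l\<close>: the abscissa deviates from \<open>x0\<close> by at most
  \<open>l + m * l\<close>, and the shadow adds at most \<open>m * l\<close>.\<close>

definition wd :: real where "wd = (2 + 2 * m) * l"

definition cells :: "real \<Rightarrow> int set" where
  "cells \<eta> = {i. {of_int i * \<eta>..(of_int i + 1) * \<eta>} \<subseteq> {x0 - wd..x0 + wd} \<and>
     {of_int i * \<eta>..(of_int i + 1) * \<eta>} \<inter> E = {}}"

text \<open>A Riemann sum for \<open>\<pi>\<close> times the harmonic measure of the complement of E.\<close>
definition barrier :: "real \<Rightarrow> complex \<Rightarrow> real" where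
  "barrier \<eta> z = (\<Sum>i\<in>cells \<eta>. \<eta> * pois (of_int i * \<eta>) z)"

lemma finite_cells: assumes "0 < \<eta>" shows "finite (cells \<eta>)"
proof (rule finite_subset)
  show "cells \<eta> \<subseteq> {\<lfloor>(x0 - wd) / \<eta>\<rfloor>..\<lceil>(x0 + wd) / \<eta>\<rceil>}"
  proof
    fix i assume "i \<in> cells \<eta>"
    then have "{of_int i * \<eta>..(of_int i + 1) * \<eta>} \<subseteq> {x0 - wd..x0 + wd}" by (simp add: cells_def)
    moreover have "of_int i * \<eta> \<in> {of_int i * \<eta>..(of_int i + 1) * \<eta>}" using assms by simp
    ultimately have "of_int i * \<eta> \<in> {x0 - wd..x0 + wd}" by (rule subsetD)
    then have "(x0 - wd) / \<eta> \<le> of_int i" "of_int i \<le> (x0 + wd) / \<eta>"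
      using assms by (simp_all add: pos_divide_le_eq pos_le_divide_eq)
    then show "i \<in> {\<lfloor>(x0 - wd) / \<eta>\<rfloor>..\<lceil>(x0 + wd) / \<eta>\<rceil>}"
      unfolding atLeastAtMost_iff by linarith
  qed
qed simp

lemma open_region: "open region"
proof -
  have "region = (\<Union>x\<in>E. {z. 0 < Im z} \<inter> {z. Im z < l} \<inter> {z. \<bar>Re z - x\<bar> < m * Im z})"
    by (auto simp: region_def)
  moreover have "open {z. \<bar>Re z - x\<bar> < m * Im z}" for x
    by (intro open_Collect_less continuous_intros)
  ultimately show ?thesis
    by (auto intro!: open_UN open_Int simp: open_halfspace_Im_gt open_halfspace_Im_lt)
qed

lemma region_Re: assumes "z \<in> region" shows "\<bar>Re z - x0\<bar> \<le> l + m * l"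
proof -
  obtain x where x: "x \<in> E" "\<bar>Re z - x\<bar> < m * Im z" "Im z < l" using assms by (auto simp: region_def)
  moreover have "\<bar>x - x0\<bar> \<le> l" using E x(1) by (auto simp: dist_real_def)
  moreover have "m * Im z \<le> m * l" using x(3) m by (intro mult_left_mono) auto
  ultimately show ?thesis by linarith
qed

lemma bounded_region: "bounded region"
proof (rule bounded_subset[of "cbox (Complex (x0 - (l + m * l)) 0) (Complex (x0 + (l + m * l)) l)"])
  show "region \<subseteq> cbox (Complex (x0 - (l + m * l)) 0) (Complex (x0 + (l + m * l)) l)"
  proof
    fix z assume z: "z \<in> region"
    then show "z \<in> cbox (Complex (x0 - (l + m * l)) 0) (Complex (x0 + (l + m * l)) l)"
      using region_Re[OF z] by (auto simp: region_def in_cbox_complex_iff)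
  qed
qed simp

lemma barrier_nonneg: "0 < \<eta> \<Longrightarrow> 0 < Im z \<Longrightarrow> 0 \<le> barrier \<eta> z"
  unfolding barrier_def by (intro sum_nonneg mult_nonneg_nonneg pois_nonneg) auto

text \<open>If the shadow of \<open>z\<close> misses \<open>E\<close>, all cells inside it are
  counted. There are nearly 2 m y / \<eta> of them, each with a term of at least \<eta> / ((1 + m^2)
  y), where y is \<open>Im z\<close>; the mesh condition limits the loss at the ends to half of the
  total.\<close>

lemma barrier_lower:
  assumes y: "0 < Im z" and \<eta>: "0 < \<eta>" "\<eta> \<le> m * Im z / 2"
    and tent: "{Re z - m * Im z<..<Re z + m * Im z} \<inter> E = {}"
    and inw: "\<bar>Re z - x0\<bar> + m * Im z \<le> wd"
  shows "m / (1 + m\<^sup>2) \<le> barrier \<eta> z"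
proof -
  define x y where "x = Re z" and "y = Im z"
  have ypos: "y > 0" using y by (simp add: y_def)
  \<comment> \<open>The rounding at the two ends of the shadow loses at most two cells altogether,
    as \<open>card\<close> records.\<close>
  define X where "X = {\<lfloor>(x - m * y) / \<eta>\<rfloor> + 1..\<lceil>(x + m * y) / \<eta>\<rceil> - 2}"
  have XI: "{of_int i * \<eta>..(of_int i + 1) * \<eta>} \<subseteq> {x - m * y<..<x + m * y}" if "i \<in> X" for i
  proof -
    have "(x - m * y) / \<eta> < of_int i" "of_int i + 1 < (x + m * y) / \<eta>"
      using that unfolding X_def by (auto simp: floor_less_iff less_ceiling_iff) linarith+
    then have "x - m * y < of_int i * \<eta>" "(of_int i + 1) * \<eta> < x + m * y" using \<eta>(1) by (simp_all add: field_simps)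
    then show ?thesis by auto
  qed
  have XC: "X \<subseteq> cells \<eta>"
  proof
    fix i assume "i \<in> X"
    note XI[OF this]
    moreover have "{x - m * y<..<x + m * y} \<subseteq> {x0 - wd..x0 + wd}" using inw by (auto simp: x_def y_def)
    ultimately show "i \<in> cells \<eta>" using tent unfolding cells_def x_def y_def by blast
  qed
  have card: "2 * (m * y) / \<eta> - 2 \<le> real (card X)"
  proof -
    have "(x + m * y) / \<eta> - 2 - (x - m * y) / \<eta> \<le> of_int (\<lceil>(x + m * y) / \<eta>\<rceil> - 2 - \<lfloor>(x - m * y) / \<eta>\<rfloor>)"
      by simp linarith
    also have "\<dots> \<le> real (nat (\<lceil>(x + m * y) / \<eta>\<rceil> - 2 - \<lfloor>(x - m * y) / \<eta>\<rfloor>))" by linarith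
    also have "nat (\<lceil>(x + m * y) / \<eta>\<rceil> - 2 - \<lfloor>(x - m * y) / \<eta>\<rfloor>) = card X" by (simp add: X_def)
    finally show ?thesis by (simp add: add_divide_distrib diff_divide_distrib)
  qed
  have trm: "\<eta> / ((1 + m\<^sup>2) * y) \<le> \<eta> * pois (of_int i * \<eta>) z" if "i \<in> X" for i
  proof -
    have "of_int i * \<eta> \<in> {x - m * y<..<x + m * y}" by (rule subsetD[OF XI[OF that]]) (use \<eta>(1) in simp)
    then have "\<bar>x - of_int i * \<eta>\<bar> \<le> m * y" by auto
    then have "(x - of_int i * \<eta>)\<^sup>2 \<le> (m * y)\<^sup>2" by (metis abs_ge_zero power2_abs power_mono)
    then have "(x - of_int i * \<eta>)\<^sup>2 + y\<^sup>2 \<le> (1 + m\<^sup>2) * y\<^sup>2" by (simp add: power_mult_distrib algebra_simps)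
    then have "y / ((1 + m\<^sup>2) * y\<^sup>2) \<le> y / ((x - of_int i * \<eta>)\<^sup>2 + y\<^sup>2)"
    proof (rule divide_left_mono)
      have "(x - of_int i * \<eta>)\<^sup>2 + y\<^sup>2 > 0" using ypos by (simp add: add_nonneg_pos)
      moreover have "(1 + m\<^sup>2) * y\<^sup>2 > 0" using ypos by (simp add: add_pos_nonneg)
      ultimately show "0 < (1 + m\<^sup>2) * y\<^sup>2 * ((x - of_int i * \<eta>)\<^sup>2 + y\<^sup>2)" by (rule mult_pos_pos[rotated])
    qed (use ypos in auto)
    moreover have "y / ((1 + m\<^sup>2) * y\<^sup>2) = 1 / ((1 + m\<^sup>2) * y)" using ypos by (simp add: power2_eq_square)
    ultimately have "1 / ((1 + m\<^sup>2) * y) \<le> pois (of_int i * \<eta>) z" by (simp add: pois_def x_def y_def)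
    from mult_left_mono[OF this, of \<eta>] \<eta>(1) show ?thesis by simp
  qed
  have p1: "(1 + m\<^sup>2) * y > 0" using ypos by (simp add: add_pos_nonneg)
  have "m * y / ((1 + m\<^sup>2) * y) \<le> (2 * (m * y) - 2 * \<eta>) / ((1 + m\<^sup>2) * y)"
    using \<eta>(2) p1 by (intro divide_right_mono) (auto simp: y_def)
  also have "2 * (m * y) - 2 * \<eta> = (2 * (m * y) / \<eta> - 2) * \<eta>" using \<eta>(1) by (simp add: left_diff_distrib)
  also have "\<dots> / ((1 + m\<^sup>2) * y) = (2 * (m * y) / \<eta> - 2) * (\<eta> / ((1 + m\<^sup>2) * y))" by simp
  also have "\<dots> \<le> real (card X) * (\<eta> / ((1 + m\<^sup>2) * y))" using card p1 \<eta>(1) by (intro mult_right_mono) auto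
  also have "\<dots> = (\<Sum>i\<in>X. \<eta> / ((1 + m\<^sup>2) * y))" by simp
  also have "\<dots> \<le> (\<Sum>i\<in>X. \<eta> * pois (of_int i * \<eta>) z)" by (rule sum_mono) (rule trm)
  also have "\<dots> \<le> barrier \<eta> z"
    unfolding barrier_def using XC finite_cells[OF \<eta>(1)] y \<eta>(1)
    by (intro sum_mono2) (auto intro!: mult_nonneg_nonneg pois_nonneg)
  finally show ?thesis using ypos by simp
qed

text \<open>Cells inside \<open>cball x0 l\<close> have total length at most that of the gaps of
  \<open>E\<close>, and there \<open>pois\<close> is at most 1 / Im z. All other cells are at
  horizontal distance at least l - l/4 - l/4 = l/2 from \<open>z\<close>, and their total length is
  at most \<open>2 * wd\<close>.\<close>

lemma barrier_upper:
  assumes y: "0 < Im z" and x: "\<bar>Re z - x0\<bar> \<le> l / 4" and \<eta>: "0 < \<eta>" "\<eta> \<le> l / 4" and Em: "E \<in> sets lebesgue"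
  shows "barrier \<eta> z \<le> measure lebesgue (cball x0 l - E) / Im z + 8 * (2 + 2 * m) * Im z / l"
proof -
  define P where "P = {i \<in> cells \<eta>. {of_int i * \<eta>..(of_int i + 1) * \<eta>} \<subseteq> cball x0 l}"
  define Q where "Q = cells \<eta> - P"
  have fin: "finite (cells \<eta>)" by (rule finite_cells[OF \<eta>(1)])
  then have fP: "finite P" "finite Q" by (auto simp: P_def Q_def)
  have le: "{of_int i * \<eta>..<(of_int i + 1) * \<eta>} \<subseteq> {of_int i * \<eta>..(of_int i + 1) * \<eta>}" for i :: int by auto
  have "cball x0 l - E \<in> lmeasurable" using Em by (intro fmeasurable_Diff) auto
  then have cP: "real (card P) * \<eta> \<le> measure lebesgue (cball x0 l - E)"
  proof (rule card_cells_le[rotated 3, OF _ fP(1) \<eta>(1)])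
    fix i assume "i \<in> P"
    then show "{of_int i * \<eta>..<(of_int i + 1) * \<eta>} \<subseteq> cball x0 l - E"
      using le[of i] unfolding P_def cells_def by blast
  qed
  have "real (card Q) * \<eta> \<le> measure lebesgue {x0 - wd..x0 + wd}"
  proof (rule card_cells_le[OF fP(2) \<eta>(1)])
    fix i assume "i \<in> Q"
    then show "{of_int i * \<eta>..<(of_int i + 1) * \<eta>} \<subseteq> {x0 - wd..x0 + wd}"
      using le[of i] by (auto simp: Q_def cells_def)
  qed (simp add: lmeasurable_compact)
  also have "\<dots> = 2 * wd" using l m by (simp add: wd_def)
  finally have cQ: "real (card Q) * \<eta> \<le> 2 * wd" .
  have tP: "\<eta> * pois (of_int i * \<eta>) z \<le> \<eta> / Im z" for i :: int
  proof -
    have "Im z / ((Re z - of_int i * \<eta>)\<^sup>2 + (Im z)\<^sup>2) \<le> Im z / (Im z)\<^sup>2"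
      using y by (intro divide_left_mono) (auto intro!: mult_pos_pos add_nonneg_pos)
    also have "\<dots> = 1 / Im z" using y by (simp add: power2_eq_square)
    finally have "pois (of_int i * \<eta>) z \<le> 1 / Im z" by (simp add: pois_def)
    from mult_left_mono[OF this, of \<eta>] show ?thesis using \<eta>(1) by simp
  qed
  have tQ: "\<eta> * pois (of_int i * \<eta>) z \<le> \<eta> * (4 * Im z / l\<^sup>2)" if i: "i \<in> Q" for i
  proof -
    have e: "(of_int i + 1) * \<eta> = of_int i * \<eta> + \<eta>" by (simp add: distrib_right)
    have "\<not> {of_int i * \<eta>..(of_int i + 1) * \<eta>} \<subseteq> {x0 - l..x0 + l}"
      using i by (auto simp: Q_def P_def cball_eq_atLeastAtMost)
    then have "of_int i * \<eta> < x0 - l \<or> x0 + l < (of_int i + 1) * \<eta>" by auto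
    then have "l / 2 \<le> \<bar>Re z - of_int i * \<eta>\<bar>" using x \<eta>(2) unfolding e by linarith
    then have "(l / 2)\<^sup>2 \<le> (Re z - of_int i * \<eta>)\<^sup>2" using l by (metis abs_le_square_iff abs_of_nonneg divide_nonneg_pos less_imp_le zero_less_numeral)
    then have "Im z / ((Re z - of_int i * \<eta>)\<^sup>2 + (Im z)\<^sup>2) \<le> Im z / (l / 2)\<^sup>2"
      using y l by (intro divide_left_mono) (auto intro!: mult_pos_pos add_nonneg_pos add_increasing2)
    also have "\<dots> = 4 * Im z / l\<^sup>2" by (simp add: power2_eq_square)
    finally show ?thesis using \<eta>(1) by (intro mult_left_mono) (auto simp: pois_def)
  qed
  have "barrier \<eta> z = (\<Sum>i\<in>P. \<eta> * pois (of_int i * \<eta>) z) + (\<Sum>i\<in>Q. \<eta> * pois (of_int i * \<eta>) z)"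
    unfolding barrier_def Q_def using fin by (subst sum.subset_diff[of P "cells \<eta>"]) (auto simp: P_def)
  also have "\<dots> \<le> (\<Sum>i\<in>P. \<eta> / Im z) + (\<Sum>i\<in>Q. \<eta> * (4 * Im z / l\<^sup>2))"
    using tP tQ by (intro add_mono sum_mono) auto
  also have "\<dots> = (real (card P) * \<eta>) / Im z + (real (card Q) * \<eta>) * (4 * Im z / l\<^sup>2)" by simp
  also have "\<dots> \<le> measure lebesgue (cball x0 l - E) / Im z + (2 * wd) * (4 * Im z / l\<^sup>2)"
    using cP cQ y by (intro add_mono divide_right_mono mult_right_mono) auto
  also have "(2 * wd) * (4 * Im z / l\<^sup>2) = 8 * (2 + 2 * m) * Im z / l"
    using l by (simp add: wd_def power2_eq_square)
  finally show ?thesis .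
qed

text \<open>The maximum principle is applied on the region without discs around the poles, where the
  sum of the Green functions is at most \<open>C0\<close>. Each part of the boundary has its own
  term that dominates this constant: \<open>h\<close> on the circles, \<open>Im\<close> at the top,
  the barrier on the sloping sides. Close to the real axis the sum itself is at most
  \<open>e\<close>, so the barrier is needed only above a fixed height, and this height limits the
  mesh.\<close>

lemma comparison:
  fixes c :: "'a \<Rightarrow> complex"
  assumes h: "locally_Re_holo region h" "\<And>z. z \<in> region \<Longrightarrow> 0 \<le> h z"
    and F: "finite F" and c: "\<And>j. j \<in> F \<Longrightarrow> 0 < Im (c j)" and a: "0 < a" and \<rho>: "0 < \<rho>"
    and disj: "\<And>i j. i \<in> F \<Longrightarrow> j \<in> F \<Longrightarrow> i \<noteq> j \<Longrightarrow>
      {Re (c i) - a * Im (c i)<..<Re (c i) + a * Im (c i)} \<inter> {Re (c j) - a * Im (c j)<..<Re (c j) + a * Im (c j)} = {}"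
    and big: "\<And>j z. j \<in> F \<Longrightarrow> z \<in> region \<Longrightarrow> dist z (c j) < 2 * \<rho> * Im (c j) \<Longrightarrow> K \<le> h z" and K: "0 < K"
    and p: "p \<in> region" "\<And>j. j \<in> F \<Longrightarrow> \<rho> * Im (c j) < dist p (c j)"
    and e: "0 < e" and C0: "C0 = ((1 + a / \<rho>)\<^sup>2 + (1 + 1 / \<rho>)\<^sup>2) / a * pi"
  shows "\<exists>\<eta>0>0. \<forall>\<eta>. 0 < \<eta> \<and> \<eta> < \<eta>0 \<longrightarrow>
     (\<Sum>j\<in>F. green (c j) p) \<le> C0 * (1 + m\<^sup>2) / m * barrier \<eta> p + C0 / l * Im p + C0 / K * h p + e"
proof -
  have C0pos: "C0 > 0" unfolding C0
  proof -
    have "1 + a / \<rho> > 0" using a \<rho> by (simp add: add_pos_pos)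
    then show "((1 + a / \<rho>)\<^sup>2 + (1 + 1 / \<rho>)\<^sup>2) / a * pi > 0" using a by (simp add: add_pos_nonneg)
  qed
  \<comment> \<open>Near the real axis \<open>green (c j) z\<close> is at most
    \<open>Im z * (8 / Im (c j))\<close>, hence the whole sum is at most \<open>y0 * s\<close> below
    height \<open>y0\<close>. The bound \<open>y0 * s \<le> 1\<close> ensures that \<open>y0\<close>
    is at most an eighth of the height of every pole.\<close>
  define s where "s = (\<Sum>j\<in>F. 8 / Im (c j))"
  have s0: "s \<ge> 0" unfolding s_def using c by (intro sum_nonneg) (auto simp: less_imp_le)
  have sj: "8 / Im (c j) \<le> s" if "j \<in> F" for j
    unfolding s_def using F that c by (intro member_le_sum) (auto simp: less_imp_le)
  define y0 where "y0 = min (e / (1 + s)) (1 / (1 + s))"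
  have y0: "y0 > 0" "y0 * s \<le> e" "y0 * s \<le> 1"
  proof -
    show "y0 > 0" using e s0 by (simp add: y0_def)
    have "y0 * s \<le> e / (1 + s) * s" "y0 * s \<le> 1 / (1 + s) * s"
      unfolding y0_def using s0 by (intro mult_right_mono min.cobounded1 min.cobounded2; simp)+
    moreover have "e / (1 + s) * s \<le> e" "1 / (1 + s) * s \<le> 1" using s0 e by (simp_all add: field_simps)
    ultimately show "y0 * s \<le> e" "y0 * s \<le> 1" by linarith+
  qed
  have small: "(\<Sum>j\<in>F. green (c j) z) \<le> e" if z: "0 < Im z" "Im z \<le> y0" for z
  proof -
    have "green (c j) z \<le> y0 * (8 / Im (c j))" if j: "j \<in> F" for j
    proof -
      define w where "w = c j"
      have w: "0 < Im w" using c[OF j] by (simp add: w_def)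
      have "y0 * (8 / Im w) \<le> y0 * s" using sj[OF j] y0(1) by (intro mult_left_mono) (auto simp: w_def)
      then have "y0 * (8 / Im w) \<le> 1" using y0(3) by linarith
      then have "y0 * 8 \<le> Im w" using w by (simp add: pos_divide_le_eq)
      then have hw: "Im w / 2 \<le> Im w - Im z" using z by linarith
      also have "\<dots> \<le> norm (z - w)" using abs_Im_le_cmod[of "z - w"] by simp
      finally have "Im w / 2 \<le> norm (z - w)" .
      then have n2: "(Im w / 2)\<^sup>2 \<le> (norm (z - w))\<^sup>2" using w by (intro power_mono) auto
      have "z \<noteq> w" using hw w by auto
      then have "green w z \<le> 2 * Im z * Im w / (norm (z - w))\<^sup>2" by (rule green_bounds(1)[OF z(1) w])
      also have "\<dots> \<le> 2 * Im z * Im w / (Im w / 2)\<^sup>2"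
        using n2 w z \<open>z \<noteq> w\<close> by (intro divide_left_mono) (auto intro!: mult_pos_pos)
      also have "\<dots> = Im z * (8 / Im w)" using w by (simp add: power2_eq_square)
      also have "\<dots> \<le> y0 * (8 / Im w)" using z w by (intro mult_right_mono) auto
      finally show ?thesis by (simp add: w_def)
    qed
    then have "(\<Sum>j\<in>F. green (c j) z) \<le> (\<Sum>j\<in>F. y0 * (8 / Im (c j)))" by (rule sum_mono)
    also have "\<dots> = y0 * s" by (simp add: s_def sum_distrib_left)
    finally show ?thesis using y0(2) by linarith
  qed
  have "(\<Sum>j\<in>F. green (c j) p) \<le> C0 * (1 + m\<^sup>2) / m * barrier \<eta> p + C0 / l * Im p + C0 / K * h p + e"
    if \<eta>: "0 < \<eta>" "\<eta> < m * y0 / 2" for \<eta>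
  proof -
    define C1 where "C1 = C0 * (1 + m\<^sup>2) / m"
    have C1: "C1 > 0" unfolding C1_def using C0pos m by (auto intro!: divide_pos_pos mult_pos_pos add_pos_nonneg)
    define \<Omega> where "\<Omega> = region - (\<Union>j\<in>F. cball (c j) (\<rho> * Im (c j)))"
    define U where "U z = (\<Sum>j\<in>F. green (c j) z) + (- C1) * barrier \<eta> z + (- (C0 / l)) * Im z + (- (C0 / K)) * h z" for z
    have \<Omega>r: "\<Omega> \<subseteq> region" by (auto simp: \<Omega>_def)
    have pos: "0 < Im z" "Im z < l" if "z \<in> region" for z using that by (auto simp: region_def)
    have "open \<Omega>" unfolding \<Omega>_def using open_region F by (intro open_Diff closed_UN) auto
    moreover have "bounded \<Omega>" using bounded_region \<Omega>r bounded_subset by blast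
    moreover have "locally_Re_holo \<Omega> U"
      unfolding U_def
    proof (intro locally_Re_holo_add locally_Re_holo_cmult locally_Re_holo_sum)
      show "locally_Re_holo \<Omega> (green (c j))" if "j \<in> F" for j
        using locally_Re_holo_green[OF c[OF that]]
      proof (rule locally_Re_holo_subset)
        have "c j \<in> cball (c j) (\<rho> * Im (c j))" using c[OF that] \<rho> by simp
        then show "\<Omega> \<subseteq> {z. 0 < Im z} - {c j}" using that pos(1) unfolding \<Omega>_def by blast
      qed
      show "locally_Re_holo \<Omega> (barrier \<eta>)"
        unfolding barrier_def
        by (intro locally_Re_holo_sum locally_Re_holo_cmult locally_Re_holo_subset[OF locally_Re_holo_pois])
          (use \<Omega>r pos in auto)
      have "locally_Re_holo \<Omega> (\<lambda>z. Re (- \<i> * z))"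
        using \<open>open \<Omega>\<close> by (intro locally_Re_holo_Re holomorphic_intros)
      then show "locally_Re_holo \<Omega> Im" by simp
      show "locally_Re_holo \<Omega> h" using locally_Re_holo_subset[OF h(1) \<Omega>r] .
    qed
    moreover have "\<exists>d>0. \<forall>z\<in>\<Omega>. dist z \<zeta> < d \<longrightarrow> U z \<le> e + e'" if \<zeta>: "\<zeta> \<in> closure \<Omega> - \<Omega>" and e': "0 < e'" for \<zeta> e'
    proof -
      have gs: "(\<Sum>j\<in>F. green (c j) z) \<le> C0" if z: "z \<in> \<Omega>" for z
        unfolding C0
      proof (rule green_sum_le[OF F c a \<rho> _ _ disj])
        show "0 < Im z" using z \<Omega>r pos by blast
        show "\<rho> * Im (c j) \<le> norm (z - c j)" if "j \<in> F" for j
          using z that by (auto simp: \<Omega>_def dist_norm norm_minus_commute)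
      qed
      have b0: "0 \<le> C1 * barrier \<eta> z" "0 \<le> C0 / l * Im z" "0 \<le> C0 / K * h z" if z: "z \<in> \<Omega>" for z
        using z \<Omega>r pos h(2) C1 C0pos l K barrier_nonneg[OF \<eta>(1)]
        by (auto intro!: mult_nonneg_nonneg simp: less_imp_le subset_iff)
      have U: "U z \<le> e + e'" if z: "z \<in> \<Omega>" and "(\<Sum>j\<in>F. green (c j) z) \<le> e + e' + C1 * barrier \<eta> z \<or>
         (\<Sum>j\<in>F. green (c j) z) \<le> e + e' + C0 / l * Im z \<or> (\<Sum>j\<in>F. green (c j) z) \<le> e + e' + C0 / K * h z" for z
        using that(2) b0[OF z] unfolding U_def by argo
      consider "Im \<zeta> < y0" | j where "j \<in> F" "dist \<zeta> (c j) \<le> \<rho> * Im (c j)" | "l \<le> Im \<zeta>"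
        | "y0 \<le> Im \<zeta>" "Im \<zeta> < l" "\<And>j. j \<in> F \<Longrightarrow> \<rho> * Im (c j) < dist \<zeta> (c j)"
        by (meson not_le)
      then show ?thesis
      proof cases
        case 1
        show ?thesis
        proof (intro exI[of _ "y0 - Im \<zeta>"] conjI ballI impI U)
          fix z assume z: "z \<in> \<Omega>" "dist z \<zeta> < y0 - Im \<zeta>"
          then have "Im z \<le> y0" using abs_Im_le_cmod[of "z - \<zeta>"] by (simp add: dist_norm)
          then have "(\<Sum>j\<in>F. green (c j) z) \<le> e" using small z \<Omega>r pos by blast
          then show "(\<Sum>j\<in>F. green (c j) z) \<le> e + e' + C1 * barrier \<eta> z \<or>
             (\<Sum>j\<in>F. green (c j) z) \<le> e + e' + C0 / l * Im z \<or> (\<Sum>j\<in>F. green (c j) z) \<le> e + e' + C0 / K * h z"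
            using b0(1)[OF z(1)] e' by linarith
        qed (use 1 in auto)
      next
        case 2
        have cj: "0 < \<rho> * Im (c j)" using c[OF 2(1)] \<rho> by simp
        show ?thesis
        proof (intro exI[of _ "\<rho> * Im (c j)"] conjI ballI impI U)
          fix z assume z: "z \<in> \<Omega>" "dist z \<zeta> < \<rho> * Im (c j)"
          then have "dist z (c j) < 2 * \<rho> * Im (c j)" using 2(2) dist_triangle[of z "c j" \<zeta>] by linarith
          then have "K \<le> h z" using big 2(1) z \<Omega>r by blast
          then have "C0 / K * K \<le> C0 / K * h z" using C0pos K by (intro mult_left_mono) auto
          then have "C0 \<le> C0 / K * h z" using K by simp
          then show "(\<Sum>j\<in>F. green (c j) z) \<le> e + e' + C1 * barrier \<eta> z \<or>
             (\<Sum>j\<in>F. green (c j) z) \<le> e + e' + C0 / l * Im z \<or> (\<Sum>j\<in>F. green (c j) z) \<le> e + e' + C0 / K * h z"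
            using gs[OF z(1)] e e' by linarith
        qed (use cj in auto)
      next
        case 3
        show ?thesis
        proof (intro exI[of _ "e' * l / C0"] conjI ballI impI U)
          fix z assume z: "z \<in> \<Omega>" "dist z \<zeta> < e' * l / C0"
          then have "l - e' * l / C0 \<le> Im z" using 3 abs_Im_le_cmod[of "z - \<zeta>"] by (simp add: dist_norm)
          then have "C0 / l * (l - e' * l / C0) \<le> C0 / l * Im z" using C0pos l by (intro mult_left_mono) auto
          moreover have "C0 / l * (l - e' * l / C0) = C0 - e'" using C0pos l by (simp add: right_diff_distrib)
          ultimately show "(\<Sum>j\<in>F. green (c j) z) \<le> e + e' + C1 * barrier \<eta> z \<or>
             (\<Sum>j\<in>F. green (c j) z) \<le> e + e' + C0 / l * Im z \<or> (\<Sum>j\<in>F. green (c j) z) \<le> e + e' + C0 / K * h z"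
            using gs[OF z(1)] e e' by linarith
        qed (use e' l C0pos in auto)
      next
        case 4
        have \<zeta>pos: "0 < Im \<zeta>" using 4 y0 by linarith
        \<comment> \<open>Away from the discs and below the top, a boundary point of
          \<open>\<Omega>\<close> lies outside the open region, so its shadow contains no point of
          \<open>E\<close> and the barrier is bounded below there.\<close>
        have "\<zeta> \<notin> region" using \<zeta> 4(3) by (force simp: \<Omega>_def dist_commute)
        then have nt: "{Re \<zeta> - m * Im \<zeta><..<Re \<zeta> + m * Im \<zeta>} \<inter> E = {}"
          using \<zeta>pos 4(2) by (auto simp: region_def abs_less_iff)
        have "closure \<Omega> \<subseteq> {z. \<bar>Re z - x0\<bar> \<le> l + m * l}"
          using \<Omega>r region_Re by (intro closure_minimal closed_Collect_le continuous_intros) auto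
        then have "\<bar>Re \<zeta> - x0\<bar> \<le> l + m * l" using \<zeta> by auto
        moreover have "m * Im \<zeta> \<le> m * l" using 4(2) m by (intro mult_left_mono) auto
        ultimately have inw: "\<bar>Re \<zeta> - x0\<bar> + m * Im \<zeta> \<le> wd" using l by (simp add: wd_def algebra_simps)
        have "m * y0 \<le> m * Im \<zeta>" using 4(1) m by (intro mult_left_mono) auto
        then have "m / (1 + m\<^sup>2) \<le> barrier \<eta> \<zeta>" using \<eta> by (intro barrier_lower[OF \<zeta>pos _ _ nt inw]) auto
        then have "C1 * (m / (1 + m\<^sup>2)) \<le> C1 * barrier \<eta> \<zeta>" using C1 by (intro mult_left_mono) auto
        moreover have "C1 * (m / (1 + m\<^sup>2)) = C0" using m by (simp add: C1_def add_pos_nonneg less_imp_neq[symmetric])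
        ultimately have B\<zeta>: "C0 \<le> C1 * barrier \<eta> \<zeta>" by simp
        have "locally_Re_holo {z. 0 < Im z} (barrier \<eta>)"
          unfolding barrier_def by (intro locally_Re_holo_sum locally_Re_holo_cmult locally_Re_holo_pois)
        then have "isCont (barrier \<eta>) \<zeta>" using \<zeta>pos by (intro locally_Re_holo_continuous) auto
        then have "isCont (\<lambda>z. C1 * barrier \<eta> z) \<zeta>" by (intro continuous_intros)
        then obtain d where d: "d > 0" "\<And>z. dist z \<zeta> < d \<Longrightarrow> dist (C1 * barrier \<eta> z) (C1 * barrier \<eta> \<zeta>) < e'"
          using e' unfolding continuous_at_eps_delta by blast
        show ?thesis
        proof (intro exI[of _ d] conjI ballI impI U d(1))
          fix z assume z: "z \<in> \<Omega>" "dist z \<zeta> < d"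
          have "C1 * barrier \<eta> \<zeta> - e' \<le> C1 * barrier \<eta> z" using d(2)[OF z(2)] by (simp add: dist_real_def)
          then show "(\<Sum>j\<in>F. green (c j) z) \<le> e + e' + C1 * barrier \<eta> z \<or>
             (\<Sum>j\<in>F. green (c j) z) \<le> e + e' + C0 / l * Im z \<or> (\<Sum>j\<in>F. green (c j) z) \<le> e + e' + C0 / K * h z"
            using gs[OF z(1)] e B\<zeta> by linarith
        qed
      qed
    qed
    moreover have "p \<in> \<Omega>" using p by (force simp: \<Omega>_def dist_commute)
    ultimately have "U p \<le> e" by (rule maximum_principle)
    then show ?thesis unfolding U_def C1_def by simp
  qed
  then show ?thesis using m y0 by (intro exI[of _ "m * y0 / 2"] conjI allI impI) simp_all
qed

end

section \<open>From omitted discs to non-tangential boundedness\<close>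

lemma exists_compact_inside:
  assumes "S \<in> lmeasurable" "bounded S" "0 < e"
  obtains K where "compact K" "K \<subseteq> S" "measure lebesgue S - e \<le> measure lebesgue (K :: real set)"
proof -
  obtain T where T: "closed T" "T \<subseteq> S" "S - T \<in> lmeasurable" "emeasure lebesgue (S - T) < ennreal e"
    using sets_lebesgue_inner_closed[OF fmeasurableD[OF assms(1)] assms(3)] by blast
  have c: "compact T" using T(1,2) assms(2) bounded_subset compact_eq_bounded_closed by blast
  then have Tm: "T \<in> lmeasurable" by (rule lmeasurable_compact)
  have "measure lebesgue (S - T) < e"
    using T(3,4) by (metis emeasure_eq_measure2 ennreal_less_iff measure_nonneg)
  moreover have "measure lebesgue (S - T) = measure lebesgue S - measure lebesgue T"
    by (rule measurable_measure_Diff[OF assms(1) fmeasurableD[OF Tm] T(2)])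
  ultimately show ?thesis using that[OF c T(2)] by linarith
qed

lemma open_sector_fibre: "open {x. z \<in> sector m k x}"
proof (cases "0 < Im z \<and> Im z < k")
  case True
  then have "{x. z \<in> sector m k x} = {x. \<bar>Re z - x\<bar> < m * Im z}" by (auto simp: sector_def)
  then show ?thesis by (simp add: open_Collect_less continuous_intros)
next
  case False
  then have "{x. z \<in> sector m k x} = {}" by (auto simp: sector_def)
  then show ?thesis by simp
qed

text \<open>If the set had positive measure, it would nearly fill some interval, and finitely many points where
  \<open>G\<close> is huge would have shadows covering a fixed part of a subinterval. On the sawtooth region the sum of the Green
  functions with these poles is dominated by a small multiple of log |G - q|, a multiple of Im z, and the
  harmonic measure of the small set missing from the interval, which contradicts its lower bound.\<close>
theorem negligible_unbounded_omitting_disc: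
  assumes G: "G holomorphic_on {z. 0 < Im z}" and m: "0 < m" and k: "0 < k" and r: "0 < r"
  shows "negligible {x. (\<forall>z\<in>sector m k x. r \<le> norm (G z - q)) \<and>
    (\<forall>M. \<forall>k'>0. \<exists>z\<in>sector (m / 2) k' x. M < norm (G z))}" (is "negligible ?S")
proof (rule ccontr)
  assume neg: "\<not> negligible ?S"
  define A where "A = {x. \<forall>z\<in>sector m k x. r \<le> norm (G z - q)}"
  have "A = - (\<Union>z\<in>{z. norm (G z - q) < r}. {x. z \<in> sector m k x})"
    by (auto simp: A_def not_le)
  then have "closed A" using open_sector_fibre by (auto simp: closed_def)
  define B where "B M k' = (\<Union>z\<in>{z. M < norm (G z)}. {x. z \<in> sector (m / 2) k' x})" for M k'
  have "open (B M k')" for M k' unfolding B_def using open_sector_fibre by blast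
  \<comment> \<open>The density argument needs a measurable set: it is the intersection of a closed
    set with countably many open ones.\<close>
  have "?S = A \<inter> (\<Inter>n::nat. \<Inter>j::nat. B (real n) (1 / real (Suc j)))"
  proof (intro equalityI subsetI)
    fix x assume x: "x \<in> A \<inter> (\<Inter>n::nat. \<Inter>j::nat. B (real n) (1 / real (Suc j)))"
    have "\<exists>z\<in>sector (m / 2) k' x. M < norm (G z)" if k': "0 < k'" for M k'
    proof -
      obtain n :: nat where n: "M \<le> real n" using real_arch_simple by blast
      obtain j :: nat where j: "1 / real (Suc j) < k'" using k' nat_approx_posE by blast
      have "x \<in> B (real n) (1 / real (Suc j))" using x by blast
      then obtain z where "real n < norm (G z)" "z \<in> sector (m / 2) (1 / real (Suc j)) x" by (auto simp: B_def)
      then show ?thesis using n j by (intro bexI[of _ z]) (auto simp: sector_def)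
    qed
    then show "x \<in> ?S" using x by (auto simp: A_def)
  next
    fix x assume x: "x \<in> ?S"
    have "x \<in> B (real n) (1 / real (Suc j))" for n j :: nat
    proof -
      have "\<exists>z\<in>sector (m / 2) (1 / real (Suc j)) x. real n < norm (G z)" using x by simp
      then show ?thesis by (auto simp: B_def)
    qed
    then show "x \<in> A \<inter> (\<Inter>n::nat. \<Inter>j::nat. B (real n) (1 / real (Suc j)))" using x by (simp add: A_def)
  qed
  moreover have "A \<inter> (\<Inter>n::nat. \<Inter>j::nat. B (real n) (1 / real (Suc j))) \<in> sets lebesgue"
    using \<open>closed A\<close> \<open>\<And>M k'. open (B M k')\<close> by (intro sets.Int sets.countable_INT'') auto
  ultimately have Sm: "?S \<in> sets lebesgue" by metis
  define S where "S = ?S"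
  have SA: "S \<subseteq> A" unfolding S_def A_def by blast
  have Sbig: "\<exists>z\<in>sector (m / 2) k' x. M < norm (G z)" if "x \<in> S" "0 < k'" for x M k'
    using that unfolding S_def by blast
  have "S \<in> sets lebesgue" "\<not> negligible S" using Sm neg by (simp_all only: S_def not_False_eq_True)
  have Seq: "S = (\<Union>n::nat. S \<inter> cball 0 (real n))"
  proof (intro equalityI subsetI)
    fix x assume "x \<in> S"
    moreover obtain n :: nat where "\<bar>x\<bar> \<le> real n" using real_arch_simple by blast
    ultimately show "x \<in> (\<Union>n::nat. S \<inter> cball 0 (real n))" by (auto simp: dist_real_def)
  qed blast
  have "\<exists>n::nat. \<not> negligible (S \<inter> cball 0 (real n))"
  proof (rule ccontr)
    assume "\<nexists>n::nat. \<not> negligible (S \<inter> cball 0 (real n))"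
    then have "negligible (\<Union>n::nat. S \<inter> cball 0 (real n))" by (intro negligible_countable_Union) auto
    then show False using \<open>\<not> negligible S\<close> Seq by metis
  qed
  then obtain n :: nat where n: "\<not> negligible (S \<inter> cball 0 (real n))" by blast
  define S0 where "S0 = S \<inter> cball 0 (real n)"
  have S0: "S0 \<in> lmeasurable" unfolding S0_def Int_commute[of S]
    by (rule fmeasurable_Int_fmeasurable[OF lmeasurable_cball \<open>S \<in> sets lebesgue\<close>])
  have S0pos: "0 < measure lebesgue S0"
    using n S0 by (metis S0_def negligible_iff_measure zero_less_measure_iff)
  \<comment> \<open>Chosen so that \<open>4 * \<rho> * (1 + m) = m / 2\<close>: a disc of radius
    \<open>4 * \<rho>\<close> times the height of its centre stays in the sector of slope
    \<open>m\<close> when the centre lies in the one of slope \<open>m / 2\<close>.\<close>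
  define \<rho> where "\<rho> = m / (8 * (1 + m))"
  have \<rho>: "0 < \<rho>" "\<rho> < 1" using m by (auto simp: \<rho>_def)
  define C0 where "C0 = ((1 + (m / 2) / \<rho>)\<^sup>2 + (1 + 1 / \<rho>)\<^sup>2) / (m / 2) * pi"
  have C0: "C0 > 0"
  proof -
    have "1 + (m / 2) / \<rho> > 0" using m \<rho> by (simp add: add_pos_pos)
    then show ?thesis unfolding C0_def using m by (simp add: add_pos_nonneg)
  qed
  define C1 where "C1 = C0 * (1 + m\<^sup>2) / m"
  have C1: "C1 > 0" unfolding C1_def using C0 m by (simp add: add_pos_nonneg)
  \<comment> \<open>The lower bound for the sum of the Green functions at \<open>p\<close>, namely 2
    \<delta> l / (5 \<delta> l)^2 times the total height \<delta> l / (10 m) of the poles. It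
    depends neither on \<delta> nor on \<open>l\<close>.\<close>
  define c3 where "c3 = 1 / (125 * m)"
  have c3: "c3 > 0" using m by (simp add: c3_def)
  \<comment> \<open>The errors of the comparison are held to \<open>c3 / 4\<close> each: \<delta>
    controls the terms proportional to the height \<delta> l of \<open>p\<close>, \<epsilon>
    controls the gaps of \<open>E\<close>, and the additive error of the comparison is the third. So
    \<open>c3 / 4\<close> is left for the term with \<open>h\<close>.\<close>
  define D where "D = C1 * (8 * (2 + 2 * m)) + C0"
  have D: "D > 0" using C1 C0 m by (simp add: D_def add_pos_pos)
  define \<delta> where "\<delta> = min (1 / 4) (c3 / (4 * D))"
  have \<delta>: "0 < \<delta>" "\<delta> \<le> 1 / 4" "D * \<delta> \<le> c3 / 4"
  proof -
    show "0 < \<delta>" "\<delta> \<le> 1 / 4" using c3 D by (auto simp: \<delta>_def)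
    have "D * \<delta> \<le> D * (c3 / (4 * D))" using D by (intro mult_left_mono) (auto simp: \<delta>_def)
    then show "D * \<delta> \<le> c3 / 4" using D by simp
  qed
  define \<epsilon> where "\<epsilon> = min (\<delta> / 2) (c3 * \<delta> / (8 * C1))"
  have \<epsilon>: "0 < \<epsilon>" "\<epsilon> \<le> \<delta> / 2" "C1 * (2 * \<epsilon> / \<delta>) \<le> c3 / 4"
  proof -
    show "0 < \<epsilon>" "\<epsilon> \<le> \<delta> / 2" using c3 C1 \<delta> by (auto simp: \<epsilon>_def)
    have "C1 * (2 * \<epsilon> / \<delta>) \<le> C1 * (2 * (c3 * \<delta> / (8 * C1)) / \<delta>)"
      using C1 \<delta>(1) by (intro mult_left_mono divide_right_mono) (auto simp: \<epsilon>_def)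
    then show "C1 * (2 * \<epsilon> / \<delta>) \<le> c3 / 4" using C1 \<delta>(1) by simp
  qed
  obtain x0 l where lp: "0 < l" "l < k" "(1 - \<epsilon>) * (2 * l) \<le> measure lebesgue (S0 \<inter> cball x0 l)"
    using weak_density[OF S0 S0pos \<epsilon>(1) k] by blast
  define E where "E = A \<inter> cball x0 l"
  interpret sawtooth E x0 l m
    using m lp(1) by unfold_locales (auto simp: E_def)
  have Em: "E \<in> lmeasurable" unfolding E_def
    using \<open>closed A\<close> by (intro lmeasurable_compact closed_Int_compact) auto
  have S0A: "S0 \<subseteq> A" using SA by (auto simp: S0_def)
  have S0l: "S0 \<inter> cball x0 t \<in> lmeasurable" for t using S0 by (intro fmeasurable.Int) auto
  have gap: "measure lebesgue (cball x0 l - E) \<le> 2 * \<epsilon> * l"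
  proof -
    have "measure lebesgue (cball x0 l - E) = measure lebesgue (cball x0 l) - measure lebesgue E"
      using Em by (intro measurable_measure_Diff) (auto simp: E_def fmeasurableD)
    moreover have "measure lebesgue (S0 \<inter> cball x0 l) \<le> measure lebesgue E"
      using S0A S0l Em by (intro measure_mono_fmeasurable) (auto simp: E_def fmeasurableD)
    moreover have "measure lebesgue (cball x0 l) = 2 * l" using l by (simp add: cball_eq_atLeastAtMost)
    ultimately show ?thesis using lp(3) by argo
  qed
  have dl: "0 < \<delta> * l" "\<delta> * l \<le> l / 4" using \<delta> l(1) mult_right_mono[of \<delta> "1 / 4" l] by auto
  have S1: "\<delta> * l \<le> measure lebesgue (S0 \<inter> cball x0 (\<delta> * l))"
  proof -
    have sub: "cball x0 (\<delta> * l) \<subseteq> cball x0 l" using dl l by (intro subset_cball) auto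
    have "measure lebesgue (S0 \<inter> cball x0 l) \<le> measure lebesgue ((S0 \<inter> cball x0 (\<delta> * l)) \<union> (cball x0 l - cball x0 (\<delta> * l)))"
      using S0l by (intro measure_mono_fmeasurable fmeasurable.Un fmeasurable_Diff) (auto simp: fmeasurableD)
    also have "\<dots> \<le> measure lebesgue (S0 \<inter> cball x0 (\<delta> * l)) + measure lebesgue (cball x0 l - cball x0 (\<delta> * l))"
      using S0l by (intro measure_Un_le) (auto simp: fmeasurableD)
    also have "measure lebesgue (cball x0 l - cball x0 (\<delta> * l)) = measure lebesgue (cball x0 l) - measure lebesgue (cball x0 (\<delta> * l))"
      using sub by (intro measurable_measure_Diff) auto
    also have "\<dots> = 2 * l - 2 * (\<delta> * l)" using l dl by (simp add: cball_eq_atLeastAtMost)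
    finally have "(1 - \<epsilon>) * (2 * l) \<le> measure lebesgue (S0 \<inter> cball x0 (\<delta> * l)) + (2 * l - 2 * (\<delta> * l))"
      using lp(3) by linarith
    moreover have "(1 - \<epsilon>) * (2 * l) = 2 * l - 2 * (\<epsilon> * l)" by (simp add: left_diff_distrib)
    moreover have "\<epsilon> * l \<le> \<delta> / 2 * l" using \<epsilon>(2) l by (intro mult_right_mono) auto
    ultimately show ?thesis by argo
  qed
  \<comment> \<open>A compact set allows finitely many poles. It lies in a small concentric
    interval, so that \<open>p\<close> is comparably close to all of them.\<close>
  obtain K where K: "compact K" "K \<subseteq> S0 \<inter> cball x0 (\<delta> * l)" "\<delta> * l / 2 \<le> measure lebesgue K"
  proof -
    have "bounded (S0 \<inter> cball x0 (\<delta> * l))" by (simp add: bounded_Int)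
    then obtain K where "compact K" "K \<subseteq> S0 \<inter> cball x0 (\<delta> * l)"
      "measure lebesgue (S0 \<inter> cball x0 (\<delta> * l)) - \<delta> * l / 2 \<le> measure lebesgue K"
      using exists_compact_inside[OF S0l, of "\<delta> * l" "\<delta> * l / 2"] dl by auto
    then show ?thesis using that S1 by (smt (verit) field_sum_of_halves)
  qed
  have "K \<noteq> {}" using K(3) dl by auto
  then obtain x1 where x1: "x1 \<in> K" by blast
  define p where "p = Complex x1 (\<delta> * l)"
  have "cball x0 (\<delta> * l) \<subseteq> cball x0 l" using dl(2) l by (intro subset_cball) linarith
  then have KA: "K \<subseteq> E" using K(2) S0A unfolding E_def by blast
  have Kx: "\<bar>x - x0\<bar> \<le> \<delta> * l" if "x \<in> K" for x using K(2) that by (auto simp: dist_real_def)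
  have pr: "p \<in> region"
    unfolding region_def p_def using x1 KA dl l m by (auto intro!: bexI[of _ x1])
  \<comment> \<open>The factor 2 makes the modulus exceed 1 strictly where |G - q| is at least
    \<open>r\<close>, as the Harnack estimate requires.\<close>
  define h where "h z = ln (norm (2 * (G z - q) / of_real r))" for z
  have regA: "r \<le> norm (G z - q)" if zr: "z \<in> region" for z
  proof -
    obtain x where "x \<in> E" "0 < Im z" "Im z < l" "\<bar>Re z - x\<bar> < m * Im z"
      using zr unfolding region_def by blast
    then have "x \<in> A" "z \<in> sector m k x" using lp(2) by (auto simp: E_def sector_def)
    then show ?thesis by (auto simp: A_def)
  qed
  have FF: "1 < norm (2 * (G z - q) / of_real r)" if "r \<le> norm (G z - q)" for z
  proof -
    have "norm (2 * (G z - q) / of_real r) = 2 * norm (G z - q) / r"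
      using r unfolding norm_divide norm_mult by simp
    then show ?thesis using that r by (simp add: less_divide_eq)
  qed
  have h0: "0 \<le> h z" if "z \<in> region" for z
    unfolding h_def using FF[OF regA[OF that]] by simp
  have hh: "locally_Re_holo region h"
    unfolding h_def
  proof (rule locally_Re_holo_ln_norm)
    show "(\<lambda>z. 2 * (G z - q) / complex_of_real r) holomorphic_on region"
      using r by (intro holomorphic_intros holomorphic_on_subset[OF G]) (auto simp: region_def)
    show "2 * (G z - q) / complex_of_real r \<noteq> 0" if "z \<in> region" for z
      using FF[OF regA[OF that]] by (metis norm_zero not_one_less_zero)
  qed (rule open_region)
  \<comment> \<open>The poles depend on \<open>K0\<close>, whereas \<open>p\<close> and all other
    constants do not; letting \<open>K0\<close> grow makes \<open>h p\<close> infinite.\<close>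
  have bound: "K0 * (c3 / (4 * C0)) \<le> h p" if K0: "0 < K0" for K0
  proof -
    \<comment> \<open>The first entry keeps the discs around the poles below height
      \<open>k\<close>, the second keeps \<open>p\<close> outside the smaller discs, and the third
      keeps the poles within horizontal distance of order \<delta> l from \<open>p\<close>.\<close>
    define k1 where "k1 = min (k / 2) (min (\<delta> * l / 2) (\<delta> * l / m))"
    have k1: "0 < k1" "k1 \<le> k / 2" "k1 \<le> \<delta> * l / 2" "k1 \<le> \<delta> * l / m"
      unfolding k1_def using k dl(1) m by (auto simp only: min_less_iff_conj min.cobounded1 intro: min.coboundedI1 min.coboundedI2 divide_pos_pos)
    \<comment> \<open>The threshold makes \<open>h\<close> at least \<open>3 * K0\<close> at the
      poles, and Harnack's inequality leaves a third of it on the discs.\<close>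
    have "\<exists>z\<in>sector (m / 2) k1 x. norm q + r * exp (3 * K0) < norm (G z)" if "x \<in> K" for x
      by (rule Sbig) (use that K(2) k1(1) in \<open>auto simp: S0_def\<close>)
    then obtain c where c: "\<And>x. x \<in> K \<Longrightarrow> c x \<in> sector (m / 2) k1 x"
      "\<And>x. x \<in> K \<Longrightarrow> norm q + r * exp (3 * K0) < norm (G (c x))" by metis
    have cI: "0 < Im (c x)" "\<bar>Re (c x) - x\<bar> < m / 2 * Im (c x)" "Im (c x) < k1" if "x \<in> K" for x
      using c(1)[OF that] by (auto simp: sector_def)
    have hc: "3 * K0 \<le> h (c x)" if "x \<in> K" for x
    proof -
      have "r * exp (3 * K0) \<le> norm (G (c x) - q)"
        using c(2)[OF that] norm_triangle_ineq2[of "G (c x)" q] by linarith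
      moreover have "norm (2 * (G (c x) - q) / of_real r) = 2 * (norm (G (c x) - q) / r)"
        using r unfolding norm_divide norm_mult by simp
      moreover have "0 \<le> norm (G (c x) - q) / r" using r by simp
      moreover have "exp (3 * K0) \<le> norm (G (c x) - q) / r"
        using r pos_le_divide_eq[of r "exp (3 * K0)" "norm (G (c x) - q)"] calculation(1) by (simp add: mult.commute)
      ultimately have le: "exp (3 * K0) \<le> norm (2 * (G (c x) - q) / of_real r)" by linarith
      show ?thesis unfolding h_def
        using le by (subst ln_ge_iff[OF less_le_trans[OF exp_gt_zero le]])
    qed
    have inA: "r \<le> norm (G z - q)" if x: "x \<in> K" and z: "dist z (c x) < 4 * \<rho> * Im (c x)" for x z
    proof -
      have z1: "\<bar>Re z - Re (c x)\<bar> < 4 * \<rho> * Im (c x)" "\<bar>Im z - Im (c x)\<bar> < 4 * \<rho> * Im (c x)"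
        using z abs_Re_le_cmod[of "z - c x"] abs_Im_le_cmod[of "z - c x"] by (auto simp: dist_norm)
      have r4: "4 * \<rho> * (1 + m) = m / 2" using m by (simp add: \<rho>_def divide_simps) (simp add: algebra_simps)?
      have r41: "4 * \<rho> < 1" using m by (simp add: \<rho>_def field_simps)
      have a1: "4 * \<rho> * Im (c x) < Im (c x)" using r41 cI(1)[OF x] by simp
      have "m * (Im (c x) - 4 * \<rho> * Im (c x)) \<le> m * Im z" using z1(2) m by (intro mult_left_mono) auto
      moreover have "4 * \<rho> * Im (c x) + m / 2 * Im (c x) = m * (Im (c x) - 4 * \<rho> * Im (c x))"
      proof -
        have "m * (4 * \<rho>) = m / 2 - 4 * \<rho>" using r4 by (simp add: algebra_simps)
        then have "m * (4 * \<rho> * Im (c x)) = (m / 2 - 4 * \<rho>) * Im (c x)" by (metis mult.assoc)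
        then show ?thesis by (simp add: algebra_simps)
      qed
      ultimately have "\<bar>Re z - x\<bar> < m * Im z" using z1(1) cI(2)[OF x] by linarith
      moreover have "0 < Im z" "Im z < k" using z1(2) a1 cI[OF x] k1 k by linarith+
      ultimately have "z \<in> sector m k x" by (simp add: sector_def)
      then show ?thesis using KA x by (auto simp: E_def A_def)
    qed
    have big: "K0 \<le> h z" if x: "x \<in> K" and z: "dist z (c x) < 2 * \<rho> * Im (c x)" for x z
    proof -
      have "ln (norm (2 * (G (c x) - q) / of_real r)) / 3 \<le> ln (norm (2 * (G z - q) / of_real r))"
      proof (rule harnack_half_ball[of "\<lambda>z. 2 * (G z - q) / of_real r" "c x" "4 * \<rho> * Im (c x)" z])
        have "ball (c x) (4 * \<rho> * Im (c x)) \<subseteq> {z. 0 < Im z}"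
        proof
          fix z assume "z \<in> ball (c x) (4 * \<rho> * Im (c x))"
          then have "\<bar>Im z - Im (c x)\<bar> < 4 * \<rho> * Im (c x)"
            using abs_Im_le_cmod[of "c x - z"] by (simp add: dist_norm)
          moreover have "4 * \<rho> < 1" using m by (simp add: \<rho>_def field_simps)
          then have "4 * \<rho> * Im (c x) < Im (c x)" using cI(1)[OF x] by simp
          ultimately show "z \<in> {z. 0 < Im z}" by simp
        qed
        then show "(\<lambda>z. 2 * (G z - q) / complex_of_real r) holomorphic_on ball (c x) (4 * \<rho> * Im (c x))"
          using r by (intro holomorphic_intros holomorphic_on_subset[OF G]) auto
        show "0 < 4 * \<rho> * Im (c x)" using \<rho> cI(1)[OF x] by simp
        show "1 < norm (2 * (G z - q) / complex_of_real r)" if "z \<in> ball (c x) (4 * \<rho> * Im (c x))" for z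
          using that by (intro FF inA[OF x]) (simp add: dist_commute)
        show "dist z (c x) \<le> 4 * \<rho> * Im (c x) / 2" using z by simp
      qed
      then show ?thesis using hc[OF x] by (simp add: h_def)
    qed
    have cov: "K \<subseteq> (\<Union>x\<in>K. ball (Re (c x)) (m / 2 * Im (c x)))"
      using cI(2) by (auto simp: dist_real_def)
    obtain F0 where F0: "F0 \<subseteq> K" "finite F0" "K \<subseteq> (\<Union>x\<in>F0. ball (Re (c x)) (m / 2 * Im (c x)))"
      using compactE_image[OF K(1) _ cov] by auto
    \<comment> \<open>A pole in the sector of slope \<open>m / 2\<close> over \<open>x\<close> has
      \<open>x\<close> in its shadow of half-width \<open>m / 2\<close> times its height. Vitali's
      lemma keeps disjoint shadows whose fivefold enlargements still cover \<open>K\<close>; hence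
      the total height of the chosen poles is bounded below.\<close>
    obtain F where F: "F \<subseteq> F0"
      "pairwise (\<lambda>i j. disjnt (ball (Re (c i)) (m / 2 * Im (c i))) (ball (Re (c j)) (m / 2 * Im (c j)))) F"
      "K \<subseteq> (\<Union>i\<in>F. ball (Re (c i)) (5 * (m / 2 * Im (c i))))"
    proof (rule Vitali_covering_lemma_balls[OF F0(3), of "m / 2 * k1"])
      fix i assume "i \<in> F0"
      then show "0 < m / 2 * Im (c i) \<and> m / 2 * Im (c i) \<le> m / 2 * k1"
        using cI(1,3)[of i] F0(1) m by auto
    qed blast
    have fF: "finite F" using F(1) F0(2) finite_subset by blast
    have FK: "F \<subseteq> K" using F(1) F0(1) by blast
    have sumy: "\<delta> * l / (10 * m) \<le> (\<Sum>i\<in>F. Im (c i))"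
    proof -
      have "measure lebesgue K \<le> measure lebesgue (\<Union>i\<in>F. ball (Re (c i)) (5 * (m / 2 * Im (c i))))"
        using F(3) fF K(1) by (intro measure_mono_fmeasurable) (auto simp: lmeasurable_compact fmeasurableD intro!: fmeasurable.finite_UN)
      also have "\<dots> \<le> (\<Sum>i\<in>F. measure lebesgue (ball (Re (c i)) (5 * (m / 2 * Im (c i)))))"
        using fF by (intro measure_UNION_le) auto
      also have "\<dots> = (\<Sum>i\<in>F. 5 * m * Im (c i))"
      proof (rule sum.cong)
        fix i assume "i \<in> F"
        then have "0 \<le> 5 * (m / 2 * Im (c i))" using cI(1)[of i] FK m by auto
        then show "measure lebesgue (ball (Re (c i)) (5 * (m / 2 * Im (c i)))) = 5 * m * Im (c i)"
          by (simp add: ball_eq_greaterThanLessThan)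
      qed simp
      also have "\<dots> = 5 * m * (\<Sum>i\<in>F. Im (c i))" by (simp add: sum_distrib_left)
      finally have "\<delta> * l / 2 \<le> 5 * m * (\<Sum>i\<in>F. Im (c i))" using K(3) by linarith
      then show ?thesis using m by (simp add: field_simps)
    qed
    have far: "\<rho> * Im (c j) < dist p (c j)" if j: "j \<in> F" for j
    proof -
      have "Im (c j) < \<delta> * l / 2" using cI(3)[of j] j FK k1(3) by auto
      moreover have "\<rho> * Im (c j) \<le> Im (c j)" using \<rho> cI(1)[of j] j FK by auto
      moreover have "\<bar>\<delta> * l - Im (c j)\<bar> \<le> dist p (c j)"
        using abs_Im_le_cmod[of "p - c j"] by (simp add: p_def dist_norm)
      ultimately show ?thesis by linarith
    qed
    have gl: "2 * (\<delta> * l) * Im (c j) / (5 * (\<delta> * l))\<^sup>2 \<le> green (c j) p" if j: "j \<in> F" for j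
    proof -
      have jK: "j \<in> K" using j FK by blast
      have "\<bar>x1 - Re (c j)\<bar> \<le> 3 * (\<delta> * l)"
      proof -
        have "m / 2 * Im (c j) \<le> m / 2 * (\<delta> * l / m)" using cI(3)[OF jK] k1(4) m by (intro mult_left_mono) auto
        also have "\<dots> = \<delta> * l / 2" using m by simp
        finally show ?thesis using cI(2)[OF jK] Kx[OF jK] Kx[OF x1] dl(1) by linarith
      qed
      moreover have "norm (p - cnj (c j)) \<le> \<bar>x1 - Re (c j)\<bar> + \<bar>\<delta> * l + Im (c j)\<bar>"
        using cmod_le[of "p - cnj (c j)"] by (simp add: p_def)
      ultimately have "norm (p - cnj (c j)) \<le> 5 * (\<delta> * l)"
        using cI(1,3)[OF jK] k1(3) dl(1) by linarith
      then have n2: "(norm (p - cnj (c j)))\<^sup>2 \<le> (5 * (\<delta> * l))\<^sup>2" by (intro power_mono) auto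
      have Imp: "Im p = \<delta> * l" by (simp add: p_def)
      have pc: "p \<noteq> c j" using far[OF j] \<rho> cI(1)[OF jK] by (metis dist_self mult_pos_pos order.asym)
      have "Im p + Im (c j) > 0" using Imp dl(1) cI(1)[OF jK] by linarith
      then have "Im (p - cnj (c j)) \<noteq> 0" by simp
      then have "p - cnj (c j) \<noteq> 0" by (metis zero_complex.sel(2))
      then have npos: "0 < (norm (p - cnj (c j)))\<^sup>2" by simp
      have "2 * (\<delta> * l) * Im (c j) / (5 * (\<delta> * l))\<^sup>2 \<le> 2 * (\<delta> * l) * Im (c j) / (norm (p - cnj (c j)))\<^sup>2"
        using n2 npos dl(1) cI(1)[OF jK] by (intro divide_left_mono) (auto intro!: mult_pos_pos)
      also have "\<dots> \<le> green (c j) p"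
        using green_bounds(2)[of p "c j"] pc dl(1) cI(1)[OF jK] by (simp add: Imp)
      finally show ?thesis .
    qed
    have lower: "c3 \<le> (\<Sum>j\<in>F. green (c j) p)"
    proof -
      have "c3 = 2 * (\<delta> * l) / (5 * (\<delta> * l))\<^sup>2 * (\<delta> * l / (10 * m))"
      proof -
        have "\<delta> * l \<noteq> 0" using dl(1) by auto
        then show ?thesis using m unfolding c3_def power2_eq_square by (simp add: divide_simps)
      qed
      also have "\<dots> \<le> 2 * (\<delta> * l) / (5 * (\<delta> * l))\<^sup>2 * (\<Sum>i\<in>F. Im (c i))"
        using sumy dl(1) by (intro mult_left_mono) auto
      also have "\<dots> = (\<Sum>j\<in>F. 2 * (\<delta> * l) * Im (c j) / (5 * (\<delta> * l))\<^sup>2)"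
        by (simp add: sum_distrib_left)
      also have "\<dots> \<le> (\<Sum>j\<in>F. green (c j) p)" by (rule sum_mono) (rule gl)
      finally show ?thesis .
    qed
    have ivl: "{Re (c i) - m / 2 * Im (c i)<..<Re (c i) + m / 2 * Im (c i)} = ball (Re (c i)) (m / 2 * Im (c i))" for i
      by (simp add: ball_eq_greaterThanLessThan)
    have "\<exists>\<eta>0>0. \<forall>\<eta>. 0 < \<eta> \<and> \<eta> < \<eta>0 \<longrightarrow>
       (\<Sum>j\<in>F. green (c j) p) \<le> C0 * (1 + m\<^sup>2) / m * barrier \<eta> p + C0 / l * Im p + C0 / K0 * h p + c3 / 4"
    proof (rule comparison[OF hh h0 fF _ _ \<rho>(1) _ _ K0 pr far _ C0_def])
      show "0 < Im (c j)" if "j \<in> F" for j using that FK cI(1) by blast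
      show "{Re (c i) - m / 2 * Im (c i)<..<Re (c i) + m / 2 * Im (c i)} \<inter> {Re (c j) - m / 2 * Im (c j)<..<Re (c j) + m / 2 * Im (c j)} = {}"
        if "i \<in> F" "j \<in> F" "i \<noteq> j" for i j
        using F(2) that unfolding ivl pairwise_def disjnt_def by blast
      show "K0 \<le> h z" if "j \<in> F" "z \<in> region" "dist z (c j) < 2 * \<rho> * Im (c j)" for j z
        using that big FK by blast
    qed (use m c3 in auto)
    then obtain \<eta>0 where \<eta>0: "\<eta>0 > 0" "\<And>\<eta>. 0 < \<eta> \<Longrightarrow> \<eta> < \<eta>0 \<Longrightarrow>
       (\<Sum>j\<in>F. green (c j) p) \<le> C1 * barrier \<eta> p + C0 / l * Im p + C0 / K0 * h p + c3 / 4"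
      unfolding C1_def by blast
    define \<eta> where "\<eta> = min (\<eta>0 / 2) (l / 4)"
    have \<eta>: "0 < \<eta>" "\<eta> < \<eta>0" "\<eta> \<le> l / 4" using \<eta>0(1) l(1) by (auto simp: \<eta>_def)
    have "barrier \<eta> p \<le> measure lebesgue (cball x0 l - E) / Im p + 8 * (2 + 2 * m) * Im p / l"
    proof (rule barrier_upper[OF _ _ \<eta>(1,3) fmeasurableD[OF Em]])
      show "\<bar>Re p - x0\<bar> \<le> l / 4" using Kx[OF x1] dl(2) unfolding p_def by simp
    qed (use dl(1) in \<open>simp add: p_def\<close>)
    also have "\<dots> \<le> 2 * \<epsilon> * l / (\<delta> * l) + 8 * (2 + 2 * m) * (\<delta> * l) / l"
      unfolding p_def complex.sel using gap dl(1) by (intro add_mono divide_right_mono order_refl) linarith+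
    also have "\<dots> = 2 * \<epsilon> / \<delta> + 8 * (2 + 2 * m) * \<delta>" using l(1) \<delta>(1) by simp
    finally have "C1 * barrier \<eta> p \<le> C1 * (2 * \<epsilon> / \<delta> + 8 * (2 + 2 * m) * \<delta>)"
      using C1 by (intro mult_left_mono) auto
    also have "\<dots> = C1 * (2 * \<epsilon> / \<delta>) + C1 * (8 * (2 + 2 * m)) * \<delta>" by (simp add: distrib_left mult.assoc)
    finally have B: "C1 * barrier \<eta> p \<le> c3 / 4 + C1 * (8 * (2 + 2 * m)) * \<delta>" using \<epsilon>(3) by linarith
    have "C0 / l * Im p = C0 * \<delta>" using l(1) by (simp add: p_def)
    moreover have "D * \<delta> = C1 * (8 * (2 + 2 * m)) * \<delta> + C0 * \<delta>" by (simp add: D_def distrib_right)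
    ultimately have "c3 / 4 \<le> C0 / K0 * h p"
      using lower \<eta>0(2)[OF \<eta>(1,2)] B \<delta>(3) by linarith
    then have "K0 * (c3 / 4) \<le> K0 * (C0 / K0 * h p)" using K0 by (intro mult_left_mono) auto
    then have "K0 * (c3 / 4) \<le> h p * C0" using K0 by (simp add: mult.commute)
    then have "K0 * (c3 / 4) / C0 \<le> h p" using C0 by (simp add: pos_divide_le_eq)
    then show ?thesis by simp
  qed
  \<comment> \<open>This value of \<open>K0\<close> turns \<open>bound\<close> into
    \<open>h p + 1 \<le> h p\<close>.\<close>
  have "0 < (h p + 1) * (4 * C0 / c3)" using h0[OF pr] C0 c3 by (simp add: add_nonneg_pos)
  from bound[OF this] have "h p + 1 \<le> h p" using C0 c3 by simp
  then show False by simp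
qed

lemma complex_countable_dense:
  "\<exists>Q :: complex set. countable Q \<and> (\<forall>z. \<forall>e>0. \<exists>q\<in>Q. norm (z - q) < e)"
proof -
  obtain Q :: "complex set" where Q: "countable Q" "\<And>X. open X \<Longrightarrow> X \<noteq> {} \<Longrightarrow> \<exists>d\<in>Q. d \<in> X"
    by (rule countable_dense_setE) blast
  have "\<exists>q\<in>Q. norm (z - q) < e" if "0 < e" for z e
    using Q(2)[of "ball z e"] that by (auto simp: dist_norm)
  then show ?thesis using Q(1) by blast
qed

text \<open>Slope, height, radius and centre of the omitted disc are made discrete, so that
  countably many null sets suffice; the omitted disc shrinks a little when its centre moves into the
  countable dense set.\<close>

lemma AE_nt_bounded_upper:
  assumes G: "G holomorphic_on half_plane 1"
  shows "AE x in lborel.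
    (\<exists>\<alpha> k q r. 0 < \<alpha> \<and> \<alpha> < pi / 2 \<and> 0 < k \<and> 0 < r \<and> (\<forall>z\<in>cone 1 \<alpha> x. norm (z - of_real x) < k \<longrightarrow> r \<le> norm (G z - q))) \<longrightarrow>
    (\<exists>\<alpha> k M. 0 < \<alpha> \<and> \<alpha> < pi / 2 \<and> 0 < k \<and> (\<forall>z\<in>cone 1 \<alpha> x. norm (z - of_real x) < k \<longrightarrow> norm (G z) \<le> M))"
proof -
  obtain Q :: "complex set" where Q: "countable Q" "\<And>z e. 0 < e \<Longrightarrow> \<exists>q\<in>Q. norm (z - q) < e"
    using complex_countable_dense by blast
  define B where "B m k r q = {x. (\<forall>z\<in>sector m k x. r \<le> norm (G z - q)) \<and>
    (\<forall>M. \<forall>k'>0. \<exists>z\<in>sector (m / 2) k' x. M < norm (G z))}" for m k r :: real and q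
  define N where "N = (\<Union>n::nat. \<Union>j::nat. \<Union>i::nat. \<Union>q\<in>Q. B (1 / real (Suc n)) (1 / real (Suc j)) (1 / real (Suc i)) q)"
  have G': "G holomorphic_on {z. 0 < Im z}" using G by (simp add: half_plane_def)
  have nB: "negligible (B (1 / real (Suc n)) (1 / real (Suc j)) (1 / real (Suc i)) q)" for n j i :: nat and q
    unfolding B_def by (rule negligible_unbounded_omitting_disc[OF G']) simp_all
  have nQ: "negligible (\<Union>q\<in>Q. B (1 / real (Suc n)) (1 / real (Suc j)) (1 / real (Suc i)) q)" for n j i :: nat
    using Q(1) nB by (intro negligible_countable_Union) auto
  have nU: "negligible (\<Union>n::nat. A n)" if "\<And>n. negligible (A n)" for A :: "nat \<Rightarrow> real set"
    using that by (intro negligible_countable_Union) auto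
  have "negligible N" unfolding N_def by (intro nU nQ)
  moreover have "(\<exists>\<alpha> k M. 0 < \<alpha> \<and> \<alpha> < pi / 2 \<and> 0 < k \<and> (\<forall>z\<in>cone 1 \<alpha> x. norm (z - of_real x) < k \<longrightarrow> norm (G z) \<le> M))"
    if x: "x \<notin> N" and \<alpha>: "0 < \<alpha>" "\<alpha> < pi / 2" and k: "0 < k" and r: "0 < r"
      and om: "\<forall>z\<in>cone 1 \<alpha> x. norm (z - of_real x) < k \<longrightarrow> r \<le> norm (G z - q)" for x \<alpha> k q r
  proof -
    have ta: "0 < tan \<alpha>" using tan_gt_0 \<alpha> .
    obtain n :: nat where n: "1 / real (Suc n) < tan \<alpha>" using nat_approx_posE[OF ta] .
    define m where "m = 1 / real (Suc n)"
    have m: "0 < m" "m < tan \<alpha>" using n by (auto simp: m_def)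
    obtain j :: nat where j: "1 / real (Suc j) < k / (m + 1)" using nat_approx_posE[of "k / (m + 1)"] k m by auto
    \<comment> \<open>Moving the centre by less than \<open>r / 2\<close> leaves an omitted disc of
      radius \<open>r / 2\<close> around it.\<close>
    obtain q' where q': "q' \<in> Q" "norm (q - q') < r / 2" using Q(2)[of "r / 2" q] r by auto
    obtain i :: nat where i: "1 / real (Suc i) < r / 2" using nat_approx_posE[of "r / 2"] r by auto
    have "1 / real (Suc i) \<le> norm (G z - q')" if z: "z \<in> sector m (1 / real (Suc j)) x" for z
    proof -
      have z': "0 < Im z" "\<bar>Re z - x\<bar> < m * Im z" "Im z < 1 / real (Suc j)" using z by (auto simp: sector_def)
      have "m * Im z \<le> tan \<alpha> * Im z" using m z' by (intro mult_right_mono) auto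
      then have "\<bar>Re z - x\<bar> < tan \<alpha> * Im z" using z'(2) by linarith
      then have zc: "z \<in> cone 1 \<alpha> x" using z'(1) by (simp add: cone_def)
      have "norm (z - of_real x) \<le> \<bar>Re z - x\<bar> + \<bar>Im z\<bar>" using cmod_le[of "z - of_real x"] by simp
      also have "\<dots> < (m + 1) * Im z" using z' by (simp add: distrib_right)
      also have "\<dots> < (m + 1) * (k / (m + 1))" using z'(3) j m by (intro mult_strict_left_mono) auto
      also have "\<dots> = k" using m by simp
      finally have "r \<le> norm (G z - q)" using om zc by blast
      moreover have "norm (G z - q) \<le> norm (G z - q') + norm (q' - q)" using norm_triangle_ineq[of "G z - q'" "q' - q"] by simp
      ultimately show ?thesis using q'(2) i by (simp add: norm_minus_commute)
    qed
    moreover have "x \<notin> B m (1 / real (Suc j)) (1 / real (Suc i)) q'" using x q'(1) unfolding N_def m_def by blast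
    ultimately obtain M k' where M: "0 < k'" "\<And>z. z \<in> sector (m / 2) k' x \<Longrightarrow> norm (G z) \<le> M"
      unfolding B_def by (auto simp: not_less)
    show ?thesis
    proof (intro exI conjI ballI impI)
      show "0 < arctan (m / 2)" "arctan (m / 2) < pi / 2" using m arctan_ubound by auto
      show "0 < k'" by (rule M(1))
      fix z assume z: "z \<in> cone 1 (arctan (m / 2)) x" "norm (z - of_real x) < k'"
      have "Im z < k'" using z(2) abs_Im_le_cmod[of "z - of_real x"] by simp
      then have "z \<in> sector (m / 2) k' x" using z(1) by (simp add: cone_def sector_def tan_arctan)
      then show "norm (G z) \<le> M" by (rule M(2))
    qed
  qed
  then have "{x. \<not> ((\<exists>\<alpha> k q r. 0 < \<alpha> \<and> \<alpha> < pi / 2 \<and> 0 < k \<and> 0 < r \<and> (\<forall>z\<in>cone 1 \<alpha> x. norm (z - of_real x) < k \<longrightarrow> r \<le> norm (G z - q))) \<longrightarrow>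
    (\<exists>\<alpha> k M. 0 < \<alpha> \<and> \<alpha> < pi / 2 \<and> 0 < k \<and> (\<forall>z\<in>cone 1 \<alpha> x. norm (z - of_real x) < k \<longrightarrow> norm (G z) \<le> M)))} \<subseteq> N"
    by blast
  ultimately show ?thesis unfolding AE_lborel_negligible by (rule negligible_subset)
qed

lemma cone_cnj: "cnj z \<in> cone e \<alpha> x \<longleftrightarrow> z \<in> cone (- e) \<alpha> x"
  by (simp add: cone_def)

text \<open>Conjugating argument and value of \<open>G\<close> gives a holomorphic function on the
  upper half-plane, which reduces the lower side to the upper one.\<close>

theorem AE_nt_bounded:
  assumes e: "e = 1 \<or> e = - 1" and G: "G holomorphic_on half_plane e"
  shows "AE x in lborel.
    (\<exists>\<alpha> k q r. 0 < \<alpha> \<and> \<alpha> < pi / 2 \<and> 0 < k \<and> 0 < r \<and> (\<forall>z\<in>cone e \<alpha> x. norm (z - of_real x) < k \<longrightarrow> r \<le> norm (G z - q))) \<longrightarrow>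
    (\<exists>\<alpha> k M. 0 < \<alpha> \<and> \<alpha> < pi / 2 \<and> 0 < k \<and> (\<forall>z\<in>cone e \<alpha> x. norm (z - of_real x) < k \<longrightarrow> norm (G z) \<le> M))"
  using e
proof
  assume "e = 1" then show ?thesis using AE_nt_bounded_upper G by simp
next
  assume em: "e = - 1"
  define H where "H = cnj \<circ> G \<circ> cnj"
  have "cnj ` half_plane 1 = half_plane (- 1)"
  proof (intro equalityI subsetI)
    fix z assume "z \<in> half_plane (- 1)"
    then show "z \<in> cnj ` half_plane 1" by (intro image_eqI[of _ _ "cnj z"]) (auto simp: half_plane_def)
  qed (auto simp: half_plane_def)
  then have "H holomorphic_on half_plane 1"
    using G em unfolding H_def by (intro holomorphic_on_compose_cnj_cnj open_half_plane) simp
  from AE_nt_bounded_upper[OF this] show ?thesis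
  proof eventually_elim
    case (elim x)
    have nc: "norm (cnj z - of_real x) = norm (z - of_real x)" for z
      by (metis complex_cnj_complex_of_real complex_cnj_diff complex_mod_cnj)
    have nq: "norm (cnj w - q) = norm (w - cnj q)" for w q
      by (metis complex_cnj_cnj complex_cnj_diff complex_mod_cnj)
    have mem: "z \<in> cone 1 \<alpha> x \<Longrightarrow> cnj z \<in> cone e \<alpha> x" "z \<in> cone e \<alpha> x \<Longrightarrow> cnj z \<in> cone 1 \<alpha> x" for z \<alpha>
      using em cone_cnj[of z "- 1" \<alpha> x] cone_cnj[of z 1 \<alpha> x] by auto
    show ?case
    proof
      assume "\<exists>\<alpha> k q r. 0 < \<alpha> \<and> \<alpha> < pi / 2 \<and> 0 < k \<and> 0 < r \<and> (\<forall>z\<in>cone e \<alpha> x. norm (z - of_real x) < k \<longrightarrow> r \<le> norm (G z - q))"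
      then obtain \<alpha> k q r where a: "0 < \<alpha>" "\<alpha> < pi / 2" "0 < k" "0 < r"
        "\<forall>z\<in>cone e \<alpha> x. norm (z - of_real x) < k \<longrightarrow> r \<le> norm (G z - q)" by blast
      have "\<forall>z\<in>cone 1 \<alpha> x. norm (z - of_real x) < k \<longrightarrow> r \<le> norm (H z - cnj q)"
        using a(5) mem(1) nc by (auto simp: H_def nq)
      then obtain \<alpha>' k' M where b: "0 < \<alpha>'" "\<alpha>' < pi / 2" "0 < k'"
        "\<forall>z\<in>cone 1 \<alpha>' x. norm (z - of_real x) < k' \<longrightarrow> norm (H z) \<le> M"
        using elim a(1-4) by blast
      have "norm (G z) \<le> M" if "z \<in> cone e \<alpha>' x" "norm (z - of_real x) < k'" for z
        using b(4)[rule_format, OF mem(2)[OF that(1)]] that(2) nc by (simp add: H_def)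
      then show "\<exists>\<alpha> k M. 0 < \<alpha> \<and> \<alpha> < pi / 2 \<and> 0 < k \<and> (\<forall>z\<in>cone e \<alpha> x. norm (z - of_real x) < k \<longrightarrow> norm (G z) \<le> M)"
        using b(1-3) by blast
    qed
  qed
qed

section \<open>Transport of limits and parametrisations by homeomorphisms\<close>

lemma tendsto_image_homeo:
  fixes \<Phi> :: "complex \<Rightarrow> complex"
  assumes cont: "continuous_on T \<Phi>" and inj: "inj_on \<Phi> T" and inv: "continuous_on (\<Phi> ` T) (inv_into T \<Phi>)"
    and S: "S \<subseteq> T" "x \<in> T"
  shows "(R \<longlongrightarrow> l) (at (\<Phi> x) within \<Phi> ` S) \<longleftrightarrow> ((\<lambda>z. R (\<Phi> z)) \<longlongrightarrow> l) (at x within S)"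
proof
  assume R: "(R \<longlongrightarrow> l) (at (\<Phi> x) within \<Phi> ` S)"
  have "filterlim \<Phi> (at (\<Phi> x) within \<Phi> ` S) (at x within S)"
    unfolding filterlim_at
  proof
    show "\<forall>\<^sub>F z in at x within S. \<Phi> z \<in> \<Phi> ` S \<and> \<Phi> z \<noteq> \<Phi> x"
      unfolding eventually_at using S inj by (intro exI[of _ 1]) (auto dest: inj_onD)
    show "(\<Phi> \<longlongrightarrow> \<Phi> x) (at x within S)"
      using cont S by (auto simp: continuous_on_def intro: tendsto_within_subset)
  qed
  then show "((\<lambda>z. R (\<Phi> z)) \<longlongrightarrow> l) (at x within S)" by (rule filterlim_compose[OF R])
next
  assume R: "((\<lambda>z. R (\<Phi> z)) \<longlongrightarrow> l) (at x within S)"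
  let ?J = "inv_into T \<Phi>"
  have J: "?J (\<Phi> z) = z" if "z \<in> T" for z using inj that by simp
  have "filterlim ?J (at x within S) (at (\<Phi> x) within \<Phi> ` S)"
    unfolding filterlim_at
  proof
    show "\<forall>\<^sub>F w in at (\<Phi> x) within \<Phi> ` S. ?J w \<in> S \<and> ?J w \<noteq> x"
      unfolding eventually_at using S J by (intro exI[of _ 1]) (auto simp: subset_iff)
    have "(?J \<longlongrightarrow> ?J (\<Phi> x)) (at (\<Phi> x) within \<Phi> ` T)"
      using inv S(2) by (auto simp: continuous_on_def)
    then show "(?J \<longlongrightarrow> x) (at (\<Phi> x) within \<Phi> ` S)"
      using J[OF S(2)] S(1) by (auto intro: tendsto_within_subset)
  qed
  from filterlim_compose[OF R this] have lim: "((\<lambda>w. R (\<Phi> (?J w))) \<longlongrightarrow> l) (at (\<Phi> x) within \<Phi> ` S)" .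
  show "(R \<longlongrightarrow> l) (at (\<Phi> x) within \<Phi> ` S)"
  proof (rule Lim_transform_eventually[OF lim])
    show "\<forall>\<^sub>F w in at (\<Phi> x) within \<Phi> ` S. R (\<Phi> (?J w)) = R w"
      unfolding eventually_at using J S(1) by (intro exI[of _ 1]) (auto simp: subset_iff)
  qed
qed

lemma locally_abs_cont_reflect:
  assumes "locally_abs_cont f" shows "locally_abs_cont (\<lambda>x. f (- x))"
  unfolding locally_abs_cont_def
proof (intro allI impI)
  fix a b \<epsilon> :: real assume "a \<le> b" "0 < \<epsilon>"
  then obtain \<delta> where \<delta>: "\<delta> > 0" "\<And>(n::nat) l r. (\<forall>i<n. - b \<le> l i \<and> l i \<le> r i \<and> r i \<le> - a) \<and>
      (\<forall>i<n. \<forall>j<n. i \<noteq> j \<longrightarrow> r i \<le> l j \<or> r j \<le> l i) \<and>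
      (\<Sum>i<n. r i - l i) < \<delta> \<Longrightarrow> (\<Sum>i<n. norm (f (r i) - f (l i))) < \<epsilon>"
    using assms[unfolded locally_abs_cont_def, rule_format, of "- b" "- a" \<epsilon>] by auto
  show "\<exists>\<delta>>0. \<forall>(n::nat) l r. (\<forall>i<n. a \<le> l i \<and> l i \<le> r i \<and> r i \<le> b) \<and>
      (\<forall>i<n. \<forall>j<n. i \<noteq> j \<longrightarrow> r i \<le> l j \<or> r j \<le> l i) \<and>
      (\<Sum>i<n. r i - l i) < \<delta> \<longrightarrow> (\<Sum>i<n. norm (f (- r i) - f (- l i))) < \<epsilon>"
  proof (intro exI[of _ \<delta>] conjI allI impI \<delta>(1))
    fix n :: nat and l r :: "nat \<Rightarrow> real"
    assume *: "(\<forall>i<n. a \<le> l i \<and> l i \<le> r i \<and> r i \<le> b) \<and> (\<forall>i<n. \<forall>j<n. i \<noteq> j \<longrightarrow> r i \<le> l j \<or> r j \<le> l i) \<and> (\<Sum>i<n. r i - l i) < \<delta>"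
    have "(\<Sum>i<n. norm (f (- l i) - f (- r i))) < \<epsilon>"
      using * by (intro \<delta>(2)) auto
    then show "(\<Sum>i<n. norm (f (- r i) - f (- l i))) < \<epsilon>" by (simp add: norm_minus_commute)
  qed
qed

lemma real_homeo_if_bij:
  assumes "continuous_on UNIV X" "strict_mono X" "surj X"
  shows "real_homeo X (inv X)"
proof -
  have inj: "inj X" using assms(2) by (rule strict_mono_imp_inj_on)
  have XI: "X (inv X y) = y" for y using assms(3) by (rule surj_f_inv_f)
  have mono: "strict_mono (inv X)" using assms(2) XI by (metis strict_mono_def strict_mono_less)
  have "surj (inv X)" using inj by (rule inj_imp_surj_inv)
  then have "continuous_on UNIV (inv X)"
    using mono by (intro continuous_onI_mono) (auto simp: strict_mono_less_eq)
  with assms inj XI mono show ?thesis by unfold_locales auto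
qed

section \<open>Boundary behaviour of the conformal maps\<close>

definition domain_side :: "real \<Rightarrow> (real \<Rightarrow> real) \<Rightarrow> complex set" where
  "domain_side e \<gamma> = {z. 0 < e * (Im z - \<gamma> (Re z))}"

lemma Omega_plus_eq: "Omega_plus \<gamma> = domain_side 1 \<gamma>"
  by (auto simp: Omega_plus_def domain_side_def)

lemma closure_domain_side:
  assumes \<gamma>: "continuous_on UNIV \<gamma>" and e: "e = 1 \<or> e = - 1"
  shows "closure (domain_side e \<gamma>) = {z. 0 \<le> e * (Im z - \<gamma> (Re z))}"
proof (rule antisym)
  show "closure (domain_side e \<gamma>) \<subseteq> {z. 0 \<le> e * (Im z - \<gamma> (Re z))}"
    by (rule closure_minimal)
      (auto simp: domain_side_def intro!: closed_Collect_le continuous_intros continuous_on_compose2[OF \<gamma>])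
  show "{z. 0 \<le> e * (Im z - \<gamma> (Re z))} \<subseteq> closure (domain_side e \<gamma>)"
  proof
    fix z assume z: "z \<in> {z. 0 \<le> e * (Im z - \<gamma> (Re z))}"
    have "(\<lambda>n. z + Complex 0 (e / real (Suc n))) \<longlonglongrightarrow> z + Complex 0 0"
      by (intro tendsto_intros LIMSEQ_Suc lim_const_over_n)
    moreover have "z + Complex 0 (e / real (Suc n)) \<in> domain_side e \<gamma>" for n
    proof -
      have "0 < 1 / real (Suc n)" by simp
      moreover have "e * (e / real (Suc n)) = 1 / real (Suc n)" using e by auto
      ultimately have "0 < e * (Im z - \<gamma> (Re z)) + e * (e / real (Suc n))" using z by (simp add: add_nonneg_pos)
      then show ?thesis by (simp add: domain_side_def algebra_simps)
    qed
    ultimately show "z \<in> closure (domain_side e \<gamma>)"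
      by (metis (no_types, lifting) add.right_neutral closure_sequential zero_complex.code)
  qed
qed

lemma open_domain_side:
  assumes "continuous_on UNIV \<gamma>" shows "open (domain_side e \<gamma>)"
  unfolding domain_side_def
  by (intro open_Collect_less continuous_intros continuous_on_compose2[OF assms]) auto

lemma Omega_minus_eq:
  assumes "continuous_on UNIV \<gamma>" shows "Omega_minus \<gamma> = domain_side (- 1) \<gamma>"
proof -
  have "Omega_minus \<gamma> = - closure (domain_side 1 \<gamma>)"
    by (simp add: Omega_minus_def Omega_plus_eq interior_complement)
  also have "\<dots> = domain_side (- 1) \<gamma>"
    unfolding closure_domain_side[OF assms, of 1, simplified] by (auto simp: domain_side_def not_le)
  finally show ?thesis .
qed

locale conformal_boundary =
  fixes e :: real and \<gamma> :: "real \<Rightarrow> real" and \<Phi> :: "complex \<Rightarrow> complex" and d\<Phi> :: "real \<Rightarrow> complex"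
  assumes e: "e = 1 \<or> e = - 1"
    and \<gamma>_cont: "continuous_on UNIV \<gamma>"
    and rectifiable: "locally_rectifiable (cparam \<gamma>)"
    and setting: "conformal_setting (half_plane e) (cone e) (domain_side e \<gamma>) \<Phi> d\<Phi>"
begin

abbreviation "H \<equiv> half_plane e"
abbreviation "\<Omega> \<equiv> domain_side e \<gamma>"

lemma
  shows \<Phi>_hol: "\<Phi> holomorphic_on H" and \<Phi>_inj: "inj_on \<Phi> H" and \<Phi>_image: "\<Phi> ` H = \<Omega>"
    and \<Phi>_cont: "continuous_on (closure H) \<Phi>" and \<Phi>_inj_cl: "inj_on \<Phi> (closure H)"
    and \<Phi>_image_cl: "\<Phi> ` closure H = closure \<Omega>"
    and \<Phi>_inv_cont: "continuous_on (closure \<Omega>) (inv_into (closure H) \<Phi>)"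
    and \<Phi>_ac: "locally_abs_cont (\<lambda>x. \<Phi> (complex_of_real x))"
    and \<Phi>_nt: "AE x in lborel. nt_conv (cone e) (deriv \<Phi>) x (d\<Phi> x) \<and> d\<Phi> x \<noteq> 0"
  using setting unfolding conformal_setting_def by (auto simp: AE_completion_iff)

lemma e0: "e \<noteq> 0" using e by auto

lemma closure_H: "closure H = {z. 0 \<le> e * Im z}" by (rule closure_half_plane[OF e0])

lemma real_in_closure [simp]: "complex_of_real x \<in> closure H" by (simp add: closure_H)

lemma real_notin_H [simp]: "complex_of_real x \<notin> H" by (simp add: half_plane_def)

definition X where "X x = Re (\<Phi> (complex_of_real x))"

text \<open>The open half-plane already exhausts the domain, so injectivity on the closed half-plane
  forces real points onto the boundary curve.\<close>

lemma \<Phi>_real: "\<Phi> (complex_of_real x) = cparam \<gamma> (X x)"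
proof -
  have "\<Phi> (of_real x) \<in> closure \<Omega>" using \<Phi>_image_cl real_in_closure by blast
  moreover have "\<Phi> (of_real x) \<notin> \<Omega>"
  proof
    assume "\<Phi> (of_real x) \<in> \<Omega>"
    then obtain z where z: "z \<in> H" "\<Phi> z = \<Phi> (of_real x)" using \<Phi>_image by (metis imageE)
    then have "z = of_real x" using \<Phi>_inj_cl closure_subset by (metis inj_onD real_in_closure subsetD)
    then show False using z(1) by simp
  qed
  ultimately have "Im (\<Phi> (of_real x)) = \<gamma> (Re (\<Phi> (of_real x)))"
    using closure_domain_side[OF \<gamma>_cont e] e by (auto simp: domain_side_def)
  then show ?thesis by (simp add: cparam_def X_def complex_eq_iff)
qed

lemma X_inj: "inj X"
proof (rule injI)
  fix x y assume "X x = X y"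
  then have "\<Phi> (of_real x) = \<Phi> (of_real y)" by (simp add: \<Phi>_real)
  then have "complex_of_real x = of_real y" using \<Phi>_inj_cl by (auto dest: inj_onD)
  then show "x = y" by simp
qed

lemma X_surj: "surj X"
  unfolding surj_def
proof
  fix y
  have "cparam \<gamma> y \<in> closure \<Omega>" unfolding closure_domain_side[OF \<gamma>_cont e] by (simp add: cparam_def)
  then have "cparam \<gamma> y \<in> \<Phi> ` closure H" by (simp only: \<Phi>_image_cl)
  then obtain z where z: "cparam \<gamma> y = \<Phi> z" "z \<in> closure H" by (rule imageE)
  have "cparam \<gamma> y \<notin> \<Omega>" by (simp add: cparam_def domain_side_def)
  then have "z \<notin> H" using z(1) \<Phi>_image by blast
  then have "\<not> 0 < e * Im z" by (simp add: half_plane_def)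
  moreover have "0 \<le> e * Im z" using z(2) unfolding closure_H by simp
  ultimately have "e * Im z = 0" by simp
  then have "Im z = 0" using e0 by simp
  then have "z = of_real (Re z)" by (simp add: complex_eq_iff)
  then have "y = X (Re z)" using z(1) by (metis X_def cparam_def complex.sel(1))
  then show "\<exists>x. y = X x" by blast
qed

lemma X_cont: "continuous_on UNIV X"
  unfolding X_def by (intro continuous_intros continuous_on_compose2[OF \<Phi>_cont]) auto

text \<open>The orientation of the boundary map is not known yet; the sign \<open>\<tau>\<close> absorbs it.\<close>
lemma oriented:
  obtains \<tau> where "\<tau> = 1 \<or> \<tau> = - 1" "strict_mono (\<lambda>x. X (\<tau> * x))"
proof -
  have "strict_mono_on UNIV X \<or> strict_antimono_on UNIV X"
    using injective_eq_monotone_map[of UNIV X] X_cont X_inj is_interval_univ by blast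
  then show ?thesis
  proof
    assume "strict_mono_on UNIV X" then show ?thesis using that[of 1] by simp
  next
    assume a: "strict_antimono_on UNIV X"
    have "strict_mono (\<lambda>x. X (- 1 * x))"
      using a by (intro strict_monoI) (auto simp: monotone_on_def)
    then show ?thesis using that[of "- 1"] by blast
  qed
qed

lemma arc_param_oriented:
  assumes \<tau>: "\<tau> = 1 \<or> \<tau> = - 1" and mono: "strict_mono (\<lambda>x. X (\<tau> * x))"
  shows "arc_param \<gamma> (\<lambda>x. \<Phi> (of_real (\<tau> * x))) (\<lambda>x. X (\<tau> * x)) (inv (\<lambda>x. X (\<tau> * x)))"
proof (rule arc_param.intro)
  show "real_homeo (\<lambda>x. X (\<tau> * x)) (inv (\<lambda>x. X (\<tau> * x)))"
  proof (rule real_homeo_if_bij[OF _ mono])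
    show "continuous_on UNIV (\<lambda>x. X (\<tau> * x))"
      by (intro continuous_on_compose2[OF X_cont] continuous_intros) auto
    have "\<exists>x. y = X (\<tau> * x)" for y
    proof -
      obtain x where "y = X x" using X_surj by (metis surjD)
      then have "y = X (\<tau> * (\<tau> * x))" using \<tau> by auto
      then show ?thesis by blast
    qed
    then show "surj (\<lambda>x. X (\<tau> * x))" by (simp add: surj_def)
  qed
  show "locally_abs_cont (\<lambda>x. \<Phi> (of_real (\<tau> * x)))"
    using \<tau> \<Phi>_ac locally_abs_cont_reflect[OF \<Phi>_ac] by auto
qed (rule rectifiable \<Phi>_real)+

lemma negligible_scale: assumes "\<tau> = 1 \<or> \<tau> = - (1::real)" "negligible N" shows "negligible {x. \<tau> * x \<in> N}"
proof -
  have "{x. \<tau> * x \<in> N} = (\<lambda>x. \<tau> * x) ` N" using assms(1) by (auto simp: image_iff) (metis minus_minus)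
  then show ?thesis using negligible_lipschitz_image_real[OF assms(2), of "\<lambda>x. \<tau> * x" 1] assms(1) by auto
qed

lemma AE_scale: assumes "\<tau> = 1 \<or> \<tau> = - (1::real)" "AE x in lborel. P x" shows "AE x in lborel. P (\<tau> * x)"
  using negligible_scale[OF assms(1), of "{x. \<not> P x}"] assms(2) unfolding AE_lborel_negligible by simp

lemma AE_tangential_eq_nt:
  "AE x in lborel. nt_conv (cone e) (deriv \<Phi>) x (d\<Phi> x) \<and> d\<Phi> x \<noteq> 0 \<and>
    (\<forall>D. ((\<lambda>t. \<Phi> (of_real t)) has_vector_derivative D) (at x) \<longrightarrow> D = d\<Phi> x)"
proof -
  note AE_not_in[OF countable_imp_null_set_lborel[OF nt_derivative_eq_tangential[OF \<Phi>_hol \<Phi>_cont e]]]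
  then show ?thesis using \<Phi>_nt by eventually_elim blast
qed

lemma AE_tangent_scaled:
  assumes \<tau>: "\<tau> = 1 \<or> \<tau> = - 1" and mono: "strict_mono (\<lambda>x. X (\<tau> * x))"
  defines "f \<equiv> arc_param.f \<gamma> (\<lambda>x. X (\<tau> * x))" and "\<sigma> \<equiv> arc_param.\<sigma> \<gamma>"
  shows "AE x in lborel. nt_conv (cone e) (deriv \<Phi>) (\<tau> * x) (d\<Phi> (\<tau> * x)) \<and> d\<Phi> (\<tau> * x) \<noteq> 0 \<and>
    ((\<lambda>x. \<Phi> (of_real (\<tau> * x))) has_vector_derivative of_real \<tau> * d\<Phi> (\<tau> * x)) (at x) \<and>
    (f has_real_derivative norm (d\<Phi> (\<tau> * x))) (at x) \<and>
    (\<sigma> has_vector_derivative of_real \<tau> * d\<Phi> (\<tau> * x) / of_real (norm (d\<Phi> (\<tau> * x)))) (at (f x))"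
proof -
  interpret P: arc_param \<gamma> "\<lambda>x. \<Phi> (of_real (\<tau> * x))" "\<lambda>x. X (\<tau> * x)" "inv (\<lambda>x. X (\<tau> * x))"
    by (rule arc_param_oriented[OF \<tau> mono])
  have t2: "\<tau> * (\<tau> * x) = x" for x using \<tau> by auto
  have nt: "AE x in lborel. nt_conv (cone e) (deriv \<Phi>) (\<tau> * x) (d\<Phi> (\<tau> * x)) \<and> d\<Phi> (\<tau> * x) \<noteq> 0 \<and>
    (\<forall>D. ((\<lambda>t. \<Phi> (of_real t)) has_vector_derivative D) (at (\<tau> * x)) \<longrightarrow> D = d\<Phi> (\<tau> * x))"
    by (rule AE_scale[OF \<tau> AE_tangential_eq_nt])
  have sc: "((\<lambda>t. \<Phi> (of_real t)) has_vector_derivative of_real \<tau> * D) (at (\<tau> * x))"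
    if "((\<lambda>x. \<Phi> (of_real (\<tau> * x))) has_vector_derivative D) (at x)" for x D
  proof -
    have "((\<lambda>x. \<tau> * x) has_vector_derivative \<tau>) (at (\<tau> * x))" by (auto intro!: derivative_eq_intros)
    moreover have "((\<lambda>x. \<Phi> (of_real (\<tau> * x))) has_vector_derivative D) (at (\<tau> * (\<tau> * x)))"
      unfolding t2 by (rule that)
    ultimately have "((\<lambda>x. \<Phi> (of_real (\<tau> * x))) \<circ> (\<lambda>x. \<tau> * x) has_vector_derivative \<tau> *\<^sub>R D) (at (\<tau> * x))"
      by (rule vector_diff_chain_at)
    then show ?thesis unfolding o_def t2 scaleR_conv_of_real .
  qed
  have "AE x in lborel. \<forall>D. ((\<lambda>x. \<Phi> (of_real (\<tau> * x))) has_vector_derivative D) (at x) \<longrightarrow> D \<noteq> 0"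
    using nt
  proof eventually_elim
    case (elim x) then show ?case using sc[of _ x] by force
  qed
  from P.tangent[OF this] nt show ?thesis
  proof eventually_elim
    case (elim x)
    then obtain D where D: "D \<noteq> 0" "((\<lambda>x. \<Phi> (of_real (\<tau> * x))) has_vector_derivative D) (at x)"
      "(P.f has_real_derivative norm D) (at x)" "(P.\<sigma> has_vector_derivative D / of_real (norm D)) (at (P.f x))" by blast
    have "of_real \<tau> * D = d\<Phi> (\<tau> * x)" using sc[OF D(2)] elim(2) by blast
    moreover have "D = of_real \<tau> * (of_real \<tau> * D)" using \<tau> by auto
    ultimately have "D = of_real \<tau> * d\<Phi> (\<tau> * x)" by metis
    moreover from this have "norm D = norm (d\<Phi> (\<tau> * x))" using \<tau> by auto
    ultimately show ?case using D elim(2) by (simp add: f_def \<sigma>_def)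
  qed
qed

text \<open>At a point where the tangent \<open>D\<close> is not vertical, the image of a vertical
  ray enters \<open>\<Omega>\<close>, so its signed height over the curve has a nonnegative
  one-sided derivative. This derivative is \<open>\<tau>\<close> times a positive number, which
  rules out \<open>\<tau> = - 1\<close>.\<close>

lemma oriented_positively: "strict_mono X"
proof -
  obtain \<tau> where \<tau>: "\<tau> = 1 \<or> \<tau> = - 1" and mono: "strict_mono (\<lambda>x. X (\<tau> * x))" using oriented .
  interpret P: arc_param \<gamma> "\<lambda>x. \<Phi> (of_real (\<tau> * x))" "\<lambda>x. X (\<tau> * x)" "inv (\<lambda>x. X (\<tau> * x))"
    by (rule arc_param_oriented[OF \<tau> mono])
  define Z where "Z = inv (\<lambda>x. X (\<tau> * x))"
  note ae = AE_tangent_scaled[OF \<tau> mono]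
  define Gd where "Gd x \<longleftrightarrow> nt_conv (cone e) (deriv \<Phi>) (\<tau> * x) (d\<Phi> (\<tau> * x)) \<and> d\<Phi> (\<tau> * x) \<noteq> 0 \<and>
    ((\<lambda>x. \<Phi> (of_real (\<tau> * x))) has_vector_derivative of_real \<tau> * d\<Phi> (\<tau> * x)) (at x) \<and>
    (P.\<sigma> has_vector_derivative of_real \<tau> * d\<Phi> (\<tau> * x) / of_real (norm (d\<Phi> (\<tau> * x)))) (at (P.f x))" for x
  have nG: "negligible {x. \<not> Gd x}"
    using ae unfolding AE_lborel_negligible Gd_def by (rule negligible_subset) blast
  \<comment> \<open>If the tangent were vertical at all good points, the abscissa \<open>P.r\<close>
    as a function of arc length would have derivative 0 off a null set. Its range, which is the
    whole line, would then be negligible.\<close>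
  have "\<exists>x. Gd x \<and> Re (of_real \<tau> * d\<Phi> (\<tau> * x)) \<noteq> 0"
  proof (rule ccontr)
    assume neg: "\<not> (\<exists>x. Gd x \<and> Re (of_real \<tau> * d\<Phi> (\<tau> * x)) \<noteq> 0)"
    have "(P.r has_real_derivative 0) (at t)" if "t \<notin> P.f ` {x. \<not> Gd x}" for t
    proof -
      obtain x where x: "t = P.f x" using P.f.fg by metis
      then have g: "Gd x" "Re (of_real \<tau> * d\<Phi> (\<tau> * x)) = 0" using that neg by auto
      let ?w = "of_real \<tau> * d\<Phi> (\<tau> * x) / of_real (norm (d\<Phi> (\<tau> * x)))"
      have "(P.\<sigma> has_vector_derivative ?w) (at t)" using g(1) x by (simp add: Gd_def)
      then have "((\<lambda>t. Re (P.\<sigma> t)) has_vector_derivative Re ?w) (at t)"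
        by (rule bounded_linear.has_vector_derivative[OF bounded_linear_Re])
      moreover have w0: "Re ?w = 0" using g(2) unfolding Re_divide_of_real by simp
      ultimately show ?thesis unfolding w0 P.Re_Im_\<sigma> has_real_derivative_iff_has_vector_derivative by simp
    qed
    then have "P.r ` UNIV \<subseteq> P.r ` {t. (P.r has_real_derivative 0) (at t)} \<union> P.r ` (P.f ` {x. \<not> Gd x})" by blast
    moreover have "negligible (P.r ` (P.f ` {x. \<not> Gd x}))"
      by (rule negligible_lipschitz_image_real[OF P.f_image_negligible[OF nG] P.r_lipschitz])
    ultimately have "negligible (P.r ` UNIV)"
      using P.r.negligible_image_deriv_0 negligible_Un negligible_subset by blast
    moreover have "P.r ` UNIV = UNIV" using P.r.fg by (metis surjI)
    ultimately show False by simp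
  qed
  then obtain x where x: "Gd x" "Re (of_real \<tau> * d\<Phi> (\<tau> * x)) \<noteq> 0" by blast
  define D where "D = of_real \<tau> * d\<Phi> (\<tau> * x)"
  define x1 where "x1 = \<tau> * x"
  have dD: "d\<Phi> x1 = of_real \<tau> * D" using \<tau> by (auto simp: D_def x1_def)
  have D: "((\<lambda>x. \<Phi> (of_real (\<tau> * x))) has_vector_derivative D) (at x)" "Re D \<noteq> 0"
    using x by (auto simp: Gd_def D_def)
  have Y': "((\<lambda>x. X (\<tau> * x)) has_real_derivative Re D) (at x)"
    using bounded_linear.has_vector_derivative[OF bounded_linear_Re D(1)]
    by (simp add: X_def has_real_derivative_iff_has_vector_derivative)
  have ReD: "Re D > 0" using P.Y.deriv_nonneg[OF Y'] D(2) by simp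
  have Z': "(Z has_real_derivative inverse (Re D)) (at (X (\<tau> * x)))"
  proof (rule DERIV_inverse_function[where f = "\<lambda>x. X (\<tau> * x)" and a = "X (\<tau> * x) - 1" and b = "X (\<tau> * x) + 1"])
    show "((\<lambda>x. X (\<tau> * x)) has_real_derivative Re D) (at (Z (X (\<tau> * x))))" using Y' by (simp add: Z_def)
    show "isCont Z (X (\<tau> * x))" using P.Y.g_cont by (simp add: Z_def continuous_on_eq_continuous_at)
  qed (use D(2) in \<open>auto simp: Z_def\<close>)
  \<comment> \<open>Nothing is known of \<open>\<gamma>\<close> in general. At this one point it is
    differentiable, because the abscissa has a nonzero derivative there and can be inverted.\<close>
  have \<gamma>': "(\<gamma> has_real_derivative Im D * inverse (Re D)) (at (X (\<tau> * x)))"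
  proof -
    have "((\<lambda>x. Im (\<Phi> (of_real (\<tau> * x)))) has_real_derivative Im D) (at (Z (X (\<tau> * x))))"
      using bounded_linear.has_vector_derivative[OF bounded_linear_Im D(1)]
      by (simp add: Z_def has_real_derivative_iff_has_vector_derivative)
    from DERIV_chain2[OF this Z'] have "((\<lambda>y. Im (\<Phi> (of_real (\<tau> * Z y)))) has_real_derivative Im D * inverse (Re D)) (at (X (\<tau> * x)))" .
    moreover have "Im (\<Phi> (of_real (\<tau> * Z y))) = \<gamma> y" for y
      using P.Y.fg[of y] unfolding \<Phi>_real by (simp add: cparam_def Z_def)
    ultimately show ?thesis by simp
  qed
  define p where "p t = \<Phi> (Complex x1 (e * t))" for t
  have p0: "p 0 = \<Phi> (of_real x1)" by (simp add: p_def complex_of_real_def)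
  have lim: "((\<lambda>t. (p t - p 0) / of_real t) \<longlongrightarrow> \<i> * of_real e * (of_real \<tau> * D)) (at_right 0)"
    using vertical_derivative[OF \<Phi>_hol \<Phi>_cont e, of x1 "d\<Phi> x1"] x(1) unfolding p0 unfolding p_def
    by (simp add: Gd_def x1_def[symmetric] dD)
  have Rp: "((\<lambda>t. Re (p t)) has_real_derivative - (e * \<tau> * Im D)) (at 0 within {0<..})"
    using tendsto_Re[OF lim] by (simp add: has_field_derivative_iff Re_divide_of_real mult.assoc)
  have Ip: "((\<lambda>t. Im (p t)) has_real_derivative e * \<tau> * Re D) (at 0 within {0<..})"
    using tendsto_Im[OF lim] by (simp add: has_field_derivative_iff Im_divide_of_real mult.assoc)
  have Rp0: "Re (p 0) = X (\<tau> * x)" by (simp add: p0 X_def x1_def)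
  have g: "((\<lambda>t. \<gamma> (Re (p t))) has_real_derivative (Im D * inverse (Re D)) * (- (e * \<tau> * Im D))) (at 0 within {0<..})"
    by (rule DERIV_chain2[OF _ Rp]) (use \<gamma>' Rp0 in simp)
  have "((\<lambda>t. e * (Im (p t) - \<gamma> (Re (p t)))) has_real_derivative
      e * (e * \<tau> * Re D - (Im D * inverse (Re D)) * (- (e * \<tau> * Im D)))) (at 0 within {0<..})"
    by (rule DERIV_cmult[OF DERIV_diff[OF Ip g]])
  then have hl: "((\<lambda>t. (e * (Im (p t) - \<gamma> (Re (p t))) - e * (Im (p 0) - \<gamma> (Re (p 0)))) / (t - 0)) \<longlongrightarrow>
      e * (e * \<tau> * Re D - (Im D * inverse (Re D)) * (- (e * \<tau> * Im D)))) (at_right 0)"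
    by (simp add: has_field_derivative_iff)
  have h0: "e * (Im (p 0) - \<gamma> (Re (p 0))) = 0" using p0 \<Phi>_real[of x1] by (simp add: cparam_def)
  have "0 \<le> e * (e * \<tau> * Re D - (Im D * inverse (Re D)) * (- (e * \<tau> * Im D)))"
  proof (rule tendsto_lowerbound[OF hl])
    have "0 \<le> (e * (Im (p t) - \<gamma> (Re (p t))) - e * (Im (p 0) - \<gamma> (Re (p 0)))) / (t - 0)" if "0 < t" for t
    proof -
      have "Complex x1 (e * t) \<in> H" using that e by (auto simp: half_plane_def)
      then have "p t \<in> \<Omega>" using \<Phi>_image by (auto simp: p_def)
      then show ?thesis using that unfolding h0 by (simp add: domain_side_def)
    qed
    then show "\<forall>\<^sub>F t in at_right 0. 0 \<le> (e * (Im (p t) - \<gamma> (Re (p t))) - e * (Im (p 0) - \<gamma> (Re (p 0)))) / (t - 0)"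
      unfolding eventually_at_right_field by (intro exI[of _ 1]) auto
  qed simp
  also have "e * (e * \<tau> * Re D - (Im D * inverse (Re D)) * (- (e * \<tau> * Im D))) = (e * e) * \<tau> * (Re D + (Im D)\<^sup>2 / Re D)"
    by (simp add: power2_eq_square algebra_simps divide_inverse)
  also have "e * e = 1" using e by auto
  finally have "0 \<le> \<tau> * (Re D + (Im D)\<^sup>2 / Re D)" by simp
  moreover have "0 < Re D + (Im D)\<^sup>2 / Re D" using ReD by (simp add: add_pos_nonneg)
  ultimately have "0 \<le> \<tau>" by (metis mult.commute mult_neg_pos not_le)
  then have "\<tau> = 1" using \<tau> by auto
  then show ?thesis using mono by simp
qed

definition XI where "XI = inv X"

sublocale arc_param \<gamma> "\<lambda>x. \<Phi> (complex_of_real x)" X XI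
  using arc_param_oriented[of 1] oriented_positively by (simp add: XI_def)

theorem AE_tangent:
  "AE x in lborel. nt_conv (cone e) (deriv \<Phi>) x (d\<Phi> x) \<and> d\<Phi> x \<noteq> 0 \<and>
    (f has_real_derivative norm (d\<Phi> x)) (at x) \<and>
    (\<sigma> has_vector_derivative d\<Phi> x / of_real (norm (d\<Phi> x))) (at (f x))"
  using AE_tangent_scaled[of 1] oriented_positively by simp

end

section \<open>Non-tangential limits, maximal functions and weighted norms\<close>

lemma nt_conv_cong:
  assumes "\<And>z. z \<in> half_plane e \<Longrightarrow> F z = G z"
  shows "nt_conv (cone e) F x l \<longleftrightarrow> nt_conv (cone e) G x l"
proof -
  have "(F \<longlongrightarrow> l) (at (complex_of_real x) within cone e \<alpha> x) \<longleftrightarrow> (G \<longlongrightarrow> l) (at (complex_of_real x) within cone e \<alpha> x)" for \<alpha>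
    using assms subsetD[OF cone_subset_half_plane] by (intro Lim_cong_within) blast+
  then show ?thesis by (simp add: nt_conv_def)
qed

lemma ntmax_cong:
  assumes "\<And>z. z \<in> half_plane e \<Longrightarrow> F z = G z"
  shows "ntmax (cone e) \<alpha> F = ntmax (cone e) \<alpha> G"
proof -
  have "F z = G z" if "z \<in> cone e \<alpha> x" for z x
    using assms subsetD[OF cone_subset_half_plane that] by blast
  then show ?thesis unfolding ntmax_def by (intro ext SUP_cong) simp_all
qed

lemma nt_conv_bounded:
  assumes "nt_conv (cone e) F x (l :: real)"
  obtains \<alpha> k M where "0 < \<alpha>" "\<alpha> < pi / 2" "0 < k" "\<And>z. z \<in> cone e \<alpha> x \<Longrightarrow> norm (z - of_real x) < k \<Longrightarrow> \<bar>F z\<bar> \<le> M"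
proof -
  obtain \<alpha> where a: "0 < \<alpha>" "\<alpha> < pi / 2" "(F \<longlongrightarrow> l) (at (of_real x) within cone e \<alpha> x)"
    using assms by (auto simp: nt_conv_def)
  have "\<forall>\<^sub>F z in at (of_real x) within cone e \<alpha> x. dist (F z) l < 1" using tendstoD[OF a(3), of 1] by simp
  then obtain k where k: "k > 0" "\<And>z. z \<in> cone e \<alpha> x \<Longrightarrow> z \<noteq> of_real x \<Longrightarrow> dist z (of_real x) < k \<Longrightarrow> dist (F z) l < 1"
    unfolding eventually_at by blast
  have "\<bar>F z\<bar> \<le> \<bar>l\<bar> + 1" if "z \<in> cone e \<alpha> x" "norm (z - of_real x) < k" for z
  proof -
    have "z \<noteq> of_real x" using that(1) by (auto simp: cone_def)
    then show ?thesis using k(2)[OF that(1)] that(2) by (auto simp: dist_norm)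
  qed
  then show ?thesis using that a k(1) by blast
qed

text \<open>The limit may be known in a cone of a different aperture than that of the maximal
  function; the smaller of the two cones serves both.\<close>

lemma nt_conv_le_ntmax:
  assumes e: "e = 1 \<or> e = - 1" and nt: "nt_conv (cone e) F x (l :: real)"
    and le: "\<And>z. z \<in> half_plane e \<Longrightarrow> \<bar>F z\<bar> \<le> norm (G z)" and \<alpha>: "0 < \<alpha>" "\<alpha> < pi / 2"
  shows "ennreal \<bar>l\<bar> \<le> ntmax (cone e) \<alpha> G x"
proof -
  obtain \<beta> where b: "0 < \<beta>" "\<beta> < pi / 2" "(F \<longlongrightarrow> l) (at (of_real x) within cone e \<beta> x)"
    using nt by (auto simp: nt_conv_def)
  define \<delta> where "\<delta> = min \<alpha> \<beta>"
  have d: "0 < \<delta>" "\<delta> < pi / 2" "\<delta> \<le> \<alpha>" "\<delta> \<le> \<beta>" using \<alpha> b by (auto simp: \<delta>_def)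
  have "(F \<longlongrightarrow> l) (at (of_real x) within cone e \<delta> x)" by (rule nt_conv_mono[OF b(3) d(1,4) b(2)])
  then have lim: "((\<lambda>z. ennreal \<bar>F z\<bar>) \<longlongrightarrow> ennreal \<bar>l\<bar>) (at (of_real x) within cone e \<delta> x)"
    by (intro tendsto_ennrealI tendsto_rabs)
  show ?thesis
  proof (rule tendsto_upperbound[OF lim _ trivial_limit_cone[OF e d(1,2)]])
    have "ennreal \<bar>F z\<bar> \<le> ntmax (cone e) \<alpha> G x" if "z \<in> cone e \<delta> x" for z
    proof -
      have "z \<in> cone e \<alpha> x" using cone_mono[OF d(1,3) \<alpha>(2)] that by blast
      moreover have "\<bar>F z\<bar> \<le> norm (G z)" using le that cone_subset_half_plane by blast
      ultimately show ?thesis unfolding ntmax_def by (intro SUP_upper2[of z] ennreal_leI)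
    qed
    then show "\<forall>\<^sub>F z in at (of_real x) within cone e \<delta> x. ennreal \<bar>F z\<bar> \<le> ntmax (cone e) \<alpha> G x"
      unfolding eventually_at by (intro exI[of _ 1]) auto
  qed
qed

text \<open>The limit along one fixed sequence on the vertical is Borel in \<open>x\<close> and
  agrees with every non-tangential limit, since the vertical lies in all cones.\<close>

lemma nt_conv_borel_version:
  assumes e: "e = 1 \<or> e = - 1" and F: "continuous_on (half_plane e) (F :: complex \<Rightarrow> real)"
  obtains b where "b \<in> borel_measurable borel" "\<And>x l. nt_conv (cone e) F x l \<Longrightarrow> b x = l"
proof -
  define c where "c n = e * (1 / real (Suc n))" for n
  have cp: "0 < e * c n" for n using e by (auto simp: c_def)
  define b where "b x = lim (\<lambda>n. F (Complex x (c n)))" for x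
  have "(\<lambda>x. F (Complex x (c n))) \<in> borel_measurable borel" for n
  proof (rule borel_measurable_continuous_onI)
    show "continuous_on UNIV (\<lambda>x. F (Complex x (c n)))"
      by (rule continuous_on_compose2[OF F]) (auto simp: Complex_eq half_plane_def cp intro!: continuous_intros)
  qed
  then have "b \<in> borel_measurable borel" unfolding b_def by measurable
  moreover have "b x = l" if nt: "nt_conv (cone e) F x l" for x l
  proof -
    obtain \<alpha> where a: "0 < \<alpha>" "\<alpha> < pi / 2" "(F \<longlongrightarrow> l) (at (of_real x) within cone e \<alpha> x)"
      using nt by (auto simp: nt_conv_def)
    have "filterlim (\<lambda>n. Complex x (c n)) (at (of_real x) within cone e \<alpha> x) sequentially"
      unfolding filterlim_at
    proof
      have "(\<lambda>n. Complex x (c n)) \<longlonglongrightarrow> Complex x (e * 0)"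
        unfolding c_def by (intro tendsto_intros LIMSEQ_Suc[OF lim_const_over_n])
      then show "(\<lambda>n. Complex x (c n)) \<longlonglongrightarrow> of_real x" by (simp add: complex_of_real_def)
      have "Complex x (c n) \<in> cone e \<alpha> x" for n
        unfolding c_def by (rule vertical_in_cone[OF e _ a(1,2)]) simp
      moreover have "Complex x (c n) \<noteq> of_real x" for n using cp[of n] by (auto simp: complex_eq_iff)
      ultimately show "\<forall>\<^sub>F n in sequentially. Complex x (c n) \<in> cone e \<alpha> x \<and> Complex x (c n) \<noteq> of_real x" by simp
    qed
    from filterlim_compose[OF a(3) this] show ?thesis unfolding b_def by (rule limI)
  qed
  ultimately show ?thesis by (rule that)
qed

lemma inward_normal_unique:
  assumes "inward_normal \<gamma> \<xi> N" "inward_normal \<gamma> \<xi> N'" shows "N = N'"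
proof -
  obtain x T where x: "\<xi> = cparam \<gamma> x" "((\<lambda>y. (cparam \<gamma> y - cparam \<gamma> x) / complex_of_real (arclen_fun \<gamma> y - arclen_fun \<gamma> x)) \<longlongrightarrow> T) (at x)" "N = \<i> * T"
    using assms(1) unfolding inward_normal_def by blast
  obtain x' T' where x': "\<xi> = cparam \<gamma> x'" "((\<lambda>y. (cparam \<gamma> y - cparam \<gamma> x') / complex_of_real (arclen_fun \<gamma> y - arclen_fun \<gamma> x')) \<longlongrightarrow> T') (at x')" "N' = \<i> * T'"
    using assms(2) unfolding inward_normal_def by blast
  have "x = x'" using x(1) x'(1) by (simp add: cparam_def)
  then have "T = T'" using x(2) x'(2) by (auto intro: tendsto_unique[OF trivial_limit_at])
  then show ?thesis using x(3) x'(3) by simp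
qed

lemma enn_powr_ennreal: "0 \<le> a \<Longrightarrow> enn_powr (ennreal a) q = ennreal (a powr q)"
  by (simp add: enn_powr_def)

lemma enn_powr_mono:
  assumes "a \<le> b" "0 \<le> q" shows "enn_powr a q \<le> enn_powr b q"
proof (cases "b = \<infinity>")
  case False
  then have "a \<noteq> \<infinity>" using assms(1) by (auto simp: top_unique)
  then show ?thesis using False assms
    by (auto simp: enn_powr_def less_top intro!: ennreal_leI powr_mono2 enn2real_mono)
qed (simp add: enn_powr_def)

lemma lpnorm_mono_AE:
  assumes "AE x in M. F x \<le> G x" "AE x in M. w x = w' x" "0 < p"
  shows "lpnorm M p w F \<le> lpnorm M p w' G"
  unfolding lpnorm_def
proof (intro enn_powr_mono nn_integral_mono_AE)
  show "AE x in M. enn_powr (F x) p * ennreal (w x) \<le> enn_powr (G x) p * ennreal (w' x)"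
    using assms(1,2) by eventually_elim (use assms(3) in \<open>auto intro!: mult_right_mono enn_powr_mono\<close>)
qed (use assms(3) in simp)

section \<open>Arc length measure and norms in boundary coordinates\<close>

context conformal_boundary
begin

definition good :: "real \<Rightarrow> bool" where
  "good x \<longleftrightarrow> nt_conv (cone e) (deriv \<Phi>) x (d\<Phi> x) \<and> d\<Phi> x \<noteq> 0 \<and>
    (f has_real_derivative norm (d\<Phi> x)) (at x) \<and>
    (\<sigma> has_vector_derivative d\<Phi> x / of_real (norm (d\<Phi> x))) (at (f x))"

lemma AE_good: "AE x in lborel. good x"
  unfolding good_def by (rule AE_tangent)

text \<open>Almost every point is good, and at good points arc length has a positive
  derivative.\<close>

lemma negligible_preimage: assumes "negligible N" shows "negligible {x. f x \<in> N}"
proof -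
  have "negligible {x. \<not> good x}" using AE_good unfolding AE_lborel_negligible .
  moreover have "{x. f x \<in> N} \<subseteq> {x. f x \<in> N \<and> (\<exists>D>0. (f has_real_derivative D) (at x))} \<union> {x. \<not> good x}"
  proof
    fix x assume x: "x \<in> {x. f x \<in> N}"
    show "x \<in> {x. f x \<in> N \<and> (\<exists>D>0. (f has_real_derivative D) (at x))} \<union> {x. \<not> good x}"
    proof (cases "good x")
      case True
      then have "0 < norm (d\<Phi> x)" "(f has_real_derivative norm (d\<Phi> x)) (at x)" by (simp_all add: good_def)
      then show ?thesis using x by blast
    qed simp
  qed
  ultimately show ?thesis
    using f.negligible_preimage_deriv_pos[OF assms] negligible_Un negligible_subset by blast
qed

lemma bd_inv_\<Phi> [simp]: "bd_inv \<Phi> (\<Phi> (complex_of_real x)) = x"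
  unfolding bd_inv_def
proof (rule the_equality)
  fix t assume "\<Phi> (complex_of_real t) = \<Phi> (complex_of_real x)"
  then show "t = x" using \<Phi>_inj_cl by (auto dest: inj_onD)
qed simp

lemma \<Phi>_\<sigma>: "\<Phi> (complex_of_real x) = \<sigma> (f x)"
  by (rule \<phi>_eq)

lemma Lambda_closed: "closed (Lambda \<gamma>)"
proof -
  have "Lambda \<gamma> = {\<xi>. Im \<xi> = \<gamma> (Re \<xi>)}"
  proof (intro equalityI subsetI)
    fix \<xi> assume "\<xi> \<in> {\<xi>. Im \<xi> = \<gamma> (Re \<xi>)}"
    then have "\<xi> = cparam \<gamma> (Re \<xi>)" by (simp add: cparam_def complex_eq_iff)
    then show "\<xi> \<in> Lambda \<gamma>" unfolding Lambda_def by blast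
  qed (auto simp: Lambda_def cparam_def)
  moreover have "closed {\<xi>. Im \<xi> = \<gamma> (Re \<xi>)}"
    by (intro closed_Collect_eq continuous_intros continuous_on_compose2[OF \<gamma>_cont]) auto
  ultimately show ?thesis by simp
qed

lemma \<sigma>_measurable: "\<sigma> \<in> borel_measurable borel"
proof (rule borel_measurable_continuous_onI)
  show "continuous_on UNIV \<sigma>"
    unfolding continuous_on_iff
  proof (intro ballI allI impI)
    fix x \<epsilon> :: real assume "0 < \<epsilon>"
    then show "\<exists>d>0. \<forall>x'\<in>UNIV. dist x' x < d \<longrightarrow> dist (\<sigma> x') (\<sigma> x) < \<epsilon>"
      using \<sigma>_lipschitz by (intro exI[of _ \<epsilon>]) (auto simp: dist_norm intro: le_less_trans)
  qed
qed

text \<open>Property (N) of arc length carries exceptional sets from the line to the curve, and its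
  almost everywhere positive derivative carries them back.\<close>

lemma AE_arclen: "(AE \<xi> in arclen \<gamma>. P \<xi>) \<longleftrightarrow> (AE x in lborel. P (\<Phi> (complex_of_real x)))"
proof -
  have "(AE \<xi> in arclen \<gamma>. P \<xi>) \<longleftrightarrow> (AE t in lborel. P (\<sigma> t))"
  proof
    assume "AE \<xi> in arclen \<gamma>. P \<xi>"
    then show "AE t in lborel. P (\<sigma> t)" unfolding arclen_eq_distr
      by (rule AE_distrD[rotated]) (simp add: \<sigma>_measurable)
  next
    assume "AE t in lborel. P (\<sigma> t)"
    then obtain N where N: "N \<in> null_sets lborel" "\<And>t. t \<notin> N \<Longrightarrow> P (\<sigma> t)"
      by (rule AE_E3) auto
    \<comment> \<open>\<open>P\<close> is arbitrary, whereas the rule for image measures asks for a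
      measurable set; on the closed graph the complement of a Borel null set of arc length
      parameters provides one.\<close>
    define B where "B = Lambda \<gamma> \<inter> {\<xi>. s (Re \<xi>) \<notin> N}"
    have "N \<in> sets borel" using null_setsD2[OF N(1)] by simp
    then have "- N \<in> sets borel" by (simp add: borel_comp)
    moreover have "(\<lambda>\<xi>. s (Re \<xi>)) \<in> borel_measurable borel"
      by (rule measurable_compose[OF _ s.borel_f]) simp
    ultimately have "(\<lambda>\<xi>. s (Re \<xi>)) -` (- N) \<inter> space borel \<in> sets borel"
      using measurable_sets by blast
    then have "{\<xi>. s (Re \<xi>) \<notin> N} \<in> sets borel" by (simp add: vimage_def)
    then have Bm: "B \<in> sets borel" unfolding B_def by (rule sets.Int[OF borel_closed[OF Lambda_closed]])
    have "AE t in lborel. t \<notin> N" using N(1) by (rule AE_not_in)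
    then have "AE t in lborel. \<sigma> t \<in> B"
      by eventually_elim (auto simp: B_def \<sigma>_def Lambda_def cparam_def)
    then have "AE \<xi> in arclen \<gamma>. \<xi> \<in> B"
      unfolding arclen_eq_distr using Bm \<sigma>_measurable by (subst AE_distr_iff) auto
    then show "AE \<xi> in arclen \<gamma>. P \<xi>"
    proof eventually_elim
      case (elim \<xi>)
      then obtain y where y: "\<xi> = cparam \<gamma> y" "s (Re \<xi>) \<notin> N" by (auto simp: B_def Lambda_def)
      then have "P (\<sigma> (s y))" using N(2)[of "s y"] by (simp add: cparam_def)
      then show ?case using y(1) by (simp add: \<sigma>_def)
    qed
  qed
  also have "\<dots> \<longleftrightarrow> (AE x in lborel. P (\<Phi> (complex_of_real x)))"
  proof
    assume "AE t in lborel. P (\<sigma> t)"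
    then have "negligible {x. f x \<in> {t. \<not> P (\<sigma> t)}}" unfolding AE_lborel_negligible by (rule negligible_preimage)
    then show "AE x in lborel. P (\<Phi> (complex_of_real x))" unfolding AE_lborel_negligible \<Phi>_\<sigma> by simp
  next
    assume "AE x in lborel. P (\<Phi> (complex_of_real x))"
    then have "negligible (f ` {x. \<not> P (\<Phi> (complex_of_real x))})" unfolding AE_lborel_negligible by (rule f_image_negligible)
    moreover have "{t. \<not> P (\<sigma> t)} \<subseteq> f ` {x. \<not> P (\<Phi> (complex_of_real x))}"
    proof
      fix t assume "t \<in> {t. \<not> P (\<sigma> t)}"
      then show "t \<in> f ` {x. \<not> P (\<Phi> (complex_of_real x))}"
        unfolding \<Phi>_\<sigma> by (intro image_eqI[of _ _ "g t"]) (auto simp del: o_apply)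
    qed
    ultimately show "AE t in lborel. P (\<sigma> t)" unfolding AE_lborel_negligible by (rule negligible_subset)
  qed
  finally show ?thesis .
qed

lemma \<Phi>_measurable: "(\<lambda>x. \<Phi> (complex_of_real x)) \<in> borel_measurable borel"
  unfolding \<Phi>_\<sigma> using measurable_compose[OF f.borel_f \<sigma>_measurable] .

text \<open>\<open>d\<Phi>\<close> is only given pointwise almost everywhere; the Borel derivative
  of arc length is a measurable version of its modulus.\<close>

lemma density_exists:
  obtains D where "D \<in> borel_measurable borel" "AE x in lborel. D x = norm (d\<Phi> x)"
    "arclen \<gamma> = distr (density lborel (\<lambda>x. ennreal (D x))) borel (\<lambda>x. \<Phi> (complex_of_real x))"
proof -
  obtain D where D: "D \<in> borel_measurable borel" "AE x in lborel. (f has_real_derivative D x) (at x)"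
    using f.borel_derivative .
  have "AE x in lborel. D x = norm (d\<Phi> x)" using D(2) AE_good
  proof eventually_elim
    case (elim x) then show ?case by (auto simp: good_def intro: DERIV_unique)
  qed
  moreover have "arclen \<gamma> = distr (density lborel (\<lambda>x. ennreal (D x))) borel (\<lambda>x. \<Phi> (complex_of_real x))"
  proof -
    have "lborel = distr (density lborel (\<lambda>x. ennreal (D x))) borel f"
      by (rule f.lborel_eq_distr[OF D(2,1) f_image_negligible])
    then have "arclen \<gamma> = distr (distr (density lborel (\<lambda>x. ennreal (D x))) borel f) borel \<sigma>"
      using arclen_eq_distr by metis
    also have "\<dots> = distr (density lborel (\<lambda>x. ennreal (D x))) borel (\<sigma> \<circ> f)"
      by (rule distr_distr) (use \<sigma>_measurable f.borel_f in simp_all)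
    also have "\<sigma> \<circ> f = (\<lambda>x. \<Phi> (complex_of_real x))" by (simp add: fun_eq_iff \<Phi>_\<sigma>)
    finally show ?thesis .
  qed
  ultimately show ?thesis using D(1) that by blast
qed

lemma nn_integral_arclen:
  assumes "G \<in> borel_measurable borel"
  shows "(\<integral>\<^sup>+\<xi>. G \<xi> \<partial>arclen \<gamma>) = (\<integral>\<^sup>+x. G (\<Phi> (complex_of_real x)) * ennreal (norm (d\<Phi> x)) \<partial>lborel)"
proof -
  obtain D where D: "D \<in> borel_measurable borel" "AE x in lborel. D x = norm (d\<Phi> x)"
    "arclen \<gamma> = distr (density lborel (\<lambda>x. ennreal (D x))) borel (\<lambda>x. \<Phi> (complex_of_real x))"
    using density_exists .
  have "(\<integral>\<^sup>+\<xi>. G \<xi> \<partial>arclen \<gamma>) = (\<integral>\<^sup>+x. G (\<Phi> (complex_of_real x)) \<partial>density lborel (\<lambda>x. ennreal (D x)))"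
    unfolding D(3) using \<Phi>_measurable assms by (subst nn_integral_distr) simp_all
  also have "\<dots> = (\<integral>\<^sup>+x. ennreal (D x) * G (\<Phi> (complex_of_real x)) \<partial>lborel)"
    using D(1) measurable_compose[OF \<Phi>_measurable assms] by (subst nn_integral_density) simp_all
  also have "\<dots> = (\<integral>\<^sup>+x. G (\<Phi> (complex_of_real x)) * ennreal (norm (d\<Phi> x)) \<partial>lborel)"
    using D(2) by (intro nn_integral_cong_AE) (auto simp: mult.commute)
  finally show ?thesis .
qed

text \<open>Of the \<open>p\<close> factors |Phi'| produced by the rescaled datum, the exponent 1 -
  p in the weight leaves exactly one, which is the density of arc length.\<close>

lemma lpnorm_transfer:
  assumes \<nu>: "\<nu> \<in> borel_measurable borel" "\<And>\<xi>. \<xi> \<in> Lambda \<gamma> \<Longrightarrow> 0 \<le> \<nu> \<xi>"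
    and h: "h \<in> borel_measurable borel" and F: "AE x in lborel. F x = norm (d\<Phi> x) * h (\<Phi> (complex_of_real x))"
  shows "lpnorm (arclen \<gamma>) p \<nu> (\<lambda>\<xi>. ennreal \<bar>h \<xi>\<bar>)
    = lpnorm lebesgue p (\<lambda>x. norm (d\<Phi> x) powr (1 - p) * \<nu> (\<Phi> (complex_of_real x))) (\<lambda>x. ennreal \<bar>F x\<bar>)"
proof -
  have "(\<integral>\<^sup>+\<xi>. enn_powr (ennreal \<bar>h \<xi>\<bar>) p * ennreal (\<nu> \<xi>) \<partial>arclen \<gamma>)
     = (\<integral>\<^sup>+x. ennreal (\<bar>h (\<Phi> (complex_of_real x))\<bar> powr p) * ennreal (\<nu> (\<Phi> (complex_of_real x))) * ennreal (norm (d\<Phi> x)) \<partial>lborel)"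
    unfolding enn_powr_ennreal[OF abs_ge_zero] using \<nu>(1) h by (subst nn_integral_arclen) simp_all
  also have "\<dots> = (\<integral>\<^sup>+x. enn_powr (ennreal \<bar>F x\<bar>) p * ennreal (norm (d\<Phi> x) powr (1 - p) * \<nu> (\<Phi> (complex_of_real x))) \<partial>lborel)"
  proof (rule nn_integral_cong_AE)
    show "AE x in lborel. ennreal (\<bar>h (\<Phi> (complex_of_real x))\<bar> powr p) * ennreal (\<nu> (\<Phi> (complex_of_real x))) * ennreal (norm (d\<Phi> x))
      = enn_powr (ennreal \<bar>F x\<bar>) p * ennreal (norm (d\<Phi> x) powr (1 - p) * \<nu> (\<Phi> (complex_of_real x)))"
      using F AE_good
    proof eventually_elim
      case (elim x)
      define n where "n = norm (d\<Phi> x)"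
      define a where "a = \<bar>h (\<Phi> (complex_of_real x))\<bar>"
      define v where "v = \<nu> (\<Phi> (complex_of_real x))"
      have n: "n > 0" using elim(2) by (simp add: good_def n_def)
      have v: "v \<ge> 0" using \<nu>(2)[of "\<Phi> (complex_of_real x)"] unfolding v_def \<Phi>_real by (auto simp: Lambda_def)
      have "n powr p * n powr (1 - p) = n" using n by (simp flip: powr_add)
      then have "(n * a) powr p * (n powr (1 - p) * v) = a powr p * v * n"
        using n by (simp add: powr_mult a_def)
      moreover have "\<bar>F x\<bar> = n * a" using elim(1) by (simp add: n_def a_def abs_mult)
      ultimately show ?case
        using n v unfolding n_def[symmetric] v_def[symmetric] a_def[symmetric] enn_powr_ennreal[OF abs_ge_zero]
        by (auto simp flip: ennreal_mult)
    qed
  qed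
  also have "\<dots> = (\<integral>\<^sup>+x. enn_powr (ennreal \<bar>F x\<bar>) p * ennreal (norm (d\<Phi> x) powr (1 - p) * \<nu> (\<Phi> (complex_of_real x))) \<partial>lebesgue)"
    by (simp add: nn_integral_completion)
  finally show ?thesis unfolding lpnorm_def by simp
qed

definition normal :: "real \<Rightarrow> complex" where
  "normal x = \<i> * (d\<Phi> x / of_real (norm (d\<Phi> x)))"

lemma inward_normal_good:
  assumes "good x" shows "inward_normal \<gamma> (\<Phi> (complex_of_real x)) (normal x)"
  unfolding inward_normal_def
proof (intro exI conjI)
  show "\<Phi> (complex_of_real x) = cparam \<gamma> (X x)" by (rule \<Phi>_real)
  show "normal x = \<i> * (d\<Phi> x / of_real (norm (d\<Phi> x)))" by (rule normal_def)
  show "norm (d\<Phi> x / of_real (norm (d\<Phi> x))) = 1" using assms by (simp add: good_def norm_divide)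
  have "(\<sigma> has_vector_derivative d\<Phi> x / of_real (norm (d\<Phi> x))) (at (s (X x)))"
    using assms unfolding good_def f_def by blast
  from vector_derivative_quotient[OF this]
  have lim: "((\<lambda>t. (\<sigma> t - \<sigma> (s (X x))) / of_real (t - s (X x))) \<longlongrightarrow> d\<Phi> x / of_real (norm (d\<Phi> x))) (at (s (X x)))" .
  have "filterlim s (at (s (X x))) (at (X x))"
    unfolding filterlim_at
  proof
    show "(s \<longlongrightarrow> s (X x)) (at (X x))" using s.f_cont by (simp add: continuous_on_def)
    have "s y \<noteq> s (X x)" if "y \<noteq> X x" for y using that s.gf by metis
    then show "\<forall>\<^sub>F y in at (X x). s y \<in> UNIV \<and> s y \<noteq> s (X x)"
      unfolding eventually_at by (intro exI[of _ 1]) auto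
  qed
  from filterlim_compose[OF lim this]
  show "((\<lambda>y. (cparam \<gamma> y - cparam \<gamma> (X x)) / complex_of_real (s y - s (X x))) \<longlongrightarrow> d\<Phi> x / of_real (norm (d\<Phi> x))) (at (X x))"
    by (simp add: \<sigma>_def)
qed

lemma Phi_nt_conv_iff:
  "Phi_nt_conv (cone e) \<Phi> R (\<Phi> (complex_of_real x)) l \<longleftrightarrow> nt_conv (cone e) (\<lambda>z. R (\<Phi> z)) x l"
proof -
  have "(R \<longlongrightarrow> l) (at (\<Phi> (complex_of_real x)) within \<Phi> ` cone e \<alpha> x) \<longleftrightarrow>
      ((\<lambda>z. R (\<Phi> z)) \<longlongrightarrow> l) (at (complex_of_real x) within cone e \<alpha> x)" for \<alpha>
  proof (rule tendsto_image_homeo[OF \<Phi>_cont \<Phi>_inj_cl])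
    show "continuous_on (\<Phi> ` closure H) (inv_into (closure H) \<Phi>)" using \<Phi>_inv_cont \<Phi>_image_cl by simp
    show "cone e \<alpha> x \<subseteq> closure H" using cone_subset_half_plane closure_subset by blast
  qed simp
  then show ?thesis by (simp add: Phi_nt_conv_def nt_conv_def)
qed

section \<open>Harmonic functions and normal derivatives under the conformal map\<close>

lemma inverse_holomorphic: obtains J where "J holomorphic_on \<Omega>" "\<And>z. z \<in> H \<Longrightarrow> J (\<Phi> z) = z"
proof -
  obtain J where "J holomorphic_on (\<Phi> ` H)" "\<And>z. z \<in> H \<Longrightarrow> deriv \<Phi> z * deriv J (\<Phi> z) = 1" "\<And>z. z \<in> H \<Longrightarrow> J (\<Phi> z) = z"
    using holomorphic_has_inverse[OF \<Phi>_hol open_half_plane \<Phi>_inj] by metis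
  then show ?thesis using that \<Phi>_image by metis
qed

lemma harmonic_pullback:
  assumes uv: "\<And>z. z \<in> H \<Longrightarrow> u z = v (\<Phi> z)"
  shows "harmonic_on H u \<longleftrightarrow> harmonic_on \<Omega> v"
proof
  assume "harmonic_on \<Omega> v"
  then have "harmonic_on H (v \<circ> \<Phi>)"
    by (rule harmonic_on_compose(1)[OF _ \<Phi>_hol]) (simp_all add: \<Phi>_image open_half_plane)
  then show "harmonic_on H u" by (rule harmonic_on_cong) (simp add: uv)
next
  assume u: "harmonic_on H u"
  obtain J where J: "J holomorphic_on \<Omega>" "\<And>z. z \<in> H \<Longrightarrow> J (\<Phi> z) = z" using inverse_holomorphic by blast
  have "J ` \<Omega> \<subseteq> H" unfolding \<Phi>_image[symmetric] using J(2) by auto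
  then have "harmonic_on \<Omega> (u \<circ> J)"
    by (rule harmonic_on_compose(1)[OF u J(1)]) (rule open_domain_side[OF \<gamma>_cont])
  then show "harmonic_on \<Omega> v"
  proof (rule harmonic_on_cong)
    fix w assume "w \<in> \<Omega>"
    then obtain z where "z \<in> H" "w = \<Phi> z" using \<Phi>_image by (metis imageE)
    then show "(u \<circ> J) w = v w" using J(2) uv by simp
  qed
qed

lemma cgrad_pullback:
  assumes v: "harmonic_on \<Omega> v" and uv: "\<And>z. z \<in> H \<Longrightarrow> u z = v (\<Phi> z)" and z: "z \<in> H"
  shows "cgrad u z = cgrad v (\<Phi> z) * deriv \<Phi> z"
proof -
  have "cgrad u z = cgrad (v \<circ> \<Phi>) z"
    using uv by (intro cgrad_cong_open[OF open_half_plane z]) simp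
  also have "\<dots> = cgrad v (\<Phi> z) * deriv \<Phi> z"
    by (rule harmonic_on_compose(2)[OF v \<Phi>_hol]) (simp_all add: \<Phi>_image open_half_plane z)
  finally show ?thesis .
qed

text \<open>The rescaled normal derivative of \<open>v\<close> and the vertical derivative of its pullback differ by
  \<open>Im (F (\<Phi>' - d\<Phi>))\<close> with \<open>F = cgrad v \<circ> \<Phi>\<close>; this tends to 0 as soon as \<open>F\<close> is
  non-tangentially bounded, which either limit forces at almost every point.\<close>
theorem AE_normal_derivative:
  assumes v: "harmonic_on \<Omega> v" and uv: "\<And>z. z \<in> H \<Longrightarrow> u z = v (\<Phi> z)"
  shows "AE x in lborel. \<forall>b. nt_conv (cone e) (dy u) x (norm (d\<Phi> x) * b) \<longleftrightarrow>
    nt_conv (cone e) (\<lambda>z. grad v (\<Phi> z) \<bullet> normal x) x b"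
proof -
  define F where "F z = cgrad v (\<Phi> z)" for z
  have u: "harmonic_on H u" using harmonic_pullback[where u=u and v=v, OF uv] v by simp
  have Gu: "cgrad u holomorphic_on H" using u by (simp add: harmonic_on_iff)
  have "cgrad v holomorphic_on \<Omega>" using v by (simp add: harmonic_on_iff)
  then have F: "F holomorphic_on H"
    using holomorphic_on_compose_gen[OF \<Phi>_hol] \<Phi>_image by (auto simp: F_def[abs_def] o_def)
  \<comment> \<open>Each direction needs its own function: a limit of \<open>dy u\<close> confines
    \<open>cgrad u\<close>, a limit of the normal derivative confines \<open>F\<close>.\<close>
  note ku = AE_nt_bounded[OF e Gu] and kF = AE_nt_bounded[OF e F]
  show ?thesis
    using ku kF AE_good
  proof eventually_elim
    case (elim x)
    define d where "d = d\<Phi> x"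
    define n where "n = norm d"
    have d: "d \<noteq> 0" "nt_conv (cone e) (deriv \<Phi>) x d" using elim(3) by (auto simp: good_def d_def)
    have n: "n > 0" using d by (simp add: n_def)
    obtain \<alpha>0 where a0: "0 < \<alpha>0" "\<alpha>0 < pi / 2" "(deriv \<Phi> \<longlongrightarrow> d) (at (of_real x) within cone e \<alpha>0 x)"
      using d(2) by (auto simp: nt_conv_def)
    have inner: "grad v (\<Phi> z) \<bullet> normal x = - Im (F z * d) / n" for z
    proof -
      have "grad v (\<Phi> z) \<bullet> normal x = Re (F z * normal x)"
        by (simp add: grad_eq_cnj_cgrad F_def inner_complex_def)
      moreover have "normal x = \<i> * d / of_real n" by (simp add: normal_def d_def n_def)
      moreover have "Re (F z * (\<i> * d / of_real n)) = - Im (F z * d) / n" using n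
        by (simp add: Re_divide_of_real field_simps)
      ultimately show ?thesis by simp
    qed
    have dyu: "dy u z = n * (grad v (\<Phi> z) \<bullet> normal x) - Im (F z * (deriv \<Phi> z - d))" if "z \<in> H" for z
    proof -
      have "n * (grad v (\<Phi> z) \<bullet> normal x) = - Im (F z * d)" unfolding inner using n by simp
      then show ?thesis using cgrad_pullback[where u=u, OF v uv that] unfolding dy_eq by (simp add: F_def algebra_simps)
    qed
    have bounded_imp: "nt_conv (cone e) (dy u) x (n * b) \<longleftrightarrow> nt_conv (cone e) (\<lambda>z. grad v (\<Phi> z) \<bullet> normal x) x b"
      if bd: "0 < \<alpha>1" "\<alpha>1 < pi / 2" "0 < k" "\<And>z. z \<in> cone e \<alpha>1 x \<Longrightarrow> norm (z - of_real x) < k \<Longrightarrow> norm (F z) \<le> M"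
      for \<alpha>1 k M b
    proof -
      have small: "((\<lambda>z. Im (F z * (deriv \<Phi> z - d))) \<longlongrightarrow> 0) (at (of_real x) within cone e \<beta> x)"
        if \<beta>: "0 < \<beta>" "\<beta> \<le> \<alpha>0" "\<beta> \<le> \<alpha>1" for \<beta>
      proof -
        have "(deriv \<Phi> \<longlongrightarrow> d) (at (of_real x) within cone e \<beta> x)" by (rule nt_conv_mono[OF a0(3) \<beta>(1,2) a0(2)])
        then have "((\<lambda>z. M * norm (deriv \<Phi> z - d)) \<longlongrightarrow> M * norm (d - d)) (at (of_real x) within cone e \<beta> x)"
          by (intro tendsto_intros)
        then have lim: "((\<lambda>z. M * norm (deriv \<Phi> z - d)) \<longlongrightarrow> 0) (at (of_real x) within cone e \<beta> x)" by simp
        show ?thesis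
        proof (rule Lim_null_comparison[OF _ lim])
          show "\<forall>\<^sub>F z in at (of_real x) within cone e \<beta> x. norm (Im (F z * (deriv \<Phi> z - d))) \<le> M * norm (deriv \<Phi> z - d)"
            unfolding eventually_at
          proof (intro exI[of _ k] conjI ballI impI bd(3))
            fix z assume z: "z \<in> cone e \<beta> x" "z \<noteq> of_real x \<and> dist z (of_real x) < k"
            have "z \<in> cone e \<alpha>1 x" using cone_mono[OF \<beta>(1,3) bd(2)] z(1) by blast
            then have "norm (F z) \<le> M" using bd(4) z(2) by (simp add: dist_norm)
            then have "norm (F z * (deriv \<Phi> z - d)) \<le> M * norm (deriv \<Phi> z - d)"
              by (simp add: norm_mult mult_right_mono)
            then show "norm (Im (F z * (deriv \<Phi> z - d))) \<le> M * norm (deriv \<Phi> z - d)"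
              using abs_Im_le_cmod order_trans unfolding real_norm_def by blast
          qed
        qed
      qed
      have cone_dyu: "dy u z = n * (grad v (\<Phi> z) \<bullet> normal x) - Im (F z * (deriv \<Phi> z - d))" if "z \<in> cone e \<beta> x" for z \<beta>
        using that cone_subset_half_plane by (intro dyu) blast
      show ?thesis
      proof
        assume "nt_conv (cone e) (dy u) x (n * b)"
        then obtain \<alpha> where a: "0 < \<alpha>" "\<alpha> < pi / 2" "(dy u \<longlongrightarrow> n * b) (at (of_real x) within cone e \<alpha> x)"
          by (auto simp: nt_conv_def)
        define \<beta> where "\<beta> = min \<alpha> (min \<alpha>0 \<alpha>1)"
        have \<beta>: "0 < \<beta>" "\<beta> \<le> \<alpha>" "\<beta> \<le> \<alpha>0" "\<beta> \<le> \<alpha>1" "\<beta> < pi / 2" using a bd a0 by (auto simp: \<beta>_def)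
        have "((\<lambda>z. (dy u z + Im (F z * (deriv \<Phi> z - d))) / n) \<longlongrightarrow> (n * b + 0) / n) (at (of_real x) within cone e \<beta> x)"
          using n by (intro tendsto_intros small nt_conv_mono[OF a(3) \<beta>(1,2) a(2)] \<beta>) auto
        then have "((\<lambda>z. (dy u z + Im (F z * (deriv \<Phi> z - d))) / n) \<longlongrightarrow> b) (at (of_real x) within cone e \<beta> x)" using n by simp
        moreover have "(dy u z + Im (F z * (deriv \<Phi> z - d))) / n = grad v (\<Phi> z) \<bullet> normal x" if "z \<in> cone e \<beta> x" for z
          using cone_dyu[OF that] n by simp
        ultimately have "((\<lambda>z. grad v (\<Phi> z) \<bullet> normal x) \<longlongrightarrow> b) (at (of_real x) within cone e \<beta> x)"
          by (subst (asm) Lim_cong_within) auto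
        then show "nt_conv (cone e) (\<lambda>z. grad v (\<Phi> z) \<bullet> normal x) x b" using \<beta>(1,5) by (auto simp: nt_conv_def)
      next
        assume "nt_conv (cone e) (\<lambda>z. grad v (\<Phi> z) \<bullet> normal x) x b"
        then obtain \<alpha> where a: "0 < \<alpha>" "\<alpha> < pi / 2" "((\<lambda>z. grad v (\<Phi> z) \<bullet> normal x) \<longlongrightarrow> b) (at (of_real x) within cone e \<alpha> x)"
          by (auto simp: nt_conv_def)
        define \<beta> where "\<beta> = min \<alpha> (min \<alpha>0 \<alpha>1)"
        have \<beta>: "0 < \<beta>" "\<beta> \<le> \<alpha>" "\<beta> \<le> \<alpha>0" "\<beta> \<le> \<alpha>1" "\<beta> < pi / 2" using a bd a0 by (auto simp: \<beta>_def)
        have "((\<lambda>z. n * (grad v (\<Phi> z) \<bullet> normal x) - Im (F z * (deriv \<Phi> z - d))) \<longlongrightarrow> n * b - 0) (at (of_real x) within cone e \<beta> x)"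
          by (intro tendsto_diff tendsto_mult tendsto_const small nt_conv_mono[OF a(3) \<beta>(1,2) a(2)] \<beta>)
        then have "(dy u \<longlongrightarrow> n * b) (at (of_real x) within cone e \<beta> x)"
          using cone_dyu[of _ \<beta>] by (subst Lim_cong_within) auto
        then show "nt_conv (cone e) (dy u) x (n * b)" using \<beta>(1,5) by (auto simp: nt_conv_def)
      qed
    qed
    have "nt_conv (cone e) (dy u) x (n * b) \<longleftrightarrow> nt_conv (cone e) (\<lambda>z. grad v (\<Phi> z) \<bullet> normal x) x b" for b
    proof -
      have 1: ?thesis if nt: "nt_conv (cone e) (dy u) x (n * b)"
      proof -
        obtain \<alpha> k M where a: "0 < \<alpha>" "\<alpha> < pi / 2" "0 < k" "\<And>z. z \<in> cone e \<alpha> x \<Longrightarrow> norm (z - of_real x) < k \<Longrightarrow> \<bar>dy u z\<bar> \<le> M"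
          using nt_conv_bounded[OF nt] by blast
        \<comment> \<open>A bound \<open>M\<close> for \<open>\<bar>dy u z\<bar>\<close> keeps the
          imaginary part of \<open>cgrad u\<close> in [-M, M], so the disc of radius 1 around i (M +
          1) is omitted.\<close>
        have "1 \<le> norm (cgrad u z - Complex 0 (M + 1))" if "z \<in> cone e \<alpha> x" "norm (z - of_real x) < k" for z
        proof -
          have "\<bar>Im (cgrad u z - Complex 0 (M + 1))\<bar> \<ge> 1" using a(4)[OF that] by (auto simp: dy_eq)
          then show ?thesis using abs_Im_le_cmod order_trans by blast
        qed
        then have "\<exists>\<alpha> k q r. 0 < \<alpha> \<and> \<alpha> < pi / 2 \<and> 0 < k \<and> 0 < r \<and> (\<forall>z\<in>cone e \<alpha> x. norm (z - of_real x) < k \<longrightarrow> r \<le> norm (cgrad u z - q))"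
          using a(1-3) by (intro exI[of _ \<alpha>] exI[of _ k] exI[of _ "Complex 0 (M + 1)"] exI[of _ 1]) auto
        then obtain \<alpha>' k' M' where b: "0 < \<alpha>'" "\<alpha>' < pi / 2" "0 < k'" "\<forall>z\<in>cone e \<alpha>' x. norm (z - of_real x) < k' \<longrightarrow> norm (cgrad u z) \<le> M'"
          using elim(1) by blast
        have "\<forall>\<^sub>F z in at (of_real x) within cone e \<alpha>0 x. dist (deriv \<Phi> z) d < n / 2" using tendstoD[OF a0(3), of "n / 2"] n by simp
        then obtain k0 where k0: "k0 > 0" "\<And>z. z \<in> cone e \<alpha>0 x \<Longrightarrow> z \<noteq> of_real x \<Longrightarrow> dist z (of_real x) < k0 \<Longrightarrow> dist (deriv \<Phi> z) d < n / 2"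
          unfolding eventually_at by blast
        show ?thesis
        proof (rule bounded_imp[of "min \<alpha>0 \<alpha>'" "min k0 k'" "2 * M' / n"])
          fix z assume z: "z \<in> cone e (min \<alpha>0 \<alpha>') x" "norm (z - of_real x) < min k0 k'"
          have zz: "z \<in> cone e \<alpha>0 x" "z \<in> cone e \<alpha>' x"
            using z(1) cone_mono[of "min \<alpha>0 \<alpha>'" \<alpha>0 e x] cone_mono[of "min \<alpha>0 \<alpha>'" \<alpha>' e x] a0 b by auto
          have zH: "z \<in> H" using zz cone_subset_half_plane by blast
          have "z \<noteq> of_real x" using zH by auto
          then have "dist (deriv \<Phi> z) d < n / 2" using k0(2)[OF zz(1)] z(2) by (simp add: dist_norm)
          \<comment> \<open>The derivative of \<open>\<Phi>\<close> stays away from 0 near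
            \<open>x\<close>, so the bound for \<open>cgrad u\<close>, which is \<open>F\<close>
            times this derivative, passes to \<open>F\<close>.\<close>
          then have ge: "n / 2 \<le> norm (deriv \<Phi> z)"
            using norm_triangle_ineq2[of d "d - deriv \<Phi> z"] by (simp add: dist_norm n_def norm_minus_commute)
          have "norm (F z) * (n / 2) \<le> norm (F z) * norm (deriv \<Phi> z)" using ge by (intro mult_left_mono) auto
          also have "\<dots> = norm (cgrad u z)" using cgrad_pullback[where u=u, OF v uv zH] by (simp add: F_def norm_mult)
          also have "\<dots> \<le> M'" using b(4) zz(2) z(2) by auto
          finally show "norm (F z) \<le> 2 * M' / n" using n by (simp add: field_simps)
        qed (use a0 b k0 in auto)
      qed
      have 2: ?thesis if nt: "nt_conv (cone e) (\<lambda>z. grad v (\<Phi> z) \<bullet> normal x) x b"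
      proof -
        obtain \<alpha> k M where a: "0 < \<alpha>" "\<alpha> < pi / 2" "0 < k"
          "\<And>z. z \<in> cone e \<alpha> x \<Longrightarrow> norm (z - of_real x) < k \<Longrightarrow> \<bar>grad v (\<Phi> z) \<bullet> normal x\<bar> \<le> M"
          using nt_conv_bounded[OF nt] by blast
        \<comment> \<open>Multiplication by \<open>d\<close> moves this centre to i n (M + 1), while
          the imaginary part of \<open>F z * d\<close> is at most n M in absolute value. The gap n
          equals |d|, so a disc of radius 1 is omitted by \<open>F\<close>.\<close>
        define q where "q = \<i> * of_real (n * (M + 1)) / d"
        have "1 \<le> norm (F z - q)" if "z \<in> cone e \<alpha> x" "norm (z - of_real x) < k" for z
        proof -
          have "\<bar>Im (F z * d)\<bar> / n \<le> M" using a(4)[OF that] n unfolding inner abs_divide abs_minus_cancel by simp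
          then have "\<bar>Im (F z * d)\<bar> \<le> n * M" using n by (simp add: pos_divide_le_eq mult.commute)
          moreover have "q * d = \<i> * of_real (n * (M + 1))" using d by (simp add: q_def)
          then have "Im ((F z - q) * d) = Im (F z * d) - n * (M + 1)" unfolding left_diff_distrib by simp
          moreover have "n * (M + 1) = n * M + n" by (simp add: distrib_left)
          ultimately have "n \<le> \<bar>Im ((F z - q) * d)\<bar>" by linarith
          also have "\<dots> \<le> norm (F z - q) * n" using abs_Im_le_cmod[of "(F z - q) * d"] by (simp add: norm_mult n_def)
          finally show ?thesis using n by simp
        qed
        then have "\<exists>\<alpha> k q r. 0 < \<alpha> \<and> \<alpha> < pi / 2 \<and> 0 < k \<and> 0 < r \<and> (\<forall>z\<in>cone e \<alpha> x. norm (z - of_real x) < k \<longrightarrow> r \<le> norm (F z - q))"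
          using a(1-3) by (intro exI[of _ \<alpha>] exI[of _ k] exI[of _ q] exI[of _ 1]) auto
        then obtain \<alpha>' k' M' where "0 < \<alpha>'" "\<alpha>' < pi / 2" "0 < k'" "\<forall>z\<in>cone e \<alpha>' x. norm (z - of_real x) < k' \<longrightarrow> norm (F z) \<le> M'"
          using elim(2) by blast
        then show ?thesis by (intro bounded_imp[of \<alpha>' k' M']) auto
      qed
      show ?thesis using 1 2 by blast
    qed
    then show ?case by (simp add: n_def d_def)
  qed
qed

end

section \<open>Transfer of the two problems\<close>

lemma abs_dy_le_norm_grad: "\<bar>dy u z\<bar> \<le> norm (grad u z)"
  using abs_Im_le_cmod[of "grad u z"] by (simp add: grad_def)

lemma borel_measurable_arclen: "borel_measurable (arclen \<gamma>) = borel_measurable borel"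
  by (rule measurable_cong_sets) (simp_all add: arclen_def)

context conformal_boundary
begin

text \<open>An inverse of the boundary map that is continuous on the whole plane, unlike
  \<open>bd_inv\<close>, so that functions on the line become Borel functions of boundary
  points.\<close>

definition bd_coord :: "complex \<Rightarrow> real" where "bd_coord \<xi> = XI (Re \<xi>)"

lemma bd_coord_\<Phi> [simp]: "bd_coord (\<Phi> (complex_of_real x)) = x"
  using Y.gf[of x] by (simp add: bd_coord_def X_def)

lemma bd_coord_measurable: "bd_coord \<in> borel_measurable borel"
  unfolding bd_coord_def
proof (rule borel_measurable_continuous_onI)
  show "continuous_on UNIV (\<lambda>\<xi>. XI (Re \<xi>))"
    by (rule continuous_on_compose2[OF Y.g_cont]) (auto intro!: continuous_intros)
qed

lemma inverse_map: obtains J where "J \<in> \<Omega> \<rightarrow> H" "\<And>z. z \<in> H \<Longrightarrow> J (\<Phi> z) = z" "\<And>\<zeta>. \<zeta> \<in> \<Omega> \<Longrightarrow> \<Phi> (J \<zeta>) = \<zeta>"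
proof -
  obtain J where J: "J holomorphic_on \<Omega>" "\<And>z. z \<in> H \<Longrightarrow> J (\<Phi> z) = z" using inverse_holomorphic by blast
  have "J \<zeta> \<in> H \<and> \<Phi> (J \<zeta>) = \<zeta>" if "\<zeta> \<in> \<Omega>" for \<zeta>
    using that J(2) unfolding \<Phi>_image[symmetric] by auto
  then show ?thesis using that J(2) by blast
qed

lemma ntmax_grad_pullback:
  assumes "\<forall>z\<in>H. u z = v (\<Phi> z)"
  shows "ntmax (cone e) \<alpha> (grad (v \<circ> \<Phi>)) = ntmax (cone e) \<alpha> (grad u)"
proof (rule ntmax_cong)
  fix z assume "z \<in> H"
  then have "cgrad (v \<circ> \<Phi>) z = cgrad u z" using assms by (intro cgrad_cong_open[OF open_half_plane]) auto
  then show "grad (v \<circ> \<Phi>) z = grad u z" by (simp add: grad_eq_cnj_cgrad)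
qed

lemma AE_normal_derivative_at_\<Phi>:
  assumes v: "harmonic_on \<Omega> v" and uv: "\<forall>z\<in>H. u z = v (\<Phi> z)"
  shows "AE x in lborel. (\<exists>N. inward_normal \<gamma> (\<Phi> (complex_of_real x)) N) \<and>
    (\<forall>N b. inward_normal \<gamma> (\<Phi> (complex_of_real x)) N \<longrightarrow>
      Phi_nt_conv (cone e) \<Phi> (\<lambda>z. grad v z \<bullet> N) (\<Phi> (complex_of_real x)) b \<longleftrightarrow>
      nt_conv (cone e) (dy u) x (norm (d\<Phi> x) * b))"
proof -
  have "AE x in lborel. \<forall>b. nt_conv (cone e) (dy u) x (norm (d\<Phi> x) * b) \<longleftrightarrow>
    nt_conv (cone e) (\<lambda>z. grad v (\<Phi> z) \<bullet> normal x) x b"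
    by (rule AE_normal_derivative[OF v]) (use uv in blast)
  then show ?thesis using AE_good
  proof eventually_elim
    case (elim x)
    note N = inward_normal_good[OF elim(2)]
    show ?case
    proof (intro conjI allI impI)
      fix N b assume "inward_normal \<gamma> (\<Phi> (complex_of_real x)) N"
      then have "N = normal x" using N by (rule inward_normal_unique)
      then show "Phi_nt_conv (cone e) \<Phi> (\<lambda>z. grad v z \<bullet> N) (\<Phi> (complex_of_real x)) b \<longleftrightarrow>
        nt_conv (cone e) (dy u) x (norm (d\<Phi> x) * b)"
        using elim(1) by (simp add: Phi_nt_conv_iff)
    qed (use N in blast)
  qed
qed

lemma Phi_nt_conv_pullback:
  assumes "\<forall>z\<in>H. u z = v (\<Phi> z)"
  shows "Phi_nt_conv (cone e) \<Phi> v (\<Phi> (complex_of_real x)) l \<longleftrightarrow> nt_conv (cone e) u x l"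
  unfolding Phi_nt_conv_iff by (rule nt_conv_cong) (use assms in simp)

lemma pull_boundary_values:
  assumes v: "harmonic_on \<Omega> v" and uv: "\<forall>z\<in>H. u z = v (\<Phi> z)"
    and bv: "AE \<xi> in arclen \<gamma>. Phi_nt_conv (cone e) \<Phi> v \<xi> (b \<xi>) \<and>
      (\<exists>N. inward_normal \<gamma> \<xi> N \<and> Phi_nt_conv (cone e) \<Phi> (\<lambda>z. grad v z \<bullet> N) \<xi> (n \<xi>))"
  shows "nt_bv (cone e) u (\<lambda>x. b (\<Phi> (complex_of_real x)))"
    and "nt_bv (cone e) (dy u) (\<lambda>x. norm (d\<Phi> x) * n (\<Phi> (complex_of_real x)))"
proof -
  have "AE x in lborel. nt_conv (cone e) u x (b (\<Phi> (complex_of_real x))) \<and>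
      nt_conv (cone e) (dy u) x (norm (d\<Phi> x) * n (\<Phi> (complex_of_real x)))"
    using bv[unfolded AE_arclen] AE_normal_derivative_at_\<Phi>[OF v uv]
  proof eventually_elim
    case (elim x)
    then show ?case unfolding Phi_nt_conv_pullback[OF uv] by blast
  qed
  then show "nt_bv (cone e) u (\<lambda>x. b (\<Phi> (complex_of_real x)))"
    and "nt_bv (cone e) (dy u) (\<lambda>x. norm (d\<Phi> x) * n (\<Phi> (complex_of_real x)))"
    unfolding nt_bv_def AE_completion_iff by (auto elim: AE_mp)
qed

text \<open>The normal derivative has to be measurable, so it is built from a Borel version of the
  limit of \<open>dy u\<close> and of |Phi'| through \<open>bd_coord\<close>. Its norm is finite
  because the limit is dominated by the maximal function of the gradient for any single aperture;
  \<pi> / 4 is one.\<close>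

lemma push_boundary_values:
  assumes u: "harmonic_on H u" and v: "harmonic_on \<Omega> v" and uv: "\<forall>z\<in>H. u z = v (\<Phi> z)"
    and b: "nt_bv (cone e) u b" and d: "nt_bv (cone e) (dy u) d"
    and \<nu>: "\<nu> \<in> borel_measurable borel" "\<forall>\<xi>\<in>Lambda \<gamma>. 0 \<le> \<nu> \<xi>" and p: "0 < p"
    and w: "AE x in lborel. w x = norm (d\<Phi> x) powr (1 - p) * \<nu> (\<Phi> (complex_of_real x))"
    and fin: "lpnorm lebesgue p w (ntmax (cone e) (pi / 4) (grad u)) < \<infinity>"
  obtains b' n where "\<forall>x. b' (\<Phi> (complex_of_real x)) = b x"
    "AE x in lborel. d x = norm (d\<Phi> x) * n (\<Phi> (complex_of_real x))" "in_Lp (arclen \<gamma>) p \<nu> n"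
    "AE \<xi> in arclen \<gamma>. Phi_nt_conv (cone e) \<Phi> v \<xi> (b' \<xi>) \<and> (\<exists>N. inward_normal \<gamma> \<xi> N) \<and>
      (\<forall>N. inward_normal \<gamma> \<xi> N \<longrightarrow> Phi_nt_conv (cone e) \<Phi> (\<lambda>z. grad v z \<bullet> N) \<xi> (n \<xi>))"
proof -
  have dx: "AE x in lborel. nt_conv (cone e) (dy u) x (d x)" and bx: "AE x in lborel. nt_conv (cone e) u x (b x)"
    using b d by (simp_all add: nt_bv_def AE_completion_iff)
  have "cgrad u holomorphic_on H" using u by (simp add: harmonic_on_iff)
  then have "continuous_on H (\<lambda>z. - Im (cgrad u z))"
    by (intro continuous_intros holomorphic_on_imp_continuous_on)
  then have "continuous_on H (dy u)" by (simp add: dy_eq[abs_def])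
  then obtain d' where d': "d' \<in> borel_measurable borel" "\<And>x l. nt_conv (cone e) (dy u) x l \<Longrightarrow> d' x = l"
    using nt_conv_borel_version[OF e] by blast
  obtain D where D: "D \<in> borel_measurable borel" "AE x in lborel. D x = norm (d\<Phi> x)"
    using density_exists by blast
  define n where "n \<xi> = d' (bd_coord \<xi>) / D (bd_coord \<xi>)" for \<xi>
  have dn: "AE x in lborel. d x = norm (d\<Phi> x) * n (\<Phi> (complex_of_real x))"
    using dx D(2) AE_good
  proof eventually_elim
    case (elim x)
    then show ?case using d'(2) by (simp add: n_def good_def)
  qed
  have nm: "n \<in> borel_measurable borel"
    unfolding n_def using measurable_compose[OF bd_coord_measurable] d'(1) D(1) by (intro borel_measurable_divide) blast+
  have "lpnorm (arclen \<gamma>) p \<nu> (\<lambda>\<xi>. ennreal \<bar>n \<xi>\<bar>)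
    = lpnorm lebesgue p (\<lambda>x. norm (d\<Phi> x) powr (1 - p) * \<nu> (\<Phi> (complex_of_real x))) (\<lambda>x. ennreal \<bar>d x\<bar>)"
    by (rule lpnorm_transfer[OF \<nu>(1) _ nm dn]) (use \<nu>(2) in blast)
  also have "\<dots> \<le> lpnorm lebesgue p w (ntmax (cone e) (pi / 4) (grad u))"
  proof (rule lpnorm_mono_AE)
    show "AE x in lebesgue. ennreal \<bar>d x\<bar> \<le> ntmax (cone e) (pi / 4) (grad u) x"
      unfolding AE_completion_iff using dx
    proof eventually_elim
      case (elim x)
      then show ?case by (rule nt_conv_le_ntmax[OF e]) (simp_all add: abs_dy_le_norm_grad)
    qed
    show "AE x in lebesgue. norm (d\<Phi> x) powr (1 - p) * \<nu> (\<Phi> (complex_of_real x)) = w x"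
      unfolding AE_completion_iff using w by eventually_elim simp
  qed (rule p)
  finally have Lp: "in_Lp (arclen \<gamma>) p \<nu> n"
    using fin nm by (auto simp: in_Lp_def borel_measurable_arclen)
  have "AE \<xi> in arclen \<gamma>. Phi_nt_conv (cone e) \<Phi> v \<xi> (b (bd_coord \<xi>)) \<and> (\<exists>N. inward_normal \<gamma> \<xi> N) \<and>
      (\<forall>N. inward_normal \<gamma> \<xi> N \<longrightarrow> Phi_nt_conv (cone e) \<Phi> (\<lambda>z. grad v z \<bullet> N) \<xi> (n \<xi>))"
    unfolding AE_arclen using AE_normal_derivative_at_\<Phi>[OF v uv] bx dx dn
  proof eventually_elim
    case (elim x)
    then show ?case unfolding Phi_nt_conv_pullback[OF uv] by simp
  qed
  then show ?thesis using that[of "\<lambda>\<xi>. b (bd_coord \<xi>)" n] dn Lp by simp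
qed

end

section \<open>The welding homeomorphism and the two weights\<close>

locale two_sides = A: conformal_boundary eA \<gamma> \<Phi>A dA + B: conformal_boundary eB \<gamma> \<Phi>B dB
  for eA eB \<gamma> \<Phi>A \<Phi>B dA dB
begin

text \<open>The welding map, factored through arc length: its derivative is then a quotient of the
  two known derivatives of arc length.\<close>

definition h where "h x = B.g (A.f x)"

lemma f_h: "B.f (h x) = A.f x"
  unfolding h_def by (rule B.f.fg)

lemma \<Phi>_h: "\<Phi>B (complex_of_real (h x)) = \<Phi>A (complex_of_real x)"
  unfolding B.\<Phi>_\<sigma> A.\<Phi>_\<sigma> f_h ..

lemma AE_h: assumes "AE y in lborel. P y" shows "AE x in lborel. P (h x)"
proof -
  have "negligible (B.f ` {y. \<not> P y})" using assms B.f_image_negligible unfolding AE_lborel_negligible by blast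
  then have "negligible {x. A.f x \<in> B.f ` {y. \<not> P y}}" by (rule A.negligible_preimage)
  moreover have "{x. \<not> P (h x)} \<subseteq> {x. A.f x \<in> B.f ` {y. \<not> P y}}"
  proof
    fix x assume "x \<in> {x. \<not> P (h x)}"
    then have "B.f (h x) \<in> B.f ` {y. \<not> P y}" by blast
    then show "x \<in> {x. A.f x \<in> B.f ` {y. \<not> P y}}" by (simp add: f_h)
  qed
  ultimately show ?thesis unfolding AE_lborel_negligible by (rule negligible_subset)
qed

lemma AE_h_derivative:
  "AE x in lborel. A.good x \<and> B.good (h x) \<and> (h has_real_derivative norm (dA x) / norm (dB (h x))) (at x)"
  using A.AE_good AE_h[OF B.AE_good]
proof eventually_elim
  case (elim x)
  have "(B.g has_real_derivative inverse (norm (dB (h x)))) (at (A.f x))"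
  proof (rule DERIV_inverse_function[where f = B.f and a = "A.f x - 1" and b = "A.f x + 1"])
    show "(B.f has_real_derivative norm (dB (h x))) (at (B.g (A.f x)))"
      using elim(2) unfolding B.good_def h_def by blast
    show "norm (dB (h x)) \<noteq> 0" using elim(2) by (simp add: B.good_def)
    show "isCont B.g (A.f x)" using B.f.g_cont continuous_on_eq_continuous_at open_UNIV by blast
    show "B.f (B.g y) = y" for y by (rule B.f.fg)
  qed simp_all
  moreover have "(A.f has_real_derivative norm (dA x)) (at x)" using elim(1) unfolding A.good_def by blast
  ultimately have "((\<lambda>x. B.g (A.f x)) has_real_derivative inverse (norm (dB (h x))) * norm (dA x)) (at x)"
    by (rule DERIV_chain2)
  then have "(h has_real_derivative norm (dA x) / norm (dB (h x))) (at x)"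
    unfolding h_def by (simp add: divide_inverse mult.commute)
  then show ?case using elim by simp
qed

end

locale transmission = P: conformal_boundary 1 \<gamma> \<Phi>p dp + M: conformal_boundary "- 1" \<gamma> \<Phi>m dm
  for \<gamma> \<Phi>p dp \<Phi>m dm +
  fixes \<nu> :: "complex \<Rightarrow> real" and p :: real
  assumes \<nu>_measurable: "\<nu> \<in> borel_measurable borel"
    and \<nu>_nonneg: "\<forall>\<xi>\<in>Lambda \<gamma>. 0 \<le> \<nu> \<xi>"
    and p: "1 < p"
begin

text \<open>Both orders are instantiated, so that \<open>MP.h\<close> is \<Psi> and
  \<open>PM.h\<close> is its inverse, and one derivative formula serves both.\<close>

sublocale MP: two_sides "- 1" 1 \<gamma> \<Phi>m \<Phi>p dm dp ..
sublocale PM: two_sides 1 "- 1" \<gamma> \<Phi>p \<Phi>m dp dm ..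

abbreviation \<Psi> where "\<Psi> \<equiv> Psi_map \<Phi>p \<Phi>m"

definition w where "w x = norm (dm x) powr (1 - p) * \<nu> (\<Phi>m (complex_of_real x))"

lemma \<Psi>_eq: "\<Psi> = MP.h"
  by (rule ext) (simp add: Psi_map_def flip: MP.\<Phi>_h)

lemma inv_\<Psi>: "inv \<Psi> = PM.h"
proof (rule inv_equality)
  show "PM.h (\<Psi> x) = x" for x
    unfolding \<Psi>_eq using PM.h_def MP.f_h[of x] M.f.gf[of x] by metis
  show "\<Psi> (PM.h y) = y" for y
    unfolding \<Psi>_eq using MP.h_def PM.f_h[of y] P.f.gf[of y] by metis
qed

lemma \<Phi>_\<Psi>: "\<Phi>p (complex_of_real (\<Psi> x)) = \<Phi>m (complex_of_real x)"
  unfolding \<Psi>_eq by (rule MP.\<Phi>_h)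

lemma AE_deriv_\<Psi>: "AE x in lborel. M.good x \<and> P.good (\<Psi> x) \<and> deriv \<Psi> x = norm (dm x) / norm (dp (\<Psi> x))"
  using MP.AE_h_derivative unfolding \<Psi>_eq
proof eventually_elim
  case (elim x) then show ?case by (simp add: DERIV_imp_deriv)
qed

text \<open>The derivative of the inverse of \<Psi> is |Phi_+'| divided by |Phi_-'| at the
  corresponding point, so in the product with \<open>w\<close> the factors of the minus side cancel.
  The weight on the plus side thus has the same form as \<open>w\<close>, and the same norm transfer
  applies to both sides.\<close>

lemma AE_wtilde: "AE y in lborel. wtilde \<Psi> p w y = norm (dp y) powr (1 - p) * \<nu> (\<Phi>p (complex_of_real y))"
  using PM.AE_h_derivative
proof eventually_elim
  case (elim y)
  define a where "a = norm (dp y)"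
  define b where "b = norm (dm (PM.h y))"
  have ab: "a > 0" "b > 0" using elim by (auto simp: P.good_def M.good_def a_def b_def)
  have "deriv PM.h y = a / b" using elim by (simp add: DERIV_imp_deriv a_def b_def)
  then have "\<bar>deriv PM.h y\<bar> powr (1 - p) * b powr (1 - p) = a powr (1 - p)"
    using ab by (simp add: powr_mult[symmetric])
  then show ?case
    unfolding wtilde_def inv_\<Psi> w_def PM.\<Phi>_h a_def[symmetric] b_def[symmetric] by (metis mult.assoc)
qed

text \<open>For a fixed pair and its pullback the two notions of solution agree, finiteness of the
  maximal norms included. Solvability and uniqueness then only require moving the data and composing
  with the conformal maps.\<close>

lemma solution_iff:
  assumes up: "\<forall>z\<in>P.H. up z = vp (\<Phi>p z)" and um: "\<forall>z\<in>M.H. um z = vm (\<Phi>m z)"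
    and f: "AE x in lborel. f x = norm (dm x) * g (\<Phi>m (complex_of_real x))"
  shows "T_solution \<gamma> \<Phi>p \<Phi>m \<mu> p \<nu> w g vp vm \<longleftrightarrow> P_solution \<Psi> \<mu> p w f up um"
proof
  assume T: "T_solution \<gamma> \<Phi>p \<Phi>m \<mu> p \<nu> w g vp vm"
  note T = T[unfolded T_solution_def Omega_plus_eq Omega_minus_eq[OF P.\<gamma>_cont] cone_plus_eq cone_minus_eq
      P.ntmax_grad_pullback[OF up] M.ntmax_grad_pullback[OF um]]
  have vp: "harmonic_on P.\<Omega> vp" and vm: "harmonic_on M.\<Omega> vm" using T by blast+
  obtain bp bm np nm where bv: "AE \<xi> in arclen \<gamma>. Phi_nt_conv (cone 1) \<Phi>p vp \<xi> (bp \<xi>) \<and>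
        Phi_nt_conv (cone (- 1)) \<Phi>m vm \<xi> (bm \<xi>) \<and>
        (\<exists>N. inward_normal \<gamma> \<xi> N \<and> Phi_nt_conv (cone 1) \<Phi>p (\<lambda>z. grad vp z \<bullet> N) \<xi> (np \<xi>) \<and>
          Phi_nt_conv (cone (- 1)) \<Phi>m (\<lambda>z. grad vm z \<bullet> N) \<xi> (nm \<xi>))"
    and eq: "AE \<xi> in arclen \<gamma>. bp \<xi> = bm \<xi>" "AE \<xi> in arclen \<gamma>. np \<xi> - \<mu> * nm \<xi> = g \<xi>"
    using T by blast
  have "AE \<xi> in arclen \<gamma>. Phi_nt_conv (cone 1) \<Phi>p vp \<xi> (bp \<xi>) \<and>
        (\<exists>N. inward_normal \<gamma> \<xi> N \<and> Phi_nt_conv (cone 1) \<Phi>p (\<lambda>z. grad vp z \<bullet> N) \<xi> (np \<xi>))"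
    using bv by eventually_elim blast
  note bvp = P.pull_boundary_values[OF vp up this]
  have "AE \<xi> in arclen \<gamma>. Phi_nt_conv (cone (- 1)) \<Phi>m vm \<xi> (bm \<xi>) \<and>
        (\<exists>N. inward_normal \<gamma> \<xi> N \<and> Phi_nt_conv (cone (- 1)) \<Phi>m (\<lambda>z. grad vm z \<bullet> N) \<xi> (nm \<xi>))"
    using bv by eventually_elim blast
  note bvm = M.pull_boundary_values[OF vm um this]
  have 1: "AE x in lebesgue. bp (\<Phi>p (complex_of_real (\<Psi> x))) = bm (\<Phi>m (complex_of_real x))"
    using eq(1) unfolding \<Phi>_\<Psi> M.AE_arclen AE_completion_iff .
  have 2: "AE x in lebesgue. T_op \<Psi> (\<lambda>x. norm (dp x) * np (\<Phi>p (complex_of_real x))) x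
      - \<mu> * (norm (dm x) * nm (\<Phi>m (complex_of_real x))) = f x"
    unfolding AE_completion_iff using eq(2)[unfolded M.AE_arclen] f AE_deriv_\<Psi>
  proof eventually_elim
    case (elim x)
    \<comment> \<open>The derivative of \<Psi> cancels |Phi_+'| at \<open>\<Psi> x\<close>, so both
      conormal terms carry the common factor |Phi_-'|.\<close>
    have "\<bar>deriv \<Psi> x\<bar> * (norm (dp (\<Psi> x)) * np (\<Phi>p (complex_of_real (\<Psi> x)))) = norm (dm x) * np (\<Phi>m (complex_of_real x))"
      using elim(3) unfolding \<Phi>_\<Psi> by (simp add: P.good_def)
    then show ?case using elim(1,2) by (simp add: T_op_def algebra_simps flip: elim(1))
  qed
  have "harmonic_on P.H up" "harmonic_on M.H um"
    using P.harmonic_pullback[of up vp] M.harmonic_pullback[of um vm] up um vp vm by blast+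
  then show "P_solution \<Psi> \<mu> p w f up um"
    unfolding P_solution_def upper_hp_eq lower_hp_eq cone_plus_eq cone_minus_eq
    using bvp bvm 1 2 T by blast
next
  assume U: "P_solution \<Psi> \<mu> p w f up um"
  note U = U[unfolded P_solution_def upper_hp_eq lower_hp_eq cone_plus_eq cone_minus_eq]
  have u: "harmonic_on P.H up" "harmonic_on M.H um" using U by blast+
  have v: "harmonic_on P.\<Omega> vp" "harmonic_on M.\<Omega> vm"
    using P.harmonic_pullback[of up vp] M.harmonic_pullback[of um vm] up um u by blast+
  obtain bp bm ep em where b: "nt_bv (cone 1) up bp" "nt_bv (cone (- 1)) um bm"
    and d: "nt_bv (cone 1) (dy up) ep" "nt_bv (cone (- 1)) (dy um) em"
    and eq: "AE x in lebesgue. bp (\<Psi> x) = bm x" "AE x in lebesgue. T_op \<Psi> ep x - \<mu> * em x = f x"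
    using U by blast
  have fin: "lpnorm lebesgue p (wtilde \<Psi> p w) (ntmax (cone 1) (pi / 4) (grad up)) < \<infinity>"
      "lpnorm lebesgue p w (ntmax (cone (- 1)) (pi / 4) (grad um)) < \<infinity>"
    using U[THEN conjunct2, THEN conjunct2, THEN conjunct2, rule_format, of "pi / 4"] by simp_all
  have p0: "0 < p" using p by simp
  obtain bp' np where P: "\<forall>x. bp' (\<Phi>p (complex_of_real x)) = bp x"
    "AE x in lborel. ep x = norm (dp x) * np (\<Phi>p (complex_of_real x))" "in_Lp (arclen \<gamma>) p \<nu> np"
    "AE \<xi> in arclen \<gamma>. Phi_nt_conv (cone 1) \<Phi>p vp \<xi> (bp' \<xi>) \<and> (\<exists>N. inward_normal \<gamma> \<xi> N) \<and>
      (\<forall>N. inward_normal \<gamma> \<xi> N \<longrightarrow> Phi_nt_conv (cone 1) \<Phi>p (\<lambda>z. grad vp z \<bullet> N) \<xi> (np \<xi>))"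
    by (rule P.push_boundary_values[OF u(1) v(1) up b(1) d(1) \<nu>_measurable \<nu>_nonneg p0 AE_wtilde fin(1)])
  have w: "AE x in lborel. w x = norm (dm x) powr (1 - p) * \<nu> (\<Phi>m (complex_of_real x))" by (simp add: w_def)
  obtain bm' nm where M: "\<forall>x. bm' (\<Phi>m (complex_of_real x)) = bm x"
    "AE x in lborel. em x = norm (dm x) * nm (\<Phi>m (complex_of_real x))" "in_Lp (arclen \<gamma>) p \<nu> nm"
    "AE \<xi> in arclen \<gamma>. Phi_nt_conv (cone (- 1)) \<Phi>m vm \<xi> (bm' \<xi>) \<and> (\<exists>N. inward_normal \<gamma> \<xi> N) \<and>
      (\<forall>N. inward_normal \<gamma> \<xi> N \<longrightarrow> Phi_nt_conv (cone (- 1)) \<Phi>m (\<lambda>z. grad vm z \<bullet> N) \<xi> (nm \<xi>))"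
    by (rule M.push_boundary_values[OF u(2) v(2) um b(2) d(2) \<nu>_measurable \<nu>_nonneg p0 w fin(2)])
  have 0: "AE \<xi> in arclen \<gamma>. Phi_nt_conv (cone 1) \<Phi>p vp \<xi> (bp' \<xi>) \<and>
        Phi_nt_conv (cone (- 1)) \<Phi>m vm \<xi> (bm' \<xi>) \<and>
        (\<exists>N. inward_normal \<gamma> \<xi> N \<and> Phi_nt_conv (cone 1) \<Phi>p (\<lambda>z. grad vp z \<bullet> N) \<xi> (np \<xi>) \<and>
          Phi_nt_conv (cone (- 1)) \<Phi>m (\<lambda>z. grad vm z \<bullet> N) \<xi> (nm \<xi>))"
    using P(4) M(4) by eventually_elim blast
  have "bp' (\<Phi>m (complex_of_real x)) = bp (\<Psi> x)" for x using P(1) \<Phi>_\<Psi>[of x] by metis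
  then have 1: "AE \<xi> in arclen \<gamma>. bp' \<xi> = bm' \<xi>"
    using eq(1) M(1) unfolding M.AE_arclen AE_completion_iff by simp
  have 2: "AE \<xi> in arclen \<gamma>. np \<xi> - \<mu> * nm \<xi> = g \<xi>"
    unfolding M.AE_arclen
    using eq(2)[unfolded AE_completion_iff] f AE_deriv_\<Psi> M(2) MP.AE_h[OF P(2), folded \<Psi>_eq]
  proof eventually_elim
    case (elim x)
    have "T_op \<Psi> ep x = norm (dm x) * np (\<Phi>m (complex_of_real x))"
      using elim(3,5) unfolding \<Phi>_\<Psi> by (simp add: T_op_def P.good_def)
    then have "norm (dm x) * (np (\<Phi>m (complex_of_real x)) - \<mu> * nm (\<Phi>m (complex_of_real x))) = norm (dm x) * g (\<Phi>m (complex_of_real x))"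
      using elim(1,2,4) by (simp add: algebra_simps)
    then show ?case using elim(3) by (simp add: M.good_def)
  qed
  show "T_solution \<gamma> \<Phi>p \<Phi>m \<mu> p \<nu> w g vp vm"
    unfolding T_solution_def Omega_plus_eq Omega_minus_eq[OF P.\<gamma>_cont] cone_plus_eq cone_minus_eq
      P.ntmax_grad_pullback[OF up] M.ntmax_grad_pullback[OF um]
    using v 0 1 2 P(3) M(3) U by blast
qed

section \<open>Transfer of data and unique solvability\<close>

lemma data_pull:
  assumes "in_Lp (arclen \<gamma>) p \<nu> g"
  obtains f where "in_Lp lebesgue p w f" "AE x in lborel. f x = norm (dm x) * g (\<Phi>m (complex_of_real x))"
    "lpnorm (arclen \<gamma>) p \<nu> (\<lambda>\<xi>. ennreal \<bar>g \<xi>\<bar>) = lpnorm lebesgue p w (\<lambda>x. ennreal \<bar>f x\<bar>)"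
proof -
  have g: "g \<in> borel_measurable borel" using assms by (simp add: in_Lp_def borel_measurable_arclen)
  obtain D where D: "D \<in> borel_measurable borel" "AE x in lborel. D x = norm (dm x)"
    using M.density_exists by blast
  define f where "f x = D x * g (\<Phi>m (complex_of_real x))" for x
  have "f \<in> borel_measurable borel"
    unfolding f_def using D(1) measurable_compose[OF M.\<Phi>_measurable g] by simp
  then have fm: "f \<in> borel_measurable lebesgue" by (simp add: measurable_completion)
  have f: "AE x in lborel. f x = norm (dm x) * g (\<Phi>m (complex_of_real x))"
    using D(2) by eventually_elim (simp add: f_def)
  have eq: "lpnorm (arclen \<gamma>) p \<nu> (\<lambda>\<xi>. ennreal \<bar>g \<xi>\<bar>) = lpnorm lebesgue p w (\<lambda>x. ennreal \<bar>f x\<bar>)"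
    unfolding w_def by (rule M.lpnorm_transfer[OF \<nu>_measurable _ g f]) (use \<nu>_nonneg in blast)
  show ?thesis using that[OF _ f eq] fm assms eq by (simp add: in_Lp_def)
qed

text \<open>The datum on the line is only Lebesgue measurable and is replaced by a Borel
  representative first, because data on the curve are Borel.\<close>

lemma data_push:
  assumes "in_Lp lebesgue p w f"
  obtains g where "in_Lp (arclen \<gamma>) p \<nu> g" "AE x in lborel. f x = norm (dm x) * g (\<Phi>m (complex_of_real x))"
    "lpnorm (arclen \<gamma>) p \<nu> (\<lambda>\<xi>. ennreal \<bar>g \<xi>\<bar>) = lpnorm lebesgue p w (\<lambda>x. ennreal \<bar>f x\<bar>)"
proof -
  obtain f' where f': "f' \<in> borel_measurable lborel" "AE x in lborel. f x = f' x"
    using completion_ex_borel_measurable_real assms unfolding in_Lp_def by blast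
  obtain D where D: "D \<in> borel_measurable borel" "AE x in lborel. D x = norm (dm x)"
    using M.density_exists by blast
  define g where "g \<xi> = f' (M.bd_coord \<xi>) / D (M.bd_coord \<xi>)" for \<xi>
  have f'm: "f' \<in> borel_measurable borel" using f'(1) by simp
  have g: "g \<in> borel_measurable borel"
    unfolding g_def using measurable_compose[OF M.bd_coord_measurable] f'm D(1) by (intro borel_measurable_divide) blast+
  have f: "AE x in lborel. f x = norm (dm x) * g (\<Phi>m (complex_of_real x))"
    using f'(2) D(2) M.AE_good by eventually_elim (simp add: g_def M.good_def)
  have eq: "lpnorm (arclen \<gamma>) p \<nu> (\<lambda>\<xi>. ennreal \<bar>g \<xi>\<bar>) = lpnorm lebesgue p w (\<lambda>x. ennreal \<bar>f x\<bar>)"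
    unfolding w_def by (rule M.lpnorm_transfer[OF \<nu>_measurable _ g f]) (use \<nu>_nonneg in blast)
  show ?thesis using that[OF _ f eq] g assms eq by (simp add: in_Lp_def borel_measurable_arclen)
qed

text \<open>Norms of data and of maximal functions are preserved exactly, so the constants
  \<open>C\<close> of the estimates and the additive constant in uniqueness carry over
  unchanged.\<close>

theorem uniquely_solvable_iff:
  "T_uniquely_solvable \<gamma> \<Phi>p \<Phi>m \<mu> p \<nu> w \<longleftrightarrow> P_uniquely_solvable \<Psi> \<mu> p w"
proof -
  note ntp = P.ntmax_grad_pullback[folded cone_plus_eq] and ntm = M.ntmax_grad_pullback[folded cone_minus_eq]
  obtain Jp where Jp: "Jp \<in> P.\<Omega> \<rightarrow> P.H" "\<And>z. z \<in> P.H \<Longrightarrow> Jp (\<Phi>p z) = z" "\<And>\<zeta>. \<zeta> \<in> P.\<Omega> \<Longrightarrow> \<Phi>p (Jp \<zeta>) = \<zeta>"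
    using P.inverse_map by blast
  obtain Jm where Jm: "Jm \<in> M.\<Omega> \<rightarrow> M.H" "\<And>z. z \<in> M.H \<Longrightarrow> Jm (\<Phi>m z) = z" "\<And>\<zeta>. \<zeta> \<in> M.\<Omega> \<Longrightarrow> \<Phi>m (Jm \<zeta>) = \<zeta>"
    using M.inverse_map by blast
  have vu: "T_solution \<gamma> \<Phi>p \<Phi>m \<mu> p \<nu> w g vp vm \<longleftrightarrow> P_solution \<Psi> \<mu> p w f (\<lambda>z. vp (\<Phi>p z)) (\<lambda>z. vm (\<Phi>m z))"
    if "AE x in lborel. f x = norm (dm x) * g (\<Phi>m (complex_of_real x))" for f g vp vm
    by (rule solution_iff[OF _ _ that]) simp_all
  have uv: "T_solution \<gamma> \<Phi>p \<Phi>m \<mu> p \<nu> w g (\<lambda>z. up (Jp z)) (\<lambda>z. um (Jm z)) \<longleftrightarrow> P_solution \<Psi> \<mu> p w f up um"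
    if "AE x in lborel. f x = norm (dm x) * g (\<Phi>m (complex_of_real x))" for f g up um
    by (rule solution_iff[OF _ _ that]) (simp_all add: Jp Jm)
  have ntv: "ntmax cone_plus \<alpha> (grad (vp \<circ> \<Phi>p)) = ntmax cone_plus \<alpha> (grad (\<lambda>z. vp (\<Phi>p z)))"
    "ntmax cone_minus \<alpha> (grad (vm \<circ> \<Phi>m)) = ntmax cone_minus \<alpha> (grad (\<lambda>z. vm (\<Phi>m z)))" for vp vm \<alpha>
    by (simp_all add: o_def)
  have ntu: "ntmax cone_plus \<alpha> (grad ((\<lambda>z. up (Jp z)) \<circ> \<Phi>p)) = ntmax cone_plus \<alpha> (grad up)"
    "ntmax cone_minus \<alpha> (grad ((\<lambda>z. um (Jm z)) \<circ> \<Phi>m)) = ntmax cone_minus \<alpha> (grad um)" for up um \<alpha>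
    by (rule ntp ntm, simp add: Jp Jm)+
  have "T_solvable \<gamma> \<Phi>p \<Phi>m \<mu> p \<nu> w \<longleftrightarrow> P_solvable \<Psi> \<mu> p w"
  proof
    assume "T_solvable \<gamma> \<Phi>p \<Phi>m \<mu> p \<nu> w"
    then obtain C where C: "\<And>g. in_Lp (arclen \<gamma>) p \<nu> g \<Longrightarrow>
     (\<exists>vp vm. T_solution \<gamma> \<Phi>p \<Phi>m \<mu> p \<nu> w g vp vm \<and>
        (\<forall>\<alpha>. 0 < \<alpha> \<and> \<alpha> < pi / 2 \<longrightarrow>
           lpnorm lebesgue p (wtilde \<Psi> p w) (ntmax cone_plus \<alpha> (grad (vp \<circ> \<Phi>p)))
             \<le> ennreal (C \<alpha>) * lpnorm (arclen \<gamma>) p \<nu> (\<lambda>\<xi>. ennreal \<bar>g \<xi>\<bar>) \<and>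
           lpnorm lebesgue p w (ntmax cone_minus \<alpha> (grad (vm \<circ> \<Phi>m)))
             \<le> ennreal (C \<alpha>) * lpnorm (arclen \<gamma>) p \<nu> (\<lambda>\<xi>. ennreal \<bar>g \<xi>\<bar>)))"
      unfolding T_solvable_def by blast
    show "P_solvable \<Psi> \<mu> p w" unfolding P_solvable_def
    proof (intro exI[of _ C] allI impI)
      fix f assume "in_Lp lebesgue p w f"
      then obtain g where g: "in_Lp (arclen \<gamma>) p \<nu> g" "AE x in lborel. f x = norm (dm x) * g (\<Phi>m (complex_of_real x))"
        "lpnorm (arclen \<gamma>) p \<nu> (\<lambda>\<xi>. ennreal \<bar>g \<xi>\<bar>) = lpnorm lebesgue p w (\<lambda>x. ennreal \<bar>f x\<bar>)" using data_push by blast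
      show "\<exists>up um. P_solution \<Psi> \<mu> p w f up um \<and>
        (\<forall>\<alpha>. 0 < \<alpha> \<and> \<alpha> < pi / 2 \<longrightarrow>
           lpnorm lebesgue p (wtilde \<Psi> p w) (ntmax cone_plus \<alpha> (grad up))
             \<le> ennreal (C \<alpha>) * lpnorm lebesgue p w (\<lambda>x. ennreal \<bar>f x\<bar>) \<and>
           lpnorm lebesgue p w (ntmax cone_minus \<alpha> (grad um))
             \<le> ennreal (C \<alpha>) * lpnorm lebesgue p w (\<lambda>x. ennreal \<bar>f x\<bar>))"
        using C[OF g(1)] unfolding g(3) ntv vu[OF g(2)] by blast
    qed
  next
    assume "P_solvable \<Psi> \<mu> p w"
    then obtain C where C: "\<And>f. in_Lp lebesgue p w f \<Longrightarrow>
     (\<exists>up um. P_solution \<Psi> \<mu> p w f up um \<and>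
        (\<forall>\<alpha>. 0 < \<alpha> \<and> \<alpha> < pi / 2 \<longrightarrow>
           lpnorm lebesgue p (wtilde \<Psi> p w) (ntmax cone_plus \<alpha> (grad up))
             \<le> ennreal (C \<alpha>) * lpnorm lebesgue p w (\<lambda>x. ennreal \<bar>f x\<bar>) \<and>
           lpnorm lebesgue p w (ntmax cone_minus \<alpha> (grad um))
             \<le> ennreal (C \<alpha>) * lpnorm lebesgue p w (\<lambda>x. ennreal \<bar>f x\<bar>)))"
      unfolding P_solvable_def by blast
    show "T_solvable \<gamma> \<Phi>p \<Phi>m \<mu> p \<nu> w" unfolding T_solvable_def
    proof (intro exI[of _ C] allI impI)
      fix g assume "in_Lp (arclen \<gamma>) p \<nu> g"
      then obtain f where f: "in_Lp lebesgue p w f" "AE x in lborel. f x = norm (dm x) * g (\<Phi>m (complex_of_real x))"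
        "lpnorm (arclen \<gamma>) p \<nu> (\<lambda>\<xi>. ennreal \<bar>g \<xi>\<bar>) = lpnorm lebesgue p w (\<lambda>x. ennreal \<bar>f x\<bar>)" using data_pull by blast
      obtain up um where u: "P_solution \<Psi> \<mu> p w f up um \<and>
        (\<forall>\<alpha>. 0 < \<alpha> \<and> \<alpha> < pi / 2 \<longrightarrow>
           lpnorm lebesgue p (wtilde \<Psi> p w) (ntmax cone_plus \<alpha> (grad up))
             \<le> ennreal (C \<alpha>) * lpnorm (arclen \<gamma>) p \<nu> (\<lambda>\<xi>. ennreal \<bar>g \<xi>\<bar>) \<and>
           lpnorm lebesgue p w (ntmax cone_minus \<alpha> (grad um))
             \<le> ennreal (C \<alpha>) * lpnorm (arclen \<gamma>) p \<nu> (\<lambda>\<xi>. ennreal \<bar>g \<xi>\<bar>))"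
        using C[OF f(1)] unfolding f(3) by blast
      show "\<exists>vp vm. T_solution \<gamma> \<Phi>p \<Phi>m \<mu> p \<nu> w g vp vm \<and>
        (\<forall>\<alpha>. 0 < \<alpha> \<and> \<alpha> < pi / 2 \<longrightarrow>
           lpnorm lebesgue p (wtilde \<Psi> p w) (ntmax cone_plus \<alpha> (grad (vp \<circ> \<Phi>p)))
             \<le> ennreal (C \<alpha>) * lpnorm (arclen \<gamma>) p \<nu> (\<lambda>\<xi>. ennreal \<bar>g \<xi>\<bar>) \<and>
           lpnorm lebesgue p w (ntmax cone_minus \<alpha> (grad (vm \<circ> \<Phi>m)))
             \<le> ennreal (C \<alpha>) * lpnorm (arclen \<gamma>) p \<nu> (\<lambda>\<xi>. ennreal \<bar>g \<xi>\<bar>))"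
        by (intro exI[of _ "\<lambda>z. up (Jp z)"] exI[of _ "\<lambda>z. um (Jm z)"], unfold ntu uv[OF f(2)]) (rule u)
    qed
  qed
  moreover have "(\<forall>g vp vm vp' vm'. in_Lp (arclen \<gamma>) p \<nu> g \<longrightarrow>
        T_solution \<gamma> \<Phi>p \<Phi>m \<mu> p \<nu> w g vp vm \<longrightarrow> T_solution \<gamma> \<Phi>p \<Phi>m \<mu> p \<nu> w g vp' vm' \<longrightarrow>
        (\<exists>c. (\<forall>z\<in>P.\<Omega>. vp z - vp' z = c) \<and> (\<forall>z\<in>M.\<Omega>. vm z - vm' z = c))) \<longleftrightarrow>
    (\<forall>f up um up' um'. in_Lp lebesgue p w f \<longrightarrow>
        P_solution \<Psi> \<mu> p w f up um \<longrightarrow> P_solution \<Psi> \<mu> p w f up' um' \<longrightarrow>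
        (\<exists>c. (\<forall>z\<in>P.H. up z - up' z = c) \<and> (\<forall>z\<in>M.H. um z - um' z = c)))" (is "?T \<longleftrightarrow> ?U")
  proof
    assume T: ?T
    show ?U
    proof (intro allI impI)
      fix f up um up' um'
      assume f: "in_Lp lebesgue p w f" and u: "P_solution \<Psi> \<mu> p w f up um" "P_solution \<Psi> \<mu> p w f up' um'"
      obtain g where g: "in_Lp (arclen \<gamma>) p \<nu> g" "AE x in lborel. f x = norm (dm x) * g (\<Phi>m (complex_of_real x))"
        using data_push[OF f] by blast
      obtain c where "\<forall>z\<in>P.\<Omega>. up (Jp z) - up' (Jp z) = c" "\<forall>z\<in>M.\<Omega>. um (Jm z) - um' (Jm z) = c"
        using T[rule_format, OF g(1) u[folded uv[OF g(2)]]] by blast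
      then show "\<exists>c. (\<forall>z\<in>P.H. up z - up' z = c) \<and> (\<forall>z\<in>M.H. um z - um' z = c)"
        unfolding P.\<Phi>_image[symmetric] M.\<Phi>_image[symmetric] using Jp(2) Jm(2) by (intro exI[of _ c]) force
    qed
  next
    assume U: ?U
    show ?T
    proof (intro allI impI)
      fix g vp vm vp' vm'
      assume g: "in_Lp (arclen \<gamma>) p \<nu> g" and v: "T_solution \<gamma> \<Phi>p \<Phi>m \<mu> p \<nu> w g vp vm" "T_solution \<gamma> \<Phi>p \<Phi>m \<mu> p \<nu> w g vp' vm'"
      obtain f where f: "in_Lp lebesgue p w f" "AE x in lborel. f x = norm (dm x) * g (\<Phi>m (complex_of_real x))"
        using data_pull[OF g] by blast
      obtain c where "\<forall>z\<in>P.H. vp (\<Phi>p z) - vp' (\<Phi>p z) = c" "\<forall>z\<in>M.H. vm (\<Phi>m z) - vm' (\<Phi>m z) = c"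
        using U[rule_format, OF f(1) v[unfolded vu[OF f(2)]]] by blast
      then show "\<exists>c. (\<forall>z\<in>P.\<Omega>. vp z - vp' z = c) \<and> (\<forall>z\<in>M.\<Omega>. vm z - vm' z = c)"
        unfolding P.\<Phi>_image[symmetric] M.\<Phi>_image[symmetric] by blast
    qed
  qed
  ultimately show ?thesis
    unfolding T_uniquely_solvable_def P_uniquely_solvable_def upper_hp_eq lower_hp_eq
      Omega_plus_eq Omega_minus_eq[OF P.\<gamma>_cont] by blast
qed

end

theorem theorem1p1:
  fixes \<gamma> :: "real \<Rightarrow> real"
    and \<Phi>p \<Phi>m :: "complex \<Rightarrow> complex"
    and d\<Phi>p d\<Phi>m :: "real \<Rightarrow> complex"
    and \<nu> :: "complex \<Rightarrow> real"
    and p \<mu> :: real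
  assumes curve_cont: "continuous_on UNIV \<gamma>"
    and curve_rect: "locally_rectifiable (cparam \<gamma>)"
    and Phi_plus: "conformal_setting upper_hp cone_plus (Omega_plus \<gamma>) \<Phi>p d\<Phi>p"
    and Phi_minus: "conformal_setting lower_hp cone_minus (Omega_minus \<gamma>) \<Phi>m d\<Phi>m"
    and p: "1 < p"
    and mu: "\<mu> \<noteq> 0"
    and nu: "weight_on_Lambda \<gamma> \<nu>"
    and Psi_ac: "locally_abs_cont (Psi_map \<Phi>p \<Phi>m)"
  shows "T_uniquely_solvable \<gamma> \<Phi>p \<Phi>m \<mu> p \<nu>
            (\<lambda>x. norm (d\<Phi>m x) powr (1 - p) * \<nu> (\<Phi>m (complex_of_real x)))
         \<longleftrightarrow> P_uniquely_solvable (Psi_map \<Phi>p \<Phi>m) \<mu> p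
            (\<lambda>x. norm (d\<Phi>m x) powr (1 - p) * \<nu> (\<Phi>m (complex_of_real x)))"
proof -
  interpret transmission \<gamma> \<Phi>p d\<Phi>p \<Phi>m d\<Phi>m \<nu> p
  proof (intro_locales; unfold_locales)
    show "conformal_setting (half_plane 1) (cone 1) (domain_side 1 \<gamma>) \<Phi>p d\<Phi>p"
      using Phi_plus unfolding upper_hp_eq cone_plus_eq Omega_plus_eq .
    show "conformal_setting (half_plane (- 1)) (cone (- 1)) (domain_side (- 1) \<gamma>) \<Phi>m d\<Phi>m"
      using Phi_minus unfolding lower_hp_eq cone_minus_eq Omega_minus_eq[OF curve_cont] .
  qed (use curve_cont curve_rect p nu in \<open>auto simp: weight_on_Lambda_def\<close>)
  show ?thesis using uniquely_solvable_iff unfolding w_def[abs_def] .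
qed

end
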